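(* Let $K$ be an infinite field of characteristic $2$, $G=\mathrm{GL}(2,K)$, and let $E$ be the natural $KG$-module. Let $r$ be a positive integer and let $\{(s_i,t_i): i=1,\dots,k\}$ be the complete set of solutions of the equation $r=2s+3t$ in integers $s,t\ge 1$. Let $\lambda=(\lambda_1,\lambda_2)$ be a partition of $r$ into at most two parts, and for each $i$ with $0<\lambda_1-\lambda_2\le t_i$ define $\lambda(i)=(\lambda_1-(s_i+t_i),\ \lambda_2-(s_i+t_i))$ (a partition of $t_i$). Then the multiplicity of $T(\lambda)$ as a direct summand of $L^r(E)$ is bounded below by $$\sum_{i:\ 0<\lambda_1-\lambda_2\le t_i} m_{s_i,t_i}\, d_{\lambda(i)}.$$
   Context: $E$ is the space $K^2$ of column vectors with its natural $G$-action. $L(E)$ is the free Lie algebra on $E$, realized as the Lie subalgebra of the tensor algebra of $E$ generated by $E$; $L^r(E)=L(E)\cap E^{\otimes r}$ is its $r$th homogeneous component, a $KG$-submodule of $E^{\otimes r}$. For positive integers $s,t$, $$m_{s,t}=\frac{1}{s+t}\sum_{d\mid s,\ d\mid t}\mu(d)\frac{((s+t)/d)!}{(s/d)!\,(t/d)!},$$ where $\mu$ is the Möbius function. For a $2$-regular partition $\nu$ of $t$ (no two nonzero parts equal), $d_\nu=\dim D^\nu$, where $D^\nu$ is the simple $KS_t$-module labelled by $\nu$ ($S_t$ the symmetric group); equivalently, for $\nu$ with at most two parts, $d_\nu$ is the multiplicity of $T(\nu)$ as a direct summand of $E^{\otimes t}$. For a partition $\lambda=(\lambda_1,\lambda_2)$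 of $r$ (with $\lambda_2\geq 0$), the dual Weyl module is $\nabla(\lambda)=S^{\lambda_1-\lambda_2}(E)\otimes\det^{\lambda_2}$ and the Weyl module $\Delta(\lambda)$ is its contravariant dual. $T(\lambda)$ denotes the indecomposable tilting module of highest weight $\lambda$: the unique (up to isomorphism) indecomposable polynomial $KG$-module of degree $r$ that has both a filtration with all sections Weyl modules and a filtration with all sections dual Weyl modules, and whose highest weight is $\lambda$. Multiplicity of an indecomposable summand is in the sense of the Krull–Schmidt theorem. *)

theory Defs
  imports
    "HOL-Analysis.Determinants"
    "HOL-Library.Function_Algebras"
    "HOL-Computational_Algebra.Squarefree"
    "HOL-Algebra.Sym_Groups"
begin

section \<open>Representations on spaces of functions\<close>

text \<open>Every vector space over \<open>'k\<close> occurring here is a subspace of some space \<open>'x \<Rightarrow> 'k\<close> with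
  pointwise operations; up to isomorphism this is no restriction, since \<open>'x\<close> is arbitrary.\<close>

definition fscale :: "'k::field \<Rightarrow> ('x \<Rightarrow> 'k) \<Rightarrow> ('x \<Rightarrow> 'k)"
  where "fscale c f = (\<lambda>x. c * f x)"

global_interpretation fs: vector_space "fscale :: 'k::field \<Rightarrow> ('x \<Rightarrow> 'k) \<Rightarrow> ('x \<Rightarrow> 'k)"
  by unfold_locales (auto simp: fscale_def fun_eq_iff algebra_simps)

definition linear_between :: "('x \<Rightarrow> 'k::field) set \<Rightarrow> ('y \<Rightarrow> 'k) set \<Rightarrow> (('x \<Rightarrow> 'k) \<Rightarrow> ('y \<Rightarrow> 'k)) \<Rightarrow> bool"
  where "linear_between V W f \<longleftrightarrow> f ` V \<subseteq> W \<and>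
    (\<forall>u\<in>V. \<forall>v\<in>V. f (u + v) = f u + f v) \<and> (\<forall>c. \<forall>v\<in>V. f (fscale c v) = fscale c (f v))"

text \<open>The linear dual: a linear functional on \<open>V\<close> is extended by zero outside \<open>V\<close>, so that
  functionals are equal iff they agree on \<open>V\<close>.\<close>

definition dual_space :: "('x \<Rightarrow> 'k::field) set \<Rightarrow> (('x \<Rightarrow> 'k) \<Rightarrow> 'k) set"
  where "dual_space V = {\<phi>. (\<forall>u\<in>V. \<forall>v\<in>V. \<phi> (u + v) = \<phi> u + \<phi> v) \<and>
    (\<forall>c. \<forall>v\<in>V. \<phi> (fscale c v) = c * \<phi> v) \<and> (\<forall>v. v \<notin> V \<longrightarrow> \<phi> v = 0)}"

record ('g, 'k, 'x) rep =
  vecs :: "('x \<Rightarrow> 'k) set"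
  act :: "'g \<Rightarrow> ('x \<Rightarrow> 'k) \<Rightarrow> ('x \<Rightarrow> 'k)"

definition is_rep :: "'g monoid \<Rightarrow> ('g, 'k::field, 'x) rep \<Rightarrow> bool"
  where "is_rep G M \<longleftrightarrow> fs.subspace (vecs M) \<and>
    (\<forall>g\<in>carrier G. linear_between (vecs M) (vecs M) (act M g)) \<and>
    (\<forall>v\<in>vecs M. act M \<one>\<^bsub>G\<^esub> v = v) \<and>
    (\<forall>g\<in>carrier G. \<forall>h\<in>carrier G. \<forall>v\<in>vecs M. act M (g \<otimes>\<^bsub>G\<^esub> h) v = act M g (act M h v))"

definition fin_dim :: "('x \<Rightarrow> 'k::field) set \<Rightarrow> bool"
  where "fin_dim V \<longleftrightarrow> (\<exists>B. finite B \<and> V \<subseteq> fs.span B)"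

definition submodule :: "'g monoid \<Rightarrow> ('g, 'k::field, 'x) rep \<Rightarrow> ('x \<Rightarrow> 'k) set \<Rightarrow> bool"
  where "submodule G M W \<longleftrightarrow> fs.subspace W \<and> W \<subseteq> vecs M \<and> (\<forall>g\<in>carrier G. act M g ` W \<subseteq> W)"

definition subrep :: "('g, 'k, 'x) rep \<Rightarrow> ('x \<Rightarrow> 'k) set \<Rightarrow> ('g, 'k, 'x) rep"
  where "subrep M W = M\<lparr>vecs := W\<rparr>"

definition rep_hom :: "'g monoid \<Rightarrow> ('g, 'k::field, 'x) rep \<Rightarrow> ('g, 'k, 'y) rep \<Rightarrow>
    (('x \<Rightarrow> 'k) \<Rightarrow> ('y \<Rightarrow> 'k)) \<Rightarrow> bool"
  where "rep_hom G M N f \<longleftrightarrow> linear_between (vecs M) (vecs N) f \<and>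
    (\<forall>g\<in>carrier G. \<forall>v\<in>vecs M. f (act M g v) = act N g (f v))"

definition rep_iso :: "'g monoid \<Rightarrow> ('g, 'k::field, 'x) rep \<Rightarrow> ('g, 'k, 'y) rep \<Rightarrow> bool"
  where "rep_iso G M N \<longleftrightarrow> (\<exists>f. rep_hom G M N f \<and> bij_betw f (vecs M) (vecs N))"

text \<open>\<open>V/W\<close> is isomorphic to \<open>Q\<close>, for submodules \<open>W \<subseteq> V\<close> of \<open>M\<close>.\<close>

definition quotient_iso :: "'g monoid \<Rightarrow> ('g, 'k::field, 'x) rep \<Rightarrow> ('x \<Rightarrow> 'k) set \<Rightarrow> ('x \<Rightarrow> 'k) set \<Rightarrow>
    ('g, 'k, 'y) rep \<Rightarrow> bool"
  where "quotient_iso G M V W Q \<longleftrightarrow>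
    (\<exists>f. rep_hom G (subrep M V) Q f \<and> f ` V = vecs Q \<and> {v\<in>V. f v = 0} = W)"

definition indecomposable :: "'g monoid \<Rightarrow> ('g, 'k::field, 'x) rep \<Rightarrow> bool"
  where "indecomposable G M \<longleftrightarrow> vecs M \<noteq> {0} \<and>
    \<not> (\<exists>U W. submodule G M U \<and> submodule G M W \<and> U \<noteq> {0} \<and> W \<noteq> {0} \<and>
           U \<inter> W = {0} \<and> {u + w |u w. u \<in> U \<and> w \<in> W} = vecs M)"

definition ks_decomposition :: "'g monoid \<Rightarrow> ('g, 'k::field, 'x) rep \<Rightarrow> nat \<Rightarrow>
    (nat \<Rightarrow> ('x \<Rightarrow> 'k) set) \<Rightarrow> bool"
  where "ks_decomposition G M n W \<longleftrightarrow>
    (\<forall>i<n. submodule G M (W i) \<and> indecomposable G (subrep M (W i))) \<and>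
    (\<forall>v\<in>vecs M. \<exists>!w. (\<forall>i<n. w i \<in> W i) \<and> (\<forall>i\<ge>n. w i = 0) \<and> v = (\<Sum>i<n. w i))"

text \<open>For finite-dimensional \<open>M\<close> such decompositions exist and, by the Krull--Schmidt theorem, the
  number of summands isomorphic to \<open>T\<close> is the same for all of them.\<close>

definition ks_multiplicity :: "'g monoid \<Rightarrow> ('g, 'k::field, 'x) rep \<Rightarrow> ('g, 'k, 'y) rep \<Rightarrow> nat"
  where "ks_multiplicity G M T =
    (THE m. \<exists>n W. ks_decomposition G M n W \<and> m = card {i\<in>{..<n}. rep_iso G (subrep M (W i)) T})"


section \<open>Modules for GL(2,K)\<close>

definition GL2 :: "('k::field ^ 2 ^ 2) monoid"
  where "GL2 = \<lparr>carrier = {g. invertible g}, mult = (**), one = mat 1\<rparr>"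

text \<open>Functions on the group that are homogeneous polynomials of degree \<open>r\<close> in the matrix entries.\<close>

definition homogeneous_on_GL2 :: "nat \<Rightarrow> ('k::field ^ 2 ^ 2 \<Rightarrow> 'k) \<Rightarrow> bool"
  where "homogeneous_on_GL2 r f \<longleftrightarrow> (\<exists>c :: (2 \<Rightarrow> 2 \<Rightarrow> nat) \<Rightarrow> 'k. \<forall>g\<in>carrier GL2.
    f g = (\<Sum>e | (\<Sum>i\<in>UNIV. \<Sum>j\<in>UNIV. e i j) = r. c e * (\<Prod>i\<in>UNIV. \<Prod>j\<in>UNIV. (g $ i $ j) ^ e i j)))"

definition polynomial_rep :: "nat \<Rightarrow> ('k::field ^ 2 ^ 2, 'k, 'x) rep \<Rightarrow> bool"
  where "polynomial_rep r M \<longleftrightarrow> is_rep GL2 M \<and> fin_dim (vecs M) \<and>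
    (\<forall>v\<in>vecs M. \<forall>\<phi>\<in>dual_space (vecs M). homogeneous_on_GL2 r (\<lambda>g. \<phi> (act M g v)))"

definition is_weight :: "('k::field ^ 2 ^ 2, 'k, 'x) rep \<Rightarrow> nat \<times> nat \<Rightarrow> bool"
  where "is_weight M \<mu> \<longleftrightarrow> (\<exists>v\<in>vecs M. v \<noteq> 0 \<and> (\<forall>x y. x \<noteq> 0 \<longrightarrow> y \<noteq> 0 \<longrightarrow>
    act M (vector [vector [x, 0], vector [0, y]]) v = fscale (x ^ fst \<mu> * y ^ snd \<mu>) v))"

definition highest_weight :: "('k::field ^ 2 ^ 2, 'k, 'x) rep \<Rightarrow> nat \<times> nat \<Rightarrow> bool"
  where "highest_weight M \<kappa> \<longleftrightarrow> is_weight M \<kappa> \<and>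
    (\<forall>\<mu>. is_weight M \<mu> \<longrightarrow> fst \<mu> + snd \<mu> = fst \<kappa> + snd \<kappa> \<and> fst \<mu> \<le> fst \<kappa>)"

text \<open>\<open>S\<^sup>n(E)\<close>, for infinite \<open>K\<close>, as the homogeneous polynomial functions of degree \<open>n\<close> on the
  dual of \<open>E\<close>: the basis vector \<open>e\<^sub>i\<close> is the coordinate function \<open>x \<mapsto> x $ i\<close>, and
  \<open>g e\<^sub>j = (\<Sum>i. g $ i $ j e\<^sub>i)\<close> becomes substitution of \<open>transpose g *v x\<close>. The second factor
  is the determinant power.\<close>

definition dual_weyl :: "nat \<times> nat \<Rightarrow> ('k::field ^ 2 ^ 2, 'k, 'k ^ 2) rep"
  where "dual_weyl \<kappa> = \<lparr>
    vecs = fs.span {\<lambda>x. (x $ 1) ^ a * (x $ 2) ^ b |a b. a + b = fst \<kappa> - snd \<kappa>},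
    act = (\<lambda>g f x. det g ^ snd \<kappa> * f (transpose g *v x))\<rparr>"

definition contravariant_dual :: "('k::field ^ 2 ^ 2, 'k, 'x) rep \<Rightarrow> ('k ^ 2 ^ 2, 'k, 'x \<Rightarrow> 'k) rep"
  where "contravariant_dual M = \<lparr>
    vecs = dual_space (vecs M),
    act = (\<lambda>g \<phi> v. if v \<in> vecs M then \<phi> (act M (transpose g) v) else 0)\<rparr>"

definition weyl :: "nat \<times> nat \<Rightarrow> ('k::field ^ 2 ^ 2, 'k, 'k ^ 2 \<Rightarrow> 'k) rep"
  where "weyl \<kappa> = contravariant_dual (dual_weyl \<kappa>)"

definition has_filtration :: "('k::field ^ 2 ^ 2, 'k, 'x) rep \<Rightarrow>
    (nat \<times> nat \<Rightarrow> ('k ^ 2 ^ 2, 'k, 'y) rep) \<Rightarrow> bool"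
  where "has_filtration M X \<longleftrightarrow> (\<exists>n F. F 0 = {0} \<and> F n = vecs M \<and> (\<forall>i\<le>n. submodule GL2 M (F i)) \<and>
    (\<forall>i<n. F i \<subseteq> F (Suc i) \<and>
      (\<exists>\<mu>. snd \<mu> \<le> fst \<mu> \<and> quotient_iso GL2 M (F (Suc i)) (F i) (X \<mu>))))"

text \<open>\<open>T\<close> is (a representative of the isomorphism class) \<open>T(\<kappa>)\<close>.\<close>

definition indecomposable_tilting :: "nat \<times> nat \<Rightarrow> ('k::field ^ 2 ^ 2, 'k, 'x) rep \<Rightarrow> bool"
  where "indecomposable_tilting \<kappa> T \<longleftrightarrow> polynomial_rep (fst \<kappa> + snd \<kappa>) T \<and> indecomposable GL2 T \<and>
    has_filtration T weyl \<and> has_filtration T dual_weyl \<and> highest_weight T \<kappa>"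


section \<open>The tensor algebra and Lie powers\<close>

text \<open>An element of the tensor algebra of \<open>E = K\<^sup>2\<close> is given by its coefficients: \<open>f\<close> stands for
  the sum of \<open>f [i\<^sub>1, \<dots>, i\<^sub>r]\<close> times \<open>e\<close>\<open>i\<^sub>1\<close> \<open>\<otimes> \<dots> \<otimes>\<close> \<open>e\<close>\<open>i\<^sub>r\<close> over all words in the letters
  \<open>1, 2\<close>. Functions of infinite support play no role: the Lie subalgebra generated by \<open>E\<close>
  consists of finitely supported functions.\<close>

definition tensor_power :: "nat \<Rightarrow> (2 list \<Rightarrow> 'k::field) set"
  where "tensor_power r = {f. \<forall>w. length w \<noteq> r \<longrightarrow> f w = 0}"

definition tensor_mult :: "(2 list \<Rightarrow> 'k::field) \<Rightarrow> (2 list \<Rightarrow> 'k) \<Rightarrow> (2 list \<Rightarrow> 'k)"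
  where "tensor_mult f h = (\<lambda>w. \<Sum>k\<le>length w. f (take k w) * h (drop k w))"

definition tensor_act :: "'k::field ^ 2 ^ 2 \<Rightarrow> (2 list \<Rightarrow> 'k) \<Rightarrow> (2 list \<Rightarrow> 'k)"
  where "tensor_act g f = (\<lambda>w. \<Sum>u | length u = length w. (\<Prod>i<length w. g $ (w ! i) $ (u ! i)) * f u)"

definition lie_subalgebra :: "(2 list \<Rightarrow> 'k::field) set \<Rightarrow> bool"
  where "lie_subalgebra A \<longleftrightarrow> fs.subspace A \<and>
    (\<forall>a\<in>A. \<forall>b\<in>A. tensor_mult a b - tensor_mult b a \<in> A)"

definition free_lie :: "(2 list \<Rightarrow> 'k::field) set"
  where "free_lie = lie_subalgebra hull tensor_power 1"

definition lie_power :: "nat \<Rightarrow> ('k::field ^ 2 ^ 2, 'k, 2 list) rep"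
  where "lie_power r = \<lparr>vecs = free_lie \<inter> tensor_power r, act = tensor_act\<rparr>"


section \<open>Simple modules for symmetric groups\<close>

text \<open>A partition is a weakly decreasing list of row lengths, possibly with trailing zeros. A
  \<open>\<nu>\<close>-tableau is given as the map sending each entry in \<open>{1..n}\<close> to its cell
  \<open>(row, column)\<close>; its tabloid only remembers the row of each entry.\<close>

definition young_diagram :: "nat list \<Rightarrow> (nat \<times> nat) set"
  where "young_diagram \<nu> = {(i, j). i < length \<nu> \<and> j < \<nu> ! i}"

definition tableaux :: "nat list \<Rightarrow> (nat \<Rightarrow> nat \<times> nat) set"
  where "tableaux \<nu> = {t. bij_betw t {1..sum_list \<nu>} (young_diagram \<nu>)}"

definition tabloid :: "nat list \<Rightarrow> (nat \<Rightarrow> nat \<times> nat) \<Rightarrow> (nat \<Rightarrow> nat)"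
  where "tabloid \<nu> t = restrict (fst \<circ> t) {1..sum_list \<nu>}"

definition column_stabilizer :: "nat list \<Rightarrow> (nat \<Rightarrow> nat \<times> nat) \<Rightarrow> (nat \<Rightarrow> nat) set"
  where "column_stabilizer \<nu> t = {\<sigma>. \<sigma> permutes {1..sum_list \<nu>} \<and>
    (\<forall>x\<in>{1..sum_list \<nu>}. snd (t (\<sigma> x)) = snd (t x))}"

text \<open>The permutation module on tabloids consists of functions on tabloids. The tableau \<open>\<sigma>t\<close>, in
  which every entry is replaced by its image under \<open>\<sigma>\<close>, is \<open>t \<circ> inv \<sigma>\<close> here.\<close>

definition polytabloid :: "nat list \<Rightarrow> (nat \<Rightarrow> nat \<times> nat) \<Rightarrow> ((nat \<Rightarrow> nat) \<Rightarrow> 'k::field)"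
  where "polytabloid \<nu> t = (\<lambda>\<rho>. \<Sum>\<sigma>\<in>column_stabilizer \<nu> t.
    of_int (sign \<sigma>) * (if tabloid \<nu> (t \<circ> Hilbert_Choice.inv \<sigma>) = \<rho> then 1 else 0))"

definition specht :: "nat list \<Rightarrow> (nat \<Rightarrow> nat, 'k::field, nat \<Rightarrow> nat) rep"
  where "specht \<nu> = \<lparr>vecs = fs.span (polytabloid \<nu> ` tableaux \<nu>), act = (\<lambda>\<sigma> u \<rho>. u (\<rho> \<circ> \<sigma>))\<rparr>"

definition tabloid_form :: "nat list \<Rightarrow> ((nat \<Rightarrow> nat) \<Rightarrow> 'k::field) \<Rightarrow> ((nat \<Rightarrow> nat) \<Rightarrow> 'k) \<Rightarrow> 'k"
  where "tabloid_form \<nu> u v = (\<Sum>\<rho>\<in>tabloid \<nu> ` tableaux \<nu>. u \<rho> * v \<rho>)"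

definition specht_functional :: "nat list \<Rightarrow> ((nat \<Rightarrow> nat) \<Rightarrow> 'k::field) \<Rightarrow> ((nat \<Rightarrow> nat) \<Rightarrow> 'k) \<Rightarrow> 'k"
  where "specht_functional \<nu> u = (\<lambda>v. if v \<in> vecs (specht \<nu>) then tabloid_form \<nu> u v else 0)"

text \<open>James's module \<open>D\<^sup>\<nu> = S\<^sup>\<nu> / (S\<^sup>\<nu> \<inter> S\<^sup>\<nu>\<^sup>\<bottom>)\<close> (\<open>\<nu>\<close> is \<open>p\<close>-regular, with \<open>p\<close> the
  characteristic). The form maps \<open>S\<^sup>\<nu>\<close> to its linear dual with kernel \<open>S\<^sup>\<nu> \<inter> S\<^sup>\<nu>\<^sup>\<bottom>\<close>, and
  the quotient is realized as the image of this map.\<close>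

definition james_D :: "nat list \<Rightarrow> (nat \<Rightarrow> nat, 'k::field, (nat \<Rightarrow> nat) \<Rightarrow> 'k) rep"
  where "james_D \<nu> = \<lparr>
    vecs = specht_functional \<nu> ` vecs (specht \<nu>),
    act = (\<lambda>\<sigma> \<phi> v. if v \<in> vecs (specht \<nu>) then \<phi> (act (specht \<nu>) (Hilbert_Choice.inv \<sigma>) v) else 0)\<rparr>"

lemma specht_functional_eq_0_iff:
  "specht_functional \<nu> u = 0 \<longleftrightarrow> (\<forall>v\<in>vecs (specht \<nu>). tabloid_form \<nu> u v = 0)"
  by (auto simp: specht_functional_def fun_eq_iff)

definition dim_D :: "'k::field itself \<Rightarrow> nat list \<Rightarrow> nat"
  where "dim_D _ \<nu> = fs.dim (vecs (james_D \<nu> :: (nat \<Rightarrow> nat, 'k, (nat \<Rightarrow> nat) \<Rightarrow> 'k) rep))"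


section \<open>The coefficients of the bound\<close>

definition moebius :: "nat \<Rightarrow> int"
  where "moebius d = (if squarefree d then (-1) ^ card (prime_factors d) else 0)"

definition m_coeff :: "nat \<Rightarrow> nat \<Rightarrow> rat"
  where "m_coeff s t = 1 / of_nat (s + t) *
    (\<Sum>d | d dvd s \<and> d dvd t. of_int (moebius d) *
      (fact ((s + t) div d) / (fact (s div d) * fact (t div d))))"

end

theory Submission
  imports Defs "HOL-Computational_Algebra.Polynomial" "HOL-Library.Sublist"
begin

text \<open>Put \<open>m = l1 - l2\<close>. The highest weight space of \<open>T = T(l1, l2)\<close> is a line, every endomorphism acts on it by a
  scalar, and the endomorphism is invertible or nilpotent according to whether this scalar is nonzero or zero.
  So the multiplicity of \<open>T\<close> in a module \<open>M\<close> is the rank of the pairing between \<open>Hom(T, M)\<close> and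
  \<open>Hom(M, T)\<close> that composition and this scalar define. In particular it is at least the size of every
  family in \<open>Hom(T, M)\<close> that is linearly independent modulo the radical of the pairing
  (\<open>card_le_ks_multiplicity\<close>). For the Lie power such a family is made of three kinds of maps.

  First, \<open>T\<close> is a direct summand of \<open>E\<^sup>\<otimes>\<^sup>m \<otimes> det ^ l2\<close> (\<open>tilting_endo_scalar\<close>). A module with a Weyl
  filtration has a map to this tensor power with prescribed values on highest weight vectors
  (\<open>weyl_filtered_hom\<close>); the map from the tensor power back to \<open>T\<close> is obtained from the dual of \<open>T\<close>. Here
  characteristic two makes an explicit construction possible: for \<open>n = 2\<^sup>k - 1\<close> all binomial coefficients
  \<open>n choose i\<close> are odd, and so polynomials of degree \<open>n\<close> in two variables are the same as symmetric tensors.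

  Secondly, for a partition \<open>\<nu> = (n1, n2)\<close> of \<open>t\<close> with \<open>n1 - n2 = m\<close>, every tableau defines a map from
  \<open>E\<^sup>\<otimes>\<^sup>m \<otimes> det ^ n2\<close> to \<open>E\<^sup>\<otimes>\<^sup>t\<close> by inserting a determinant for each column of length two. It takes the
  highest weight vector to the polytabloid, and the pairing of these maps with their transposes is James's
  form on the Specht module. Its rank is \<open>dim D\<^sup>\<nu>\<close> (\<open>specht_homs_independent\<close>).

  Thirdly, the Lie square of \<open>E\<close> is \<open>det\<close> and the Lie cube is \<open>E \<otimes> det\<close>. A Lyndon word with \<open>s\<close> letters for the
  former and \<open>t\<close> letters for the latter, where \<open>r = 2 s + 3 t\<close>, defines by iterated brackets a map from
  \<open>E\<^sup>\<otimes>\<^sup>t \<otimes> det ^ (s + t)\<close> to the Lie power, with the word itself as leading term. Contractions with the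
  alternating form give maps back that are triangular with respect to the lexicographic order of words
  (\<open>lyndon_maps\<close>); it is characteristic two that makes the form vanish on the Lie square. By Moebius inversion
  there are at least \<open>m_coeff s t\<close> such words (\<open>m_coeff_le_lyndon\<close>).

  In a combination of composites of these maps, the triangularity singles out one Lyndon word, and James's form
  separates the composites that belong to it (\<open>lyndon_specht_independent\<close>).\<close>

section \<open>Linear algebra in spaces of functions\<close>

global_interpretation fsff: vector_space_pair
    "fscale :: 'k::field \<Rightarrow> ('x \<Rightarrow> 'k) \<Rightarrow> _" "fscale :: 'k \<Rightarrow> ('y \<Rightarrow> 'k) \<Rightarrow> _"
  by unfold_locales

global_interpretation fsk: vector_space_pair
    "fscale :: 'k::field \<Rightarrow> ('x \<Rightarrow> 'k) \<Rightarrow> _" "(*) :: 'k \<Rightarrow> 'k \<Rightarrow> 'k"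
  by unfold_locales (auto simp: algebra_simps)

abbreviation linfun :: "(('x \<Rightarrow> 'k::field) \<Rightarrow> 'k) \<Rightarrow> bool"
  where "linfun \<equiv> Vector_Spaces.linear fscale (*)"

abbreviation linmap :: "(('x \<Rightarrow> 'k::field) \<Rightarrow> ('y \<Rightarrow> 'k)) \<Rightarrow> bool"
  where "linmap \<equiv> Vector_Spaces.linear fscale fscale"

lemma fscale_apply: "fscale c f x = c * f x"
  by (simp add: fscale_def)

lemma sum_fun_apply: "(\<Sum>i\<in>A. f i) x = (\<Sum>i\<in>A. f i x)"
  for f :: "'i \<Rightarrow> 'x \<Rightarrow> 'k::comm_monoid_add"
  by (induction A rule: infinite_finite_induct) auto

text \<open>Vectors are functions, and rules about them are applied to variables of function type.
  Rewriting the pointwise operations by default would destroy the vector structure of goals.\<close>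

declare plus_fun_apply [simp del] zero_fun_apply [simp del] minus_apply [simp del] uminus_apply [simp del]

lemmas fun_simps = plus_fun_apply zero_fun_apply minus_apply uminus_apply fscale_apply sum_fun_apply

lemma linfun_iff: "linfun g \<longleftrightarrow> (\<forall>u v. g (u + v) = g u + g v) \<and> (\<forall>c v. g (fscale c v) = c * g v)"
proof -
  have "vector_space ((*) :: 'a \<Rightarrow> 'a \<Rightarrow> 'a)" by unfold_locales (auto simp: algebra_simps)
  with fs.vector_space_axioms show ?thesis unfolding Vector_Spaces.linear_iff by blast
qed

lemma linmap_iff: "linmap g \<longleftrightarrow> (\<forall>u v. g (u + v) = g u + g v) \<and> (\<forall>c v. g (fscale c v) = fscale c (g v))"
  by (auto simp: Vector_Spaces.linear_iff fs.vector_space_axioms)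

lemma linfun_add: "linfun g \<Longrightarrow> g (u + v) = g u + g v"
  and linfun_scale: "linfun g \<Longrightarrow> g (fscale c v) = c * g v"
  by (simp_all add: linfun_iff)

lemma linfun_zero: "linfun g \<Longrightarrow> g 0 = 0"
  by (metis add_cancel_right_right linfun_add)

lemma linfun_sum: "linfun g \<Longrightarrow> g (\<Sum>i\<in>A. f i) = (\<Sum>i\<in>A. g (f i))"
  by (induction A rule: infinite_finite_induct) (auto simp: linfun_add linfun_zero)

lemma linmap_add: "linmap g \<Longrightarrow> g (u + v) = g u + g v"
  and linmap_scale: "linmap g \<Longrightarrow> g (fscale c v) = fscale c (g v)"
  by (simp_all add: linmap_iff)

lemma linmap_zero: "linmap g \<Longrightarrow> g 0 = 0"
  by (metis add_cancel_right_right linmap_add)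

lemma linmap_sum: "linmap g \<Longrightarrow> g (\<Sum>i\<in>A. f i) = (\<Sum>i\<in>A. g (f i))"
  by (induction A rule: infinite_finite_induct) (auto simp: linmap_add linmap_zero)

lemma linear_between_mem: "linear_between V W h \<Longrightarrow> v \<in> V \<Longrightarrow> h v \<in> W"
  and linear_between_add: "linear_between V W h \<Longrightarrow> u \<in> V \<Longrightarrow> v \<in> V \<Longrightarrow> h (u + v) = h u + h v"
  and linear_between_scale: "linear_between V W h \<Longrightarrow> v \<in> V \<Longrightarrow> h (fscale c v) = fscale c (h v)"
  by (auto simp: linear_between_def)

lemma linear_between_zero:
  assumes "linear_between V W h" "fs.subspace V" shows "h 0 = 0"
  by (metis add_cancel_right_right assms linear_between_add fs.subspace_0)

lemma linear_between_sum:
  assumes h: "linear_between V W h" and V: "fs.subspace V" and f: "\<And>i. i \<in> A \<Longrightarrow> f i \<in> V"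
  shows "h (\<Sum>i\<in>A. f i) = (\<Sum>i\<in>A. h (f i))"
  using f
  by (induction A rule: infinite_finite_induct)
     (auto simp: linear_between_zero[OF h V] linear_between_add[OF h] fs.subspace_sum[OF V])

lemma linear_between_extend:
  assumes h: "linear_between V W h" and V: "fs.subspace V"
  shows "\<exists>H. linmap H \<and> (\<forall>v\<in>V. H v = h v)"
proof -
  obtain B where B: "B \<subseteq> V" "fs.independent B" "V \<subseteq> fs.span B"
    using fs.basis_exists[of V] by metis
  from fsff.linear_independent_extend[OF B(2), of h]
  obtain H where H: "linmap H \<and> (\<forall>b\<in>B. H b = h b)" ..
  note add = linmap_add[OF H[THEN conjunct1]] and sc = linmap_scale[OF H[THEN conjunct1]]
  have "v \<in> V \<and> H v = h v" if "v \<in> fs.span B" for v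
    using that
  proof (induction rule: fs.span_induct_alt)
    case base
    show ?case
      by (intro conjI fs.subspace_0[OF V])
         (simp only: linmap_zero[OF H[THEN conjunct1]] linear_between_zero[OF h V])
  next
    case (step c x y)
    have x: "x \<in> V" using B(1) step(1) ..
    have cx: "fscale c x \<in> V" by (rule fs.subspace_scale[OF V x])
    have y: "y \<in> V" "H y = h y" using step by auto
    have "H x = h x" using H step(1) by simp
    then have "H (fscale c x + y) = h (fscale c x + y)"
      unfolding add sc linear_between_add[OF h cx y(1)] linear_between_scale[OF h x] y(2) by simp
    with fs.subspace_add[OF V cx y(1)] show ?case ..
  qed
  then have "\<forall>v\<in>V. H v = h v" using B(3) by auto
  with H have "linmap H \<and> (\<forall>v\<in>V. H v = h v)" by simp
  then show ?thesis by (rule exI[of _ H])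
qed

lemma functional_extend:
  assumes V: "fs.subspace V"
    and add: "\<And>u v. u \<in> V \<Longrightarrow> v \<in> V \<Longrightarrow> \<phi> (u + v) = \<phi> u + \<phi> v"
    and sc: "\<And>c v. v \<in> V \<Longrightarrow> \<phi> (fscale c v) = c * \<phi> v"
  shows "\<exists>g. linfun g \<and> (\<forall>v\<in>V. g v = (\<phi> v :: 'k::field))"
proof -
  have "linear_between V UNIV (\<lambda>v. (\<lambda>_::unit. \<phi> v))"
    using add sc by (auto simp: linear_between_def fun_simps fun_eq_iff)
  from linear_between_extend[OF this V]
  obtain H where H: "linmap H" "\<And>v. v \<in> V \<Longrightarrow> H v = (\<lambda>_::unit. \<phi> v)" by metis
  have "linfun (\<lambda>v. H v ())"
    unfolding linfun_iff by (simp add: linmap_add[OF H(1)] linmap_scale[OF H(1)] fun_simps)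
  moreover have "\<forall>v\<in>V. H v () = \<phi> v" by (simp add: H(2))
  ultimately show ?thesis by (intro exI[of _ "\<lambda>v. H v ()"] conjI)
qed

lemma dual_space_extend:
  assumes "fs.subspace V" "\<phi> \<in> dual_space V"
  shows "\<exists>g. linfun g \<and> (\<forall>v\<in>V. g v = \<phi> v)"
  using functional_extend[OF assms(1), of \<phi>] assms(2) by (auto simp: dual_space_def)

lemma dual_spaceI:
  assumes "linfun g" "fs.subspace V" shows "(\<lambda>v. if v \<in> V then g v else 0) \<in> dual_space V"
  using assms(2)
  by (auto simp: dual_space_def fun_simps linfun_add[OF assms(1)] linfun_scale[OF assms(1)]
      fs.subspace_add fs.subspace_scale)

lemma functional_separates:
  assumes W: "fs.subspace W" and v: "v \<notin> W"
  shows "\<exists>g. linfun g \<and> g v = 1 \<and> (\<forall>w\<in>W. g w = 0)"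
proof -
  obtain B where B: "B \<subseteq> W" "fs.independent B" "W \<subseteq> fs.span B"
    using fs.basis_exists[of W] by metis
  have span: "fs.span B = W" using B W by (meson fs.span_minimal subset_antisym)
  have ind: "fs.independent (insert v B)"
    using B v span by (simp add: fs.independent_insertI)
  from fsk.linear_independent_extend[OF ind, of "\<lambda>b. if b = v then 1 else 0"]
  obtain g where "linfun g \<and> (\<forall>b\<in>insert v B. g b = (if b = v then 1 else 0))" ..
  then have g: "linfun g" "b \<in> insert v B \<Longrightarrow> g b = (if b = v then 1 else 0)" for b
    by auto
  have "g w = 0" if "w \<in> fs.span B" for w
    using that
  proof (induction rule: fs.span_induct_alt)
    case base show ?case by (rule linfun_zero[OF g(1)])
  next
    case (step c x y)
    have "x \<noteq> v" using step B v by blast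
    with step have "g (fscale c x + y) = 0"
      unfolding linfun_add[OF g(1)] linfun_scale[OF g(1)] by (simp add: g(2))
    then show ?case .
  qed
  with g span show ?thesis by auto
qed

lemma functional_factor:
  assumes h: "linear_between V W h" and V: "fs.subspace V"
    and inj: "\<And>v. v \<in> V \<Longrightarrow> h v = 0 \<Longrightarrow> v = 0" and \<zeta>: "linfun \<zeta>"
  shows "\<exists>g. linfun g \<and> (\<forall>v\<in>V. g (h v) = \<zeta> v)"
proof -
  obtain H where H: "linmap H" "\<And>v. v \<in> V \<Longrightarrow> H v = h v"
    using linear_between_extend[OF h V] by metis
  have "inj_on H V"
  proof
    fix u v assume uv: "u \<in> V" "v \<in> V" "H u = H v"
    have "H (u - v) + H v = H u" using linmap_add[OF H(1), of "u - v" v] by simp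
    then have "H (u - v) = 0" using uv by simp
    then have "u - v = 0" using uv H(2) inj[of "u - v"] fs.subspace_diff[OF V] by metis
    then show "u = v" by simp
  qed
  then obtain G where G: "linmap G" "\<And>v. v \<in> V \<Longrightarrow> G (H v) = v"
    using fsff.linear_exists_left_inverse_on[OF H(1) V] by metis
  have "linfun (\<lambda>w. \<zeta> (G w))"
    unfolding linfun_iff
    by (simp add: linmap_add[OF G(1)] linmap_scale[OF G(1)] linfun_add[OF \<zeta>] linfun_scale[OF \<zeta>])
  with G(2) H(2) show ?thesis by (intro exI[of _ "\<lambda>w. \<zeta> (G w)"]) auto
qed

lemma fin_dim_subset: "fin_dim V \<Longrightarrow> U \<subseteq> V \<Longrightarrow> fin_dim U"
  by (auto simp: fin_dim_def)

lemma fin_dim_basis: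
  assumes "fin_dim V" "fs.subspace V"
  obtains B where "finite B" "B \<subseteq> V" "fs.independent B" "fs.span B = V"
proof -
  obtain C where C: "finite C" "V \<subseteq> fs.span C" using assms by (auto simp: fin_dim_def)
  obtain B where B: "B \<subseteq> V" "fs.independent B" "V \<subseteq> fs.span B"
    using fs.basis_exists[of V] by metis
  have "finite B" using fs.independent_span_bound[OF C(1) B(2)] B C by blast
  moreover have "fs.span B = V" using B assms(2) by (meson fs.span_minimal subset_antisym)
  ultimately show ?thesis using that B by blast
qed

lemma dim_strict_mono:
  assumes "fin_dim V" "fs.subspace V" "fs.subspace U" "U \<subset> V"
  shows "fs.dim U < fs.dim V"
proof -
  obtain C where C: "finite C" "C \<subseteq> V" "fs.independent C" "fs.span C = V"
    using fin_dim_basis assms by metis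
  obtain B where B: "finite B" "B \<subseteq> U" "fs.independent B" "fs.span B = U"
    using fin_dim_basis fin_dim_subset assms by (metis psubset_imp_subset)
  obtain v where v: "v \<in> V" "v \<notin> U" using assms by blast
  have "fs.independent (insert v B)" using B v by (simp add: fs.independent_insertI)
  moreover have "insert v B \<subseteq> fs.span C" using B v C assms by blast
  ultimately have "card (insert v B) \<le> card C" using fs.independent_span_bound[OF C(1)] by blast
  moreover have "v \<notin> B" using v B by blast
  moreover have "card B = fs.dim U" "card C = fs.dim V"
    using B C fs.dim_span_eq_card_independent by metis+
  ultimately show ?thesis using B by simp
qed

lemma dim_mono_fin:
  assumes "fin_dim V" "fs.subspace V" "fs.subspace U" "U \<subseteq> V"
  shows "fs.dim U \<le> fs.dim V"
  using dim_strict_mono[OF assms(1-3)] assms(4) by (metis less_imp_le order_refl psubsetI)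

lemma fin_dim_dual_basis:
  assumes "fin_dim V" "fs.subspace V"
  shows "\<exists>B G. finite B \<and> B \<subseteq> V \<and> (\<forall>b. linfun (G b)) \<and> (\<forall>v\<in>V. v = (\<Sum>b\<in>B. fscale (G b v) b))"
proof -
  obtain B where B: "finite B" "B \<subseteq> V" "fs.independent B" "fs.span B = V"
    using fin_dim_basis assms by metis
  have "\<exists>g. linfun g \<and> (\<forall>x\<in>B. g x = (if x = b then 1 else 0))" for b
    by (rule fsk.linear_independent_extend[OF B(3)])
  from choice[OF allI[OF this]]
  obtain G where G': "\<forall>b. linfun (G b) \<and> (\<forall>x\<in>B. G b x = (if x = b then 1 else 0))" ..
  then have G: "linfun (G b)" "x \<in> B \<Longrightarrow> G b x = (if x = b then 1 else 0)" for b x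
    by auto
  have "v = (\<Sum>b\<in>B. fscale (G b v) b)" if "v \<in> fs.span B" for v
    using that
  proof (induction rule: fs.span_induct_alt)
    case base
    have "0 = (\<Sum>b\<in>B. fscale (G b 0) b)" by (simp add: linfun_zero[OF G(1)])
    then show ?case .
  next
    case (step c x y)
    have "(\<Sum>b\<in>B. fscale (G b (fscale c x + y)) b)
        = (\<Sum>b\<in>B. fscale (if x = b then c else 0) b + fscale (G b y) b)"
      using step(1) by (intro sum.cong)
        (auto simp: linfun_add[OF G(1)] linfun_scale[OF G(1)] G(2) fs.scale_left_distrib)
    also have "\<dots> = (\<Sum>b\<in>B. fscale (if x = b then c else 0) b) + y"
      by (simp only: sum.distrib step(2)[symmetric])
    also have "(\<Sum>b\<in>B. fscale (if x = b then c else 0) b) = (\<Sum>b\<in>B. if x = b then fscale c b else 0)"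
      by (intro sum.cong) auto
    also have "\<dots> = fscale c x" using B step(1) by simp
    finally have "fscale c x + y = (\<Sum>b\<in>B. fscale (G b (fscale c x + y)) b)" by (rule sym)
    then show ?case .
  qed
  then have "v = (\<Sum>b\<in>B. fscale (G b v) b)" if "v \<in> V" for v using that unfolding B(4) .
  then have "\<forall>v\<in>V. v = (\<Sum>b\<in>B. fscale (G b v) b)" by (rule ballI)
  with B(1,2) G(1) show ?thesis by (intro exI[of _ B] exI[of _ G] conjI allI)
qed

text \<open>With a basis and its coordinate functionals \<open>r b\<close>, the functional \<open>\<Phi>\<close> is evaluation at the vector
  whose coordinates are \<open>\<Phi> (r b)\<close>.\<close>

lemma double_dual:
  assumes V: "fin_dim V" "fs.subspace V"
    and add: "\<And>\<phi> \<psi>. \<phi> \<in> dual_space V \<Longrightarrow> \<psi> \<in> dual_space V \<Longrightarrow> \<Phi> (\<phi> + \<psi>) = \<Phi> \<phi> + \<Phi> \<psi>"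
    and sc: "\<And>c \<phi>. \<phi> \<in> dual_space V \<Longrightarrow> \<Phi> (fscale c \<phi>) = c * \<Phi> \<phi>"
  shows "\<exists>y\<in>V. \<forall>\<phi>\<in>dual_space V. \<Phi> \<phi> = (\<phi> y :: 'k::field)"
proof -
  from fin_dim_dual_basis[OF V]
  obtain B where "\<exists>G. finite B \<and> B \<subseteq> V \<and> (\<forall>b. linfun (G b)) \<and> (\<forall>v\<in>V. v = (\<Sum>b\<in>B. fscale (G b v) b))" ..
  then obtain G where BG: "finite B \<and> B \<subseteq> V \<and> (\<forall>b. linfun (G b)) \<and> (\<forall>v\<in>V. v = (\<Sum>b\<in>B. fscale (G b v) b))" ..
  then have B: "finite B" "B \<subseteq> V" and G: "linfun (G b)" for b by auto
  have exp: "v = (\<Sum>b\<in>B. fscale (G b v) b)" if "v \<in> V" for v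
    using BG that by (elim conjE) (erule (1) bspec)
  define r where "r b = (\<lambda>v. if v \<in> V then G b v else 0)" for b
  have r: "r b \<in> dual_space V" for b unfolding r_def by (rule dual_spaceI[OF G V(2)])
  have sub: "fs.subspace (dual_space V)"
    by (auto simp: fs.subspace_def dual_space_def fun_simps algebra_simps)
  have \<Phi>: "linear_between (dual_space V) UNIV (\<lambda>\<phi>. (\<lambda>_::unit. \<Phi> \<phi>))"
    using add sc by (auto simp: linear_between_def fun_simps fun_eq_iff)
  define y where "y = (\<Sum>b\<in>B. fscale (\<Phi> (r b)) b)"
  have bV: "b \<in> V" if "b \<in> B" for b using B that by auto
  have "\<Phi> \<phi> = \<phi> y" if \<phi>: "\<phi> \<in> dual_space V" for \<phi>
  proof -
    from dual_space_extend[OF V(2) \<phi>]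
    obtain g where "linfun g \<and> (\<forall>v\<in>V. g v = \<phi> v)" ..
    then have g: "linfun g" "v \<in> V \<Longrightarrow> g v = \<phi> v" for v by auto
    have "\<phi> = (\<Sum>b\<in>B. fscale (\<phi> b) (r b))"
    proof
      fix v show "\<phi> v = (\<Sum>b\<in>B. fscale (\<phi> b) (r b)) v"
      proof (cases "v \<in> V")
        case True
        have "\<phi> v = g v" using g(2)[OF True] by simp
        also have "\<dots> = g (\<Sum>b\<in>B. fscale (G b v) b)" by (rule arg_cong[OF exp[OF True], of g])
        also have "\<dots> = (\<Sum>b\<in>B. G b v * \<phi> b)"
          by (auto simp: linfun_sum[OF g(1)] linfun_scale[OF g(1)] g(2) bV intro!: sum.cong)
        finally show ?thesis using True by (simp add: fun_simps r_def mult.commute)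
      next
        case False
        with \<phi> show ?thesis by (simp add: fun_simps r_def dual_space_def)
      qed
    qed
    then have "(\<lambda>_::unit. \<Phi> \<phi>) = (\<lambda>_. \<Phi> (\<Sum>b\<in>B. fscale (\<phi> b) (r b)))" by simp
    also have "\<dots> = (\<Sum>b\<in>B. (\<lambda>_. \<Phi> (fscale (\<phi> b) (r b))))"
      by (rule linear_between_sum[OF \<Phi> sub]) (simp add: r fs.subspace_scale[OF sub])
    finally have "\<Phi> \<phi> = (\<Sum>b\<in>B. \<Phi> (fscale (\<phi> b) (r b)))" by (auto simp: fun_simps fun_eq_iff)
    also have "\<dots> = (\<Sum>b\<in>B. \<phi> b * \<Phi> (r b))" by (simp add: sc r)
    also have "\<dots> = g y" unfolding y_def
      by (auto simp: linfun_sum[OF g(1)] linfun_scale[OF g(1)] g(2) bV intro!: sum.cong)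
    also have "\<dots> = \<phi> y" unfolding y_def by (intro g(2) fs.subspace_sum V fs.subspace_scale bV)
    finally show ?thesis .
  qed
  moreover have "y \<in> V" unfolding y_def by (intro fs.subspace_sum V fs.subspace_scale bV)
  ultimately show ?thesis by blast
qed

lemma scalar_polynomial_zero:
  fixes a :: "nat \<Rightarrow> 'k::field"
  assumes "infinite C" "\<And>c. c \<in> C \<Longrightarrow> (\<Sum>i\<le>n. c ^ i * a i) = 0" "i \<le> n"
  shows "a i = 0"
proof -
  define p where "p = (\<Sum>i\<le>n. monom (a i) i)"
  have "poly p c = (\<Sum>i\<le>n. c ^ i * a i)" for c
    by (simp add: p_def poly_sum poly_monom mult.commute)
  then have "C \<subseteq> {c. poly p c = 0}" using assms(2) by auto
  then have "p = 0" using poly_roots_finite assms(1) finite_subset by blast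
  then have "coeff p i = 0" by simp
  then show ?thesis using assms(3) by (simp add: p_def coeff_sum)
qed

text \<open>A functional that kills \<open>V\<close> turns the curve into a polynomial with infinitely many zeros.\<close>

lemma curve_coefficients_mem:
  fixes v :: "nat \<Rightarrow> 'x \<Rightarrow> 'k::field"
  assumes V: "fs.subspace V" and C: "infinite C"
    and mem: "\<And>c. c \<in> C \<Longrightarrow> (\<Sum>i\<le>n. fscale (c ^ i) (v i)) \<in> V" and "i \<le> n"
  shows "v i \<in> V"
proof (rule ccontr)
  assume "v i \<notin> V"
  from functional_separates[OF V this]
  obtain g where "linfun g \<and> g (v i) = 1 \<and> (\<forall>w\<in>V. g w = 0)" ..
  then have g: "linfun g" "g (v i) = 1" "w \<in> V \<Longrightarrow> g w = 0" for w by auto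
  have "(\<Sum>i\<le>n. c ^ i * g (v i)) = 0" if "c \<in> C" for c
    using g(3)[OF mem[OF that]] by (simp add: linfun_sum[OF g(1)] linfun_scale[OF g(1)])
  from scalar_polynomial_zero[OF C this \<open>i \<le> n\<close>] g(2) show False by simp
qed

lemma card_le_if_trivial_solutions:
  fixes A :: "'i \<Rightarrow> 'j \<Rightarrow> 'k::field"
  assumes fin: "finite I" "finite J"
    and triv: "\<And>\<alpha> j. (\<And>i. i \<in> I \<Longrightarrow> (\<Sum>j\<in>J. \<alpha> j * A i j) = 0) \<Longrightarrow> j \<in> J \<Longrightarrow> \<alpha> j = 0"
  shows "card J \<le> card I"
proof -
  define u where "u j = (\<lambda>i. if i \<in> I then A i j else 0)" for j
  define e where "e i = (\<lambda>i'. if i' = i then 1 else 0 :: 'k)" for i :: 'i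
  have "inj_on u J"
  proof
    fix j j' assume j: "j \<in> J" "j' \<in> J" "u j = u j'"
    show "j = j'"
    proof (rule ccontr)
      assume ne: "j \<noteq> j'"
      define \<alpha> where "\<alpha> x = (if x = j then 1 else 0) - (if x = j' then 1 else 0 :: 'k)" for x
      have "(\<Sum>x\<in>J. \<alpha> x * A i x) = 0" if "i \<in> I" for i
      proof -
        have "(\<Sum>x\<in>J. \<alpha> x * A i x) = A i j - A i j'"
          using j fin by (simp add: \<alpha>_def left_diff_distrib sum_subtractf if_distrib[of "\<lambda>x. x * _"] cong: if_cong)
        also have "\<dots> = u j i - u j' i" using that by (simp add: u_def)
        finally show ?thesis using j by simp
      qed
      from triv[OF this j(1)] ne show False by (simp add: \<alpha>_def)
    qed
  qed
  moreover have "fs.independent (u ` J)"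
  proof (rule fs.independent_if_scalars_zero)
    show "finite (u ` J)" using fin by simp
    fix f x assume f: "(\<Sum>x\<in>u ` J. fscale (f x) x) = 0" and x: "x \<in> u ` J"
    then obtain j where j: "j \<in> J" "x = u j" by blast
    have s: "(\<Sum>j\<in>J. fscale (f (u j)) (u j)) = 0"
      using f \<open>inj_on u J\<close> by (simp add: sum.reindex)
    have "(\<Sum>j\<in>J. f (u j) * A i j) = 0" if "i \<in> I" for i
      using fun_cong[OF s, of i] that by (simp add: fun_simps u_def)
    from triv[OF this j(1)] j(2) show "f x = 0" by simp
  qed
  moreover have "u ` J \<subseteq> fs.span (e ` I)"
  proof safe
    fix j assume "j \<in> J"
    have "u j = (\<Sum>i\<in>I. fscale (A i j) (e i))"
    proof
      fix i
      have "(\<Sum>i'\<in>I. fscale (A i' j) (e i')) i = (\<Sum>i'\<in>I. if i = i' then A i' j else 0)"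
        by (simp add: fun_simps e_def if_distrib cong: if_cong)
      also have "\<dots> = u j i" using fin by (simp add: u_def)
      finally show "u j i = (\<Sum>i\<in>I. fscale (A i j) (e i)) i" ..
    qed
    then show "u j \<in> fs.span (e ` I)"
      by (metis (no_types, lifting) fs.span_base fs.span_scale fs.span_sum imageI)
  qed
  ultimately have "card (u ` J) \<le> card (e ` I)"
    using fs.independent_span_bound[of "e ` I" "u ` J"] fin by auto
  with \<open>inj_on u J\<close> show ?thesis
    using card_image card_image_le[OF fin(1), of e] by (metis order_trans)
qed

section \<open>Homomorphisms and Krull--Schmidt multiplicities\<close>

lemma rep_hom_mem: "rep_hom G M N f \<Longrightarrow> v \<in> vecs M \<Longrightarrow> f v \<in> vecs N"
  and rep_hom_add: "rep_hom G M N f \<Longrightarrow> u \<in> vecs M \<Longrightarrow> v \<in> vecs M \<Longrightarrow> f (u + v) = f u + f v"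
  and rep_hom_scale: "rep_hom G M N f \<Longrightarrow> v \<in> vecs M \<Longrightarrow> f (fscale c v) = fscale c (f v)"
  and rep_hom_act: "rep_hom G M N f \<Longrightarrow> g \<in> carrier G \<Longrightarrow> v \<in> vecs M \<Longrightarrow> f (act M g v) = act N g (f v)"
  by (auto simp: rep_hom_def linear_between_def)

lemma rep_homI:
  assumes "\<And>v. v \<in> vecs M \<Longrightarrow> f v \<in> vecs N"
    and "\<And>u v. u \<in> vecs M \<Longrightarrow> v \<in> vecs M \<Longrightarrow> f (u + v) = f u + f v"
    and "\<And>c v. v \<in> vecs M \<Longrightarrow> f (fscale c v) = fscale c (f v)"
    and "\<And>g v. g \<in> carrier G \<Longrightarrow> v \<in> vecs M \<Longrightarrow> f (act M g v) = act N g (f v)"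
  shows "rep_hom G M N f"
  using assms by (auto simp: rep_hom_def linear_between_def)

lemma rep_hom_comp:
  assumes f: "rep_hom G M N f" and h: "rep_hom G N P h"
  shows "rep_hom G M P (\<lambda>v. h (f v))"
  by (rule rep_homI)
     (simp_all add: rep_hom_mem[OF f] rep_hom_mem[OF h] rep_hom_add[OF f] rep_hom_add[OF h]
       rep_hom_scale[OF f] rep_hom_scale[OF h] rep_hom_act[OF f] rep_hom_act[OF h])

lemma rep_subspace: "is_rep G M \<Longrightarrow> fs.subspace (vecs M)"
  and rep_act_mem: "is_rep G M \<Longrightarrow> g \<in> carrier G \<Longrightarrow> v \<in> vecs M \<Longrightarrow> act M g v \<in> vecs M"
  and rep_act_add: "is_rep G M \<Longrightarrow> g \<in> carrier G \<Longrightarrow> u \<in> vecs M \<Longrightarrow> v \<in> vecs M \<Longrightarrow>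
    act M g (u + v) = act M g u + act M g v"
  and rep_act_scale: "is_rep G M \<Longrightarrow> g \<in> carrier G \<Longrightarrow> v \<in> vecs M \<Longrightarrow>
    act M g (fscale c v) = fscale c (act M g v)"
  by (auto simp: is_rep_def linear_between_def image_subset_iff)

lemma rep_act_linear: "is_rep G M \<Longrightarrow> g \<in> carrier G \<Longrightarrow> linear_between (vecs M) (vecs M) (act M g)"
  by (auto simp: is_rep_def)

lemma rep_act_sum:
  assumes "is_rep G M" "g \<in> carrier G" "\<And>i. i \<in> A \<Longrightarrow> f i \<in> vecs M"
  shows "act M g (\<Sum>i\<in>A. f i) = (\<Sum>i\<in>A. act M g (f i))"
  by (rule linear_between_sum[OF rep_act_linear rep_subspace]) (use assms in auto)

lemma rep_hom_zero: "rep_hom G M N f \<Longrightarrow> fs.subspace (vecs M) \<Longrightarrow> f 0 = 0"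
  by (auto simp: rep_hom_def intro: linear_between_zero)

lemma rep_hom_diff:
  assumes f: "rep_hom G M N f" and M: "fs.subspace (vecs M)" and uv: "u \<in> vecs M" "v \<in> vecs M"
  shows "f (u - v) = f u - f v"
proof -
  have "f (u - v) + f v = f u"
    using rep_hom_add[OF f fs.subspace_diff[OF M uv] uv(2)] by simp
  then show ?thesis by (simp add: eq_diff_eq)
qed

lemma rep_hom_sum:
  assumes "rep_hom G M N f" "fs.subspace (vecs M)" "\<And>i. i \<in> A \<Longrightarrow> h i \<in> vecs M"
  shows "f (\<Sum>i\<in>A. h i) = (\<Sum>i\<in>A. f (h i))"
  by (rule linear_between_sum) (use assms in \<open>auto simp: rep_hom_def\<close>)

lemma rep_hom_lincomb:
  assumes N: "is_rep G N" and f: "\<And>i. i \<in> A \<Longrightarrow> rep_hom G M N (f i)"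
  shows "rep_hom G M N (\<lambda>v. \<Sum>i\<in>A. fscale (c i) (f i v))"
proof (rule rep_homI)
  note VN = rep_subspace[OF N]
  have *: "fscale (c i) (f i v) \<in> vecs N" if "v \<in> vecs M" "i \<in> A" for i v
    by (rule fs.subspace_scale[OF VN rep_hom_mem[OF f[OF that(2)] that(1)]])
  then show "(\<Sum>i\<in>A. fscale (c i) (f i v)) \<in> vecs N" if "v \<in> vecs M" for v
    using that by (rule_tac fs.subspace_sum[OF VN])
  show "(\<Sum>i\<in>A. fscale (c i) (f i (u + v))) = (\<Sum>i\<in>A. fscale (c i) (f i u)) + (\<Sum>i\<in>A. fscale (c i) (f i v))"
    if "u \<in> vecs M" "v \<in> vecs M" for u v
    unfolding sum.distrib[symmetric]
    by (rule sum.cong) (simp_all add: rep_hom_add[OF f that] fs.scale_right_distrib)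
  show "(\<Sum>i\<in>A. fscale (c i) (f i (fscale d v))) = fscale d (\<Sum>i\<in>A. fscale (c i) (f i v))"
    if "v \<in> vecs M" for d v
    unfolding fs.scale_sum_right
    by (rule sum.cong) (simp_all add: rep_hom_scale[OF f that] mult.commute)
  show "(\<Sum>i\<in>A. fscale (c i) (f i (act M g v))) = act N g (\<Sum>i\<in>A. fscale (c i) (f i v))"
    if g: "g \<in> carrier G" and v: "v \<in> vecs M" for g v
  proof -
    have "act N g (\<Sum>i\<in>A. fscale (c i) (f i v)) = (\<Sum>i\<in>A. act N g (fscale (c i) (f i v)))"
      by (rule rep_act_sum[OF N g]) (rule *[OF v])
    also have "\<dots> = (\<Sum>i\<in>A. fscale (c i) (f i (act M g v)))"
      by (rule sum.cong)
         (simp_all add: rep_act_scale[OF N g rep_hom_mem[OF f v]] rep_hom_act[OF f g v])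
    finally show ?thesis by (rule sym)
  qed
qed

lemma vecs_subrep [simp]: "vecs (subrep M W) = W" and act_subrep [simp]: "act (subrep M W) = act M"
  by (auto simp: subrep_def)

lemma subrep_is_rep:
  assumes M: "is_rep G M" and W: "submodule G M W"
  shows "is_rep G (subrep M W)"
proof -
  have WM: "v \<in> vecs M" if "v \<in> W" for v using W that by (auto simp: submodule_def)
  have "linear_between W W (act M g)" if g: "g \<in> carrier G" for g
    unfolding linear_between_def
  proof (intro conjI ballI allI)
    show "act M g ` W \<subseteq> W" using W g by (simp add: submodule_def)
  qed (simp_all add: rep_act_add[OF M g] rep_act_scale[OF M g] WM)
  moreover have "fs.subspace W" using W by (simp add: submodule_def)
  moreover have "act M \<one>\<^bsub>G\<^esub> v = v" if "v \<in> W" for v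
    using M WM[OF that] by (simp add: is_rep_def)
  moreover have "act M (g \<otimes>\<^bsub>G\<^esub> h) v = act M g (act M h v)"
    if "g \<in> carrier G" "h \<in> carrier G" "v \<in> W" for g h v
    using M that WM[OF that(3)] by (simp add: is_rep_def)
  ultimately show ?thesis by (simp add: is_rep_def)
qed

lemma submodule_subrep: "submodule G M V \<Longrightarrow> submodule G (subrep M V) W \<longleftrightarrow> submodule G M W \<and> W \<subseteq> V"
  unfolding submodule_def by auto

lemma subrep_subrep [simp]: "subrep (subrep M V) W = subrep M W"
  by (simp add: subrep_def)

lemma submodule_image:
  assumes f: "rep_hom G M N f" and M: "is_rep G M"
  shows "submodule G N (f ` vecs M)"
  unfolding submodule_def
proof (intro conjI ballI)
  show "fs.subspace (f ` vecs M)"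
  proof (rule fs.subspaceI)
    show "0 \<in> f ` vecs M"
      by (rule image_eqI[of _ _ 0]) (use rep_hom_zero[OF f] rep_subspace[OF M] fs.subspace_0 in auto)
  next
    fix x y assume "x \<in> f ` vecs M" "y \<in> f ` vecs M"
    then obtain u v where uv: "u \<in> vecs M" "v \<in> vecs M" "x = f u" "y = f v" by blast
    then have "x + y = f (u + v)" by (simp add: rep_hom_add[OF f])
    then show "x + y \<in> f ` vecs M" using uv fs.subspace_add[OF rep_subspace[OF M]] by blast
  next
    fix c x assume "x \<in> f ` vecs M"
    then obtain u where u: "u \<in> vecs M" "x = f u" by blast
    then have "fscale c x = f (fscale c u)" by (simp add: rep_hom_scale[OF f])
    then show "fscale c x \<in> f ` vecs M" using u fs.subspace_scale[OF rep_subspace[OF M]] by blast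
  qed
  show "f ` vecs M \<subseteq> vecs N" by (auto simp: rep_hom_mem[OF f])
  fix g assume g: "g \<in> carrier G"
  show "act N g ` f ` vecs M \<subseteq> f ` vecs M"
  proof safe
    fix v assume v: "v \<in> vecs M"
    then have "act N g (f v) = f (act M g v)" using g by (simp add: rep_hom_act[OF f])
    then show "act N g (f v) \<in> f ` vecs M" using rep_act_mem[OF M g v] by simp
  qed
qed

lemma submodule_kernel:
  assumes f: "rep_hom G M N f" and M: "is_rep G M" and N: "is_rep G N"
  shows "submodule G M {v \<in> vecs M. f v = 0}"
  unfolding submodule_def
proof (intro conjI ballI)
  have N0: "act N g 0 = 0" if "g \<in> carrier G" for g
    using linear_between_zero[OF rep_act_linear[OF N that] rep_subspace[OF N]] .
  show "fs.subspace {v \<in> vecs M. f v = 0}"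
    using rep_subspace[OF M] rep_hom_zero[OF f rep_subspace[OF M]]
    by (auto simp: fs.subspace_def rep_hom_add[OF f] rep_hom_scale[OF f])
  fix g assume g: "g \<in> carrier G"
  then show "act M g ` {v \<in> vecs M. f v = 0} \<subseteq> {v \<in> vecs M. f v = 0}"
    using N0 rep_act_mem[OF M] by (auto simp: rep_hom_act[OF f])
qed auto

lemma indecomposable_split:
  assumes "indecomposable G M" "submodule G M U" "submodule G M W" "U \<inter> W = {0}"
    "{u + w |u w. u \<in> U \<and> w \<in> W} = vecs M"
  shows "U = {0} \<or> W = {0}"
  using assms unfolding indecomposable_def by blast

lemma rep_hom_funpow:
  assumes "rep_hom G T T h" shows "rep_hom G T T (h ^^ n)"
proof (induction n)
  case 0 show ?case by (rule rep_homI) auto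
next
  case (Suc n)
  from rep_hom_comp[OF Suc assms] show ?case by simp
qed

lemma eventually_constant_bounded:
  fixes d :: "nat \<Rightarrow> nat"
  assumes "\<And>n. d n \<le> d (Suc n)" "\<And>n. d n \<le> B"
  shows "\<exists>N. \<forall>n\<ge>N. d n = d N"
proof -
  have "range d \<subseteq> {..B}" using assms(2) by auto
  then have "finite (range d)" using finite_subset by blast
  then have "Max (range d) \<in> range d" by (intro Max_in) auto
  then obtain N where N: "d N = Max (range d)" by auto
  have "d N \<le> d n" if "n \<ge> N" for n using lift_Suc_mono_le[of d, OF assms(1)] that by blast
  moreover have "d n \<le> d N" for n using N \<open>finite (range d)\<close> by simp
  ultimately show ?thesis by (meson le_antisym)
qed

text \<open>By dimension the kernels and the images of the powers of \<open>h\<close> become stationary, and the stable kernel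
  and the stable image are then complementary submodules; one of them has to be zero.\<close>

lemma fitting:
  assumes h: "rep_hom G T T h" and T: "is_rep G T" "fin_dim (vecs T)" "indecomposable G T"
  shows "bij_betw h (vecs T) (vecs T) \<or> (\<exists>n. \<forall>v\<in>vecs T. (h ^^ n) v = 0)"
proof -
  define K where "K n = {v \<in> vecs T. (h ^^ n) v = 0}" for n
  define I where "I n = (h ^^ n) ` vecs T" for n
  note hn = rep_hom_funpow[OF h] and V = rep_subspace[OF T(1)]
  have K: "submodule G T (K n)" for n unfolding K_def by (rule submodule_kernel[OF hn T(1) T(1)])
  have I: "submodule G T (I n)" for n unfolding I_def by (rule submodule_image[OF hn T(1)])
  have subs: "fs.subspace (K n)" "fs.subspace (I n)" "K n \<subseteq> vecs T" "I n \<subseteq> vecs T" for n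
    using K I by (auto simp: submodule_def)
  have fd: "fin_dim (K n)" "fin_dim (I n)" for n
    by (rule fin_dim_subset[OF T(2) subs(3)], rule fin_dim_subset[OF T(2) subs(4)])
  have h0: "h 0 = 0" by (rule rep_hom_zero[OF h V])
  have Kmono: "K n \<subseteq> K (Suc n)" for n unfolding K_def by (auto simp: h0)
  have Imono: "I (Suc n) \<subseteq> I n" for n unfolding I_def
    by (auto simp: funpow_swap1 rep_hom_mem[OF h])
  have "\<exists>N. \<forall>n\<ge>N. fs.dim (K n) = fs.dim (K N)"
    by (rule eventually_constant_bounded[of _ "fs.dim (vecs T)"])
       (rule dim_mono_fin[OF fd(1) subs(1) subs(1) Kmono], rule dim_mono_fin[OF T(2) V subs(1) subs(3)])
  then obtain N1 where N1: "\<And>n. n \<ge> N1 \<Longrightarrow> fs.dim (K n) = fs.dim (K N1)" by blast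
  have "\<exists>N. \<forall>n\<ge>N. fs.dim (vecs T) - fs.dim (I n) = fs.dim (vecs T) - fs.dim (I N)"
  proof (rule eventually_constant_bounded[of _ "fs.dim (vecs T)"])
    fix n show "fs.dim (vecs T) - fs.dim (I n) \<le> fs.dim (vecs T) - fs.dim (I (Suc n))"
      using dim_mono_fin[OF fd(2) subs(2) subs(2) Imono] by (rule diff_le_mono2)
  qed simp
  then obtain N2 where N2: "\<And>n. n \<ge> N2 \<Longrightarrow> fs.dim (vecs T) - fs.dim (I n) = fs.dim (vecs T) - fs.dim (I N2)"
    by blast
  have Ile: "fs.dim (I n) \<le> fs.dim (vecs T)" for n by (rule dim_mono_fin[OF T(2) V subs(2) subs(4)])
  define N where "N = Suc (N1 + N2)"
  have "fs.dim (K (N + N)) = fs.dim (K N)" using N1[of N] N1[of "N+N"] by (simp add: N_def)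
  moreover have "K N \<subseteq> K (N + N)" using lift_Suc_mono_le[of K, OF Kmono] by simp
  ultimately have KN: "K (N + N) = K N"
    using dim_strict_mono[OF fd(1) subs(1) subs(1)] by (metis less_irrefl psubsetI)
  have "fs.dim (I (N + N)) = fs.dim (I N)"
    using N2[of N] N2[of "N+N"] Ile[of N] Ile[of "N+N"] by (simp add: N_def)
  moreover have "I (N + N) \<subseteq> I N" using lift_Suc_antimono_le[of I, OF Imono] by simp
  ultimately have IN: "I (N + N) = I N"
    using dim_strict_mono[OF fd(2) subs(2) subs(2)] by (metis less_irrefl psubsetI)
  have "K N \<inter> I N = {0}"
  proof -
    have "x = 0" if "x \<in> K N" "x \<in> I N" for x
    proof -
      obtain u where u: "u \<in> vecs T" "x = (h ^^ N) u" using \<open>x \<in> I N\<close> by (auto simp: I_def)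
      then have "u \<in> K (N + N)" using that by (simp add: K_def funpow_add)
      with KN u show "x = 0" by (simp add: K_def)
    qed
    then show ?thesis using subs fs.subspace_0 by blast
  qed
  moreover have "{u + w |u w. u \<in> K N \<and> w \<in> I N} = vecs T"
  proof
    show "{u + w |u w. u \<in> K N \<and> w \<in> I N} \<subseteq> vecs T"
      using subs(3,4) fs.subspace_add[OF V] by blast
    show "vecs T \<subseteq> {u + w |u w. u \<in> K N \<and> w \<in> I N}"
    proof
      fix v assume v: "v \<in> vecs T"
      then have "(h ^^ N) v \<in> I (N + N)" using IN by (auto simp: I_def)
      then obtain u where u: "u \<in> vecs T" "(h ^^ N) v = (h ^^ N) ((h ^^ N) u)"
        by (auto simp: I_def funpow_add)
      have m: "(h ^^ N) u \<in> vecs T" by (rule rep_hom_mem[OF hn u(1)])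
      have "v - (h ^^ N) u \<in> K N"
        using u v m fs.subspace_diff[OF V] by (simp add: K_def rep_hom_diff[OF hn V])
      moreover have "(h ^^ N) u \<in> I N" using u by (auto simp: I_def)
      ultimately show "v \<in> {u + w |u w. u \<in> K N \<and> w \<in> I N}"
        by (intro CollectI exI[of _ "v - (h ^^ N) u"] exI[of _ "(h ^^ N) u"]) auto
    qed
  qed
  ultimately have "K N = {0} \<or> I N = {0}" by (rule indecomposable_split[OF T(3) K I])
  then consider "K N = {0}" | "I N = {0}" by blast
  then show ?thesis
  proof cases
    case 1
    have "vecs T \<subseteq> I N"
    proof
      fix v assume "v \<in> vecs T"
      then have "v \<in> {u + w |u w. u \<in> K N \<and> w \<in> I N}" using \<open>_ = vecs T\<close> by simp
      with 1 show "v \<in> I N" by auto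
    qed
    have "vecs T \<subseteq> h ` vecs T"
    proof
      fix v assume "v \<in> vecs T"
      with \<open>vecs T \<subseteq> I N\<close> obtain u where u: "u \<in> vecs T" "v = (h ^^ N) u" by (auto simp: I_def)
      then have "v = h ((h ^^ (N1 + N2)) u)" by (simp add: N_def)
      then show "v \<in> h ` vecs T" by (rule image_eqI[OF _ rep_hom_mem[OF hn u(1)]])
    qed
    moreover have "inj_on h (vecs T)"
    proof
      fix u v assume uv: "u \<in> vecs T" "v \<in> vecs T" "h u = h v"
      have "(h ^^ N) (u - v) = (h ^^ (N1 + N2)) (h (u - v))" by (simp add: N_def funpow_swap1)
      also have "h (u - v) = 0" using uv by (simp add: rep_hom_diff[OF h V])
      also have "(h ^^ (N1 + N2)) 0 = 0" by (rule rep_hom_zero[OF hn V])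
      finally have "u - v \<in> K N" using fs.subspace_diff[OF V uv(1,2)] by (simp add: K_def)
      with 1 show "u = v" by simp
    qed
    ultimately show ?thesis using rep_hom_mem[OF h] by (auto simp: bij_betw_def)
  next
    case 2
    then show ?thesis by (auto simp: I_def)
  qed
qed

text \<open>If \<open>g \<circ> f\<close> is bijective, then \<open>W\<close> is the direct sum of the image of \<open>f\<close> and the kernel of \<open>g\<close>.\<close>

lemma rep_iso_if_split:
  assumes f: "rep_hom G T W f" and g: "rep_hom G W T g" and b: "bij_betw (\<lambda>v. g (f v)) (vecs T) (vecs T)"
    and T: "is_rep G T" "vecs T \<noteq> {0}" and W: "is_rep G W" "indecomposable G W"
  shows "bij_betw f (vecs T) (vecs W)"
proof -
  define U where "U = f ` vecs T"
  define K where "K = {w \<in> vecs W. g w = 0}"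
  have sub: "submodule G W U" "submodule G W K"
    unfolding U_def K_def by (rule submodule_image[OF f T(1)], rule submodule_kernel[OF g W(1) T(1)])
  note VT = rep_subspace[OF T(1)] and VW = rep_subspace[OF W(1)]
  have z: "f 0 = 0" "g 0 = 0" by (rule rep_hom_zero[OF f VT], rule rep_hom_zero[OF g VW])
  have inj: "u = v" if "u \<in> vecs T" "v \<in> vecs T" "g (f u) = g (f v)" for u v
    using b that by (auto simp: bij_betw_def inj_on_def)
  have int: "U \<inter> K = {0}"
  proof -
    have "x = 0" if "x \<in> U" "x \<in> K" for x
    proof -
      obtain u where u: "u \<in> vecs T" "x = f u" using \<open>x \<in> U\<close> by (auto simp: U_def)
      then have "g (f u) = g (f 0)" using \<open>x \<in> K\<close> z by (simp add: K_def)
      then have "u = 0" using inj u fs.subspace_0[OF VT] by blast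
      with u z show "x = 0" by simp
    qed
    moreover have "0 \<in> U" "0 \<in> K" using sub fs.subspace_0 by (auto simp: submodule_def)
    ultimately show ?thesis by blast
  qed
  have sum: "{u + w |u w. u \<in> U \<and> w \<in> K} = vecs W"
  proof
    show "{u + w |u w. u \<in> U \<and> w \<in> K} \<subseteq> vecs W"
      using sub fs.subspace_add[OF VW] unfolding submodule_def by blast
    show "vecs W \<subseteq> {u + w |u w. u \<in> U \<and> w \<in> K}"
    proof
      fix w assume w: "w \<in> vecs W"
      then have "g w \<in> (\<lambda>v. g (f v)) ` vecs T" using b rep_hom_mem[OF g] by (auto simp: bij_betw_def)
      then obtain t where t: "t \<in> vecs T" "g w = g (f t)" by blast
      have "w - f t \<in> K"
        using t w rep_hom_mem[OF f] fs.subspace_diff[OF VW] by (simp add: K_def rep_hom_diff[OF g VW])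
      then show "w \<in> {u + w |u w. u \<in> U \<and> w \<in> K}"
        using t by (intro CollectI exI[of _ "f t"] exI[of _ "w - f t"]) (auto simp: U_def)
    qed
  qed
  have "U \<noteq> {0}"
  proof
    assume "U = {0}"
    then have "f u = 0" if "u \<in> vecs T" for u using that by (auto simp: U_def)
    then have "u = 0" if "u \<in> vecs T" for u
      using inj[of u 0] that z fs.subspace_0[OF VT] by simp
    with T(2) fs.subspace_0[OF VT] show False by blast
  qed
  with indecomposable_split[OF W(2) sub int sum] have "K = {0}" by blast
  with sum have "U = vecs W" by auto
  moreover have "inj_on f (vecs T)" using inj by (auto simp: inj_on_def)
  ultimately show ?thesis by (simp add: bij_betw_def U_def)
qed

lemma rep_hom_inverse:
  assumes f: "rep_hom G M N f" and b: "bij_betw f (vecs M) (vecs N)" and M: "is_rep G M"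
  shows "rep_hom G N M (inv_into (vecs M) f)"
proof (rule rep_homI)
  let ?i = "inv_into (vecs M) f"
  have im: "?i v \<in> vecs M" "f (?i v) = v" if "v \<in> vecs N" for v
    using b that by (auto simp: bij_betw_def inv_into_into f_inv_into_f)
  have eq: "?i v = u" if "u \<in> vecs M" "f u = v" for u v
    using b that by (auto simp: bij_betw_def)
  note V = rep_subspace[OF M]
  show "?i v \<in> vecs M" if "v \<in> vecs N" for v using im that by blast
  show "?i (u + v) = ?i u + ?i v" if "u \<in> vecs N" "v \<in> vecs N" for u v
    using that im by (intro eq) (auto simp: rep_hom_add[OF f] fs.subspace_add[OF V])
  show "?i (fscale c v) = fscale c (?i v)" if "v \<in> vecs N" for c v
    using that im by (intro eq) (auto simp: rep_hom_scale[OF f] fs.subspace_scale[OF V])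
  show "?i (act N g v) = act M g (?i v)" if "g \<in> carrier G" "v \<in> vecs N" for g v
    using that im by (intro eq) (auto simp: rep_hom_act[OF f] rep_act_mem[OF M])
qed

lemma rep_iso_iff_from:
  assumes "is_rep G M" "is_rep G N"
  shows "rep_iso G M N \<longleftrightarrow> (\<exists>f. rep_hom G N M f \<and> bij_betw f (vecs N) (vecs M))"
proof
  assume "rep_iso G M N"
  then obtain f where "rep_hom G M N f \<and> bij_betw f (vecs M) (vecs N)" unfolding rep_iso_def ..
  then show "\<exists>f. rep_hom G N M f \<and> bij_betw f (vecs N) (vecs M)"
    using rep_hom_inverse[OF _ _ assms(1)] bij_betw_inv_into by (intro exI[of _ "inv_into (vecs M) f"]) auto
next
  assume "\<exists>f. rep_hom G N M f \<and> bij_betw f (vecs N) (vecs M)"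
  then obtain f where "rep_hom G N M f \<and> bij_betw f (vecs N) (vecs M)" ..
  then show "rep_iso G M N"
    unfolding rep_iso_def
    using rep_hom_inverse[OF _ _ assms(2)] bij_betw_inv_into by (intro exI[of _ "inv_into (vecs N) f"]) auto
qed

subsection \<open>The summand projections of a decomposition\<close>

definition summand_proj :: "nat \<Rightarrow> (nat \<Rightarrow> ('x \<Rightarrow> 'k::field) set) \<Rightarrow> ('x \<Rightarrow> 'k) \<Rightarrow> nat \<Rightarrow> 'x \<Rightarrow> 'k"
  where "summand_proj n W v = (THE w. (\<forall>i<n. w i \<in> W i) \<and> (\<forall>i\<ge>n. w i = 0) \<and> v = (\<Sum>i<n. w i))"

lemma summand_proj:
  assumes "ks_decomposition G M n W" "v \<in> vecs M"
  shows summand_proj_mem: "i < n \<Longrightarrow> summand_proj n W v i \<in> W i"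
    and summand_proj_outside: "i \<ge> n \<Longrightarrow> summand_proj n W v i = 0"
    and summand_proj_sum: "(\<Sum>i<n. summand_proj n W v i) = v"
proof -
  have "\<forall>v\<in>vecs M. \<exists>!w. (\<forall>i<n. w i \<in> W i) \<and> (\<forall>i\<ge>n. w i = 0) \<and> v = (\<Sum>i<n. w i)"
    using assms(1) unfolding ks_decomposition_def by (rule conjunct2)
  from bspec[OF this assms(2)]
  have "\<exists>!w. (\<forall>i<n. w i \<in> W i) \<and> (\<forall>i\<ge>n. w i = 0) \<and> v = (\<Sum>i<n. w i)" .
  from theI'[OF this] show "i < n \<Longrightarrow> summand_proj n W v i \<in> W i"
      "i \<ge> n \<Longrightarrow> summand_proj n W v i = 0" "(\<Sum>i<n. summand_proj n W v i) = v"
    unfolding summand_proj_def by auto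
qed

lemma summand_proj_eqI:
  assumes "ks_decomposition G M n W" "v \<in> vecs M"
    and "\<And>i. i < n \<Longrightarrow> w i \<in> W i" "\<And>i. i \<ge> n \<Longrightarrow> w i = 0" "v = (\<Sum>i<n. w i)"
  shows "summand_proj n W v = w"
proof -
  have "\<forall>v\<in>vecs M. \<exists>!w. (\<forall>i<n. w i \<in> W i) \<and> (\<forall>i\<ge>n. w i = 0) \<and> v = (\<Sum>i<n. w i)"
    using assms(1) unfolding ks_decomposition_def by (rule conjunct2)
  from bspec[OF this assms(2)]
  have ex1: "\<exists>!w. (\<forall>i<n. w i \<in> W i) \<and> (\<forall>i\<ge>n. w i = 0) \<and> v = (\<Sum>i<n. w i)" .
  show ?thesis
    unfolding summand_proj_def by (rule the1_equality[OF ex1]) (use assms(3-5) in simp)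
qed

lemma ks_summand:
  assumes "ks_decomposition G M n W" "i < n"
  shows "submodule G M (W i)" "indecomposable G (subrep M (W i))" "W i \<subseteq> vecs M" "fs.subspace (W i)"
  using assms by (auto simp: ks_decomposition_def submodule_def)

lemma summand_proj_hom:
  assumes D: "ks_decomposition G M n W" and M: "is_rep G M" and "i < n"
  shows "rep_hom G M (subrep M (W i)) (\<lambda>v. summand_proj n W v i)"
proof (rule rep_homI)
  note V = rep_subspace[OF M]
  note P = summand_proj[OF D]
  show "summand_proj n W v i \<in> vecs (subrep M (W i))" if "v \<in> vecs M" for v
    using P(1)[OF that \<open>i < n\<close>] by simp
  show "summand_proj n W (u + v) i = summand_proj n W u i + summand_proj n W v i"
    if "u \<in> vecs M" "v \<in> vecs M" for u v
  proof -
    have "summand_proj n W (u + v) = (\<lambda>i. summand_proj n W u i + summand_proj n W v i)"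
      using that P(1)[OF that(1)] P(1)[OF that(2)] P(2)[OF that(1)] P(2)[OF that(2)]
        P(3)[OF that(1)] P(3)[OF that(2)] ks_summand(4)[OF D]
      by (intro summand_proj_eqI[OF D]) (auto simp: fs.subspace_add[OF V] fs.subspace_add sum.distrib)
    then show ?thesis by simp
  qed
  show "summand_proj n W (fscale c v) i = fscale c (summand_proj n W v i)" if "v \<in> vecs M" for c v
  proof -
    have "summand_proj n W (fscale c v) = (\<lambda>i. fscale c (summand_proj n W v i))"
      using that P(1)[OF that] P(2)[OF that] P(3)[OF that] ks_summand(4)[OF D]
      by (intro summand_proj_eqI[OF D])
         (auto simp: fs.subspace_scale[OF V] fs.subspace_scale fs.scale_sum_right[symmetric])
    then show ?thesis by simp
  qed
  show "summand_proj n W (act M g v) i = act (subrep M (W i)) g (summand_proj n W v i)"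
    if g: "g \<in> carrier G" and v: "v \<in> vecs M" for g v
  proof -
    have z: "act M g 0 = 0" using linear_between_zero[OF rep_act_linear[OF M g] V] .
    have "(\<Sum>i<n. act M g (summand_proj n W v i)) = act M g (\<Sum>i<n. summand_proj n W v i)"
      by (rule rep_act_sum[OF M g, symmetric]) (use P(1)[OF v] ks_summand(3)[OF D] in auto)
    moreover have "act M g (summand_proj n W v i) \<in> W i" if "i < n" for i
      using ks_summand(1)[OF D that] P(1)[OF v that] g by (auto simp: submodule_def)
    ultimately have "summand_proj n W (act M g v) = (\<lambda>i. act M g (summand_proj n W v i))"
      using P(2,3)[OF v] z
      by (intro summand_proj_eqI[OF D rep_act_mem[OF M g v]]) auto
    then show ?thesis by simp
  qed
qed

lemma submodule_inclusion:
  "submodule G M W \<Longrightarrow> rep_hom G (subrep M W) M (\<lambda>v. v)"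
  by (rule rep_homI) (auto simp: submodule_def)

subsection \<open>Counting summands by means of linear algebra\<close>

text \<open>If every endomorphism of \<open>T\<close> multiplies the vector \<open>v\<^sub>1\<close> by a scalar, then this scalar is
  zero exactly for the nilpotent endomorphisms, and the summands of \<open>M\<close> isomorphic to \<open>T\<close> can be
  counted by the rank of the pairing that composition \<open>T \<rightarrow> M \<rightarrow> T\<close> defines.\<close>

definition endo_scalar :: "'g monoid \<Rightarrow> ('g, 'k::field, 'y) rep \<Rightarrow> ('y \<Rightarrow> 'k) \<Rightarrow> (('y \<Rightarrow> 'k) \<Rightarrow> 'k) \<Rightarrow> bool"
  where "endo_scalar G T v1 \<zeta> \<longleftrightarrow> is_rep G T \<and> fin_dim (vecs T) \<and> indecomposable G T \<and>
    v1 \<in> vecs T \<and> linfun \<zeta> \<and> \<zeta> v1 = 1 \<and> (\<forall>h. rep_hom G T T h \<longrightarrow> h v1 = fscale (\<zeta> (h v1)) v1)"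

definition radical_independent ::
    "'g monoid \<Rightarrow> ('g, 'k::field, 'y) rep \<Rightarrow> ('y \<Rightarrow> 'k) \<Rightarrow> (('y \<Rightarrow> 'k) \<Rightarrow> 'k) \<Rightarrow>
     ('g, 'k, 'x) rep \<Rightarrow> 'j set \<Rightarrow> ('j \<Rightarrow> ('y \<Rightarrow> 'k) \<Rightarrow> 'x \<Rightarrow> 'k) \<Rightarrow> bool"
  where "radical_independent G T v1 \<zeta> M J f \<longleftrightarrow> (\<forall>j\<in>J. rep_hom G T M (f j)) \<and>
    (\<forall>\<alpha>. (\<exists>j\<in>J. \<alpha> j \<noteq> 0) \<longrightarrow> (\<exists>g. rep_hom G M T g \<and> \<zeta> (g (\<Sum>j\<in>J. fscale (\<alpha> j) (f j v1))) \<noteq> 0))"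

lemma endo_scalar_bij:
  assumes E: "endo_scalar G T v1 \<zeta>" and h: "rep_hom G T T h" and "\<zeta> (h v1) \<noteq> 0"
  shows "bij_betw h (vecs T) (vecs T)"
proof -
  have T: "is_rep G T" "fin_dim (vecs T)" "indecomposable G T" "v1 \<in> vecs T" "linfun \<zeta>" "\<zeta> v1 = 1"
    using E by (auto simp: endo_scalar_def)
  have hv: "h v1 = fscale (\<zeta> (h v1)) v1" using E h unfolding endo_scalar_def by blast
  have "(h ^^ n) v1 = fscale (\<zeta> (h v1) ^ n) v1" for n
  proof (induction n)
    case (Suc n)
    have "(h ^^ Suc n) v1 = fscale (\<zeta> (h v1) ^ n) (h v1)"
      using Suc by (simp add: rep_hom_scale[OF h T(4)])
    also have "\<dots> = fscale (\<zeta> (h v1) ^ n) (fscale (\<zeta> (h v1)) v1)" using hv by simp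
    finally show ?case by (simp add: mult.commute)
  qed simp
  then have "\<zeta> ((h ^^ n) v1) = \<zeta> (h v1) ^ n" for n by (simp add: linfun_scale T)
  then have "(h ^^ n) v1 \<noteq> 0" for n using assms(3) linfun_zero[OF T(5)] by (metis power_not_zero)
  then show ?thesis using fitting[OF h T(1-3)] T(4) by blast
qed

text \<open>A summand that is not isomorphic to \<open>T\<close> contributes only non-bijective endomorphisms of \<open>T\<close>, on which
  the scalar vanishes. So the pairing only sees the coordinates of \<open>f j v1\<close> at the summands isomorphic
  to \<open>T\<close>, one scalar for each of them; with fewer summands than maps some combination would be in the
  radical.\<close>

lemma radical_independent_card_le:
  assumes E: "endo_scalar G T v1 \<zeta>" and M: "is_rep G M"
    and D: "ks_decomposition G M n W" and J: "finite J" and ind: "radical_independent G T v1 \<zeta> M J f"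
  shows "card J \<le> card {i\<in>{..<n}. rep_iso G (subrep M (W i)) T}"
proof -
  define S where "S = {i\<in>{..<n}. rep_iso G (subrep M (W i)) T}"
  have T: "is_rep G T" "fin_dim (vecs T)" "indecomposable G T" "v1 \<in> vecs T" "linfun \<zeta>" "\<zeta> v1 = 1"
    using E by (auto simp: endo_scalar_def)
  have T0: "vecs T \<noteq> {0}" using T(3) by (simp add: indecomposable_def)
  have sc: "h v1 = fscale (\<zeta> (h v1)) v1" if "rep_hom G T T h" for h
    using E that unfolding endo_scalar_def by blast
  have f: "rep_hom G T M (f j)" if "j \<in> J" for j using ind that by (auto simp: radical_independent_def)
  define p where "p i v = summand_proj n W v i" for i v
  have p: "rep_hom G M (subrep M (W i)) (p i)" if "i < n" for i
    unfolding p_def by (rule summand_proj_hom[OF D M that])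
  have Wrep: "is_rep G (subrep M (W i))" if "i < n" for i
    by (rule subrep_is_rep[OF M ks_summand(1)[OF D that]])
  have "\<forall>i\<in>S. \<exists>h. rep_hom G (subrep M (W i)) T h \<and> bij_betw h (W i) (vecs T)"
    by (auto simp: S_def rep_iso_def)
  from bchoice[OF this]
  obtain h where "\<forall>i\<in>S. rep_hom G (subrep M (W i)) T (h i) \<and> bij_betw (h i) (W i) (vecs T)" ..
  then have h: "rep_hom G (subrep M (W i)) T (h i)" "bij_betw (h i) (W i) (vecs T)" if "i \<in> S" for i
    using that by auto
  define A where "A i j = \<zeta> (h i (p i (f j v1)))" for i j
  have "card J \<le> card S"
  proof (rule card_le_if_trivial_solutions[where A = A])
    fix \<alpha> j0 assume sol: "\<And>i. i \<in> S \<Longrightarrow> (\<Sum>j\<in>J. \<alpha> j * A i j) = 0" and j0: "j0 \<in> J"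
    define F where "F v = (\<Sum>j\<in>J. fscale (\<alpha> j) (f j v))" for v
    have F: "rep_hom G T M F" unfolding F_def by (rule rep_hom_lincomb[OF M f])
    have "\<zeta> (g (F v1)) = 0" if g: "rep_hom G M T g" for g
    proof -
      have FM: "F v1 \<in> vecs M" by (rule rep_hom_mem[OF F T(4)])
      have pM: "p i (F v1) \<in> vecs M" if "i < n" for i
        using summand_proj(1)[OF D FM that] ks_summand(3)[OF D that] by (auto simp: p_def)
      have "g (F v1) = g (\<Sum>i<n. p i (F v1))" using summand_proj(3)[OF D FM] by (simp add: p_def)
      also have "\<dots> = (\<Sum>i<n. g (p i (F v1)))"
        by (rule rep_hom_sum[OF g rep_subspace[OF M]]) (simp add: pM)
      finally have *: "\<zeta> (g (F v1)) = (\<Sum>i<n. \<zeta> (g (p i (F v1))))" by (simp add: linfun_sum[OF T(5)])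
      have "\<zeta> (g (p i (F v1))) = 0" if i: "i < n" for i
      proof (rule ccontr)
        assume nz: "\<zeta> (g (p i (F v1))) \<noteq> 0"
        have pF: "rep_hom G T (subrep M (W i)) (\<lambda>v. p i (F v))" by (rule rep_hom_comp[OF F p[OF i]])
        have gW: "rep_hom G (subrep M (W i)) T g"
          using rep_hom_comp[OF submodule_inclusion[OF ks_summand(1)[OF D i]] g] .
        have gpF: "rep_hom G T T (\<lambda>v. g (p i (F v)))" by (rule rep_hom_comp[OF pF gW])
        have "bij_betw (\<lambda>v. g (p i (F v))) (vecs T) (vecs T)"
          by (rule endo_scalar_bij[OF E gpF]) (rule nz)
        then have "bij_betw (\<lambda>v. p i (F v)) (vecs T) (vecs (subrep M (W i)))"
          by (rule rep_iso_if_split[OF pF gW _ T(1) T0 Wrep[OF i] ks_summand(2)[OF D i]])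
        with pF have "rep_hom G T (subrep M (W i)) (\<lambda>v. p i (F v)) \<and>
            bij_betw (\<lambda>v. p i (F v)) (vecs T) (vecs (subrep M (W i)))" ..
        then have "\<exists>f. rep_hom G T (subrep M (W i)) f \<and> bij_betw f (vecs T) (vecs (subrep M (W i)))"
          by (rule exI[of _ "\<lambda>v. p i (F v)"])
        then have "i \<in> S" using i unfolding rep_iso_iff_from[OF Wrep[OF i] T(1), symmetric] by (simp add: S_def)
        let ?h' = "inv_into (W i) (h i)"
        have h': "rep_hom G T (subrep M (W i)) ?h'"
          using rep_hom_inverse[OF h(1)[OF \<open>i \<in> S\<close>] _ Wrep[OF i]] h(2)[OF \<open>i \<in> S\<close>] by simp
        have k: "rep_hom G T T (\<lambda>v. h i (p i (F v)))" by (rule rep_hom_comp[OF pF h(1)[OF \<open>i \<in> S\<close>]])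
        have q: "rep_hom G T T (\<lambda>v. g (?h' v))" by (rule rep_hom_comp[OF h' gW])
        have "\<zeta> (h i (p i (F v1))) = (\<Sum>j\<in>J. \<alpha> j * A i j)"
        proof -
          have fM: "f j v1 \<in> vecs M" if "j \<in> J" for j by (rule rep_hom_mem[OF f[OF that] T(4)])
          have hp: "rep_hom G M T (\<lambda>v. h i (p i v))" by (rule rep_hom_comp[OF p[OF i] h(1)[OF \<open>i \<in> S\<close>]])
          have "h i (p i (F v1)) = (\<Sum>j\<in>J. h i (p i (fscale (\<alpha> j) (f j v1))))"
            unfolding F_def
            by (rule rep_hom_sum[OF hp rep_subspace[OF M]]) (simp add: fM fs.subspace_scale[OF rep_subspace[OF M]])
          also have "\<dots> = (\<Sum>j\<in>J. fscale (\<alpha> j) (h i (p i (f j v1))))"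
            by (intro sum.cong refl rep_hom_scale[OF hp] fM)
          finally show ?thesis by (simp add: linfun_sum[OF T(5)] linfun_scale[OF T(5)] A_def)
        qed
        with sol[OF \<open>i \<in> S\<close>] have "h i (p i (F v1)) = 0" using sc[OF k] by simp
        moreover have "p i (F v1) \<in> W i" using rep_hom_mem[OF pF T(4)] by simp
        ultimately have "p i (F v1) = ?h' 0"
          using bij_betw_inv_into_left[OF h(2)[OF \<open>i \<in> S\<close>], of "p i (F v1)"] by simp
        then have "g (p i (F v1)) = 0" using rep_hom_zero[OF q rep_subspace[OF T(1)]] by simp
        with nz linfun_zero[OF T(5)] show False by simp
      qed
      with * show ?thesis by simp
    qed
    then have no: "\<not> (\<exists>g. rep_hom G M T g \<and> \<zeta> (g (\<Sum>j\<in>J. fscale (\<alpha> j) (f j v1))) \<noteq> 0)"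
      by (simp add: F_def)
    have "\<forall>\<alpha>. (\<exists>j\<in>J. \<alpha> j \<noteq> 0) \<longrightarrow> (\<exists>g. rep_hom G M T g \<and> \<zeta> (g (\<Sum>j\<in>J. fscale (\<alpha> j) (f j v1))) \<noteq> 0)"
      using ind unfolding radical_independent_def by (rule conjunct2)
    from spec[OF this, of \<alpha>] no j0 show "\<alpha> j0 = 0" by blast
  qed (use J in \<open>auto simp: S_def\<close>)
  then show ?thesis by (simp add: S_def)
qed

text \<open>The inclusions of the summands isomorphic to \<open>T\<close> attain the bound, with the projections as partners.
  Together with the previous estimate, applied to two decompositions, this gives the uniqueness of the
  number of such summands, hence a value for \<open>ks_multiplicity\<close>.\<close>

lemma ks_summands_independent:
  assumes E: "endo_scalar G T v1 \<zeta>" and M: "is_rep G M" and D: "ks_decomposition G M n W"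
  defines "S \<equiv> {i\<in>{..<n}. rep_iso G (subrep M (W i)) T}"
  shows "\<exists>f. radical_independent G T v1 \<zeta> M S f"
proof -
  have T: "is_rep G T" "v1 \<in> vecs T" "linfun \<zeta>" "\<zeta> v1 = 1"
    using E by (auto simp: endo_scalar_def)
  have Wrep: "is_rep G (subrep M (W i))" if "i < n" for i
    by (rule subrep_is_rep[OF M ks_summand(1)[OF D that]])
  have "\<forall>i\<in>S. \<exists>h. rep_hom G (subrep M (W i)) T h \<and> bij_betw h (W i) (vecs T)"
    by (auto simp: S_def rep_iso_def)
  from bchoice[OF this]
  obtain h where "\<forall>i\<in>S. rep_hom G (subrep M (W i)) T (h i) \<and> bij_betw (h i) (W i) (vecs T)" ..
  then have h: "rep_hom G (subrep M (W i)) T (h i)" "bij_betw (h i) (W i) (vecs T)" if "i \<in> S" for i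
    using that by auto
  define f where "f i = inv_into (W i) (h i)" for i
  have Sn: "i < n" if "i \<in> S" for i using that by (simp add: S_def)
  have fW: "rep_hom G T (subrep M (W i)) (f i)" if "i \<in> S" for i
    using rep_hom_inverse[OF h(1)[OF that]] h(2)[OF that] Wrep[OF Sn[OF that]] by (simp add: f_def)
  have f: "rep_hom G T M (f i)" if "i \<in> S" for i
    using rep_hom_comp[OF fW[OF that] submodule_inclusion[OF ks_summand(1)[OF D Sn[OF that]]]] .
  have "radical_independent G T v1 \<zeta> M S f"
    unfolding radical_independent_def
  proof (intro conjI ballI allI impI f)
    fix \<alpha> :: "nat \<Rightarrow> 'b" assume "\<exists>j\<in>S. \<alpha> j \<noteq> 0"
    then obtain i where i: "i \<in> S" "\<alpha> i \<noteq> 0" by blast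
    define F where "F = (\<Sum>j\<in>S. fscale (\<alpha> j) (f j v1))"
    have "F \<in> vecs M" unfolding F_def
      by (rule fs.subspace_sum[OF rep_subspace[OF M]])
         (rule fs.subspace_scale[OF rep_subspace[OF M] rep_hom_mem[OF f T(2)]])
    have fm: "f j v1 \<in> W j" if "j \<in> S" for j using rep_hom_mem[OF fW[OF that] T(2)] by simp
    have "summand_proj n W F = (\<lambda>j. if j \<in> S then fscale (\<alpha> j) (f j v1) else 0)"
    proof (rule summand_proj_eqI[OF D \<open>F \<in> vecs M\<close>])
      have "S \<subseteq> {..<n}" by (auto simp: S_def)
      then show "F = (\<Sum>j<n. if j \<in> S then fscale (\<alpha> j) (f j v1) else 0)"
        by (simp add: F_def sum.If_cases Int_absorb1)
    qed (use fm ks_summand(4)[OF D] in \<open>auto simp: fs.subspace_0 fs.subspace_scale dest: Sn\<close>)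
    then have "summand_proj n W F i = fscale (\<alpha> i) (f i v1)" using i by simp
    moreover have "h i (fscale (\<alpha> i) (f i v1)) = fscale (\<alpha> i) v1"
      using rep_hom_scale[OF h(1)[OF i(1)], of "f i v1"] fm[OF i(1)] h(2)[OF i(1)] T(2)
      by (simp add: f_def bij_betw_inv_into_right)
    ultimately have "\<zeta> (h i (summand_proj n W F i)) \<noteq> 0" using i T by (simp add: linfun_scale)
    moreover have "rep_hom G M T (\<lambda>v. h i (summand_proj n W v i))"
      by (rule rep_hom_comp[OF summand_proj_hom[OF D M Sn[OF i(1)]] h(1)[OF i(1)]])
    ultimately show "\<exists>g. rep_hom G M T g \<and> \<zeta> (g (\<Sum>j\<in>S. fscale (\<alpha> j) (f j v1))) \<noteq> 0"
      unfolding F_def by (intro exI[of _ "\<lambda>v. h i (summand_proj n W v i)"] conjI)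
  qed
  then show ?thesis by blast
qed

subsection \<open>Existence of decompositions\<close>

lemma ks_decompositionI:
  assumes M: "is_rep G M" and W: "\<And>i. i < n \<Longrightarrow> submodule G M (W i)"
    and "\<And>i. i < n \<Longrightarrow> indecomposable G (subrep M (W i))"
    and ex: "\<And>v. v \<in> vecs M \<Longrightarrow> \<exists>w. (\<forall>i<n. w i \<in> W i) \<and> v = (\<Sum>i<n. w i)"
    and zero: "\<And>w i. (\<And>i. i < n \<Longrightarrow> w i \<in> W i) \<Longrightarrow> (\<Sum>i<n. w i) = 0 \<Longrightarrow> i < n \<Longrightarrow> w i = 0"
  shows "ks_decomposition G M n W"
  unfolding ks_decomposition_def
proof (intro conjI allI impI ballI assms)
  fix v assume "v \<in> vecs M"
  from ex[OF this] obtain w where "(\<forall>i<n. w i \<in> W i) \<and> v = (\<Sum>i<n. w i)" ..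
  then have w: "\<forall>i<n. w i \<in> W i" "v = (\<Sum>i<n. w i)" by auto
  show "\<exists>!w. (\<forall>i<n. w i \<in> W i) \<and> (\<forall>i\<ge>n. w i = 0) \<and> v = (\<Sum>i<n. w i)"
  proof (rule ex1I)
    show "(\<forall>i<n. (if i < n then w i else 0) \<in> W i) \<and> (\<forall>i\<ge>n. (if i < n then w i else 0) = 0)
        \<and> v = (\<Sum>i<n. if i < n then w i else 0)" using w by auto
    fix u assume u: "(\<forall>i<n. u i \<in> W i) \<and> (\<forall>i\<ge>n. u i = 0) \<and> v = (\<Sum>i<n. u i)"
    have "u i - w i = 0" if "i < n" for i
    proof (rule zero[of "\<lambda>i. u i - w i"])
      show "u i - w i \<in> W i" if "i < n" for i
        using u w W[OF that] that by (simp add: submodule_def fs.subspace_diff)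
    qed (use that u w in \<open>auto simp: sum_subtractf\<close>)
    then have "u i = w i" if "i < n" for i using that by simp
    with u show "u = (\<lambda>i. if i < n then w i else 0)" by (intro ext) simp
  qed
qed

lemma ks_decomposition_zero:
  assumes D: "ks_decomposition G M n W" and M: "is_rep G M"
    and w: "\<And>i. i < n \<Longrightarrow> w i \<in> W i" and "(\<Sum>i<n. w i) = 0" "i < n"
  shows "w i = 0"
proof -
  have "0 \<in> vecs M" using fs.subspace_0 rep_subspace M by blast
  then have "summand_proj n W 0 = (\<lambda>i. if i < n then w i else 0)" "summand_proj n W 0 = (\<lambda>i. 0)"
    using assms ks_summand(4)[OF D]
    by (auto intro!: summand_proj_eqI[OF D] simp: fs.subspace_0)
  then show ?thesis using \<open>i < n\<close> by (metis (mono_tags))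
qed

lemma sum_lessThan_add: "(\<Sum>i<m + n. f i) = (\<Sum>i<m. f i) + (\<Sum>i<n. f (m + i))"
  for f :: "nat \<Rightarrow> 'a::comm_monoid_add"
  by (induction n) (auto simp: ac_simps)

text \<open>Induction on the dimension: a decomposable module is a sum of two smaller ones.\<close>

lemma ks_decomposition_exists:
  assumes M: "is_rep G M" and fd: "fin_dim (vecs M)" and V: "submodule G M V"
  shows "\<exists>n W. ks_decomposition G (subrep M V) n W"
  using V
proof (induction "fs.dim V" arbitrary: V rule: less_induct)
  case less
  have MV: "is_rep G (subrep M V)" by (rule subrep_is_rep[OF M less.prems])
  have sV: "fs.subspace V" "V \<subseteq> vecs M" using less.prems by (auto simp: submodule_def)
  have fdV: "fin_dim V" using fd fin_dim_subset sV by blast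
  consider "V = {0}" | "V \<noteq> {0}" "indecomposable G (subrep M V)"
    | "V \<noteq> {0}" "\<not> indecomposable G (subrep M V)" by blast
  then show ?case
  proof cases
    case 1
    have "ks_decomposition G (subrep M V) 0 (\<lambda>_. V)"
      by (rule ks_decompositionI[OF MV]) (use 1 in auto)
    then show ?thesis by blast
  next
    case 2
    have "ks_decomposition G (subrep M V) 1 (\<lambda>_. V)"
      by (rule ks_decompositionI[OF MV])
         (use 2 less.prems in \<open>auto simp: submodule_subrep intro: exI[of _ "\<lambda>_. _"]\<close>)
    then show ?thesis by blast
  next
    case 3
    then obtain U W where UW: "submodule G (subrep M V) U" "submodule G (subrep M V) W"
        "U \<noteq> {0}" "W \<noteq> {0}" "U \<inter> W = {0}" "{u + w |u w. u \<in> U \<and> w \<in> W} = V"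
      unfolding indecomposable_def by auto
    have U: "submodule G M U" "U \<subseteq> V" and W: "submodule G M W" "W \<subseteq> V"
      using UW(1,2) submodule_subrep[OF less.prems] by auto
    have sUW: "fs.subspace U" "fs.subspace W" using U W by (auto simp: submodule_def)
    have "U \<noteq> V" "W \<noteq> V" using UW(3-5) U W fs.subspace_0[OF sUW(1)] fs.subspace_0[OF sUW(2)] by auto
    then have "fs.dim U < fs.dim V" "fs.dim W < fs.dim V"
      using dim_strict_mono[OF fdV sV(1)] sUW U W by auto
    with less.hyps U W obtain n1 W1 n2 W2 where
      D1: "ks_decomposition G (subrep M U) n1 W1" and D2: "ks_decomposition G (subrep M W) n2 W2" by meson
    define W' where "W' i = (if i < n1 then W1 i else W2 (i - n1))" for i
    have MU: "is_rep G (subrep M U)" "is_rep G (subrep M W)"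
      using subrep_is_rep[OF M] U W by auto
    have sub1: "submodule G M (W1 i)" "W1 i \<subseteq> U" if "i < n1" for i
      using ks_summand(1)[OF D1 that] submodule_subrep[OF U(1)] by auto
    have sub2: "submodule G M (W2 i)" "W2 i \<subseteq> W" if "i < n2" for i
      using ks_summand(1)[OF D2 that] submodule_subrep[OF W(1)] by auto
    have "ks_decomposition G (subrep M V) (n1 + n2) W'"
    proof (rule ks_decompositionI[OF MV])
      fix i assume i: "i < n1 + n2"
      then show "submodule G (subrep M V) (W' i)"
        using sub1[of i] sub2[of "i - n1"] order_trans[OF _ U(2)] order_trans[OF _ W(2)]
        by (simp add: W'_def submodule_subrep[OF less.prems])
      show "indecomposable G (subrep (subrep M V) (W' i))"
        using i ks_summand(2)[OF D1, of i] ks_summand(2)[OF D2, of "i - n1"] by (auto simp: W'_def)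
    next
      fix v assume "v \<in> vecs (subrep M V)"
      then have "v \<in> V" by simp
      then obtain u w where uw: "u \<in> U" "w \<in> W" "v = u + w" using UW(6) by blast
      let ?w = "\<lambda>i. if i < n1 then summand_proj n1 W1 u i else summand_proj n2 W2 w (i - n1)"
      have "v = (\<Sum>i<n1 + n2. ?w i)"
        using uw summand_proj(3)[OF D1, of u] summand_proj(3)[OF D2, of w] by (simp add: sum_lessThan_add)
      moreover have "\<forall>i<n1+n2. ?w i \<in> W' i"
        using uw summand_proj(1)[OF D1, of u] summand_proj(1)[OF D2, of w] by (auto simp: W'_def)
      ultimately show "\<exists>w. (\<forall>i<n1+n2. w i \<in> W' i) \<and> v = (\<Sum>i<n1+n2. w i)"
        by (intro exI[of _ ?w] conjI)
    next
      fix w i assume w: "\<And>i. i < n1 + n2 \<Longrightarrow> w i \<in> W' i" and s: "(\<Sum>i<n1 + n2. w i) = 0" and i: "i < n1 + n2"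
      have w1: "w i \<in> W1 i" if "i < n1" for i using w[of i] that by (simp add: W'_def)
      have w2: "w (n1 + i) \<in> W2 i" if "i < n2" for i using w[of "n1 + i"] that by (simp add: W'_def)
      define x y where "x = (\<Sum>i<n1. w i)" and "y = (\<Sum>i<n2. w (n1 + i))"
      have xU: "x \<in> U" unfolding x_def by (rule fs.subspace_sum[OF sUW(1)]) (use w1 sub1 in auto)
      have yW: "y \<in> W" unfolding y_def by (rule fs.subspace_sum[OF sUW(2)]) (use w2 sub2 in auto)
      have "x + y = 0" using s by (simp add: x_def y_def sum_lessThan_add)
      then have "x = - y" by (simp add: eq_neg_iff_add_eq_0)
      then have "x \<in> W" using yW fs.subspace_neg[OF sUW(2)] by simp
      then have "x \<in> U \<inter> W" using xU by (rule_tac IntI)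
      then have x0: "x = 0" unfolding UW(5) by (rule singletonD)
      then have y0: "y = 0" using \<open>x + y = 0\<close> by simp
      show "w i = 0"
      proof (cases "i < n1")
        case True
        show ?thesis
          by (rule ks_decomposition_zero[OF D1 MU(1) w1 x0[unfolded x_def] True])
      next
        case False
        then have lt: "i - n1 < n2" using i by simp
        have "w (n1 + (i - n1)) = 0"
          by (rule ks_decomposition_zero[OF D2 MU(2) w2 y0[unfolded y_def] lt])
        with False show ?thesis by simp
      qed
    qed
    then show ?thesis by blast
  qed
qed

theorem card_le_ks_multiplicity:
  assumes E: "endo_scalar G T v1 \<zeta>" and M: "is_rep G M" "fin_dim (vecs M)"
    and J: "finite J" "radical_independent G T v1 \<zeta> M J f"
  shows "card J \<le> ks_multiplicity G M T"
proof -
  have "submodule G M (vecs M)"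
    using rep_subspace[OF M(1)] rep_act_mem[OF M(1)] by (auto simp: submodule_def)
  then have "\<exists>n W. ks_decomposition G (subrep M (vecs M)) n W"
    by (rule ks_decomposition_exists[OF M])
  then obtain n W where D: "ks_decomposition G M n W" by (auto simp: subrep_def)
  have le: "card {i\<in>{..<n}. rep_iso G (subrep M (W i)) T} \<le> card {i\<in>{..<n'}. rep_iso G (subrep M (W' i)) T}"
    if "ks_decomposition G M n W" "ks_decomposition G M n' W'" for n W n' W'
  proof -
    from ks_summands_independent[OF E M(1) that(1)]
    obtain f where "radical_independent G T v1 \<zeta> M {i\<in>{..<n}. rep_iso G (subrep M (W i)) T} f" ..
    from radical_independent_card_le[OF E M(1) that(2) _ this] show ?thesis by simp
  qed
  have "ks_multiplicity G M T = card {i\<in>{..<n}. rep_iso G (subrep M (W i)) T}"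
    unfolding ks_multiplicity_def
  proof (rule the_equality)
    fix m assume "\<exists>n W. ks_decomposition G M n W \<and> m = card {i\<in>{..<n}. rep_iso G (subrep M (W i)) T}"
    then obtain n' W' where "ks_decomposition G M n' W'"
        "m = card {i\<in>{..<n'}. rep_iso G (subrep M (W' i)) T}" by blast
    then show "m = card {i\<in>{..<n}. rep_iso G (subrep M (W i)) T}"
      using le[OF D, of n' W'] le[OF _ D, of n' W'] by simp
  qed (use D in blast)
  with radical_independent_card_le[OF E M(1) D J] show ?thesis by simp
qed

section \<open>Lyndon words in two letters\<close>

text \<open>Strictly greater at the first place where the words differ, with \<open>True\<close> above \<open>False\<close>. A word is not
  comparable to its prefixes, so the relation is stable under appending letters on the right.\<close>

fun lex_gt :: "bool list \<Rightarrow> bool list \<Rightarrow> bool"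
  where "lex_gt (x # xs) (y # ys) = (if x = y then lex_gt xs ys else x)"
  | "lex_gt _ _ = False"

lemma lex_gt_Nil [simp]: "\<not> lex_gt x []"
  by (cases x) auto

lemma lex_gt_append: "lex_gt x y \<Longrightarrow> lex_gt (x @ u) (y @ v)"
  by (induction x y rule: lex_gt.induct) (auto split: if_splits)

lemma lex_gt_same_prefix [simp]: "lex_gt (p @ x) (p @ y) = lex_gt x y"
  by (induction p) auto

lemma lex_gt_irrefl [simp]: "\<not> lex_gt x x"
  by (induction x) auto

lemma lex_gt_trans: "lex_gt x y \<Longrightarrow> lex_gt y z \<Longrightarrow> lex_gt x z"
proof (induction x y arbitrary: z rule: lex_gt.induct)
  case (1 x xs y ys)
  then show ?case by (cases z) (auto split: if_splits)
qed auto

lemma lex_gt_asym: "lex_gt x y \<Longrightarrow> \<not> lex_gt y x"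
  using lex_gt_trans lex_gt_irrefl by blast

lemma lex_gt_cases:
  obtains "lex_gt x y" | "lex_gt y x" | r where "x = y @ r" | r where "y = x @ r"
proof -
  have "lex_gt x y \<or> lex_gt y x \<or> (\<exists>r. x = y @ r) \<or> (\<exists>r. y = x @ r)"
    by (induction x y rule: lex_gt.induct) auto
  then show ?thesis using that by blast
qed

lemma lex_gt_total: "length x = length y \<Longrightarrow> x \<noteq> y \<Longrightarrow> lex_gt x y \<or> lex_gt y x"
  by (induction x y rule: lex_gt.induct) auto

lemma lex_gt_minimal:
  assumes "finite A" "A \<noteq> {}"
  obtains m where "m \<in> A" "\<And>x. x \<in> A \<Longrightarrow> \<not> lex_gt m x"
proof -
  have asym: "asymp_on A (\<lambda>x y. lex_gt y x)" by (rule asymp_onI) (rule lex_gt_asym)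
  have trans: "transp_on A (\<lambda>x y. lex_gt y x)" by (rule transp_onI) (rule lex_gt_trans)
  obtain m where m: "m \<in> A" "\<forall>x\<in>A. x \<noteq> m \<longrightarrow> \<not> lex_gt m x"
    using Finite_Set.bex_min_element[OF assms(1) asym trans assms(2)] by blast
  show ?thesis
  proof (rule that[OF m(1)])
    fix x assume "x \<in> A"
    then show "\<not> lex_gt m x" using m(2) by (cases "x = m") auto
  qed
qed

text \<open>The letter \<open>True\<close> will stand for the Lie square of \<open>E\<close> and \<open>False\<close> for the Lie cube. A Lyndon word is
  smaller than its proper suffixes; as a word with a proper suffix that is also a prefix is not of this
  kind, comparability of suffixes may be built into the condition.\<close>

definition lyndon :: "bool list \<Rightarrow> bool"
  where "lyndon w \<longleftrightarrow> w \<noteq> [] \<and> (\<forall>u v. w = u @ v \<longrightarrow> u \<noteq> [] \<longrightarrow> v \<noteq> [] \<longrightarrow> lex_gt v w)"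

lemma lyndon_suffix: "lyndon (u @ v) \<Longrightarrow> u \<noteq> [] \<Longrightarrow> v \<noteq> [] \<Longrightarrow> lex_gt v (u @ v)"
  unfolding lyndon_def by blast

lemma lyndon_starts_False:
  assumes "lyndon w" "False \<in> set w"
  obtains w' where "w = False # w'"
proof (cases w)
  case (Cons x w')
  show ?thesis
  proof (cases x)
    case True
    obtain p q where pq: "w = p @ False # q" using assms(2) by (meson split_list)
    then have "p \<noteq> []" using Cons True by auto
    then have "lex_gt (False # q) w" using lyndon_suffix assms(1) pq by blast
    with Cons True show ?thesis by simp
  qed (use Cons that in auto)
qed (use assms in \<open>auto simp: lyndon_def\<close>)

text \<open>The standard factorization: \<open>v\<close> is the smallest proper suffix.\<close>

lemma lyndon_factorization:
  assumes w: "lyndon w" and "length w \<ge> 2"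
  obtains u v where "w = u @ v" "lyndon u" "lyndon v" "lex_gt (v @ u) (u @ v)"
proof -
  define S where "S = {v. \<exists>u. w = u @ v \<and> u \<noteq> [] \<and> v \<noteq> []}"
  have "S \<subseteq> set (suffixes w)" by (auto simp: S_def suffix_def)
  then have "finite S" using finite_subset by blast
  moreover have "S \<noteq> {}"
  proof -
    have "w = butlast w @ [last w]" "butlast w \<noteq> []"
      using assms(2) by (cases w rule: rev_cases; force)+
    then show ?thesis unfolding S_def by blast
  qed
  ultimately obtain v0 where v0: "v0 \<in> S" "\<And>x. x \<in> S \<Longrightarrow> \<not> lex_gt v0 x"
    using lex_gt_minimal by metis
  define A where "A = {v \<in> S. \<forall>x\<in>S. \<not> lex_gt v x}"
  have "v0 \<in> A" using v0 by (auto simp: A_def)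
  then obtain v where v: "v \<in> A" "\<And>y. y \<in> A \<Longrightarrow> length v \<le> length y"
    using ex_has_least_nat[of "\<lambda>v. v \<in> A" v0 length] by blast
  then obtain u where u: "w = u @ v" "u \<noteq> []" "v \<noteq> []" by (auto simp: A_def S_def)
  have min: "\<not> lex_gt v x" if "x \<in> S" for x using v(1) that by (auto simp: A_def)
  have "lyndon v"
    unfolding lyndon_def
  proof (intro conjI allI impI u)
    fix p x assume px: "v = p @ x" "p \<noteq> []" "x \<noteq> []"
    then have xS: "x \<in> S" using u by (auto simp: S_def intro!: exI[of _ "u @ p"])
    show "lex_gt x v"
    proof (cases x v rule: lex_gt_cases)
      case (4 r)
      have "x \<in> A"
        unfolding A_def
      proof (intro CollectI conjI ballI xS notI)
        fix y assume y: "y \<in> S" "lex_gt x y"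
        then have "lex_gt (x @ r) (y @ [])" using lex_gt_append by blast
        with min[OF y(1)] 4 show False by simp
      qed
      then have "length v \<le> length x" by (rule v(2))
      with px show ?thesis by simp
    next
      case (3 r)
      then have "length x = length v + length r" by simp
      with px show ?thesis by simp
    qed (use min[OF xS] in auto)
  qed
  moreover have "lyndon u"
    unfolding lyndon_def
  proof (intro conjI allI impI u)
    fix p q assume pq: "u = p @ q" "p \<noteq> []" "q \<noteq> []"
    then have g: "lex_gt (q @ v) (u @ v)" using lyndon_suffix[of p "q @ v"] w u by simp
    show "lex_gt q u"
    proof (cases q u rule: lex_gt_cases)
      case 2
      then have "lex_gt (u @ v) (q @ v)" by (rule lex_gt_append)
      with g lex_gt_asym show ?thesis by blast
    next
      case (3 r)
      then have "length q = length u + length r" by simp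
      with pq show ?thesis by simp
    next
      case (4 r)
      with g have "lex_gt v (r @ v)" by simp
      moreover have "r @ v \<in> S" using 4 u pq by (auto simp: S_def intro!: exI[of _ q])
      ultimately show ?thesis using min by blast
    qed
  qed
  moreover have "lex_gt (v @ u) (u @ v)"
    using lex_gt_append[OF lyndon_suffix, of u v u "[]"] w u by simp
  ultimately show ?thesis using that u by blast
qed

lemma lyndon_if_minimal_rotation:
  assumes "w \<noteq> []" and rot: "\<And>u v. w = u @ v \<Longrightarrow> u \<noteq> [] \<Longrightarrow> v \<noteq> [] \<Longrightarrow> lex_gt (v @ u) w"
  shows "lyndon w"
  unfolding lyndon_def
proof (intro conjI allI impI assms)
  fix u v assume uv: "w = u @ v" "u \<noteq> []" "v \<noteq> []"
  have g: "lex_gt (v @ u) w" using rot uv by blast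
  show "lex_gt v w"
  proof (cases v w rule: lex_gt_cases)
    case 2
    then have "lex_gt (w @ []) (v @ u)" by (rule lex_gt_append)
    with g lex_gt_asym show ?thesis by auto
  next
    case (3 r)
    then have "length v = length w + length r" by simp
    with uv show ?thesis by simp
  next
    case (4 u')
    then have len: "length u' = length u" using uv by (metis add_left_cancel length_append add.commute)
    have "lex_gt u u'" using g 4 by simp
    then have "u' \<noteq> u" "\<not> lex_gt u' u" using lex_gt_asym by auto
    moreover have "u' \<noteq> []" using len uv by auto
    then have "lex_gt (u' @ v) w" using rot[of v u'] 4 uv by simp
    then have "lex_gt (u' @ v) (u @ v)" using uv by simp
    ultimately have False
      using lex_gt_total[OF len] lex_gt_append[of u u' v v] lex_gt_asym by blast
    then show ?thesis ..
  qed
qed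

subsection \<open>Words with given letter counts\<close>

definition two_letter_words :: "nat \<Rightarrow> nat \<Rightarrow> bool list set"
  where "two_letter_words s t = {w. count_list w True = s \<and> count_list w False = t}"

lemma length_two_letter_word: "length w = count_list w True + count_list w False"
proof (induction w)
  case (Cons x w) then show ?case by (cases x) auto
qed simp

lemma finite_two_letter_words [simp]: "finite (two_letter_words s t)"
proof (rule finite_subset)
  show "two_letter_words s t \<subseteq> {w. set w \<subseteq> UNIV \<and> length w = s + t}"
    by (auto simp: two_letter_words_def length_two_letter_word)
qed (rule finite_lists_length_eq, simp)

lemma two_letter_words_step:
  "two_letter_words (Suc s) (Suc t) =
    Cons True ` two_letter_words s (Suc t) \<union> Cons False ` two_letter_words (Suc s) t"
proof
  show "two_letter_words (Suc s) (Suc t) \<subseteq>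
    Cons True ` two_letter_words s (Suc t) \<union> Cons False ` two_letter_words (Suc s) t"
  proof
    fix w assume "w \<in> two_letter_words (Suc s) (Suc t)"
    then show "w \<in> Cons True ` two_letter_words s (Suc t) \<union> Cons False ` two_letter_words (Suc s) t"
      by (cases w) (auto simp: two_letter_words_def split: if_splits)
  qed
qed (auto simp: two_letter_words_def)

lemma count_list_zero: "count_list w x = 0 \<longleftrightarrow> x \<notin> set w"
  by (induction w) auto

lemma two_letter_words_base:
  "two_letter_words 0 t = {replicate t False}" "two_letter_words s 0 = {replicate s True}"
proof -
  have r: "w = replicate (length w) x" if "\<And>y. y \<in> set w \<Longrightarrow> y = x" for w :: "bool list" and x
    using replicate_length_same[of w x] that by simp
  have c: "count_list (replicate n x) y = (if x = y then n else 0)" for n and x y :: bool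
    by (induction n) auto
  have "w = replicate t False" if "w \<in> two_letter_words 0 t" for w
  proof -
    have T: "True \<notin> set w" and len: "length w = t"
      using that length_two_letter_word[of w] by (auto simp: two_letter_words_def count_list_zero)
    have "y = False" if "y \<in> set w" for y using T that by (cases y) auto
    from r[of w False, OF this] len show ?thesis by simp
  qed
  then show "two_letter_words 0 t = {replicate t False}" by (auto simp: two_letter_words_def c)
  have "w = replicate s True" if "w \<in> two_letter_words s 0" for w
  proof -
    have T: "False \<notin> set w" and len: "length w = s"
      using that length_two_letter_word[of w] by (auto simp: two_letter_words_def count_list_zero)
    have "y = True" if "y \<in> set w" for y using T that by (cases y) auto
    from r[of w True, OF this] len show ?thesis by simp
  qed
  then show "two_letter_words s 0 = {replicate s True}" by (auto simp: two_letter_words_def c)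
qed

lemma card_two_letter_words: "card (two_letter_words s t) = (s + t) choose s"
proof (induction "s + t" arbitrary: s t)
  case 0 then show ?case by (simp add: two_letter_words_base)
next
  case (Suc n)
  show ?case
  proof (cases "s = 0 \<or> t = 0")
    case True then show ?thesis by (auto simp: two_letter_words_base)
  next
    case False
    then obtain s' t' where st: "s = Suc s'" "t = Suc t'" by (metis not0_implies_Suc)
    have "card (two_letter_words s t)
        = card (Cons True ` two_letter_words s' (Suc t')) + card (Cons False ` two_letter_words (Suc s') t')"
      unfolding st two_letter_words_step by (rule card_Un_disjoint) auto
    also have "\<dots> = ((s' + Suc t') choose s') + ((Suc s' + t') choose Suc s')"
      using Suc.hyps(1)[of s' "Suc t'"] Suc.hyps(1)[of "Suc s'" t'] Suc.hyps(2) st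
      by (simp add: card_image)
    finally show ?thesis by (simp add: st)
  qed
qed

subsection \<open>Powers of words\<close>

definition word_power :: "nat \<Rightarrow> 'a list \<Rightarrow> 'a list"
  where "word_power d x = concat (replicate d x)"

lemma word_power_simps [simp]: "word_power 0 x = []" "word_power (Suc d) x = x @ word_power d x"
  by (auto simp: word_power_def)

lemma word_power_commutes: "x @ word_power d x = word_power d x @ x"
  by (induction d) auto

lemma count_list_word_power: "count_list (word_power d x) y = d * count_list x y"
  by (induction d) auto

lemma rotate_word_power: "rotate (length x) (word_power d x) = word_power d x"
  by (cases d) (simp_all add: rotate_append flip: word_power_commutes)

lemma word_power_if_commutes:
  assumes "x @ y = y @ x" "length y = k * length x"
  shows "y = word_power k x"
  using assms
proof (induction k arbitrary: y)
  case (Suc k)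
  then have "length x \<le> length y" by simp
  then obtain z where z: "y = x @ z"
    using Suc.prems(1) by (metis append_eq_append_conv_if append_take_drop_id)
  with Suc.prems have "x @ z = z @ x" "length z = k * length x" by auto
  with Suc.IH z show ?case by auto
qed simp

lemma rotate_fixed_is_power:
  assumes "rotate e w = w" "length w = d * e" "d > 0" "e > 0"
  shows "w = word_power d (take e w)"
proof -
  have le: "e \<le> length w" using assms by simp
  have "rotate e w = drop e w @ take e w"
    using rotate_append[of "take e w" "drop e w"] le by simp
  then have "take e w @ drop e w = drop e w @ take e w" using assms by simp
  moreover have "length (drop e w) = (d - 1) * length (take e w)"
    using assms le by (simp add: diff_mult_distrib)
  ultimately have "drop e w = word_power (d - 1) (take e w)" by (rule word_power_if_commutes)
  then have "take e w @ drop e w = word_power (Suc (d - 1)) (take e w)" by simp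
  with assms show ?thesis by simp
qed

text \<open>The words fixed by a rotation through the \<open>d\<close>-th part of their length are the \<open>d\<close>-th powers.\<close>

lemma card_rotation_fixed_words:
  assumes "d dvd s" "d dvd t" "s + t > 0"
  shows "card {w \<in> two_letter_words s t. rotate ((s + t) div d) w = w}
    = ((s + t) div d) choose (s div d)"
proof -
  obtain s' t' where st: "s = d * s'" "t = d * t'" using assms by (auto elim!: dvdE)
  have d: "d > 0" using assms st by (cases d) auto
  have e: "(s + t) div d = s' + t'" using d by (simp add: st flip: distrib_left)
  have "bij_betw (word_power d) (two_letter_words s' t')
      {w \<in> two_letter_words s t. rotate (s' + t') w = w}"
  proof (rule bij_betw_byWitness[where f' = "take (s' + t')"])
    show "\<forall>x\<in>two_letter_words s' t'. take (s' + t') (word_power d x) = x"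
      using d by (cases d) (auto simp: two_letter_words_def length_two_letter_word)
    show "\<forall>w\<in>{w \<in> two_letter_words s t. rotate (s' + t') w = w}. word_power d (take (s' + t') w) = w"
    proof safe
      fix w assume w: "w \<in> two_letter_words s t" "rotate (s' + t') w = w"
      have "length w = d * (s' + t')"
        using w length_two_letter_word[of w] by (simp add: two_letter_words_def st distrib_left)
      moreover have "s' + t' > 0" using assms(3) st by auto
      ultimately show "word_power d (take (s' + t') w) = w"
        using rotate_fixed_is_power[OF w(2) _ d] by simp
    qed
    show "word_power d ` two_letter_words s' t' \<subseteq> {w \<in> two_letter_words s t. rotate (s' + t') w = w}"
    proof safe
      fix x assume x: "x \<in> two_letter_words s' t'"
      then show "word_power d x \<in> two_letter_words s t"
        by (simp add: two_letter_words_def count_list_word_power st)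
      show "rotate (s' + t') (word_power d x) = word_power d x"
        using rotate_word_power[of x d] length_two_letter_word[of x] x by (simp add: two_letter_words_def)
    qed
    show "take (s' + t') ` {w \<in> two_letter_words s t. rotate (s' + t') w = w} \<subseteq> two_letter_words s' t'"
    proof safe
      fix w assume w: "w \<in> two_letter_words s t" "rotate (s' + t') w = w"
      then have "length w = d * (s' + t')"
        by (simp add: two_letter_words_def length_two_letter_word st distrib_left)
      then have "w = word_power d (take (s' + t') w)"
        using rotate_fixed_is_power w d assms(3) st by auto
      then have "count_list w x = d * count_list (take (s' + t') w) x" for x
        by (metis count_list_word_power)
      then show "take (s' + t') w \<in> two_letter_words s' t'"
        using w(1) d by (simp add: two_letter_words_def st)
    qed
  qed
  then have "card {w \<in> two_letter_words s t. rotate (s' + t') w = w} = card (two_letter_words s' t')"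
    by (simp add: bij_betw_same_card)
  also have "\<dots> = (s' + t') choose s'" by (rule card_two_letter_words)
  finally show ?thesis using e st d by simp
qed

lemma count_list_rotate: "count_list (rotate n w) x = count_list w x"
proof -
  have "count_list (rotate1 w) x = count_list w x" for w :: "'a list" by (cases w) auto
  then show ?thesis by (induction n) auto
qed

subsection \<open>Moebius inversion\<close>

lemma moebius_mult_prime:
  assumes "prime p" "\<not> p dvd d" "squarefree d"
  shows "squarefree (p * d)" "moebius (p * d) = - moebius d"
proof -
  have cop: "coprime p d" using assms by (simp add: prime_imp_coprime)
  show sf: "squarefree (p * d)" using squarefree_mult_coprime[OF cop] assms squarefree_prime by blast
  have d: "d \<noteq> 0" using assms by (metis dvd_0_right)
  have "prime_factors (p * d) = insert p (prime_factors d)"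
    using assms d by (simp add: prime_factors_product prime_prime_factors)
  moreover have "p \<notin> prime_factors d" using assms by auto
  ultimately show "moebius (p * d) = - moebius d" using sf assms by (simp add: moebius_def)
qed

lemma sum_moebius_divisors:
  assumes "n > 0" shows "(\<Sum>d | d dvd n. moebius d) = (if n = 1 then 1 else 0)"
proof (cases "n = 1")
  case True then show ?thesis by (simp add: moebius_def)
next
  case False
  then obtain p where p: "prime p" "p dvd n" using prime_factor_nat by blast
  define D0 where "D0 = {d. d dvd n \<and> squarefree d \<and> \<not> p dvd d}"
  define D1 where "D1 = {d. d dvd n \<and> squarefree d \<and> p dvd d}"
  have fin: "finite {d. d dvd n}" using assms by simp
  have "D0 \<subseteq> {d. d dvd n}" "D1 \<subseteq> {d. d dvd n}" by (auto simp: D0_def D1_def)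
  then have f: "finite D0" "finite D1" using fin finite_subset by auto
  have "(\<Sum>d | d dvd n. moebius d) = (\<Sum>d\<in>D0 \<union> D1. moebius d)"
    by (rule sum.mono_neutral_right[OF fin]) (auto simp: D0_def D1_def moebius_def)
  also have "\<dots> = (\<Sum>d\<in>D0. moebius d) + (\<Sum>d\<in>D1. moebius d)"
    by (rule sum.union_disjoint[OF f]) (auto simp: D0_def D1_def)
  also have "(\<Sum>d\<in>D1. moebius d) = (\<Sum>d\<in>D0. moebius (p * d))"
  proof (rule sum.reindex_bij_witness[where i = "\<lambda>d. p * d" and j = "\<lambda>d. d div p"])
    fix d assume d: "d \<in> D1"
    then obtain e where e: "d = p * e" by (auto simp: D1_def)
    have p0: "p > 0" using p prime_gt_0_nat by blast
    show "p * (d div p) = d" using e p0 by simp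
    have "\<not> p dvd e"
    proof
      assume "p dvd e"
      then have "p\<^sup>2 dvd d" using e by (simp add: power2_eq_square)
      then have "p dvd 1" using d by (auto simp: D1_def squarefree_def)
      with p show False by simp
    qed
    moreover have "squarefree e" using d e by (auto simp: D1_def dest: squarefree_multD)
    moreover have "e dvd n" using d e by (auto simp: D1_def intro: dvd_mult_right)
    ultimately show "d div p \<in> D0" using e p0 by (simp add: D0_def)
    show "moebius (p * (d div p)) = moebius d" using e p0 by simp
  next
    fix d assume d: "d \<in> D0"
    have p0: "p > 0" using p prime_gt_0_nat by blast
    show "p * d div p = d" using p0 by simp
    have "coprime p d" using d p by (simp add: D0_def prime_imp_coprime)
    then have "p * d dvd n" using d p by (simp add: D0_def divides_mult)
    then show "p * d \<in> D1" using d p moebius_mult_prime(1)[OF p(1)] by (auto simp: D0_def D1_def)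
  qed
  also have "\<dots> = - (\<Sum>d\<in>D0. moebius d)"
    unfolding sum_negf[symmetric] by (rule sum.cong) (auto simp: D0_def moebius_mult_prime(2)[OF p(1)])
  finally show ?thesis using False by simp
qed

definition primitive :: "'a list \<Rightarrow> bool"
  where "primitive w \<longleftrightarrow> (\<forall>k. 0 < k \<longrightarrow> k < length w \<longrightarrow> rotate k w \<noteq> w)"

lemma rotate_mult_fixed: "rotate p w = w \<Longrightarrow> rotate (q * p) w = w"
proof (induction q)
  case (Suc q)
  have "rotate (Suc q * p) w = rotate p (rotate (q * p) w)" by (simp add: rotate_rotate)
  with Suc show ?case by simp
qed simp

text \<open>The rotations fixing \<open>w\<close> are the multiples of the least period, which divides the length; so the
  divisors that count are the divisors of a single number, and that number is one exactly when \<open>w\<close> is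
  primitive.\<close>

lemma sum_moebius_rotations:
  assumes w: "w \<in> two_letter_words s t" and pos: "s + t > 0"
  shows "(\<Sum>d | d dvd s \<and> d dvd t. if rotate ((s + t) div d) w = w then moebius d else 0)
    = (if primitive w then 1 else 0)"
proof -
  define N where "N = s + t"
  have len: "length w = N" using w by (simp add: two_letter_words_def length_two_letter_word N_def)
  define p where "p = (LEAST k. 0 < k \<and> rotate k w = w)"
  have N: "0 < N \<and> rotate N w = w" using pos len by (simp add: N_def[symmetric] rotate_id)
  have p: "0 < p" "rotate p w = w" using LeastI[of "\<lambda>k. 0 < k \<and> rotate k w = w", OF N] by (auto simp: p_def)
  have least: "p \<le> k" if "0 < k" "rotate k w = w" for k
    unfolding p_def by (rule Least_le) (use that in simp)
  have dvd: "rotate k w = w \<longleftrightarrow> p dvd k" for k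
  proof
    assume k: "rotate k w = w"
    have "rotate (k mod p) (rotate (k div p * p) w) = rotate k w" by (simp add: rotate_rotate)
    then have "rotate (k mod p) w = w" using k rotate_mult_fixed[OF p(2)] by simp
    then have "k mod p = 0" using least[of "k mod p"] p(1) by (meson leD mod_less_divisor neq0_conv)
    then show "p dvd k" by auto
  qed (auto simp: mult.commute[of p] rotate_mult_fixed[OF p(2)] elim!: dvdE)
  obtain M where M: "N = p * M" using dvd[of N] N by (auto elim!: dvdE)
  have M0: "M > 0" using N M by (cases M) auto
  have "{d. (d dvd s \<and> d dvd t) \<and> rotate (N div d) w = w} = {d. d dvd M}"
  proof (rule Set.set_eqI, rule iffI)
    fix d assume "d \<in> {d. (d dvd s \<and> d dvd t) \<and> rotate (N div d) w = w}"
    then have d: "d dvd N" "p dvd N div d" by (auto simp: N_def dvd)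
    then have "p * d dvd p * M" using M N by (metis dvd_div_iff_mult dvd_0_left neq0_conv mult.commute)
    then show "d \<in> {d. d dvd M}" using p by simp
  next
    fix d assume "d \<in> {d. d dvd M}"
    then obtain e where e: "M = d * e" by (auto elim!: dvdE)
    then have de: "d > 0" "e > 0" using M0 by auto
    have Nd: "N div d = p * e" using M e de by simp
    have fixed: "rotate (p * e) w = w" using dvd by simp
    have "w = word_power d (take (p * e) w)"
      by (rule rotate_fixed_is_power[OF fixed]) (use len M e de p in auto)
    then have "count_list w x = d * count_list (take (p * e) w) x" for x
      by (metis count_list_word_power)
    then have "d dvd s" "d dvd t" using w by (auto simp: two_letter_words_def)
    then show "d \<in> {d. (d dvd s \<and> d dvd t) \<and> rotate (N div d) w = w}" using Nd fixed by simp
  qed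
  moreover have "finite {d. d dvd s \<and> d dvd t}"
  proof (rule finite_subset)
    show "{d. d dvd s \<and> d dvd t} \<subseteq> {d. d dvd N}" by (auto simp: N_def)
  qed (use N in simp)
  ultimately have "(\<Sum>d | d dvd s \<and> d dvd t. if rotate (N div d) w = w then moebius d else 0)
      = (\<Sum>d | d dvd M. moebius d)"
    by (simp add: sum.If_cases Int_def)
  also have "\<dots> = (if M = 1 then 1 else 0)" by (rule sum_moebius_divisors[OF M0])
  also have "M = 1 \<longleftrightarrow> primitive w"
  proof
    assume "M = 1"
    then have "p = N" using M by simp
    show "primitive w"
      unfolding primitive_def
    proof (intro allI impI notI)
      fix k assume k: "0 < k" "k < length w" "rotate k w = w"
      from least[OF k(1,3)] k(2) len \<open>p = N\<close> show False by simp
    qed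
  next
    assume prim: "primitive w"
    then have "\<not> p < N" using p by (auto simp: primitive_def len)
    then have "N \<le> p * 1" by simp
    then have "p * M \<le> p * 1" unfolding M .
    then show "M = 1" using p M0 by simp
  qed
  finally show ?thesis by (simp add: N_def)
qed

text \<open>The least rotation of a primitive word is a Lyndon word, and a word of length \<open>s + t\<close> has at most
  \<open>s + t\<close> rotations.\<close>

lemma primitive_words_le_lyndon:
  assumes pos: "s + t > 0"
  shows "card {w \<in> two_letter_words s t. primitive w}
    \<le> (s + t) * card {w \<in> two_letter_words s t. lyndon w}"
proof -
  define N where "N = s + t"
  define L where "L = {w \<in> two_letter_words s t. lyndon w}"
  have finL: "finite L" by (simp add: L_def)
  have "{w \<in> two_letter_words s t. primitive w} \<subseteq> (\<lambda>(w, i). rotate i w) ` (L \<times> {..<N})"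
  proof safe
    fix w assume w: "w \<in> two_letter_words s t" "primitive w"
    then have len: "length w = N" by (simp add: two_letter_words_def length_two_letter_word N_def)
    have "finite ((\<lambda>i. rotate i w) ` {..<N})" "(\<lambda>i. rotate i w) ` {..<N} \<noteq> {}"
      using pos by (auto simp: N_def)
    then obtain m where m: "m \<in> (\<lambda>i. rotate i w) ` {..<N}"
        "\<And>x. x \<in> (\<lambda>i. rotate i w) ` {..<N} \<Longrightarrow> \<not> lex_gt m x"
      by (rule lex_gt_minimal) blast
    obtain i where i: "i < N" "m = rotate i w" using m by auto
    have return: "rotate (N - i) m = w" using i len by (simp add: rotate_rotate rotate_id)
    have lenm: "length m = N" using i len by simp
    have "lyndon m"
    proof (rule lyndon_if_minimal_rotation)
      show "m \<noteq> []" using lenm pos by (auto simp: N_def)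
      fix u v assume uv: "m = u @ v" "u \<noteq> []" "v \<noteq> []"
      have vu: "v @ u = rotate (length u) m" using uv by (simp add: rotate_append)
      have lu: "0 < length u" "length u < N" using uv lenm by auto
      have "v @ u \<noteq> m"
      proof
        assume "v @ u = m"
        then have "rotate (length u) m = m" using vu by simp
        then have "rotate (N - i) (rotate (length u) m) = w" using return by simp
        moreover have "rotate (N - i) (rotate (length u) m) = rotate (length u) (rotate (N - i) m)"
          by (simp add: rotate_rotate add.commute)
        ultimately have "rotate (length u) w = w" using return by simp
        with w(2) lu len show False by (auto simp: primitive_def)
      qed
      moreover have "v @ u \<in> (\<lambda>i. rotate i w) ` {..<N}"
      proof (rule image_eqI)
        have "v @ u = rotate (length u + i) w" using vu i by (simp add: rotate_rotate)
        also have "\<dots> = rotate ((length u + i) mod N) w" using rotate_conv_mod len by metis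
        finally show "v @ u = rotate ((length u + i) mod N) w" .
      qed (use pos in \<open>simp add: N_def\<close>)
      then have "\<not> lex_gt m (v @ u)" by (rule m(2))
      ultimately show "lex_gt (v @ u) m"
        using lex_gt_total[of "v @ u" m] uv by auto
    qed
    moreover have "m \<in> two_letter_words s t"
    proof -
      have "count_list m x = count_list w x" for x using i by (simp add: count_list_rotate)
      then show ?thesis using w(1) by (simp add: two_letter_words_def)
    qed
    ultimately have "m \<in> L" by (simp add: L_def)
    moreover have "rotate ((N - i) mod N) m = w" using return rotate_conv_mod lenm by metis
    ultimately show "w \<in> (\<lambda>(w, i). rotate i w) ` (L \<times> {..<N})"
      using pos by (intro image_eqI[of _ _ "(m, (N - i) mod N)"]) (auto simp: N_def)
  qed
  then have "card {w \<in> two_letter_words s t. primitive w} \<le> card (L \<times> {..<N})"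
    by (rule surj_card_le[rotated]) (use finL in simp)
  then show ?thesis by (simp add: L_def N_def card_cartesian_product mult.commute)
qed

text \<open>The sum over \<open>d\<close> counts the words fixed by rotations with Moebius weights, which leaves the
  primitive words; and at most \<open>s + t\<close> of these are rotations of the same Lyndon word.\<close>

theorem m_coeff_le_lyndon:
  assumes pos: "s + t > 0"
  shows "m_coeff s t \<le> of_nat (card {w \<in> two_letter_words s t. lyndon w})"
proof -
  let ?W = "two_letter_words s t" and ?D = "{d. d dvd s \<and> d dvd t}"
  have "(\<Sum>d\<in>?D. of_int (moebius d) * (fact ((s + t) div d) / (fact (s div d) * fact (t div d))))
      = (\<Sum>d\<in>?D. of_int (moebius d * int (card {w \<in> ?W. rotate ((s + t) div d) w = w})) :: rat)"
  proof (rule sum.cong)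
    fix d assume d: "d \<in> ?D"
    then have "card {w \<in> ?W. rotate ((s + t) div d) w = w} = ((s + t) div d) choose (s div d)"
      using card_rotation_fixed_words pos by simp
    moreover have "(s + t) div d = s div d + t div d" using d by (auto simp: div_add)
    ultimately show "of_int (moebius d) * (fact ((s + t) div d) / (fact (s div d) * fact (t div d)))
      = (of_int (moebius d * int (card {w \<in> ?W. rotate ((s + t) div d) w = w})) :: rat)"
      by (simp add: binomial_fact)
  qed simp
  also have "\<dots> = of_int (\<Sum>d\<in>?D. \<Sum>w\<in>?W. if rotate ((s + t) div d) w = w then moebius d else 0)"
    by (simp add: sum.If_cases Int_def mult.commute)
  also have "\<dots> = of_int (\<Sum>w\<in>?W. \<Sum>d\<in>?D. if rotate ((s + t) div d) w = w then moebius d else 0)"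
    by (subst sum.swap) simp
  also have "\<dots> = of_int (\<Sum>w\<in>?W. if primitive w then 1 else 0)"
    by (intro arg_cong[where f = of_int] sum.cong refl sum_moebius_rotations[OF _ pos])
  also have "\<dots> = of_nat (card {w \<in> ?W. primitive w})"
    by (simp add: sum.If_cases Int_def)
  also have "\<dots> \<le> of_nat ((s + t) * card {w \<in> ?W. lyndon w})"
    using primitive_words_le_lyndon[OF pos] by (simp only: of_nat_le_iff)
  finally have le: "(\<Sum>d\<in>?D. of_int (moebius d) * (fact ((s + t) div d) / (fact (s div d) * fact (t div d))))
      \<le> (of_nat (s + t) * of_nat (card {w \<in> ?W. lyndon w}) :: rat)" by (simp only: of_nat_mult)
  have "(of_nat (s + t) :: rat) > 0" using pos by (simp only: of_nat_0_less_iff)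
  then have "1 / of_nat (s + t) * (of_nat (s + t) * of_nat (card {w \<in> ?W. lyndon w}))
      = (of_nat (card {w \<in> ?W. lyndon w}) :: rat)" by (simp del: of_nat_add)
  moreover have "m_coeff s t \<le> 1 / of_nat (s + t) * (of_nat (s + t) * of_nat (card {w \<in> ?W. lyndon w}))"
    unfolding m_coeff_def by (rule mult_left_mono[OF le]) (simp del: of_nat_add)
  ultimately show ?thesis by simp
qed

section \<open>The tensor algebra of the natural module\<close>

lemma finite_words [simp]: "finite {u :: 2 list. length u = n}"
  using finite_lists_length_eq[of "UNIV :: 2 set" n] by simp

lemma sum_words_Suc:
  "(\<Sum>u | length u = Suc n. F u) = (\<Sum>j\<in>UNIV. \<Sum>u | length u = n. F (j # u))"
  for F :: "2 list \<Rightarrow> 'a::comm_monoid_add"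
proof -
  have "{u :: 2 list. length u = Suc n} = (\<lambda>(j, u). j # u) ` (UNIV \<times> {u. length u = n})"
    by (auto simp: length_Suc_conv image_iff)
  moreover have "inj_on (\<lambda>(j, u). j # u) (UNIV \<times> {u :: 2 list. length u = n})"
    by (auto simp: inj_on_def)
  ultimately show ?thesis
    by (simp add: sum.reindex sum.cartesian_product case_prod_unfold o_def)
qed

lemma sum_words_add:
  "(\<Sum>u | length u = m + n. F u) = (\<Sum>u | length u = m. \<Sum>v | length v = n. F (u @ v))"
  for F :: "2 list \<Rightarrow> 'a::comm_monoid_add"
proof (induction m arbitrary: F)
  case (Suc m)
  then show ?case by (simp add: sum_words_Suc)
qed simp

text \<open>Coefficients of words beginning with \<open>j\<close>; recursion on this left derivative replaces indices into
  words.\<close>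

definition lder :: "2 \<Rightarrow> (2 list \<Rightarrow> 'k::field) \<Rightarrow> 2 list \<Rightarrow> 'k"
  where "lder j f = (\<lambda>w. f (j # w))"

text \<open>The matrix coefficient of the tensor power of \<open>g\<close> at two words.\<close>

fun gcoeff :: "'k::field ^ 2 ^ 2 \<Rightarrow> 2 list \<Rightarrow> 2 list \<Rightarrow> 'k"
  where "gcoeff g (i # w) (j # u) = g $ i $ j * gcoeff g w u"
  | "gcoeff g _ _ = 1"

lemma gcoeff_prod: "length u = length w \<Longrightarrow> gcoeff g w u = (\<Prod>i<length w. g $ (w ! i) $ (u ! i))"
  by (induction g w u rule: gcoeff.induct) (auto simp: prod.lessThan_Suc_shift simp del: prod.lessThan_Suc)

lemma gcoeff_append:
  "length w1 = length u1 \<Longrightarrow> gcoeff g (w1 @ w2) (u1 @ u2) = gcoeff g w1 u1 * gcoeff g w2 u2"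
  by (induction g w1 u1 rule: gcoeff.induct) auto

lemma tensor_act_gcoeff: "tensor_act g f w = (\<Sum>u | length u = length w. gcoeff g w u * f u)"
  unfolding tensor_act_def by (rule sum.cong) (auto simp: gcoeff_prod)

lemma tensor_act_Nil [simp]: "tensor_act g f [] = f []"
  by (simp add: tensor_act_gcoeff)

lemma tensor_act_Cons: "tensor_act g f (i # w) = (\<Sum>j\<in>UNIV. g $ i $ j * tensor_act g (lder j f) w)"
  by (simp add: tensor_act_gcoeff sum_words_Suc sum_distrib_left lder_def mult.assoc)

lemma tensor_act_add: "tensor_act g (f + h) = tensor_act g f + tensor_act g h"
  by (rule ext) (simp add: tensor_act_gcoeff fun_simps distrib_left sum.distrib)

lemma tensor_act_scale: "tensor_act g (fscale c f) = fscale c (tensor_act g f)"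
  by (rule ext) (simp add: tensor_act_gcoeff fun_simps sum_distrib_left mult.left_commute)

lemma tensor_act_zero: "tensor_act g 0 = 0"
  by (rule ext) (simp add: tensor_act_gcoeff fun_simps)

lemma tensor_act_diff: "tensor_act g (f - h) = tensor_act g f - tensor_act g h"
  by (rule ext) (simp add: tensor_act_gcoeff fun_simps right_diff_distrib sum_subtractf)

lemma tensor_act_sum: "tensor_act g (\<Sum>i\<in>A. f i) = (\<Sum>i\<in>A. tensor_act g (f i))"
  by (induction A rule: infinite_finite_induct) (auto simp: tensor_act_zero tensor_act_add)

lemma lder_add: "lder j (f + h) = lder j f + lder j h"
  and lder_scale: "lder j (fscale c f) = fscale c (lder j f)"
  and lder_zero: "lder j 0 = 0"
  by (rule ext, simp add: lder_def fun_simps)+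

lemma lder_tensor_act: "lder i (tensor_act g f) = (\<Sum>j\<in>UNIV. fscale (g $ i $ j) (tensor_act g (lder j f)))"
  by (rule ext) (simp add: lder_def[of i] tensor_act_Cons fun_simps)

lemma tensor_act_one: "tensor_act (mat 1) f = f"
proof
  fix w show "tensor_act (mat 1) f w = f w"
  proof (induction w arbitrary: f)
    case (Cons i w)
    then show ?case by (simp add: tensor_act_Cons mat_def lder_def if_distrib[of "\<lambda>x. x * _"] cong: if_cong)
  qed simp
qed

lemma tensor_act_mult: "tensor_act (g ** h) f = tensor_act g (tensor_act h f)"
proof
  fix w show "tensor_act (g ** h) f w = tensor_act g (tensor_act h f) w"
  proof (induction w arbitrary: f)
    case (Cons i w)
    have "(g ** h) $ i $ j = (\<Sum>k\<in>UNIV. g $ i $ k * h $ k $ j)" for j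
      by (simp add: matrix_matrix_mult_def)
    then have "tensor_act (g ** h) f (i # w)
        = (\<Sum>j\<in>UNIV. \<Sum>k\<in>UNIV. g $ i $ k * (h $ k $ j * tensor_act g (tensor_act h (lder j f)) w))"
      by (simp add: tensor_act_Cons Cons sum_distrib_right mult.assoc)
    also have "\<dots> = (\<Sum>k\<in>UNIV. \<Sum>j\<in>UNIV. g $ i $ k * (h $ k $ j * tensor_act g (tensor_act h (lder j f)) w))"
      by (rule sum.swap)
    also have "\<dots> = tensor_act g (tensor_act h f) (i # w)"
      by (simp add: tensor_act_Cons lder_tensor_act tensor_act_sum tensor_act_scale fun_simps sum_distrib_left)
    finally show ?case .
  qed simp
qed

lemma tensor_power_subspace: "fs.subspace (tensor_power r)"
  by (auto simp: fs.subspace_def tensor_power_def fun_simps)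

lemma tensor_act_power: "f \<in> tensor_power r \<Longrightarrow> tensor_act g f \<in> tensor_power r"
  by (auto simp: tensor_power_def tensor_act_gcoeff)

definition delta :: "2 list \<Rightarrow> 2 list \<Rightarrow> 'k::field"
  where "delta u = (\<lambda>w. if w = u then 1 else 0)"

lemma delta_power: "delta u \<in> tensor_power (length u)"
  by (auto simp: delta_def tensor_power_def)

lemma tensor_power_expand:
  assumes "f \<in> tensor_power r"
  shows "f = (\<Sum>u | length u = r. fscale (f u) (delta u))"
proof
  fix w
  have "(\<Sum>u | length u = r. fscale (f u) (delta u)) w = (\<Sum>u | length u = r. if u = w then f u else 0)"
    unfolding sum_fun_apply by (rule sum.cong) (auto simp: fun_simps delta_def)
  also have "\<dots> = f w" using assms by (simp add: tensor_power_def)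
  finally show "f w = (\<Sum>u | length u = r. fscale (f u) (delta u)) w" by (rule sym)
qed

lemma fin_dim_tensor_power: "fin_dim (tensor_power r :: (2 list \<Rightarrow> 'k::field) set)"
  unfolding fin_dim_def
proof (intro exI conjI subsetI)
  show "finite (delta ` {u. length u = r} :: (2 list \<Rightarrow> 'k) set)" by simp
  fix f :: "2 list \<Rightarrow> 'k" assume "f \<in> tensor_power r"
  from tensor_power_expand[OF this]
  have f: "f = (\<Sum>u | length u = r. fscale (f u) (delta u))" .
  have mem: "(\<Sum>u | length u = r. fscale (f u) (delta u)) \<in> fs.span (delta ` {u. length u = r})"
    by (rule fs.span_sum) (rule fs.span_scale, rule fs.span_base, simp)
  show "f \<in> fs.span (delta ` {u. length u = r})" by (subst f) (rule mem)
qed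

subsection \<open>Multiplication\<close>

lemma tensor_mult_Nil [simp]: "tensor_mult f h [] = f [] * h []"
  by (simp add: tensor_mult_def)

lemma tensor_mult_Cons: "tensor_mult f h (i # w) = f [] * h (i # w) + tensor_mult (lder i f) h w"
  by (simp add: tensor_mult_def lder_def sum.atMost_Suc_shift del: sum.atMost_Suc)

lemma tensor_mult_add_left: "tensor_mult (f + f') h = tensor_mult f h + tensor_mult f' h"
  and tensor_mult_add_right: "tensor_mult f (h + h') = tensor_mult f h + tensor_mult f h'"
  and tensor_mult_diff_left: "tensor_mult (f - f') h = tensor_mult f h - tensor_mult f' h"
  and tensor_mult_diff_right: "tensor_mult f (h - h') = tensor_mult f h - tensor_mult f h'"
  and tensor_mult_scale_left: "tensor_mult (fscale c f) h = fscale c (tensor_mult f h)"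
  and tensor_mult_scale_right: "tensor_mult f (fscale c h) = fscale c (tensor_mult f h)"
  and tensor_mult_zero_left: "tensor_mult 0 h = 0"
  and tensor_mult_zero_right: "tensor_mult f 0 = 0"
  by (rule ext, simp add: tensor_mult_def fun_simps algebra_simps sum.distrib sum_subtractf sum_distrib_left)+

lemma tensor_mult_sum_left: "tensor_mult (\<Sum>i\<in>A. f i) h = (\<Sum>i\<in>A. tensor_mult (f i) h)"
  by (induction A rule: infinite_finite_induct) (auto simp: tensor_mult_zero_left tensor_mult_add_left)

lemma tensor_mult_sum_right: "tensor_mult f (\<Sum>i\<in>A. h i) = (\<Sum>i\<in>A. tensor_mult f (h i))"
  by (induction A rule: infinite_finite_induct) (auto simp: tensor_mult_zero_right tensor_mult_add_right)

lemma lder_tensor_mult: "lder i (tensor_mult f h) = fscale (f []) (lder i h) + tensor_mult (lder i f) h"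
  by (rule ext) (simp add: lder_def[of i "tensor_mult f h"] tensor_mult_Cons fun_simps, simp add: lder_def)

lemma tensor_act_tensor_mult:
  "tensor_act g (tensor_mult f h) = tensor_mult (tensor_act g f) (tensor_act g h)"
proof
  fix w show "tensor_act g (tensor_mult f h) w = tensor_mult (tensor_act g f) (tensor_act g h) w"
  proof (induction w arbitrary: f)
    case (Cons i w)
    have "tensor_act g (tensor_mult f h) (i # w)
      = (\<Sum>j\<in>UNIV. g $ i $ j * (f [] * tensor_act g (lder j h) w + tensor_mult (tensor_act g (lder j f)) (tensor_act g h) w))"
      by (simp add: tensor_act_Cons lder_tensor_mult tensor_act_add tensor_act_scale fun_simps Cons)
    also have "\<dots> = f [] * (\<Sum>j\<in>UNIV. g $ i $ j * tensor_act g (lder j h) w)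
        + (\<Sum>j\<in>UNIV. g $ i $ j * tensor_mult (tensor_act g (lder j f)) (tensor_act g h) w)"
      by (simp add: distrib_left sum.distrib sum_distrib_left mult.left_commute)
    also have "\<dots> = tensor_mult (tensor_act g f) (tensor_act g h) (i # w)"
      by (simp add: tensor_mult_Cons tensor_act_Cons lder_tensor_act tensor_mult_sum_left
          tensor_mult_scale_left fun_simps)
    finally show ?case .
  qed simp
qed

lemma tensor_mult_assoc: "tensor_mult (tensor_mult f h) k = tensor_mult f (tensor_mult h k)"
proof
  fix w show "tensor_mult (tensor_mult f h) k w = tensor_mult f (tensor_mult h k) w"
  proof (induction w arbitrary: f)
    case (Cons i w)
    then show ?case
      by (simp add: tensor_mult_Cons lder_tensor_mult tensor_mult_add_left tensor_mult_scale_left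
          fun_simps distrib_left mult.assoc add.assoc)
  qed simp
qed

lemma lder_delta: "lder j (delta (i # u)) = (if j = i then delta u else 0)" "lder j (delta []) = 0"
  by (rule ext, simp add: lder_def delta_def fun_simps)+

lemma delta_simps [simp]:
  "delta [] [] = 1" "delta [] (i # u) = 0" "delta (i # u) [] = 0"
  "delta (i # u) (j # w) = (if j = i then delta u w else 0)"
  by (auto simp: delta_def)

lemma tensor_mult_one_left: "tensor_mult (delta []) h = h"
proof
  fix w show "tensor_mult (delta []) h w = h w"
    by (cases w) (simp_all add: tensor_mult_Cons lder_delta tensor_mult_zero_left fun_simps)
qed

lemma tensor_mult_delta: "tensor_mult (delta u) (delta v) = (delta (u @ v) :: 2 list \<Rightarrow> 'k::field)"
proof (induction u)
  case (Cons i u)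
  show ?case
  proof
    fix w show "tensor_mult (delta (i # u)) (delta v) w = (delta ((i # u) @ v) :: 2 list \<Rightarrow> 'k) w"
    proof (cases w)
      case (Cons j w')
      then show ?thesis using fun_cong[OF Cons.IH, of w']
        by (simp add: tensor_mult_Cons lder_delta tensor_mult_zero_left fun_simps)
    qed simp
  qed
qed (simp add: tensor_mult_one_left)

lemma tensor_mult_power:
  assumes "f \<in> tensor_power p" "h \<in> tensor_power q"
  shows "tensor_mult f h \<in> tensor_power (p + q)"
  unfolding tensor_power_def
proof (intro CollectI allI impI)
  fix w :: "2 list" assume w: "length w \<noteq> p + q"
  have "f (take k w) * h (drop k w) = 0" if "k \<in> {..length w}" for k
  proof (cases "k = p")
    case True
    then have "length (drop k w) \<noteq> q" using w that by simp
    with assms(2) show ?thesis by (simp add: tensor_power_def)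
  next
    case False
    then have "length (take k w) \<noteq> p" using that by simp
    with assms(1) show ?thesis by (simp add: tensor_power_def)
  qed
  then show "tensor_mult f h w = 0" unfolding tensor_mult_def by (rule sum.neutral[OF ballI])
qed

lemma tensor_mult_homogeneous:
  assumes f: "f \<in> tensor_power (length u)"
  shows "tensor_mult f h (u @ w) = f u * h w"
proof -
  have "tensor_mult f h (u @ w) = (\<Sum>k\<le>length (u @ w). if k = length u then f u * h w else 0)"
    unfolding tensor_mult_def
  proof (rule sum.cong[OF refl])
    fix k assume k: "k \<in> {..length (u @ w)}"
    show "f (take k (u @ w)) * h (drop k (u @ w)) = (if k = length u then f u * h w else 0)"
    proof (cases "k = length u")
      case False
      then have "length (take k (u @ w)) \<noteq> length u" using k by simp
      moreover have "\<forall>v. length v \<noteq> length u \<longrightarrow> f v = 0" using f by (simp add: tensor_power_def)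
      ultimately have "f (take k (u @ w)) = 0" by blast
      with False show ?thesis by simp
    qed simp
  qed
  then show ?thesis by simp
qed

lemma tensor_mult_short:
  assumes f: "f \<in> tensor_power p" and w: "length w < p"
  shows "tensor_mult f h w = 0"
proof -
  have "f (take k w) = 0" for k using f w by (simp add: tensor_power_def)
  then show ?thesis by (simp add: tensor_mult_def)
qed

subsection \<open>Tensor powers and Lie powers as representations\<close>

lemma carrier_GL2 [simp]: "carrier GL2 = {g. invertible g}"
  and mult_GL2 [simp]: "g \<otimes>\<^bsub>GL2\<^esub> h = g ** h" and one_GL2 [simp]: "\<one>\<^bsub>GL2\<^esub> = mat 1"
  by (auto simp: GL2_def)

definition det_tensor :: "nat \<Rightarrow> nat \<Rightarrow> ('k::field ^ 2 ^ 2, 'k, 2 list) rep"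
  where "det_tensor t k = \<lparr>vecs = tensor_power t, act = (\<lambda>g f. fscale (det g ^ k) (tensor_act g f))\<rparr>"

lemma det_tensor_simps [simp]: "vecs (det_tensor t k) = tensor_power t"
    "act (det_tensor t k) g f = fscale (det g ^ k) (tensor_act g f)"
  by (auto simp: det_tensor_def)

lemma is_rep_det_tensor: "is_rep GL2 (det_tensor t k)"
  unfolding is_rep_def linear_between_def
  by (auto simp: tensor_power_subspace tensor_act_power fs.subspace_scale[OF tensor_power_subspace]
      tensor_act_add tensor_act_scale tensor_act_one tensor_act_mult fs.scale_right_distrib det_mul
      power_mult_distrib mult.commute)

definition lie_bracket :: "(2 list \<Rightarrow> 'k::field) \<Rightarrow> (2 list \<Rightarrow> 'k) \<Rightarrow> 2 list \<Rightarrow> 'k"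
  where "lie_bracket a b = tensor_mult a b - tensor_mult b a"

lemma free_lie_subalgebra: "lie_subalgebra free_lie"
  unfolding free_lie_def
proof (rule hull_in)
  fix S :: "(2 list \<Rightarrow> 'a) set set" assume S: "Ball S lie_subalgebra"
  then show "lie_subalgebra (\<Inter>S)"
    by (auto simp: lie_subalgebra_def intro!: fs.subspace_Inter)
qed

lemma free_lie_subspace: "fs.subspace free_lie"
  by (rule free_lie_subalgebra[unfolded lie_subalgebra_def, THEN conjunct1])

lemma free_lie_bracket: "a \<in> free_lie \<Longrightarrow> b \<in> free_lie \<Longrightarrow> lie_bracket a b \<in> free_lie"
  using free_lie_subalgebra by (auto simp: lie_subalgebra_def lie_bracket_def)

lemma free_lie_generators: "tensor_power 1 \<subseteq> free_lie"
  unfolding free_lie_def by (rule hull_subset)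

lemma tensor_act_free_lie: "a \<in> free_lie \<Longrightarrow> tensor_act g a \<in> free_lie"
proof -
  have "lie_subalgebra {a. tensor_act g a \<in> free_lie}"
    unfolding lie_subalgebra_def fs.subspace_def
    using free_lie_bracket
    by (auto simp: tensor_act_zero tensor_act_add tensor_act_scale tensor_act_diff tensor_act_tensor_mult
        fs.subspace_0 fs.subspace_add fs.subspace_scale free_lie_subspace lie_bracket_def)
  moreover have "tensor_power 1 \<subseteq> {a. tensor_act g a \<in> free_lie}"
    using tensor_act_power free_lie_generators by blast
  ultimately have "free_lie \<subseteq> {a. tensor_act g a \<in> free_lie}"
    unfolding free_lie_def[where 'k = 'a] by (intro hull_minimal)
  then show "a \<in> free_lie \<Longrightarrow> tensor_act g a \<in> free_lie" by blast
qed

lemma lie_power_simps [simp]: "vecs (lie_power r) = free_lie \<inter> tensor_power r" "act (lie_power r) = tensor_act"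
  by (auto simp: lie_power_def)

lemma is_rep_lie_power: "is_rep GL2 (lie_power r)"
  unfolding is_rep_def linear_between_def
  by (auto simp: tensor_power_subspace free_lie_subspace fs.subspace_inter tensor_act_power
      tensor_act_free_lie tensor_act_add tensor_act_scale tensor_act_one tensor_act_mult)

lemma fin_dim_lie_power: "fin_dim (vecs (lie_power r))"
  by (rule fin_dim_subset[OF fin_dim_tensor_power[of r]]) simp

subsection \<open>Contraction with the determinant form\<close>

text \<open>The map that evaluates the alternating form on the first two tensor factors.\<close>

definition contract :: "(2 list \<Rightarrow> 'k::field) \<Rightarrow> 2 list \<Rightarrow> 'k"
  where "contract f = (\<lambda>w. f (1 # 2 # w) - f (2 # 1 # w))"

lemma contract_lder: "contract f = lder 2 (lder 1 f) - lder 1 (lder 2 f)"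
  by (rule ext) (simp add: contract_def lder_def fun_simps)

lemma contract_add: "contract (f + h) = contract f + contract h"
  and contract_scale: "contract (fscale c f) = fscale c (contract f)"
  and contract_zero: "contract 0 = 0"
  by (rule ext, simp add: contract_def fun_simps algebra_simps)+

lemma contract_power: "f \<in> tensor_power (Suc (Suc n)) \<Longrightarrow> contract f \<in> tensor_power n"
  by (auto simp: contract_def tensor_power_def)

lemma contract_tensor_act: "contract (tensor_act g f) = fscale (det g) (tensor_act g (contract f))"
proof
  fix w
  show "contract (tensor_act g f) w = fscale (det g) (tensor_act g (contract f)) w"
    unfolding contract_lder[of f]
    by (simp add: contract_def tensor_act_Cons sum_2 tensor_act_diff fun_simps det_2 algebra_simps)
qed

section \<open>Lyndon words in the Lie square and the Lie cube\<close>

lemma lie_bracket_add_left: "lie_bracket (a + a') b = lie_bracket a b + lie_bracket a' b"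
  and lie_bracket_add_right: "lie_bracket a (b + b') = lie_bracket a b + lie_bracket a b'"
  and lie_bracket_scale_left: "lie_bracket (fscale c a) b = fscale c (lie_bracket a b)"
  and lie_bracket_scale_right: "lie_bracket a (fscale c b) = fscale c (lie_bracket a b)"
  by (simp_all add: lie_bracket_def tensor_mult_add_left tensor_mult_add_right tensor_mult_scale_left
      tensor_mult_scale_right fs.scale_right_diff_distrib)

lemma lie_bracket_sum_left: "lie_bracket (\<Sum>i\<in>A. f i) b = (\<Sum>i\<in>A. lie_bracket (f i) b)"
  and lie_bracket_sum_right: "lie_bracket a (\<Sum>i\<in>A. f i) = (\<Sum>i\<in>A. lie_bracket a (f i))"
  by (simp_all add: lie_bracket_def tensor_mult_sum_left tensor_mult_sum_right sum_subtractf)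

lemma tensor_act_bracket: "tensor_act g (lie_bracket a b) = lie_bracket (tensor_act g a) (tensor_act g b)"
  by (simp add: lie_bracket_def tensor_act_diff tensor_act_tensor_mult)

lemma lie_bracket_power:
  assumes "a \<in> tensor_power p" "b \<in> tensor_power q" shows "lie_bracket a b \<in> tensor_power (p + q)"
  using tensor_mult_power[OF assms] tensor_mult_power[OF assms(2,1)]
  by (simp add: lie_bracket_def add.commute fs.subspace_diff[OF tensor_power_subspace])

definition lie_square :: "2 list \<Rightarrow> 'k::field"
  where "lie_square = lie_bracket (delta [1]) (delta [2])"

definition lie_cube :: "2 \<Rightarrow> 2 list \<Rightarrow> 'k::field"
  where "lie_cube i = lie_bracket lie_square (delta [i])"

lemma lie_square_eq: "lie_square = delta [1, 2] - delta [2, 1]"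
  by (simp add: lie_square_def lie_bracket_def tensor_mult_delta)

lemma lie_cube_eq: "lie_cube i = delta [1, 2, i] - delta [2, 1, i] - (delta [i, 1, 2] - delta [i, 2, 1])"
  by (simp add: lie_cube_def lie_square_eq lie_bracket_def tensor_mult_delta tensor_mult_diff_left
      tensor_mult_diff_right)

lemma delta_letter_power: "delta [i] \<in> tensor_power 1"
  using delta_power[of "[i]"] by simp

lemma lie_square_power: "lie_square \<in> tensor_power 2"
  using lie_bracket_power[OF delta_letter_power delta_letter_power, of 1 2]
  by (simp add: lie_square_def numeral_2_eq_2)

lemma lie_cube_power: "lie_cube i \<in> tensor_power 3"
  using lie_bracket_power[OF lie_square_power delta_letter_power, of i] by (simp add: lie_cube_def)

lemma lie_square_free: "lie_square \<in> free_lie"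
  unfolding lie_square_def
  by (intro free_lie_bracket subsetD[OF free_lie_generators] delta_letter_power)

lemma lie_cube_free: "lie_cube i \<in> free_lie"
  unfolding lie_cube_def
  by (intro free_lie_bracket lie_square_free subsetD[OF free_lie_generators] delta_letter_power)

lemma tensor_act_delta_letter: "tensor_act g (delta [i]) = (\<Sum>j\<in>UNIV. fscale (g $ j $ i) (delta [j]))"
proof
  have one: "tensor_act g (delta []) = delta []"
  proof
    fix w show "tensor_act g (delta []) w = delta [] w"
      by (cases w) (simp_all add: tensor_act_Cons lder_delta tensor_act_zero fun_simps)
  qed
  fix w
  show "tensor_act g (delta [i]) w = (\<Sum>j\<in>UNIV. fscale (g $ j $ i) (delta [j])) w"
  proof (cases w)
    case Nil then show ?thesis by (simp add: fun_simps)
  next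
    case (Cons a u)
    have "tensor_act g (delta [i]) w = (\<Sum>j\<in>UNIV. if j = i then g $ a $ i * delta [] u else 0)"
      unfolding Cons tensor_act_Cons
      by (rule sum.cong) (auto simp: lder_delta one tensor_act_zero fun_simps)
    also have "\<dots> = (\<Sum>j\<in>UNIV. if a = j then g $ a $ i * delta [] u else 0)" by simp
    also have "\<dots> = (\<Sum>j\<in>UNIV. fscale (g $ j $ i) (delta [j])) w"
      unfolding Cons sum_fun_apply by (rule sum.cong) (auto simp: fun_simps)
    finally show ?thesis .
  qed
qed

lemma tensor_act_lie_square: "tensor_act g lie_square = fscale (det g) lie_square"
proof -
  have self: "lie_bracket a a = 0" for a :: "2 list \<Rightarrow> 'k::field" by (simp add: lie_bracket_def)
  have anti: "lie_bracket (delta [2]) (delta [1]) = - (lie_square :: 2 list \<Rightarrow> 'a)"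
    by (simp add: lie_square_def lie_bracket_def)
  show ?thesis
    unfolding lie_square_def tensor_act_bracket tensor_act_delta_letter sum_2
    unfolding lie_bracket_add_left lie_bracket_add_right lie_bracket_scale_left lie_bracket_scale_right
      self anti
    unfolding lie_square_def[symmetric] det_2
    by (simp add: fs.scale_left_diff_distrib mult.commute)
qed

lemma tensor_act_lie_cube:
  "tensor_act g (lie_cube i) = fscale (det g) (\<Sum>j\<in>UNIV. fscale (g $ j $ i) (lie_cube j))"
  unfolding lie_cube_def tensor_act_bracket tensor_act_lie_square tensor_act_delta_letter
    lie_bracket_scale_left lie_bracket_sum_right lie_bracket_scale_right
  by (simp add: fs.scale_sum_right mult.commute)

subsection \<open>Words in the Lie square and the Lie cube\<close>

text \<open>A word in the generators of the Lie square (\<open>None\<close>) and the Lie cube (\<open>Some i\<close>), multiplied out in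
  the tensor algebra. Its shape forgets which generator of the Lie cube occurs.\<close>

fun word_elem :: "2 option list \<Rightarrow> 2 list \<Rightarrow> 'k::field"
  where "word_elem [] = delta []"
  | "word_elem (None # x) = tensor_mult lie_square (word_elem x)"
  | "word_elem (Some i # x) = tensor_mult (lie_cube i) (word_elem x)"

abbreviation shape :: "2 option list \<Rightarrow> bool list"
  where "shape \<equiv> map (\<lambda>c. c = None)"

fun labels :: "2 option list \<Rightarrow> 2 list"
  where "labels [] = []" | "labels (None # x) = labels x" | "labels (Some i # x) = i # labels x"

text \<open>The last equation only makes the function total; it is never reached when there are enough labels.\<close>

fun fill :: "bool list \<Rightarrow> 2 list \<Rightarrow> 2 option list"
  where "fill [] is = []"
  | "fill (True # w) is = None # fill w is"
  | "fill (False # w) (i # is) = Some i # fill w is"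
  | "fill (False # w) [] = Some 1 # fill w []"

lemma shape_fill [simp]: "shape (fill w is) = w"
  by (induction w "is" rule: fill.induct) auto

lemma length_fill [simp]: "length (fill w is) = length w"
  by (induction w "is" rule: fill.induct) auto

lemma labels_fill: "length is = count_list w False \<Longrightarrow> labels (fill w is) = is"
  by (induction w "is" rule: fill.induct) auto

lemma fill_append: "length is = count_list u False \<Longrightarrow> fill (u @ v) (is @ js) = fill u is @ fill v js"
  by (induction u "is" rule: fill.induct) auto

lemma word_elem_append: "word_elem (x @ y) = tensor_mult (word_elem x) (word_elem y)"
  by (induction x rule: word_elem.induct) (auto simp: tensor_mult_one_left tensor_mult_assoc)

definition words_above :: "bool list \<Rightarrow> (2 list \<Rightarrow> 'k::field) set"
  where "words_above w = fs.span {word_elem x |x. length x = length w \<and> lex_gt (shape x) w}"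

definition words_from :: "bool list \<Rightarrow> (2 list \<Rightarrow> 'k::field) set"
  where "words_from w = fs.span {word_elem x |x. length x = length w \<and> (shape x = w \<or> lex_gt (shape x) w)}"

lemma tensor_mult_span:
  assumes x: "x \<in> fs.span S" and y: "y \<in> fs.span S'"
    and mem: "\<And>s s'. s \<in> S \<Longrightarrow> s' \<in> S' \<Longrightarrow> tensor_mult s s' \<in> fs.span R"
  shows "tensor_mult x y \<in> fs.span R"
proof -
  have right: "tensor_mult s y \<in> fs.span R" if s: "s \<in> S" for s
    using y
  proof (induction rule: fs.span_induct_alt)
    case base
    have "tensor_mult s 0 \<in> fs.span R" unfolding tensor_mult_zero_right by (rule fs.span_zero)
    then show ?case .
  next
    case (step c a b)
    have "tensor_mult s (fscale c a + b) \<in> fs.span R"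
      unfolding tensor_mult_add_right tensor_mult_scale_right
      by (intro fs.span_add fs.span_scale mem s step)
    then show ?case .
  qed
  show ?thesis
    using x
  proof (induction rule: fs.span_induct_alt)
    case base
    have "tensor_mult 0 y \<in> fs.span R" unfolding tensor_mult_zero_left by (rule fs.span_zero)
    then show ?case .
  next
    case (step c a b)
    have "tensor_mult (fscale c a + b) y \<in> fs.span R"
      unfolding tensor_mult_add_left tensor_mult_scale_left
      by (intro fs.span_add fs.span_scale right step)
    then show ?case .
  qed
qed

lemma words_above_mult_left:
  assumes "x \<in> words_above u" "y \<in> words_from v" shows "tensor_mult x y \<in> words_above (u @ v)"
  unfolding words_above_def
proof (rule tensor_mult_span[OF assms[unfolded words_above_def words_from_def]])
  fix s s' :: "2 list \<Rightarrow> 'a"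
  assume "s \<in> {word_elem x |x. length x = length u \<and> lex_gt (shape x) u}"
    and "s' \<in> {word_elem x |x. length x = length v \<and> (shape x = v \<or> lex_gt (shape x) v)}"
  then obtain x y where "s = word_elem x" "length x = length u" "lex_gt (shape x) u"
      "s' = word_elem y" "length y = length v" by blast
  then have "tensor_mult s s' = word_elem (x @ y)" "length (x @ y) = length (u @ v)"
      "lex_gt (shape (x @ y)) (u @ v)" by (simp_all add: word_elem_append lex_gt_append)
  then show "tensor_mult s s' \<in> fs.span {word_elem x |x. length x = length (u @ v) \<and> lex_gt (shape x) (u @ v)}"
    by (intro fs.span_base CollectI exI[of _ "x @ y"] conjI)
qed

lemma lex_gt_append_from:
  assumes "x = u \<or> lex_gt x u" "lex_gt y v" "length x = length u"
  shows "lex_gt (x @ y) (u @ v)"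
  using assms lex_gt_append by auto

lemma words_above_mult_right:
  assumes "x \<in> words_from u" "y \<in> words_above v" shows "tensor_mult x y \<in> words_above (u @ v)"
  unfolding words_above_def
proof (rule tensor_mult_span[OF assms[unfolded words_above_def words_from_def]])
  fix s s' :: "2 list \<Rightarrow> 'a"
  assume "s \<in> {word_elem x |x. length x = length u \<and> (shape x = u \<or> lex_gt (shape x) u)}"
    and "s' \<in> {word_elem x |x. length x = length v \<and> lex_gt (shape x) v}"
  then obtain x y where "s = word_elem x" "length x = length u" "shape x = u \<or> lex_gt (shape x) u"
      "s' = word_elem y" "length y = length v" "lex_gt (shape y) v" by blast
  then have "tensor_mult s s' = word_elem (x @ y)" "length (x @ y) = length (u @ v)"
      "lex_gt (shape (x @ y)) (u @ v)"
    using lex_gt_append_from[of "shape x" u "shape y" v] by (simp_all add: word_elem_append)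
  then show "tensor_mult s s' \<in> fs.span {word_elem x |x. length x = length (u @ v) \<and> lex_gt (shape x) (u @ v)}"
    by (intro fs.span_base CollectI exI[of _ "x @ y"] conjI)
qed

lemma words_above_mult_swap:
  assumes "x \<in> words_from v" "y \<in> words_from u" and gt: "lex_gt (v @ u) (u @ v)"
  shows "tensor_mult x y \<in> words_above (u @ v)"
  unfolding words_above_def
proof (rule tensor_mult_span[OF assms(1,2)[unfolded words_from_def]])
  fix s s' :: "2 list \<Rightarrow> 'a"
  assume "s \<in> {word_elem x |x. length x = length v \<and> (shape x = v \<or> lex_gt (shape x) v)}"
    and "s' \<in> {word_elem x |x. length x = length u \<and> (shape x = u \<or> lex_gt (shape x) u)}"
  then obtain x y where xy: "s = word_elem x" "length x = length v" "shape x = v \<or> lex_gt (shape x) v"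
      "s' = word_elem y" "length y = length u" "shape y = u \<or> lex_gt (shape y) u" by blast
  have "shape x @ shape y = v @ u \<or> lex_gt (shape x @ shape y) (v @ u)"
    using xy(3,6) lex_gt_append[of "shape x" v] by auto
  with gt have "lex_gt (shape x @ shape y) (u @ v)" using lex_gt_trans by metis
  with xy have "tensor_mult s s' = word_elem (x @ y)" "length (x @ y) = length (u @ v)"
      "lex_gt (shape (x @ y)) (u @ v)" by (simp_all add: word_elem_append)
  then show "tensor_mult s s' \<in> fs.span {word_elem x |x. length x = length (u @ v) \<and> lex_gt (shape x) (u @ v)}"
    by (intro fs.span_base CollectI exI[of _ "x @ y"] conjI)
qed

lemma word_elem_fill_from: "word_elem (fill w is) \<in> words_from w"
  unfolding words_from_def by (intro fs.span_base CollectI exI[of _ "fill w is"]) simp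

lemma words_above_from: "x \<in> words_above w \<Longrightarrow> x \<in> words_from w"
proof -
  have "words_above w \<subseteq> words_from w"
    unfolding words_above_def words_from_def by (rule fs.span_mono) blast
  then show "x \<in> words_above w \<Longrightarrow> x \<in> words_from w" by blast
qed

text \<open>A family of Lie elements, indexed by the labels of the cubic letters, that spans a copy of a tensor
  power of \<open>E\<close> twisted by a determinant, and whose leading term is the word itself.\<close>

definition lyndon_element ::
    "bool list \<Rightarrow> 2 list \<Rightarrow> (2 list \<Rightarrow> 2 list \<Rightarrow> 'k::field) \<Rightarrow> bool"
  where "lyndon_element w is X \<longleftrightarrow>
    X is \<in> free_lie \<inter> tensor_power (2 * count_list w True + 3 * count_list w False) \<and>
    (\<forall>g. tensor_act g (X is) = fscale (det g ^ length w)
      (\<Sum>js | length js = length is. fscale (gcoeff g js is) (X js))) \<and>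
    X is - word_elem (fill w is) \<in> words_above w"

text \<open>For the standard factorization \<open>w = u v\<close> take brackets of the families for \<open>u\<close> and \<open>v\<close>. The product
  in the order \<open>u v\<close> keeps the leading word, and the product in the order \<open>v u\<close> lies above it because
  \<open>v u\<close> is greater than \<open>u v\<close>.\<close>

lemma lyndon_elements_exist:
  assumes "lyndon w"
  shows "\<exists>X :: 2 list \<Rightarrow> 2 list \<Rightarrow> 'k::field. \<forall>is. length is = count_list w False \<longrightarrow> lyndon_element w is X"
  using assms
proof (induction "length w" arbitrary: w rule: less_induct)
  case less
  have "w \<noteq> []" using less.prems by (simp add: lyndon_def)
  then consider "w = [True]" | "w = [False]" | "length w \<ge> 2"
    by (cases w rule: list.exhaust; cases "tl w") (auto simp: Suc_le_eq)
  then show ?case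
  proof cases
    case 1
    have "lyndon_element w is (\<lambda>_. lie_square :: 2 list \<Rightarrow> 'k)" if "length is = count_list w False" for "is"
    proof -
      have m: "tensor_mult lie_square (delta []) = (lie_square :: 2 list \<Rightarrow> 'k)"
        by (simp add: lie_square_eq tensor_mult_diff_left tensor_mult_delta)
      show ?thesis
        using that 1 lie_square_free lie_square_power
        by (simp add: lyndon_element_def tensor_act_lie_square m words_above_def fs.span_zero)
    qed
    then show ?thesis by (intro exI[of _ "\<lambda>_. lie_square"]) blast
  next
    case 2
    have "lyndon_element w is (\<lambda>is. lie_cube (hd is) :: 2 list \<Rightarrow> 'k)"
      if len: "length is = count_list w False" for "is"
    proof -
      obtain i where i: "is = [i]" using len 2 by (cases "is") auto
      have m: "tensor_mult (lie_cube i) (delta []) = (lie_cube i :: 2 list \<Rightarrow> 'k)"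
        by (simp add: lie_cube_eq tensor_mult_diff_left tensor_mult_delta)
      have s: "(\<Sum>js | length js = Suc 0. fscale (gcoeff g js [i]) (lie_cube (hd js)))
          = (\<Sum>j\<in>UNIV. fscale (g $ j $ i) (lie_cube j :: 2 list \<Rightarrow> 'k))" for g
        by (simp add: sum_words_Suc)
      show ?thesis
        using 2 lie_cube_free[of i] lie_cube_power[of i]
        by (simp add: i lyndon_element_def tensor_act_lie_cube m s words_above_def fs.span_zero)
    qed
    then show ?thesis by (intro exI[of _ "\<lambda>is. lie_cube (hd is)"]) blast
  next
    case 3
    obtain u v where uv: "w = u @ v" "lyndon u" "lyndon v" "lex_gt (v @ u) (u @ v)"
      using lyndon_factorization[OF less.prems 3] by blast
    have ne: "u \<noteq> []" "v \<noteq> []" using uv by (auto simp: lyndon_def)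
    then have lt: "length u < length w" "length v < length w" using uv(1) by auto
    from less.hyps[OF lt(1) uv(2)] obtain Xu :: "2 list \<Rightarrow> 2 list \<Rightarrow> 'k" where
      "\<forall>is. length is = count_list u False \<longrightarrow> lyndon_element u is Xu" ..
    then have Xu: "lyndon_element u is Xu" if "length is = count_list u False" for "is" using that by blast
    from less.hyps[OF lt(2) uv(3)] obtain Xv :: "2 list \<Rightarrow> 2 list \<Rightarrow> 'k" where
      "\<forall>is. length is = count_list v False \<longrightarrow> lyndon_element v is Xv" ..
    then have Xv: "lyndon_element v is Xv" if "length is = count_list v False" for "is" using that by blast
    define p where "p = count_list u False"
    define q where "q = count_list v False"
    define X where "X is = lie_bracket (Xu (take p is)) (Xv (drop p is))" for "is"
    have "lyndon_element w is X" if len: "length is = count_list w False" for "is"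
    proof -
      define i1 i2 where "i1 = take p is" and "i2 = drop p is"
      have split_is: "is = i1 @ i2" by (simp add: i1_def i2_def)
      have l1: "length i1 = p" and l2: "length i2 = q"
        using len uv(1) by (simp_all add: i1_def i2_def p_def q_def)
      have Xis: "X is = lie_bracket (Xu i1) (Xv i2)" by (simp add: X_def i1_def i2_def)
      note U = Xu[of i1, unfolded lyndon_element_def, OF l1[unfolded p_def]]
        and V = Xv[of i2, unfolded lyndon_element_def, OF l2[unfolded q_def]]
      have "X is \<in> free_lie" unfolding Xis using U V by (auto intro: free_lie_bracket)
      moreover have "X is \<in> tensor_power ((2 * count_list u True + 3 * count_list u False)
          + (2 * count_list v True + 3 * count_list v False))"
        unfolding Xis by (rule lie_bracket_power) (use U V in auto)
      then have "X is \<in> tensor_power (2 * count_list w True + 3 * count_list w False)"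
        by (simp add: uv(1) algebra_simps)
      moreover have "tensor_act g (X is) = fscale (det g ^ length w)
          (\<Sum>js | length js = length is. fscale (gcoeff g js is) (X js))" for g
      proof -
        have "(\<Sum>js | length js = length is. fscale (gcoeff g js is) (X js))
          = (\<Sum>j1 | length j1 = p. \<Sum>j2 | length j2 = q. fscale (gcoeff g (j1 @ j2) is) (X (j1 @ j2)))"
          unfolding split_is length_append l1 l2 by (rule sum_words_add)
        also have "\<dots> = (\<Sum>j1 | length j1 = p. \<Sum>j2 | length j2 = q.
            fscale (gcoeff g j1 i1) (fscale (gcoeff g j2 i2) (lie_bracket (Xu j1) (Xv j2))))"
          by (intro sum.cong refl) (simp add: split_is X_def l1 gcoeff_append)
        finally have S: "(\<Sum>js | length js = length is. fscale (gcoeff g js is) (X js))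
          = lie_bracket (\<Sum>j1 | length j1 = p. fscale (gcoeff g j1 i1) (Xu j1))
              (\<Sum>j2 | length j2 = q. fscale (gcoeff g j2 i2) (Xv j2))"
          unfolding lie_bracket_sum_left
          by (simp add: lie_bracket_sum_right lie_bracket_scale_left
              lie_bracket_scale_right fs.scale_sum_right mult.commute)
        have a: "tensor_act g (Xu i1) = fscale (det g ^ length u)
            (\<Sum>j1 | length j1 = p. fscale (gcoeff g j1 i1) (Xu j1))"
          using U l1 by simp
        have b: "tensor_act g (Xv i2) = fscale (det g ^ length v)
            (\<Sum>j2 | length j2 = q. fscale (gcoeff g j2 i2) (Xv j2))"
          using V l2 by simp
        show ?thesis
          unfolding Xis tensor_act_bracket a b S lie_bracket_scale_left lie_bracket_scale_right
          by (simp add: uv(1) power_add)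
      qed
      moreover have "X is - word_elem (fill w is) \<in> words_above w"
      proof -
        let ?mu = "word_elem (fill u i1) :: 2 list \<Rightarrow> 'k" and ?mv = "word_elem (fill v i2) :: 2 list \<Rightarrow> 'k"
        have du: "Xu i1 - ?mu \<in> words_above u" and dv: "Xv i2 - ?mv \<in> words_above v" using U V by auto
        have sub: "fs.subspace (words_from x)" "fs.subspace (words_above x)" for x :: "bool list"
          by (simp_all add: words_from_def words_above_def)
        have fu: "Xu i1 \<in> words_from u"
          using fs.subspace_add[OF sub(1) words_above_from[OF du] word_elem_fill_from[of u i1]] by simp
        have fv: "Xv i2 \<in> words_from v"
          using fs.subspace_add[OF sub(1) words_above_from[OF dv] word_elem_fill_from[of v i2]] by simp
        have "word_elem (fill w is) = tensor_mult ?mu ?mv"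
          using l1 by (simp add: split_is uv(1) fill_append p_def word_elem_append)
        then have "X is - word_elem (fill w is) = tensor_mult (Xu i1 - ?mu) (Xv i2)
            + tensor_mult ?mu (Xv i2 - ?mv) - tensor_mult (Xv i2) (Xu i1)"
          by (simp add: Xis lie_bracket_def tensor_mult_diff_left tensor_mult_diff_right)
        also have "\<dots> \<in> words_above (u @ v)"
          by (intro fs.subspace_diff[OF sub(2)] fs.subspace_add[OF sub(2)] words_above_mult_left[OF du fv]
              words_above_mult_right[OF word_elem_fill_from dv] words_above_mult_swap[OF fv fu uv(4)])
        finally show ?thesis by (simp add: uv(1))
      qed
      ultimately show ?thesis by (simp add: lyndon_element_def)
    qed
    then show ?thesis by (intro exI[of _ X]) blast
  qed
qed

subsection \<open>Contractions that detect Lyndon words\<close>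

text \<open>Applied to a basis vector \<open>i\<close> of \<open>E\<close> followed by a word in the generators, where \<open>i\<close> is the label of the
  last cubic letter and not yet part of the output. In characteristic two the contraction of the first two
  factors takes \<open>i\<close> followed by the Lie square to \<open>i\<close>, and the Lie cube \<open>[[1, 2], j]\<close> to \<open>j\<close>, but it is zero
  on the Lie square. A cubic letter of \<open>w\<close> outputs \<open>i\<close> first, so that the contraction then tells a cubic
  letter of the word from a quadratic one.\<close>

fun cut_kept :: "bool list \<Rightarrow> (2 list \<Rightarrow> 'k::field) \<Rightarrow> 2 list \<Rightarrow> 'k"
  where "cut_kept [] f = f"
  | "cut_kept (True # w) f = cut_kept w (contract f)"
  | "cut_kept (False # w) f =
      (\<lambda>z. case z of [] \<Rightarrow> 0 | i # z' \<Rightarrow> cut_kept w (contract (lder i f)) z')"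

definition lyndon_cut :: "bool list \<Rightarrow> (2 list \<Rightarrow> 'k::field) \<Rightarrow> 2 list \<Rightarrow> 'k"
  where "lyndon_cut w f = cut_kept (tl w) (contract f)"

lemma cut_kept_add: "cut_kept w (f + h) = cut_kept w f + cut_kept w h"
  by (induction w f arbitrary: h rule: cut_kept.induct)
     (simp_all add: contract_add lder_add fun_eq_iff fun_simps split: list.split)

lemma cut_kept_scale: "cut_kept w (fscale c f) = fscale c (cut_kept w f)"
proof (induction w f rule: cut_kept.induct)
  case (2 w f)
  show ?case by (simp only: cut_kept.simps contract_scale 2)
next
  case (3 w f)
  show ?case
  proof
    fix z show "cut_kept (False # w) (fscale c f) z = fscale c (cut_kept (False # w) f) z"
      by (cases z) (simp_all only: cut_kept.simps list.case lder_scale contract_scale 3 fscale_apply mult_zero_right)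
  qed
qed simp

lemma cut_kept_zero: "cut_kept w 0 = 0"
  using cut_kept_scale[of w 0 0] by simp

lemma cut_kept_sum: "cut_kept w (\<Sum>i\<in>A. f i) = (\<Sum>i\<in>A. cut_kept w (f i))"
  by (induction A rule: infinite_finite_induct) (auto simp: cut_kept_zero cut_kept_add)

lemma contract_sum: "contract (\<Sum>i\<in>A. f i) = (\<Sum>i\<in>A. contract (f i))"
  by (induction A rule: infinite_finite_induct) (auto simp: contract_zero contract_add)

lemma lder_cut_kept_False: "lder j (cut_kept (False # w) f) = cut_kept w (contract (lder j f))"
  by (rule ext) (simp add: lder_def)

lemma cut_kept_tensor_act:
  "cut_kept w (tensor_act g f) = fscale (det g ^ length w) (tensor_act g (cut_kept w f))"
proof (induction w arbitrary: f)
  case Nil then show ?case by simp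
next
  case (Cons x w)
  show ?case
  proof (cases x)
    case True
    then show ?thesis by (simp add: contract_tensor_act cut_kept_scale Cons.IH mult.commute)
  next
    case False
    show ?thesis
    proof
      fix z
      show "cut_kept (x # w) (tensor_act g f) z
          = fscale (det g ^ length (x # w)) (tensor_act g (cut_kept (x # w) f)) z"
      proof (cases z)
        case Nil then show ?thesis using False by (simp add: fun_simps)
      next
        case (Cons i z')
        have "cut_kept (x # w) (tensor_act g f) z = cut_kept w (contract (lder i (tensor_act g f))) z'"
          using False Cons by simp
        also have "contract (lder i (tensor_act g f))
            = (\<Sum>j\<in>UNIV. fscale (g $ i $ j) (fscale (det g) (tensor_act g (contract (lder j f)))))"
          by (simp add: lder_tensor_act contract_sum contract_scale contract_tensor_act)
        also have "cut_kept w \<dots> z' = (\<Sum>j\<in>UNIV. g $ i $ j *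
            (det g * (det g ^ length w * tensor_act g (cut_kept w (contract (lder j f))) z')))"
          by (simp add: cut_kept_sum cut_kept_scale Cons.IH fun_simps mult.assoc)
        also have "\<dots> = det g ^ length (x # w) * (\<Sum>j\<in>UNIV. g $ i $ j *
            tensor_act g (cut_kept w (contract (lder j f))) z')"
          by (simp add: sum_distrib_left mult.assoc mult.left_commute)
        also have "\<dots> = fscale (det g ^ length (x # w)) (tensor_act g (cut_kept (x # w) f)) z"
          using False Cons by (simp add: tensor_act_Cons lder_cut_kept_False fun_simps del: cut_kept.simps)
        finally show ?thesis .
      qed
    qed
  qed
qed

lemma lder_power: "f \<in> tensor_power (Suc n) \<Longrightarrow> lder j f \<in> tensor_power n"
  by (auto simp: lder_def tensor_power_def)

lemma cut_kept_power:
  "f \<in> tensor_power (Suc (2 * count_list w True + 3 * count_list w False)) \<Longrightarrow>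
    cut_kept w f \<in> tensor_power (Suc (count_list w False))"
proof (induction w arbitrary: f)
  case (Cons x w)
  show ?case
  proof (cases x)
    case True
    then have "Suc (2 * count_list (x # w) True + 3 * count_list (x # w) False)
        = Suc (Suc (Suc (2 * count_list w True + 3 * count_list w False)))" by simp
    from Cons.IH[OF contract_power[OF Cons.prems[unfolded this]]] True show ?thesis by simp
  next
    case False
    have "cut_kept w (contract (lder j f)) \<in> tensor_power (Suc (count_list w False))" for j
    proof -
      have "Suc (2 * count_list (x # w) True + 3 * count_list (x # w) False)
          = Suc (Suc (Suc (Suc (2 * count_list w True + 3 * count_list w False))))" using False by simp
      from Cons.IH[OF contract_power[OF lder_power[OF Cons.prems[unfolded this]]]] show ?thesis .
    qed
    then show ?thesis using False by (auto simp: tensor_power_def split: list.split)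
  qed
qed simp

text \<open>Only the first three tensor factors matter, so the rules for the letters of a word follow by
  evaluating the form on tensors of degree three.\<close>

lemma contract_cubic_mult:
  assumes F: "F \<in> tensor_power 3"
  shows "contract (tensor_mult F h) = (\<Sum>z\<in>UNIV. fscale (F [1, 2, z] - F [2, 1, z]) (tensor_mult (delta [z]) h))"
proof
  fix w
  have m: "tensor_mult F h (a # b # c # w') = F [a, b, c] * h w'" for a b c w'
    using tensor_mult_homogeneous[of F "[a, b, c]" h w'] F by (simp add: numeral_3_eq_3)
  show "contract (tensor_mult F h) w
      = (\<Sum>z\<in>UNIV. fscale (F [1, 2, z] - F [2, 1, z]) (tensor_mult (delta [z]) h)) w"
  proof (cases w)
    case Nil
    then show ?thesis using tensor_mult_short[OF F] by (simp add: contract_def fun_simps)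
  next
    case (Cons z w')
    have "(\<Sum>y\<in>UNIV. fscale (F [1, 2, y] - F [2, 1, y]) (tensor_mult (delta [y]) h)) w
        = (\<Sum>y\<in>UNIV. if z = y then (F [1, 2, y] - F [2, 1, y]) * h w' else 0)"
      unfolding sum_fun_apply Cons
      by (rule sum.cong) (auto simp: fun_simps tensor_mult_Cons lder_delta tensor_mult_one_left tensor_mult_zero_left)
    then show ?thesis by (simp add: contract_def Cons m left_diff_distrib)
  qed
qed

context
  assumes char2: "CHAR('k::field) = 2"
begin

lemma two_eq_zero: "(2 :: 'k) = 0"
  using of_nat_CHAR[where 'a = 'k] char2 by simp

lemma add_self: "x + x = (0 :: 'k)"
  using two_eq_zero by (metis mult_2 mult_zero_left)

lemma minus_eq_self: "- x = (x :: 'k)"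
  using add_self by (simp add: eq_neg_iff_add_eq_0 minus_equation_iff)

lemma contract_square_mult: "contract (tensor_mult lie_square h) = (0 :: 2 list \<Rightarrow> 'k)"
proof
  fix w
  have m: "tensor_mult lie_square h (a # b # w) = lie_square [a, b] * h w" for a b :: 2
    using tensor_mult_homogeneous[of "lie_square :: 2 list \<Rightarrow> 'k" "[a, b]" h w] lie_square_power
    by (simp add: numeral_2_eq_2)
  show "contract (tensor_mult lie_square h) w = 0 w"
    unfolding contract_def m by (simp add: lie_square_eq fun_simps add_self)
qed

lemma contract_cube_mult: "contract (tensor_mult (lie_cube i) h) = tensor_mult (delta [i]) (h :: 2 list \<Rightarrow> 'k)"
  unfolding contract_cubic_mult[OF lie_cube_power] sum_2
  unfolding lie_cube_eq
  using exhaust_2[of i]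
  by (auto simp: fun_simps minus_eq_self add_self)

lemma contract_letter_square_mult:
  "contract (tensor_mult (delta [i]) (tensor_mult lie_square h)) = tensor_mult (delta [i]) (h :: 2 list \<Rightarrow> 'k)"
proof -
  have "tensor_mult (delta [i]) lie_square \<in> tensor_power 3"
    using tensor_mult_power[OF delta_letter_power lie_square_power, of i] by (simp add: numeral_3_eq_3)
  from contract_cubic_mult[OF this, of h] show ?thesis
    unfolding tensor_mult_assoc sum_2 lie_square_eq[symmetric]
    unfolding lie_square_eq tensor_mult_diff_right tensor_mult_delta
    using exhaust_2[of i] by (auto simp: fun_simps minus_eq_self add_self)
qed

lemma lder_letter_mult: "lder j (tensor_mult (delta [i]) h) = (if j = i then h else 0)"
  by (simp add: lder_tensor_mult lder_delta tensor_mult_one_left tensor_mult_zero_left)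

lemma cut_kept_word:
  "cut_kept (shape x) (tensor_mult (delta [i]) (word_elem x)) = (delta (i # labels x) :: 2 list \<Rightarrow> 'k)"
proof (induction x arbitrary: i)
  case Nil then show ?case by (simp add: tensor_mult_delta)
next
  case (Cons c x)
  show ?case
  proof (cases c)
    case None
    then show ?thesis by (simp add: contract_letter_square_mult Cons.IH)
  next
    case (Some k)
    show ?thesis
    proof
      fix z
      show "cut_kept (shape (c # x)) (tensor_mult (delta [i]) (word_elem (c # x))) z
          = (delta (i # labels (c # x)) :: 2 list \<Rightarrow> 'k) z"
        using Some by (cases z) (simp_all add: lder_letter_mult contract_cube_mult Cons.IH contract_zero
            cut_kept_zero fun_simps del: delta_simps(4), simp_all)
    qed
  qed
qed

text \<open>At the first difference the word has a quadratic letter where \<open>w\<close> expects a cubic one; then the form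
  meets the Lie square.\<close>

lemma cut_kept_word_above:
  "lex_gt (shape x) w \<Longrightarrow> cut_kept w (tensor_mult (delta [i]) (word_elem x)) = (0 :: 2 list \<Rightarrow> 'k)"
proof (induction x arbitrary: i w)
  case (Cons c x)
  obtain y w' where w: "w = y # w'" using Cons.prems by (cases w) auto
  show ?case
  proof (cases c)
    case None
    show ?thesis
    proof (cases y)
      case True
      then show ?thesis using Cons None w by (simp add: contract_letter_square_mult)
    next
      case False
      show ?thesis
      proof
        fix z show "cut_kept w (tensor_mult (delta [i]) (word_elem (c # x))) z = (0 :: 2 list \<Rightarrow> 'k) z"
          using None False w by (cases z)
            (auto simp: lder_letter_mult contract_square_mult contract_zero cut_kept_zero fun_simps)
      qed
    qed
  next
    case (Some k)
    then have y: "\<not> y" "lex_gt (shape x) w'" using Cons.prems w by (auto split: if_splits)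
    show ?thesis
    proof
      fix z show "cut_kept w (tensor_mult (delta [i]) (word_elem (c # x))) z = (0 :: 2 list \<Rightarrow> 'k) z"
        using Some y w Cons.IH[OF y(2)] by (cases z)
          (auto simp: lder_letter_mult contract_cube_mult contract_zero cut_kept_zero fun_simps)
    qed
  qed
qed simp

lemma cut_word:
  assumes "shape x = False # w'"
  shows "lyndon_cut (False # w') (word_elem x) = (delta (labels x) :: 2 list \<Rightarrow> 'k)"
proof -
  obtain i x' where x: "x = Some i # x'" "shape x' = w'" using assms by (cases x) auto
  then show ?thesis using cut_kept_word[of x' i] by (simp add: lyndon_cut_def contract_cube_mult)
qed

lemma cut_word_above:
  assumes "lex_gt (shape x) (False # w')"
  shows "lyndon_cut (False # w') (word_elem x) = (0 :: 2 list \<Rightarrow> 'k)"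
proof (cases x)
  case (Cons c x')
  show ?thesis
  proof (cases c)
    case None
    then show ?thesis using Cons by (simp add: lyndon_cut_def contract_square_mult cut_kept_zero)
  next
    case (Some i)
    then have "lex_gt (shape x') w'" using assms Cons by simp
    then show ?thesis using Cons Some cut_kept_word_above[of x' w' i] by (simp add: lyndon_cut_def contract_cube_mult)
  qed
qed (use assms in simp)

lemma cut_words_above:
  assumes "f \<in> words_above v" "v = False # w' \<or> lex_gt v (False # w')"
  shows "lyndon_cut (False # w') f = (0 :: 2 list \<Rightarrow> 'k)"
  using assms(1) unfolding words_above_def
proof (induction rule: fs.span_induct_alt)
  case base
  have "lyndon_cut (False # w') 0 = (0 :: 2 list \<Rightarrow> 'k)" by (simp add: lyndon_cut_def contract_zero cut_kept_zero)
  then show ?case .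
next
  case (step c a b)
  then obtain x where x: "a = word_elem x" "lex_gt (shape x) v" by blast
  then have "lex_gt (shape x) (False # w')" using assms(2) lex_gt_trans by blast
  then have "lyndon_cut (False # w') a = 0" using cut_word_above x by blast
  then have "lyndon_cut (False # w') (fscale c a + b) = 0"
    using step(2) by (simp add: lyndon_cut_def contract_add contract_scale cut_kept_add cut_kept_scale)
  then show ?case .
qed

text \<open>For a Lyndon word \<open>w\<close> with \<open>s\<close> letters for the Lie square and \<open>t \<ge> 1\<close> letters for the Lie cube,
  the Lie elements with leading word \<open>w\<close> embed \<open>E\<^sup>\<otimes>\<^sup>t \<otimes> det\<^sup>s\<^sup>+\<^sup>t\<close> into the Lie power. The contractions are
  a left inverse, and they are triangular with respect to the lexicographic order since they kill every
  word above the one that they are made for.\<close>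

lemma lyndon_maps:
  assumes w: "lyndon w" "count_list w False \<ge> 1"
  shows "\<exists>P :: (2 list \<Rightarrow> 'k) \<Rightarrow> 2 list \<Rightarrow> 'k.
    rep_hom GL2 (det_tensor (count_list w False) (length w))
      (lie_power (2 * count_list w True + 3 * count_list w False)) P \<and>
    (\<forall>f\<in>tensor_power (count_list w False). lyndon_cut w (P f) = f) \<and>
    (\<forall>f v. v \<noteq> [] \<longrightarrow> \<not> hd v \<longrightarrow> lex_gt w v \<longrightarrow> lyndon_cut v (P f) = 0)"
proof -
  define t where "t = count_list w False"
  define r where "r = 2 * count_list w True + 3 * t"
  from lyndon_elements_exist[OF w(1)] obtain X :: "2 list \<Rightarrow> 2 list \<Rightarrow> 'k" where
    "\<forall>is. length is = count_list w False \<longrightarrow> lyndon_element w is X" ..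
  then have X: "lyndon_element w is X" if "length is = t" for "is" using that by (simp add: t_def)
  have Xmem: "X is \<in> free_lie \<inter> tensor_power r" if "length is = t" for "is"
    using X[OF that] by (simp add: lyndon_element_def r_def t_def)
  define P where "P f = (\<Sum>is | length is = t. fscale (f is) (X is))" for f :: "2 list \<Rightarrow> 'k"
  have hom: "rep_hom GL2 (det_tensor t (length w)) (lie_power r) P"
  proof (rule rep_homI)
    have sub: "fs.subspace (free_lie \<inter> tensor_power r :: (2 list \<Rightarrow> 'k) set)"
      by (rule fs.subspace_inter[OF free_lie_subspace tensor_power_subspace])
    show "P f \<in> vecs (lie_power r)" for f
      unfolding P_def lie_power_simps
      by (rule fs.subspace_sum[OF sub]) (rule fs.subspace_scale[OF sub Xmem], simp)
    show "P (f + h) = P f + P h" for f h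
      by (simp add: P_def fun_simps fs.scale_left_distrib sum.distrib)
    show "P (fscale c f) = fscale c (P f)" for c f
      by (simp add: P_def fun_simps fs.scale_sum_right)
    fix g :: "'k ^ 2 ^ 2" and f :: "2 list \<Rightarrow> 'k"
    have "act (lie_power r) g (P f) = (\<Sum>is | length is = t. fscale (f is) (tensor_act g (X is)))"
      by (simp add: P_def tensor_act_sum tensor_act_scale)
    also have "\<dots> = (\<Sum>is | length is = t. \<Sum>js | length js = t.
        fscale (det g ^ length w * (gcoeff g js is * f is)) (X js))"
      using X by (intro sum.cong refl)
        (simp add: lyndon_element_def fs.scale_sum_right mult.assoc mult.commute mult.left_commute)
    also have "\<dots> = (\<Sum>js | length js = t. \<Sum>is | length is = t.
        fscale (det g ^ length w * (gcoeff g js is * f is)) (X js))" by (rule sum.swap)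
    also have "\<dots> = P (act (det_tensor t (length w)) g f)"
      unfolding P_def
      by (intro sum.cong refl)
         (simp add: fun_simps tensor_act_gcoeff fs.scale_sum_left sum_distrib_left)
    finally show "P (act (det_tensor t (length w)) g f) = act (lie_power r) g (P f)" by (rule sym)
  qed
  have cutP: "lyndon_cut v (P f) = (\<Sum>is | length is = t. fscale (f is) (lyndon_cut v (X is)))" for v f
    by (simp add: P_def lyndon_cut_def contract_sum contract_scale cut_kept_sum cut_kept_scale)
  have Xsplit: "X is = word_elem (fill w is) + (X is - word_elem (fill w is))" for "is" by simp
  have cut_add: "lyndon_cut v (a + b) = lyndon_cut v a + lyndon_cut v b" for v and a b :: "2 list \<Rightarrow> 'k"
    by (simp add: lyndon_cut_def contract_add cut_kept_add)
  have cutX: "lyndon_cut v (X is) = lyndon_cut v (word_elem (fill w is)) + lyndon_cut v (X is - word_elem (fill w is))" for v "is"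
    using cut_add[of v "word_elem (fill w is)" "X is - word_elem (fill w is)"] by simp
  have above: "X is - word_elem (fill w is) \<in> words_above w" if "length is = t" for "is"
    using X[OF that] by (simp add: lyndon_element_def)
  have "lyndon_cut w (P f) = f" if f: "f \<in> tensor_power t" for f
  proof -
    have "False \<in> set w" using w(2) count_list_zero by (metis not_one_le_zero)
    then obtain w' where w': "w = False # w'" using lyndon_starts_False[OF w(1)] by blast
    have "lyndon_cut w (X is) = delta is" if "length is = t" for "is"
    proof -
      have "lyndon_cut w (word_elem (fill w is)) = (delta (labels (fill w is)) :: 2 list \<Rightarrow> 'k)"
        using cut_word[of "fill w is" w'] w' shape_fill[of w "is"] by simp
      moreover have "lyndon_cut w (X is - word_elem (fill w is)) = 0"
        using cut_words_above[OF above[OF that], of w'] w' by simp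
      ultimately show ?thesis using cutX[of w "is"] labels_fill[of "is" w] that by (simp add: t_def)
    qed
    then have "lyndon_cut w (P f) = (\<Sum>is | length is = t. fscale (f is) (delta is))" by (simp add: cutP)
    then show ?thesis using tensor_power_expand[OF f] by simp
  qed
  moreover have "lyndon_cut v (P f) = 0" if v: "v \<noteq> []" "\<not> hd v" "lex_gt w v" for f v
  proof -
    obtain v' where v': "v = False # v'" using v by (cases v) auto
    have "lyndon_cut v (X is) = 0" if "length is = t" for "is"
    proof -
      have "lyndon_cut v (word_elem (fill w is)) = (0 :: 2 list \<Rightarrow> 'k)"
        using cut_word_above[of "fill w is" v'] v' shape_fill[of w "is"] v(3) by simp
      moreover have "lyndon_cut v (X is - word_elem (fill w is)) = 0"
        using cut_words_above[OF above[OF that], of v'] v' v(3) by simp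
      ultimately show ?thesis using cutX[of v "is"] by simp
    qed
    then show ?thesis by (simp add: cutP)
  qed
  ultimately show ?thesis using hom unfolding t_def[symmetric] r_def[symmetric]
    by (intro exI[of _ P] conjI ballI allI impI)
qed

end

lemma cut_hom:
  assumes "w = False # w'"
  shows "rep_hom GL2 (lie_power (2 * count_list w True + 3 * count_list w False))
    (det_tensor (count_list w False) (length w)) (lyndon_cut w)"
proof (rule rep_homI)
  fix f :: "2 list \<Rightarrow> 'k::field"
  assume "f \<in> vecs (lie_power (2 * count_list w True + 3 * count_list w False))"
  then have f: "f \<in> tensor_power (Suc (Suc (Suc (2 * count_list w' True + 3 * count_list w' False))))"
    using assms by (simp add: numeral_eq_Suc)
  show "lyndon_cut w f \<in> vecs (det_tensor (count_list w False) (length w))"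
    using cut_kept_power[OF contract_power[OF f]] assms by (simp add: lyndon_cut_def)
next
  fix f h :: "2 list \<Rightarrow> 'k::field"
  show "lyndon_cut w (f + h) = lyndon_cut w f + lyndon_cut w h" by (simp add: lyndon_cut_def contract_add cut_kept_add)
next
  fix c and f :: "2 list \<Rightarrow> 'k::field"
  show "lyndon_cut w (fscale c f) = fscale c (lyndon_cut w f)" by (simp add: lyndon_cut_def contract_scale cut_kept_scale)
next
  fix g :: "'k::field ^ 2 ^ 2" and f :: "2 list \<Rightarrow> 'k"
  show "lyndon_cut w (act (lie_power (2 * count_list w True + 3 * count_list w False)) g f)
      = act (det_tensor (count_list w False) (length w)) g (lyndon_cut w f)"
    using assms by (simp add: lyndon_cut_def contract_tensor_act cut_kept_scale cut_kept_tensor_act)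
qed

section \<open>Two-row Specht modules and tensor powers\<close>

definition word_form :: "nat \<Rightarrow> (2 list \<Rightarrow> 'k::field) \<Rightarrow> (2 list \<Rightarrow> 'k) \<Rightarrow> 'k"
  where "word_form t f h = (\<Sum>w | length w = t. f w * h w)"

lemma word_form_add_right: "word_form t f (h + h') = word_form t f h + word_form t f h'"
  and word_form_scale_right: "word_form t f (fscale c h) = c * word_form t f h"
  and word_form_add_left: "word_form t (f + f') h = word_form t f h + word_form t f' h"
  and word_form_scale_left: "word_form t (fscale c f) h = c * word_form t f h"
  by (simp_all add: word_form_def fun_simps algebra_simps sum.distrib sum_distrib_left)

lemma word_form_delta: "word_form t (delta u) h = (if length u = t then h u else 0)"
proof -
  have "word_form t (delta u) h = (\<Sum>w | length w = t. if u = w then h u else 0)"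
    unfolding word_form_def by (rule sum.cong) (auto simp: delta_def)
  then show ?thesis by simp
qed

lemma gcoeff_transpose: "gcoeff (transpose g) u w = gcoeff g w u"
  by (induction g w u rule: gcoeff.induct) (auto simp: transpose_def)

lemma word_form_tensor_act: "word_form t (tensor_act g f) h = word_form t f (tensor_act (transpose g) h)"
proof -
  have "word_form t (tensor_act g f) h
      = (\<Sum>w | length w = t. \<Sum>u | length u = t. gcoeff g w u * f u * h w)"
    unfolding word_form_def tensor_act_gcoeff sum_distrib_right by (rule sum.cong) auto
  also have "\<dots> = (\<Sum>u | length u = t. \<Sum>w | length w = t. gcoeff g w u * f u * h w)" by (rule sum.swap)
  also have "\<dots> = word_form t f (tensor_act (transpose g) h)"
    unfolding word_form_def tensor_act_gcoeff sum_distrib_left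
    by (intro sum.cong) (auto simp: gcoeff_transpose mult_ac)
  finally show ?thesis .
qed

definition place_perm :: "(nat \<Rightarrow> nat) \<Rightarrow> (2 list \<Rightarrow> 'k::field) \<Rightarrow> 2 list \<Rightarrow> 'k"
  where "place_perm p f = (\<lambda>w. f (permute_list p w))"

lemma place_perm_power: "f \<in> tensor_power t \<Longrightarrow> place_perm p f \<in> tensor_power t"
  by (auto simp: place_perm_def tensor_power_def)

lemma bij_permute_words:
  assumes p: "p permutes {..<t}"
  shows "bij_betw (permute_list p) {u :: 2 list. length u = t} {u. length u = t}"
proof (rule bij_betw_byWitness[where f' = "permute_list (Hilbert_Choice.inv p)"])
  have q: "Hilbert_Choice.inv p permutes {..<t}" using p by (rule permutes_inv)
  have 1: "permute_list (Hilbert_Choice.inv p) (permute_list p u) = u" if "length u = t" for u :: "2 list"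
  proof -
    have "permute_list (p \<circ> Hilbert_Choice.inv p) u = permute_list (Hilbert_Choice.inv p) (permute_list p u)"
      by (rule permute_list_compose) (use q that in simp)
    moreover have "p \<circ> Hilbert_Choice.inv p = id" using permutes_inv_o(1)[OF p] .
    ultimately show ?thesis by simp
  qed
  have 2: "permute_list p (permute_list (Hilbert_Choice.inv p) u) = u" if "length u = t" for u :: "2 list"
  proof -
    have "permute_list (Hilbert_Choice.inv p \<circ> p) u = permute_list p (permute_list (Hilbert_Choice.inv p) u)"
      by (rule permute_list_compose) (use p that in simp)
    moreover have "Hilbert_Choice.inv p \<circ> p = id" using permutes_inv_o(2)[OF p] .
    ultimately show ?thesis by simp
  qed
  show "\<forall>a\<in>{u :: 2 list. length u = t}. permute_list (Hilbert_Choice.inv p) (permute_list p a) = a" using 1 by simp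
  show "\<forall>a\<in>{u :: 2 list. length u = t}. permute_list p (permute_list (Hilbert_Choice.inv p) a) = a" using 2 by simp
qed auto

lemma gcoeff_permute:
  assumes p: "p permutes {..<t}" and "length w = t" "length u = t"
  shows "gcoeff g (permute_list p w) (permute_list p u) = gcoeff g w u"
proof -
  have "gcoeff g (permute_list p w) (permute_list p u) = (\<Prod>i<t. g $ (w ! p i) $ (u ! p i))"
    using assms by (simp add: gcoeff_prod permute_list_nth)
  also have "\<dots> = (\<Prod>i<t. g $ (w ! i) $ (u ! i))"
    using permutes_imp_bij[OF p] prod.reindex_bij_betw[of p "{..<t}" "{..<t}" "\<lambda>i. g $ (w ! i) $ (u ! i)"] by simp
  also have "\<dots> = gcoeff g w u" using assms by (simp add: gcoeff_prod)
  finally show ?thesis .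
qed

lemma place_perm_hom:
  assumes p: "p permutes {..<t}"
  shows "rep_hom GL2 (det_tensor t k) (det_tensor t k) (place_perm p)"
proof (rule rep_homI)
  fix f :: "2 list \<Rightarrow> 'a" assume f: "f \<in> vecs (det_tensor t k)"
  then show "place_perm p f \<in> vecs (det_tensor t k)" using place_perm_power by simp
  fix g :: "'a ^ 2 ^ 2"
  have "place_perm p (tensor_act g f) w = tensor_act g (place_perm p f) w" for w
  proof (cases "length w = t")
    case True
    have "tensor_act g (place_perm p f) w
        = (\<Sum>u | length u = t. gcoeff g (permute_list p w) (permute_list p u) * f (permute_list p u))"
      unfolding tensor_act_gcoeff place_perm_def True
      by (rule sum.cong) (simp_all add: gcoeff_permute[OF p True])
    also have "\<dots> = (\<Sum>u | length u = t. gcoeff g (permute_list p w) u * f u)"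
      by (rule sum.reindex_bij_betw[OF bij_permute_words[OF p], of "\<lambda>u. gcoeff g (permute_list p w) u * f u"])
    finally show ?thesis by (simp add: place_perm_def tensor_act_gcoeff True)
  next
    case False
    have "place_perm p f \<in> tensor_power t" using f place_perm_power by simp
    then have "tensor_act g (place_perm p f) \<in> tensor_power t" by (rule tensor_act_power)
    moreover have "place_perm p (tensor_act g f) \<in> tensor_power t"
      using f by (intro place_perm_power tensor_act_power) simp
    ultimately show ?thesis using False by (simp add: tensor_power_def)
  qed
  then have "place_perm p (tensor_act g f) = tensor_act g (place_perm p f)" by (rule ext)
  moreover have "place_perm p (fscale c h) = fscale c (place_perm p h)" for c and h :: "2 list \<Rightarrow> 'a"
    by (rule ext) (simp add: place_perm_def fscale_apply)
  ultimately show "place_perm p (act (det_tensor t k) g f) = act (det_tensor t k) g (place_perm p f)" by simp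
next
  show "place_perm p (u + v) = place_perm p u + place_perm p v" for u v :: "2 list \<Rightarrow> 'a"
    by (rule ext) (simp add: place_perm_def plus_fun_apply)
  show "place_perm p (fscale c v) = fscale c (place_perm p v)" for c and v :: "2 list \<Rightarrow> 'a"
    by (rule ext) (simp add: place_perm_def fscale_apply)
qed

lemma word_form_place_perm:
  assumes p: "p permutes {..<t}"
  shows "word_form t f (place_perm p h) = word_form t (place_perm (Hilbert_Choice.inv p) f) h"
proof -
  have q: "Hilbert_Choice.inv p permutes {..<t}" using p by (rule permutes_inv)
  have "word_form t (place_perm (Hilbert_Choice.inv p) f) h = (\<Sum>w | length w = t.
      (\<lambda>w. f w * h (permute_list p w)) (permute_list (Hilbert_Choice.inv p) w))"
    unfolding word_form_def
  proof (rule sum.cong[OF refl])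
    fix w :: "2 list" assume w: "w \<in> {w. length w = t}"
    have "permute_list (Hilbert_Choice.inv p \<circ> p) w = permute_list p (permute_list (Hilbert_Choice.inv p) w)"
      by (rule permute_list_compose) (use p w in simp)
    then have "permute_list p (permute_list (Hilbert_Choice.inv p) w) = w" using permutes_inv_o(2)[OF p] by simp
    then show "place_perm (Hilbert_Choice.inv p) f w * h w = (\<lambda>w. f w * h (permute_list p w)) (permute_list (Hilbert_Choice.inv p) w)"
      by (simp add: place_perm_def)
  qed
  also have "\<dots> = (\<Sum>w | length w = t. f w * h (permute_list p w))"
    by (rule sum.reindex_bij_betw[OF bij_permute_words[OF q], of "\<lambda>w. f w * h (permute_list p w)"])
  finally show ?thesis by (simp add: word_form_def place_perm_def)
qed

subsection \<open>Inserting and contracting determinants\<close>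

definition insert_dets :: "nat \<Rightarrow> (2 list \<Rightarrow> 'k::field) \<Rightarrow> 2 list \<Rightarrow> 'k"
  where "insert_dets n = (tensor_mult lie_square ^^ n)"

definition contract_dets :: "nat \<Rightarrow> (2 list \<Rightarrow> 'k::field) \<Rightarrow> 2 list \<Rightarrow> 'k"
  where "contract_dets n = (contract ^^ n)"

lemma insert_det_hom: "rep_hom GL2 (det_tensor m (Suc k)) (det_tensor (m + 2) k) (tensor_mult lie_square)"
proof (rule rep_homI)
  show "tensor_mult lie_square v \<in> vecs (det_tensor (m + 2) k)" if "v \<in> vecs (det_tensor m (Suc k))" for v
    using tensor_mult_power[OF lie_square_power, of v m] that by (simp add: add.commute)
qed (simp_all add: tensor_mult_add_right tensor_mult_scale_right tensor_act_tensor_mult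
    tensor_act_lie_square tensor_mult_scale_left mult.commute)

lemma contract_hom: "rep_hom GL2 (det_tensor (m + 2) k) (det_tensor m (Suc k)) contract"
proof (rule rep_homI)
  show "contract v \<in> vecs (det_tensor m (Suc k))" if "v \<in> vecs (det_tensor (m + 2) k)" for v
    using contract_power[of v m] that by simp
qed (simp_all add: contract_add contract_scale contract_tensor_act mult.commute)

lemma insert_dets_hom: "rep_hom GL2 (det_tensor m (n + k)) (det_tensor (m + 2 * n) k) (insert_dets n)"
proof (induction n arbitrary: k)
  case 0 show ?case by (rule rep_homI) (simp_all add: insert_dets_def)
next
  case (Suc n)
  have "rep_hom GL2 (det_tensor m (n + Suc k) :: ('a ^ 2 ^ 2, 'a, 2 list) rep) (det_tensor (m + 2 * n + 2) k)
      (\<lambda>v. tensor_mult lie_square (insert_dets n v))"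
    by (rule rep_hom_comp[OF Suc.IH insert_det_hom])
  then show ?case by (simp add: insert_dets_def)
qed

lemma contract_dets_hom: "rep_hom GL2 (det_tensor (m + 2 * n) k) (det_tensor m (n + k)) (contract_dets n)"
proof (induction n arbitrary: k)
  case 0 show ?case by (rule rep_homI) (simp_all add: contract_dets_def)
next
  case (Suc n)
  have "rep_hom GL2 (det_tensor (m + 2 * n + 2) k :: ('a ^ 2 ^ 2, 'a, 2 list) rep) (det_tensor m (n + Suc k))
      (\<lambda>v. contract_dets n (contract v))"
    by (rule rep_hom_comp[OF contract_hom Suc.IH])
  then show ?case by (simp add: contract_dets_def funpow_swap1)
qed

lemma tensor_mult_lie_square: "tensor_mult lie_square h (a # b # w) = lie_square [a, b] * h w"
  using tensor_mult_homogeneous[of lie_square "[a, b]" h w] lie_square_power by (simp add: numeral_2_eq_2)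

lemma word_form_contract: "word_form (t + 2) (tensor_mult lie_square f) h = word_form t f (contract h)"
proof -
  have "word_form (t + 2) (tensor_mult lie_square f) h
      = (\<Sum>a\<in>UNIV. \<Sum>b\<in>UNIV. \<Sum>w | length w = t. lie_square [a, b] * f w * h (a # b # w))"
    by (simp add: word_form_def sum_words_Suc tensor_mult_lie_square)
  also have "\<dots> = (\<Sum>w | length w = t. f w * contract h w)"
    unfolding sum_2 lie_square_eq
    by (simp add: fun_simps contract_def sum_negf sum_subtractf right_diff_distrib)
  finally show ?thesis by (simp add: word_form_def)
qed

lemma word_form_contract_dets: "word_form (t + 2 * n) (insert_dets n f) h = word_form t f (contract_dets n h)"
proof (induction n arbitrary: h)
  case (Suc n)
  have "word_form (t + 2 * Suc n) (insert_dets (Suc n) f) h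
      = word_form (t + 2 * n + 2) (tensor_mult lie_square (insert_dets n f)) h"
    by (simp add: insert_dets_def)
  also have "\<dots> = word_form t f (contract_dets (Suc n) h)"
    unfolding word_form_contract Suc.IH by (simp add: contract_dets_def funpow_swap1)
  finally show ?case .
qed (simp add: insert_dets_def contract_dets_def)

subsection \<open>Polytabloids as highest weight vectors\<close>

lemma young_diagram_two_rows:
  "(i, j) \<in> young_diagram [n1, n2] \<longleftrightarrow> (i = 0 \<and> j < n1) \<or> (i = 1 \<and> j < n2)"
  by (auto simp: young_diagram_def less_Suc_eq)

text \<open>The places of a word are matched with the cells of the diagram: the columns of length two first, each
  as a pair of consecutive places, then the rest of the first row.\<close>

definition word_of_cells :: "nat \<Rightarrow> nat \<Rightarrow> nat \<times> nat"
  where "word_of_cells n2 i = (if i < 2 * n2 then (i mod 2, i div 2) else (0, i - n2))"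

lemma word_of_cells_bij:
  assumes "n2 \<le> n1"
  shows "bij_betw (word_of_cells n2) {..<n1 + n2} (young_diagram [n1, n2])"
proof (rule bij_betw_byWitness[where f' = "\<lambda>(a, c). if c < n2 then 2 * c + a else c + n2"])
  show "\<forall>i\<in>{..<n1 + n2}. (case word_of_cells n2 i of (a, c) \<Rightarrow> if c < n2 then 2 * c + a else c + n2) = i"
    by (auto simp: word_of_cells_def)
  show "\<forall>c\<in>young_diagram [n1, n2].
      word_of_cells n2 (case c of (a, c) \<Rightarrow> if c < n2 then 2 * c + a else c + n2) = c"
    using assms by (auto simp: word_of_cells_def young_diagram_two_rows)
  show "word_of_cells n2 ` {..<n1 + n2} \<subseteq> young_diagram [n1, n2]"
    using assms by (auto simp: word_of_cells_def young_diagram_two_rows)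
  show "(\<lambda>(a, c). if c < n2 then 2 * c + a else c + n2) ` young_diagram [n1, n2] \<subseteq> {..<n1 + n2}"
    using assms by (auto simp: young_diagram_two_rows)
qed

definition tableau_entry :: "nat \<Rightarrow> nat \<Rightarrow> (nat \<Rightarrow> nat \<times> nat) \<Rightarrow> nat \<times> nat \<Rightarrow> nat"
  where "tableau_entry n1 n2 \<tau> c = inv_into {1..n1 + n2} \<tau> c"

definition tableau_perm :: "nat \<Rightarrow> nat \<Rightarrow> (nat \<Rightarrow> nat \<times> nat) \<Rightarrow> nat \<Rightarrow> nat"
  where "tableau_perm n1 n2 \<tau> i =
    (if i < n1 + n2 then tableau_entry n1 n2 \<tau> (word_of_cells n2 i) - 1 else i)"

lemma tableau_bij: "\<tau> \<in> tableaux [n1, n2] \<longleftrightarrow> bij_betw \<tau> {1..n1 + n2} (young_diagram [n1, n2])"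
  by (simp add: tableaux_def)

lemma tableau_entry:
  assumes "\<tau> \<in> tableaux [n1, n2]"
  shows "c \<in> young_diagram [n1, n2] \<Longrightarrow> \<tau> (tableau_entry n1 n2 \<tau> c) = c"
    and "c \<in> young_diagram [n1, n2] \<Longrightarrow> tableau_entry n1 n2 \<tau> c \<in> {1..n1 + n2}"
    and "x \<in> {1..n1 + n2} \<Longrightarrow> tableau_entry n1 n2 \<tau> (\<tau> x) = x"
    and "x \<in> {1..n1 + n2} \<Longrightarrow> \<tau> x \<in> young_diagram [n1, n2]"
proof -
  have b: "bij_betw \<tau> {1..n1 + n2} (young_diagram [n1, n2])" using assms by (simp add: tableau_bij)
  show "c \<in> young_diagram [n1, n2] \<Longrightarrow> \<tau> (tableau_entry n1 n2 \<tau> c) = c"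
    unfolding tableau_entry_def by (rule bij_betw_inv_into_right[OF b])
  show "c \<in> young_diagram [n1, n2] \<Longrightarrow> tableau_entry n1 n2 \<tau> c \<in> {1..n1 + n2}"
    unfolding tableau_entry_def using bij_betw_apply[OF bij_betw_inv_into[OF b]] .
  show "x \<in> {1..n1 + n2} \<Longrightarrow> tableau_entry n1 n2 \<tau> (\<tau> x) = x"
    unfolding tableau_entry_def by (rule bij_betw_inv_into_left[OF b])
  show "x \<in> {1..n1 + n2} \<Longrightarrow> \<tau> x \<in> young_diagram [n1, n2]" using bij_betw_apply[OF b] .
qed

lemma tableau_perm_permutes:
  assumes \<tau>: "\<tau> \<in> tableaux [n1, n2]" and le: "n2 \<le> n1"
  shows "tableau_perm n1 n2 \<tau> permutes {..<n1 + n2}"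
proof (rule bij_imp_permutes)
  have b: "bij_betw \<tau> {1..n1 + n2} (young_diagram [n1, n2])" using \<tau> by (simp add: tableau_bij)
  have "bij_betw (\<lambda>i. tableau_entry n1 n2 \<tau> (word_of_cells n2 i)) {..<n1 + n2} {1..n1 + n2}"
    using bij_betw_trans[OF word_of_cells_bij[OF le] bij_betw_inv_into[OF b]]
    by (simp add: o_def tableau_entry_def)
  moreover have "bij_betw (\<lambda>x. x - 1) {1..n1 + n2} {..<n1 + n2}"
    by (rule bij_betw_byWitness[where f' = Suc]) auto
  ultimately have "bij_betw (\<lambda>i. tableau_entry n1 n2 \<tau> (word_of_cells n2 i) - 1) {..<n1 + n2} {..<n1 + n2}"
    using bij_betw_trans by (fastforce simp: o_def)
  then show "bij_betw (tableau_perm n1 n2 \<tau>) {..<n1 + n2} {..<n1 + n2}"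
    by (rule bij_betw_cong[THEN iffD1, rotated]) (simp add: tableau_perm_def)
qed (simp add: tableau_perm_def)

text \<open>The row of the entry \<open>x\<close> is recorded by the letter at the place \<open>x - 1\<close>.\<close>

definition tabloid_of_word :: "2 list \<Rightarrow> nat \<Rightarrow> nat"
  where "tabloid_of_word w = restrict (\<lambda>x. if w ! (x - 1) = 1 then 0 else 1) {1..length w}"

text \<open>The words that occur in the highest weight vector made from \<open>\<tau>\<close>: the two entries of a column carry
  different letters, and the remaining entries carry the letter \<open>1\<close>.\<close>

definition column_word :: "nat \<Rightarrow> nat \<Rightarrow> (nat \<Rightarrow> nat \<times> nat) \<Rightarrow> 2 list \<Rightarrow> bool"
  where "column_word n1 n2 \<tau> w \<longleftrightarrow>
    (\<forall>c<n2. w ! (tableau_entry n1 n2 \<tau> (0, c) - 1) \<noteq> w ! (tableau_entry n1 n2 \<tau> (1, c) - 1)) \<and>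
    (\<forall>c. n2 \<le> c \<longrightarrow> c < n1 \<longrightarrow> w ! (tableau_entry n1 n2 \<tau> (0, c) - 1) = 1)"

lemma column_word_iff:
  assumes \<tau>: "\<tau> \<in> tableaux [n1, n2]" and le: "n2 \<le> n1" and len: "length w = n1 + n2"
  shows "(\<exists>\<sigma>\<in>column_stabilizer [n1, n2] \<tau>. tabloid [n1, n2] (\<tau> \<circ> Hilbert_Choice.inv \<sigma>) = tabloid_of_word w)
    \<longleftrightarrow> column_word n1 n2 \<tau> w"
proof
  note T = tableau_entry[OF \<tau>]
  assume "\<exists>\<sigma>\<in>column_stabilizer [n1, n2] \<tau>. tabloid [n1, n2] (\<tau> \<circ> Hilbert_Choice.inv \<sigma>) = tabloid_of_word w"
  then obtain \<sigma> where \<sigma>: "\<sigma> permutes {1..n1 + n2}" "\<forall>x\<in>{1..n1 + n2}. snd (\<tau> (\<sigma> x)) = snd (\<tau> x)"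
    and tab: "tabloid [n1, n2] (\<tau> \<circ> Hilbert_Choice.inv \<sigma>) = tabloid_of_word w" by (auto simp: column_stabilizer_def)
  have q: "Hilbert_Choice.inv \<sigma> permutes {1..n1 + n2}" using \<sigma>(1) by (rule permutes_inv)
  have mem: "Hilbert_Choice.inv \<sigma> x \<in> {1..n1 + n2}" if "x \<in> {1..n1 + n2}" for x
    using permutes_in_image[OF q] that by simp
  have col: "snd (\<tau> (Hilbert_Choice.inv \<sigma> x)) = snd (\<tau> x)" if "x \<in> {1..n1 + n2}" for x
    using \<sigma>(2)[rule_format, OF mem[OF that]] permutes_inverses(1)[OF \<sigma>(1)] by simp
  have row: "fst (\<tau> (Hilbert_Choice.inv \<sigma> x)) = (if w ! (x - 1) = 1 then 0 else 1)" if "x \<in> {1..n1 + n2}" for x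
    using fun_cong[OF tab, of x] that len by (simp add: tabloid_def tabloid_of_word_def)
  show "column_word n1 n2 \<tau> w"
    unfolding column_word_def
  proof (intro conjI allI impI)
    fix c assume c: "c < n2"
    define x y where "x = tableau_entry n1 n2 \<tau> (0, c)" and "y = tableau_entry n1 n2 \<tau> (1, c)"
    have d: "(0, c) \<in> young_diagram [n1, n2]" "(1, c) \<in> young_diagram [n1, n2]"
      using c le by (auto simp: young_diagram_two_rows)
    have xy: "x \<in> {1..n1 + n2}" "y \<in> {1..n1 + n2}" "\<tau> x = (0, c)" "\<tau> y = (1, c)"
      using T(1,2)[OF d(1)] T(1,2)[OF d(2)] by (auto simp: x_def y_def)
    have "x \<noteq> y" using xy by auto
    then have "Hilbert_Choice.inv \<sigma> x \<noteq> Hilbert_Choice.inv \<sigma> y" using permutes_inj[OF q] by (auto dest: injD)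
    then have "\<tau> (Hilbert_Choice.inv \<sigma> x) \<noteq> \<tau> (Hilbert_Choice.inv \<sigma> y)" using T(3)[OF mem[OF xy(1)]] T(3)[OF mem[OF xy(2)]] by metis
    moreover have "snd (\<tau> (Hilbert_Choice.inv \<sigma> x)) = snd (\<tau> (Hilbert_Choice.inv \<sigma> y))" using col xy by simp
    ultimately have "fst (\<tau> (Hilbert_Choice.inv \<sigma> x)) \<noteq> fst (\<tau> (Hilbert_Choice.inv \<sigma> y))" by (auto simp: prod_eq_iff)
    then show "w ! (x - 1) \<noteq> w ! (y - 1)" using row[OF xy(1)] row[OF xy(2)] by auto
  next
    fix c assume c: "n2 \<le> c" "c < n1"
    define x where "x = tableau_entry n1 n2 \<tau> (0, c)"
    have d: "(0, c) \<in> young_diagram [n1, n2]" using c by (auto simp: young_diagram_two_rows)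
    have x: "x \<in> {1..n1 + n2}" "\<tau> x = (0, c)" using T(1,2)[OF d] by (auto simp: x_def)
    have "\<tau> (Hilbert_Choice.inv \<sigma> x) \<in> young_diagram [n1, n2]" by (rule T(4)[OF mem[OF x(1)]])
    moreover have "snd (\<tau> (Hilbert_Choice.inv \<sigma> x)) = c" using col x by simp
    ultimately have "fst (\<tau> (Hilbert_Choice.inv \<sigma> x)) = 0"
      using c young_diagram_two_rows[of "fst (\<tau> (Hilbert_Choice.inv \<sigma> x))" "snd (\<tau> (Hilbert_Choice.inv \<sigma> x))" n1 n2] by auto
    then show "w ! (x - 1) = 1" using row[OF x(1)] by (auto split: if_splits)
  qed
next
  note T = tableau_entry[OF \<tau>]
  assume cw: "column_word n1 n2 \<tau> w"
  define \<rho> where "\<rho> x = (if w ! (x - 1) = 1 then 0 else 1 :: nat)" for x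
  have cell: "(\<rho> x, snd (\<tau> x)) \<in> young_diagram [n1, n2]" if x: "x \<in> {1..n1 + n2}" for x
  proof (cases "snd (\<tau> x) < n2")
    case True then show ?thesis using le by (auto simp: young_diagram_two_rows \<rho>_def)
  next
    case False
    have "\<tau> x \<in> young_diagram [n1, n2]" by (rule T(4)[OF x])
    then have t: "\<tau> x = (0, snd (\<tau> x))" "snd (\<tau> x) < n1"
      using False young_diagram_two_rows[of "fst (\<tau> x)" "snd (\<tau> x)" n1 n2] by (auto simp: prod_eq_iff)
    then have "tableau_entry n1 n2 \<tau> (0, snd (\<tau> x)) = x" using T(3)[OF x] by metis
    then have "w ! (x - 1) = 1" using cw False t(2) unfolding column_word_def by (metis not_less)
    then show ?thesis unfolding young_diagram_two_rows using t(2) by (simp add: \<rho>_def)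
  qed
  define \<theta> where "\<theta> x = (if x \<in> {1..n1 + n2} then tableau_entry n1 n2 \<tau> (\<rho> x, snd (\<tau> x)) else x)" for x
  have \<theta>mem: "\<theta> x \<in> {1..n1 + n2}" if "x \<in> {1..n1 + n2}" for x
    using T(2)[OF cell[OF that]] that by (simp add: \<theta>_def)
  have \<theta>\<tau>: "\<tau> (\<theta> x) = (\<rho> x, snd (\<tau> x))" if "x \<in> {1..n1 + n2}" for x
    using T(1)[OF cell[OF that]] that by (simp add: \<theta>_def)
  have "inj_on \<theta> {1..n1 + n2}"
  proof
    fix x y assume x: "x \<in> {1..n1 + n2}" and y: "y \<in> {1..n1 + n2}" and eq: "\<theta> x = \<theta> y"
    have r: "\<rho> x = \<rho> y" and c: "snd (\<tau> x) = snd (\<tau> y)" using \<theta>\<tau>[OF x] \<theta>\<tau>[OF y] eq by auto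
    show "x = y"
    proof (rule ccontr)
      assume "x \<noteq> y"
      then have "\<tau> x \<noteq> \<tau> y" using T(3)[OF x] T(3)[OF y] by metis
      then have f: "fst (\<tau> x) \<noteq> fst (\<tau> y)" using c by (auto simp: prod_eq_iff)
      define d where "d = snd (\<tau> x)"
      have "(fst (\<tau> x), d) \<in> young_diagram [n1, n2]" "(fst (\<tau> y), d) \<in> young_diagram [n1, n2]"
      proof -
        have "(fst (\<tau> x), d) = \<tau> x" "(fst (\<tau> y), d) = \<tau> y" using c by (auto simp: d_def prod_eq_iff)
        with T(4)[OF x] T(4)[OF y]
        show "(fst (\<tau> x), d) \<in> young_diagram [n1, n2]" "(fst (\<tau> y), d) \<in> young_diagram [n1, n2]"
          by (simp_all only:)
      qed
      then have "d < n2" "(fst (\<tau> x) = 0 \<and> fst (\<tau> y) = 1) \<or> (fst (\<tau> x) = 1 \<and> fst (\<tau> y) = 0)"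
        using f by (auto simp: young_diagram_two_rows)
      then have "d < n2" "(\<tau> x = (0, d) \<and> \<tau> y = (1, d)) \<or> (\<tau> x = (1, d) \<and> \<tau> y = (0, d))"
        using c by (auto simp: prod_eq_iff d_def)
      then have "w ! (x - 1) \<noteq> w ! (y - 1)"
        using cw T(3)[OF x] T(3)[OF y] unfolding column_word_def by metis
      then show False using r exhaust_2[of "w ! (x - 1)"] exhaust_2[of "w ! (y - 1)"]
        by (auto simp: \<rho>_def split: if_splits)
    qed
  qed
  moreover have "\<theta> ` {1..n1 + n2} \<subseteq> {1..n1 + n2}" using \<theta>mem by blast
  ultimately have "bij_betw \<theta> {1..n1 + n2} {1..n1 + n2}"
    unfolding bij_betw_def by (meson endo_inj_surj finite_atLeastAtMost)
  then have perm: "\<theta> permutes {1..n1 + n2}"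
    by (rule bij_imp_permutes) (unfold \<theta>_def, rule if_not_P)
  have ii: "Hilbert_Choice.inv (Hilbert_Choice.inv \<theta>) = \<theta>" by (rule permutes_inv_inv[OF perm])
  have "Hilbert_Choice.inv \<theta> \<in> column_stabilizer [n1, n2] \<tau>"
    unfolding column_stabilizer_def
  proof (intro CollectI conjI ballI)
    show "Hilbert_Choice.inv \<theta> permutes {1..sum_list [n1, n2]}" using permutes_inv[OF perm] by simp
    fix x assume x: "x \<in> {1..sum_list [n1, n2]}"
    then have m: "Hilbert_Choice.inv \<theta> x \<in> {1..n1 + n2}" using permutes_in_image[OF permutes_inv[OF perm]] by simp
    have "snd (\<tau> (\<theta> (Hilbert_Choice.inv \<theta> x))) = snd (\<tau> (Hilbert_Choice.inv \<theta> x))" using \<theta>\<tau>[OF m] by simp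
    then show "snd (\<tau> (Hilbert_Choice.inv \<theta> x)) = snd (\<tau> x)" using permutes_inverses(1)[OF perm] by simp
  qed
  moreover have "tabloid [n1, n2] (\<tau> \<circ> Hilbert_Choice.inv (Hilbert_Choice.inv \<theta>)) = tabloid_of_word w"
  proof
    fix x
    show "tabloid [n1, n2] (\<tau> \<circ> Hilbert_Choice.inv (Hilbert_Choice.inv \<theta>)) x = tabloid_of_word w x"
      using \<theta>\<tau>[of x] len
      by (cases "x \<in> {1..n1 + n2}") (auto simp: ii tabloid_def tabloid_of_word_def \<rho>_def)
  qed
  ultimately show "\<exists>\<sigma>\<in>column_stabilizer [n1, n2] \<tau>. tabloid [n1, n2] (\<tau> \<circ> Hilbert_Choice.inv \<sigma>) = tabloid_of_word w"
    by blast
qed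

text \<open>A column has at most two entries, so a permutation of the columns is known once the row of every entry
  is known.\<close>

lemma column_stabilizer_tabloid_inj:
  assumes \<tau>: "\<tau> \<in> tableaux [n1, n2]"
    and \<sigma>: "\<sigma> \<in> column_stabilizer [n1, n2] \<tau>" "\<sigma>' \<in> column_stabilizer [n1, n2] \<tau>"
    and eq: "tabloid [n1, n2] (\<tau> \<circ> Hilbert_Choice.inv \<sigma>) = tabloid [n1, n2] (\<tau> \<circ> Hilbert_Choice.inv \<sigma>')"
  shows "\<sigma> = \<sigma>'"
proof -
  note T = tableau_entry[OF \<tau>]
  have p: "\<sigma> permutes {1..n1 + n2}" "\<sigma>' permutes {1..n1 + n2}" using \<sigma> by (auto simp: column_stabilizer_def)
  have col: "snd (\<tau> (Hilbert_Choice.inv s x)) = snd (\<tau> x)"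
    if "x \<in> {1..n1 + n2}" "s \<in> column_stabilizer [n1, n2] \<tau>" for x s
  proof -
    have s: "s permutes {1..n1 + n2}" "\<forall>x\<in>{1..n1 + n2}. snd (\<tau> (s x)) = snd (\<tau> x)"
      using that(2) by (auto simp: column_stabilizer_def)
    have "Hilbert_Choice.inv s x \<in> {1..n1 + n2}" using permutes_in_image[OF permutes_inv[OF s(1)]] that(1) by simp
    then show ?thesis using s(2) permutes_inverses(1)[OF s(1)] by metis
  qed
  have "Hilbert_Choice.inv \<sigma> x = Hilbert_Choice.inv \<sigma>' x" for x
  proof (cases "x \<in> {1..n1 + n2}")
    case True
    have m: "Hilbert_Choice.inv \<sigma> x \<in> {1..n1 + n2}" "Hilbert_Choice.inv \<sigma>' x \<in> {1..n1 + n2}"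
      using permutes_in_image[OF permutes_inv[OF p(1)]] permutes_in_image[OF permutes_inv[OF p(2)]] True by auto
    have "fst (\<tau> (Hilbert_Choice.inv \<sigma> x)) = fst (\<tau> (Hilbert_Choice.inv \<sigma>' x))"
      using fun_cong[OF eq, of x] True by (simp add: tabloid_def)
    moreover have "snd (\<tau> (Hilbert_Choice.inv \<sigma> x)) = snd (\<tau> (Hilbert_Choice.inv \<sigma>' x))" using col True \<sigma> by simp
    ultimately have "\<tau> (Hilbert_Choice.inv \<sigma> x) = \<tau> (Hilbert_Choice.inv \<sigma>' x)" by (rule prod_eqI)
    then show ?thesis using T(3)[OF m(1)] T(3)[OF m(2)] by metis
  next
    case False
    then show ?thesis using permutes_not_in[OF permutes_inv[OF p(1)]] permutes_not_in[OF permutes_inv[OF p(2)]] by simp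
  qed
  then have "Hilbert_Choice.inv \<sigma> = Hilbert_Choice.inv \<sigma>'" by (rule ext)
  then show ?thesis using permutes_inv_inv[OF p(1)] permutes_inv_inv[OF p(2)] by metis
qed

context
  assumes char2: "CHAR('k::field) = 2"
begin

lemma polytabloid_char_two:
  assumes \<tau>: "\<tau> \<in> tableaux [n1, n2]"
  shows "(polytabloid [n1, n2] \<tau> \<rho> :: 'k) =
    (if \<exists>\<sigma>\<in>column_stabilizer [n1, n2] \<tau>. tabloid [n1, n2] (\<tau> \<circ> Hilbert_Choice.inv \<sigma>) = \<rho> then 1 else 0)"
proof -
  let ?C = "column_stabilizer [n1, n2] \<tau>"
  have fin: "finite ?C"
  proof (rule finite_subset)
    show "?C \<subseteq> {\<sigma>. \<sigma> permutes {1..n1 + n2}}" by (auto simp: column_stabilizer_def)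
  qed (rule finite_permutations, simp)
  have sgn: "of_int (sign \<sigma>) = (1 :: 'k)" for \<sigma> :: "nat \<Rightarrow> nat"
    using minus_eq_self[OF char2, of 1] by (cases "sign \<sigma> = 1") (auto simp: sign_def)
  have s: "polytabloid [n1, n2] \<tau> \<rho> = (\<Sum>\<sigma>\<in>?C. if tabloid [n1, n2] (\<tau> \<circ> Hilbert_Choice.inv \<sigma>) = \<rho> then 1 else 0 :: 'k)"
    by (simp add: polytabloid_def sgn)
  show ?thesis
  proof (cases "\<exists>\<sigma>\<in>?C. tabloid [n1, n2] (\<tau> \<circ> Hilbert_Choice.inv \<sigma>) = \<rho>")
    case True
    then obtain \<sigma> where \<sigma>: "\<sigma> \<in> ?C" "tabloid [n1, n2] (\<tau> \<circ> Hilbert_Choice.inv \<sigma>) = \<rho>" by blast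
    have "polytabloid [n1, n2] \<tau> \<rho> = (\<Sum>\<sigma>'\<in>?C. if \<sigma>' = \<sigma> then 1 else 0 :: 'k)"
      unfolding s
    proof (rule sum.cong[OF refl])
      fix \<sigma>' assume \<sigma>': "\<sigma>' \<in> ?C"
      show "(if tabloid [n1, n2] (\<tau> \<circ> Hilbert_Choice.inv \<sigma>') = \<rho> then 1 else 0) = (if \<sigma>' = \<sigma> then 1 else 0 :: 'k)"
      proof (cases "\<sigma>' = \<sigma>")
        case False
        then have "tabloid [n1, n2] (\<tau> \<circ> Hilbert_Choice.inv \<sigma>') \<noteq> \<rho>"
          using column_stabilizer_tabloid_inj[OF \<tau> \<sigma>' \<sigma>(1)] \<sigma>(2) by metis
        with False show ?thesis by (simp only: if_False)
      qed (simp add: \<sigma>(2))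
    qed
    also have "\<dots> = 1" using fin \<sigma>(1) by simp
    finally show ?thesis unfolding if_P[OF True] .
  next
    case False
    then have "polytabloid [n1, n2] \<tau> \<rho> = (\<Sum>\<sigma>'\<in>?C. 0 :: 'k)" unfolding s by (intro sum.cong refl) auto
    then show ?thesis unfolding if_not_P[OF False] by simp
  qed
qed

lemma insert_dets_delta:
  assumes "length v = 2 * n + m"
  shows "(insert_dets n (delta (replicate m 1)) v :: 'k) =
    (if (\<forall>c<n. v ! (2 * c) \<noteq> v ! (2 * c + 1)) \<and> (\<forall>i. 2 * n \<le> i \<longrightarrow> i < 2 * n + m \<longrightarrow> v ! i = 1) then 1 else 0)"
  using assms
proof (induction n arbitrary: v)
  case 0
  then have "v = replicate m 1 \<longleftrightarrow> (\<forall>i<m. v ! i = 1)" by (auto simp: list_eq_iff_nth_eq)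
  then show ?case by (simp add: insert_dets_def delta_def)
next
  case (Suc n)
  then obtain a b v' where v: "v = a # b # v'" by (cases v; cases "tl v") auto
  have A: "lie_square [a, b] = (if a \<noteq> b then 1 else 0 :: 'k)"
    using exhaust_2[of a] exhaust_2[of b] minus_eq_self[OF char2, of 1] by (auto simp: lie_square_eq fun_simps)
  have 1: "(\<forall>c<Suc n. v ! (2 * c) \<noteq> v ! (2 * c + 1)) \<longleftrightarrow> a \<noteq> b \<and> (\<forall>c<n. v' ! (2 * c) \<noteq> v' ! (2 * c + 1))"
    unfolding v All_less_Suc2 by simp
  have 2: "(\<forall>i. 2 * Suc n \<le> i \<longrightarrow> i < 2 * Suc n + m \<longrightarrow> v ! i = 1)
      \<longleftrightarrow> (\<forall>i. 2 * n \<le> i \<longrightarrow> i < 2 * n + m \<longrightarrow> v' ! i = 1)" (is "?L \<longleftrightarrow> ?R")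
  proof
    assume L: ?L
    show ?R
    proof (intro allI impI)
      fix i assume "2 * n \<le> i" "i < 2 * n + m"
      then have "v ! Suc (Suc i) = 1" by (intro L[rule_format]) simp_all
      then show "v' ! i = 1" by (simp add: v)
    qed
  next
    assume R: ?R
    show ?L
    proof (intro allI impI)
      fix i assume i: "2 * Suc n \<le> i" "i < 2 * Suc n + m"
      define j where "j = i - 2"
      have j: "i = Suc (Suc j)" "2 * n \<le> j" "j < 2 * n + m" using i by (simp_all add: j_def)
      have "v' ! j = 1" by (rule R[rule_format, OF j(2,3)])
      then show "v ! i = 1" by (simp add: v j(1))
    qed
  qed
  have "insert_dets (Suc n) (delta (replicate m 1)) v
      = lie_square [a, b] * (insert_dets n (delta (replicate m 1)) v' :: 'k)"
    by (simp add: insert_dets_def v tensor_mult_lie_square)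
  then show ?case unfolding 1 2 using Suc.IH[of v'] Suc.prems by (simp add: A v)
qed

text \<open>One determinant for each column of length two, placed at the entries of that column.\<close>

definition specht_hom :: "nat \<Rightarrow> nat \<Rightarrow> (nat \<Rightarrow> nat \<times> nat) \<Rightarrow> (2 list \<Rightarrow> 'k) \<Rightarrow> 2 list \<Rightarrow> 'k"
  where "specht_hom n1 n2 \<tau> f = place_perm (tableau_perm n1 n2 \<tau>) (insert_dets n2 f)"

definition specht_cohom :: "nat \<Rightarrow> nat \<Rightarrow> (nat \<Rightarrow> nat \<times> nat) \<Rightarrow> (2 list \<Rightarrow> 'k) \<Rightarrow> 2 list \<Rightarrow> 'k"
  where "specht_cohom n1 n2 \<tau> f = contract_dets n2 (place_perm (Hilbert_Choice.inv (tableau_perm n1 n2 \<tau>)) f)"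

lemma specht_hom_hom:
  assumes "\<tau> \<in> tableaux [n1, n2]" and le: "n2 \<le> n1"
  shows "rep_hom GL2 (det_tensor (n1 - n2) (n2 + k)) (det_tensor (n1 + n2) k) (specht_hom n1 n2 \<tau>)"
    and "rep_hom GL2 (det_tensor (n1 + n2) k) (det_tensor (n1 - n2) (n2 + k)) (specht_cohom n1 n2 \<tau>)"
proof -
  have t: "n1 - n2 + 2 * n2 = n1 + n2" using le by simp
  note p = tableau_perm_permutes[OF assms]
  show "rep_hom GL2 (det_tensor (n1 - n2) (n2 + k)) (det_tensor (n1 + n2) k) (specht_hom n1 n2 \<tau>)"
    unfolding specht_hom_def
    by (rule rep_hom_comp[OF insert_dets_hom[of "n1 - n2" n2 k, unfolded t] place_perm_hom[OF p]])
  show "rep_hom GL2 (det_tensor (n1 + n2) k) (det_tensor (n1 - n2) (n2 + k)) (specht_cohom n1 n2 \<tau>)"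
    unfolding specht_cohom_def
    by (rule rep_hom_comp[OF place_perm_hom[OF permutes_inv[OF p]] contract_dets_hom[of "n1 - n2" n2 k, unfolded t]])
qed

lemma specht_cohom_apply:
  assumes "\<tau> \<in> tableaux [n1, n2]" and le: "n2 \<le> n1"
  shows "specht_cohom n1 n2 \<tau> h (replicate (n1 - n2) 1)
    = word_form (n1 + n2) (specht_hom n1 n2 \<tau> (delta (replicate (n1 - n2) 1))) h"
proof -
  have t: "n1 - n2 + 2 * n2 = n1 + n2" using le by simp
  note p = tableau_perm_permutes[OF assms]
  let ?p = "tableau_perm n1 n2 \<tau>" and ?d = "delta (replicate (n1 - n2) 1) :: 2 list \<Rightarrow> 'k"
  have "specht_cohom n1 n2 \<tau> h (replicate (n1 - n2) 1)
      = word_form (n1 - n2) ?d (contract_dets n2 (place_perm (Hilbert_Choice.inv ?p) h))"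
    by (simp add: word_form_delta specht_cohom_def)
  also have "\<dots> = word_form (n1 + n2) (insert_dets n2 ?d) (place_perm (Hilbert_Choice.inv ?p) h)"
    by (rule word_form_contract_dets[of "n1 - n2" n2, unfolded t, symmetric])
  also have "\<dots> = word_form (n1 + n2) (place_perm (Hilbert_Choice.inv (Hilbert_Choice.inv ?p)) (insert_dets n2 ?d)) h"
    by (rule word_form_place_perm[OF permutes_inv[OF p]])
  finally show ?thesis by (simp add: permutes_inv_inv[OF p] specht_hom_def)
qed

lemma specht_hom_highest:
  assumes \<tau>: "\<tau> \<in> tableaux [n1, n2]" and le: "n2 \<le> n1" and len: "length w = n1 + n2"
  shows "specht_hom n1 n2 \<tau> (delta (replicate (n1 - n2) 1)) w = (polytabloid [n1, n2] \<tau> (tabloid_of_word w) :: 'k)"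
proof -
  let ?p = "tableau_perm n1 n2 \<tau>"
  note p = tableau_perm_permutes[OF \<tau> le]
  have nth: "permute_list ?p w ! i = w ! (tableau_entry n1 n2 \<tau> (word_of_cells n2 i) - 1)" if "i < n1 + n2" for i
    using that p len by (simp add: permute_list_nth tableau_perm_def)
  have l: "length (permute_list ?p w) = 2 * n2 + (n1 - n2)" using le len by simp
  have "(\<forall>c<n2. permute_list ?p w ! (2 * c) \<noteq> permute_list ?p w ! (2 * c + 1)) \<longleftrightarrow>
      (\<forall>c<n2. w ! (tableau_entry n1 n2 \<tau> (0, c) - 1) \<noteq> w ! (tableau_entry n1 n2 \<tau> (1, c) - 1))"
  proof (intro all_cong)
    fix c assume c: "c < n2"
    have "permute_list ?p w ! (2 * c) = w ! (tableau_entry n1 n2 \<tau> (0, c) - 1)"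
      using nth[of "2 * c"] c le by (simp add: word_of_cells_def)
    moreover have "permute_list ?p w ! (2 * c + 1) = w ! (tableau_entry n1 n2 \<tau> (1, c) - 1)"
      using nth[of "2 * c + 1"] c le by (simp add: word_of_cells_def)
    ultimately show "(permute_list ?p w ! (2 * c) \<noteq> permute_list ?p w ! (2 * c + 1)) \<longleftrightarrow>
      w ! (tableau_entry n1 n2 \<tau> (0, c) - 1) \<noteq> w ! (tableau_entry n1 n2 \<tau> (1, c) - 1)" by simp
  qed
  moreover have "(\<forall>i. 2 * n2 \<le> i \<longrightarrow> i < 2 * n2 + (n1 - n2) \<longrightarrow> permute_list ?p w ! i = 1) \<longleftrightarrow>
      (\<forall>c. n2 \<le> c \<longrightarrow> c < n1 \<longrightarrow> w ! (tableau_entry n1 n2 \<tau> (0, c) - 1) = 1)" (is "?L \<longleftrightarrow> ?R")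
  proof
    assume L: ?L
    show ?R
    proof (intro allI impI)
      fix c assume "n2 \<le> c" "c < n1"
      then have "permute_list ?p w ! (c + n2) = 1" by (intro L[rule_format]) simp_all
      with nth[of "c + n2"] \<open>n2 \<le> c\<close> \<open>c < n1\<close>
      show "w ! (tableau_entry n1 n2 \<tau> (0, c) - 1) = 1" by (simp add: word_of_cells_def)
    qed
  next
    assume R: ?R
    show ?L
    proof (intro allI impI)
      fix i assume "2 * n2 \<le> i" "i < 2 * n2 + (n1 - n2)"
      then have "w ! (tableau_entry n1 n2 \<tau> (0, i - n2) - 1) = 1" by (intro R[rule_format]) simp_all
      with nth[of i] le \<open>2 * n2 \<le> i\<close> \<open>i < 2 * n2 + (n1 - n2)\<close>
      show "permute_list ?p w ! i = 1" by (simp add: word_of_cells_def)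
    qed
  qed
  ultimately have "specht_hom n1 n2 \<tau> (delta (replicate (n1 - n2) 1)) w
      = (if column_word n1 n2 \<tau> w then 1 else 0)"
    unfolding specht_hom_def place_perm_def insert_dets_delta[OF l] column_word_def by simp
  then show ?thesis
    unfolding polytabloid_char_two[OF \<tau>] column_word_iff[OF \<tau> le len] .
qed

lemma tabloid_form_words:
  assumes \<tau>: "\<tau> \<in> tableaux [n1, n2]" and le: "n2 \<le> n1"
  shows "tabloid_form [n1, n2] (polytabloid [n1, n2] \<tau>) u
    = word_form (n1 + n2) (specht_hom n1 n2 \<tau> (delta (replicate (n1 - n2) 1))) (\<lambda>w. u (tabloid_of_word w) :: 'k)"
proof -
  let ?W = "{w :: 2 list. length w = n1 + n2}"
  have inj: "inj_on tabloid_of_word ?W"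
  proof
    fix w v :: "2 list" assume w: "w \<in> ?W" and v: "v \<in> ?W" and eq: "tabloid_of_word w = tabloid_of_word v"
    show "w = v"
    proof (rule nth_equalityI)
      fix i assume "i < length w"
      then have "(if w ! i = 1 then 0 else 1 :: nat) = (if v ! i = 1 then 0 else 1)"
        using fun_cong[OF eq, of "Suc i"] w v by (simp add: tabloid_of_word_def)
      then show "w ! i = v ! i" using exhaust_2[of "w ! i"] exhaust_2[of "v ! i"] by (auto split: if_splits)
    qed (use w v in simp)
  qed
  have sub: "tabloid [n1, n2] ` tableaux [n1, n2] \<subseteq> tabloid_of_word ` ?W"
  proof safe
    fix t assume t: "t \<in> tableaux [n1, n2]"
    define w :: "2 list" where "w = map (\<lambda>i. if fst (t (Suc i)) = 0 then 1 else 2) [0..<n1 + n2]"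
    have row: "fst (t x) = 0 \<or> fst (t x) = 1" if "x \<in> {1..n1 + n2}" for x
      using tableau_entry(4)[OF t that] young_diagram_two_rows[of "fst (t x)" "snd (t x)" n1 n2] by auto
    have "tabloid [n1, n2] t = tabloid_of_word w"
    proof
      fix x show "tabloid [n1, n2] t x = tabloid_of_word w x"
        using row[of x]
        by (cases "x \<in> {1..n1 + n2}") (auto simp: tabloid_def tabloid_of_word_def w_def)
    qed
    then show "tabloid [n1, n2] t \<in> tabloid_of_word ` ?W" by (auto simp: w_def)
  qed
  have zero: "(polytabloid [n1, n2] \<tau> \<rho> :: 'k) = 0" if "\<rho> \<notin> tabloid [n1, n2] ` tableaux [n1, n2]" for \<rho>
  proof -
    have "\<tau> \<circ> Hilbert_Choice.inv \<sigma> \<in> tableaux [n1, n2]" if "\<sigma> \<in> column_stabilizer [n1, n2] \<tau>" for \<sigma>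
    proof -
      have "\<sigma> permutes {1..n1 + n2}" using that by (simp add: column_stabilizer_def)
      from bij_betw_trans[OF permutes_imp_bij[OF permutes_inv[OF this]], of \<tau>] \<tau>
      show ?thesis by (simp add: tableau_bij)
    qed
    then show ?thesis using that polytabloid_char_two[OF \<tau>, of \<rho>] by auto
  qed
  have "tabloid_form [n1, n2] (polytabloid [n1, n2] \<tau>) u
      = (\<Sum>\<rho>\<in>tabloid_of_word ` ?W. polytabloid [n1, n2] \<tau> \<rho> * u \<rho>)"
    unfolding tabloid_form_def
    by (rule sum.mono_neutral_left) (use sub zero in auto)
  also have "\<dots> = (\<Sum>w\<in>?W. polytabloid [n1, n2] \<tau> (tabloid_of_word w) * u (tabloid_of_word w))"
    by (simp add: sum.reindex[OF inj])
  also have "\<dots> = word_form (n1 + n2) (specht_hom n1 n2 \<tau> (delta (replicate (n1 - n2) 1))) (\<lambda>w. u (tabloid_of_word w))"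
    unfolding word_form_def
    by (rule sum.cong) (simp_all add: specht_hom_highest[OF \<tau> le])
  finally show ?thesis .
qed

text \<open>The transpose of inserting determinants is contracting them, so the form on words turns into James's
  form on polytabloids.\<close>

lemma specht_gram:
  assumes \<tau>: "\<tau> \<in> tableaux [n1, n2]" and \<tau>': "\<tau>' \<in> tableaux [n1, n2]" and le: "n2 \<le> n1"
  shows "specht_cohom n1 n2 \<tau> (specht_hom n1 n2 \<tau>' (delta (replicate (n1 - n2) 1))) (replicate (n1 - n2) 1)
    = tabloid_form [n1, n2] (polytabloid [n1, n2] \<tau>) (polytabloid [n1, n2] \<tau>' :: _ \<Rightarrow> 'k)"
  unfolding tabloid_form_words[OF \<tau> le] specht_cohom_apply[OF \<tau> le] word_form_def
  by (rule sum.cong) (simp_all add: specht_hom_highest[OF \<tau>' le])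

lemma specht_functional_linear: "linmap (specht_functional [n1, n2] :: ((nat \<Rightarrow> nat) \<Rightarrow> 'k) \<Rightarrow> _)"
  unfolding linmap_iff
  by (auto simp: specht_functional_def tabloid_form_def fun_eq_iff fun_simps distrib_right sum.distrib
      sum_distrib_left mult.assoc)

text \<open>The simple module \<open>D\<^sup>\<nu>\<close> is the multiplicity space that the form leaves over: its dimension is
  the rank of the pairing between maps into the tensor power and maps back.\<close>

lemma specht_homs_independent:
  assumes le: "n2 \<le> n1"
  shows "\<exists>F. (\<forall>j<dim_D TYPE('k) [n1, n2].
        rep_hom GL2 (det_tensor (n1 - n2) (n2 + k)) (det_tensor (n1 + n2) k) (F j)) \<and>
      (\<forall>\<alpha>. (\<exists>j<dim_D TYPE('k) [n1, n2]. \<alpha> j \<noteq> (0 :: 'k)) \<longrightarrow>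
        (\<exists>g. rep_hom GL2 (det_tensor (n1 + n2) k) (det_tensor (n1 - n2) (n2 + k)) g \<and>
          g (\<Sum>j<dim_D TYPE('k) [n1, n2]. fscale (\<alpha> j) (F j (delta (replicate (n1 - n2) 1))))
            (replicate (n1 - n2) 1) \<noteq> 0))"
proof -
  let ?\<nu> = "[n1, n2]" and ?d = "delta (replicate (n1 - n2) 1) :: 2 list \<Rightarrow> 'k"
  define d where "d = dim_D TYPE('k) ?\<nu>"
  define \<Phi> :: "((nat \<Rightarrow> nat) \<Rightarrow> 'k) \<Rightarrow> _" where "\<Phi> = specht_functional ?\<nu>"
  define S where "S = (polytabloid ?\<nu> ` tableaux ?\<nu> :: ((nat \<Rightarrow> nat) \<Rightarrow> 'k) set)"
  have \<Phi>: "linmap \<Phi>" unfolding \<Phi>_def by (rule specht_functional_linear)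
  have "\<Phi> ` fs.span S = fs.span (\<Phi> ` S)" using fsff.linear_span_image[OF \<Phi>, of S] by simp
  then have dim: "d = fs.dim (\<Phi> ` S)" by (simp add: d_def dim_D_def james_D_def specht_def \<Phi>_def S_def)
  obtain B where B: "B \<subseteq> \<Phi> ` S" "fs.independent B" "\<Phi> ` S \<subseteq> fs.span B" "card B = d"
    using fs.basis_exists[of "\<Phi> ` S"] dim by metis
  show ?thesis
  proof (cases "d = 0")
    case True
    then show ?thesis by (simp add: d_def[symmetric])
  next
    case False
    then have fin: "finite B" using B(4) by (metis card.infinite)
    from ex_bij_betw_nat_finite[OF fin] obtain b where "bij_betw b {0..<card B} B" ..
    then have b: "bij_betw b {..<d} B" using B(4) by (simp add: atLeast0LessThan)
    have "\<forall>j\<in>{..<d}. \<exists>\<tau>. \<tau> \<in> tableaux ?\<nu> \<and> \<Phi> (polytabloid ?\<nu> \<tau>) = b j"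
    proof
      fix j assume "j \<in> {..<d}"
      then have "b j \<in> \<Phi> ` S" using B(1) bij_betw_apply[OF b] by (rule_tac subsetD)
      then show "\<exists>\<tau>. \<tau> \<in> tableaux ?\<nu> \<and> \<Phi> (polytabloid ?\<nu> \<tau>) = b j" by (auto simp: S_def)
    qed
    from bchoice[OF this] obtain T where
      "\<forall>j\<in>{..<d}. T j \<in> tableaux ?\<nu> \<and> \<Phi> (polytabloid ?\<nu> (T j)) = b j" ..
    then have T: "T j \<in> tableaux ?\<nu>" "\<Phi> (polytabloid ?\<nu> (T j)) = b j" if "j < d" for j using that by auto
    have nondeg: "\<exists>g. rep_hom GL2 (det_tensor (n1 + n2) k) (det_tensor (n1 - n2) (n2 + k)) g \<and>
          g (\<Sum>j<d. fscale (\<alpha> j) (specht_hom n1 n2 (T j) ?d)) (replicate (n1 - n2) 1) \<noteq> 0"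
      if nz: "\<exists>j<d. \<alpha> j \<noteq> (0 :: 'k)" for \<alpha>
    proof (rule ccontr)
      assume no: "\<not> ?thesis"
      have form0: "(\<Sum>j<d. \<alpha> j * tabloid_form ?\<nu> (polytabloid ?\<nu> (T j)) (polytabloid ?\<nu> \<tau>)) = 0"
        if \<tau>: "\<tau> \<in> tableaux ?\<nu>" for \<tau>
      proof -
        note hom = specht_hom_hom(2)[OF \<tau> le, of k]
        have TP: "specht_hom n1 n2 (T j) ?d \<in> vecs (det_tensor (n1 + n2) k)" if "j < d" for j
          by (rule rep_hom_mem[OF specht_hom_hom(1)[OF T(1)[OF that] le]]) (use delta_power[of "replicate (n1 - n2) 1"] in simp)
        have sub: "fs.subspace (vecs (det_tensor (n1 + n2) k) :: (2 list \<Rightarrow> 'k) set)"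
          by (simp add: tensor_power_subspace)
        have "specht_cohom n1 n2 \<tau> (\<Sum>j<d. fscale (\<alpha> j) (specht_hom n1 n2 (T j) ?d))
            = (\<Sum>j<d. specht_cohom n1 n2 \<tau> (fscale (\<alpha> j) (specht_hom n1 n2 (T j) ?d)))"
          by (rule rep_hom_sum[OF hom sub]) (simp add: fs.subspace_scale[OF sub TP] del: det_tensor_simps)
        also have "\<dots> = (\<Sum>j<d. fscale (\<alpha> j) (specht_cohom n1 n2 \<tau> (specht_hom n1 n2 (T j) ?d)))"
          by (rule sum.cong) (simp_all add: rep_hom_scale[OF hom TP])
        finally have "specht_cohom n1 n2 \<tau> (\<Sum>j<d. fscale (\<alpha> j) (specht_hom n1 n2 (T j) ?d)) (replicate (n1 - n2) 1)
            = (\<Sum>j<d. \<alpha> j * tabloid_form ?\<nu> (polytabloid ?\<nu> \<tau>) (polytabloid ?\<nu> (T j)))"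
          by (simp add: fun_simps specht_gram[OF \<tau> T(1) le])
        moreover have "specht_cohom n1 n2 \<tau> (\<Sum>j<d. fscale (\<alpha> j) (specht_hom n1 n2 (T j) ?d)) (replicate (n1 - n2) 1) = 0"
        proof (rule ccontr)
          assume "\<not> ?thesis"
          with hom have "rep_hom GL2 (det_tensor (n1 + n2) k) (det_tensor (n1 - n2) (n2 + k)) (specht_cohom n1 n2 \<tau>) \<and>
            specht_cohom n1 n2 \<tau> (\<Sum>j<d. fscale (\<alpha> j) (specht_hom n1 n2 (T j) ?d)) (replicate (n1 - n2) 1) \<noteq> 0" ..
          then have "\<exists>g. rep_hom GL2 (det_tensor (n1 + n2) k) (det_tensor (n1 - n2) (n2 + k)) g \<and>
            g (\<Sum>j<d. fscale (\<alpha> j) (specht_hom n1 n2 (T j) ?d)) (replicate (n1 - n2) 1) \<noteq> 0"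
            by (rule exI[of _ "specht_cohom n1 n2 \<tau>"])
          with no show False by (rule notE)
        qed
        ultimately show ?thesis by (simp add: tabloid_form_def mult.commute)
      qed
      define x where "x = (\<Sum>j<d. fscale (\<alpha> j) (polytabloid ?\<nu> (T j)))"
      have form_x: "tabloid_form ?\<nu> x v = (\<Sum>j<d. \<alpha> j * tabloid_form ?\<nu> (polytabloid ?\<nu> (T j)) v)" for v
        unfolding x_def tabloid_form_def
        by (simp add: fun_simps sum_distrib_left sum_distrib_right mult.assoc) (rule sum.swap)
      have "tabloid_form ?\<nu> x v = 0" if "v \<in> fs.span S" for v
        using that
      proof (induction rule: fs.span_induct_alt)
        case base
        have "tabloid_form ?\<nu> x 0 = 0" by (simp add: tabloid_form_def fun_simps)
        then show ?case .
      next
        case (step c a v)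
        then have "tabloid_form ?\<nu> x a = 0" using form0 form_x by (auto simp: S_def)
        then have "tabloid_form ?\<nu> x (fscale c a + v) = 0"
          using step(2) by (simp add: tabloid_form_def fun_simps distrib_left sum.distrib mult.left_commute
              sum_distrib_left[symmetric])
        then show ?case .
      qed
      then have "\<Phi> x = 0" by (auto simp: \<Phi>_def specht_functional_eq_0_iff specht_def S_def)
      moreover have "\<Phi> x = (\<Sum>j<d. fscale (\<alpha> j) (b j))"
        unfolding x_def linmap_sum[OF \<Phi>] linmap_scale[OF \<Phi>] by (rule sum.cong) (simp_all add: T(2))
      moreover have "(\<Sum>j<d. fscale (\<alpha> j) (b j)) = (\<Sum>y\<in>B. fscale (\<alpha> (inv_into {..<d} b y)) y)"
        using sum.reindex_bij_betw[OF b, of "\<lambda>y. fscale (\<alpha> (inv_into {..<d} b y)) y"]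
          bij_betw_inv_into_left[OF b] by simp
      ultimately have s0: "(\<Sum>y\<in>B. fscale (\<alpha> (inv_into {..<d} b y)) y) = 0" by simp
      have "\<alpha> j = 0" if "j < d" for j
      proof -
        have "b j \<in> B" using bij_betw_apply[OF b] that by simp
        from fs.independentD[OF B(2) fin subset_refl s0 this]
        have "\<alpha> (inv_into {..<d} b (b j)) = 0" .
        then show ?thesis using bij_betw_inv_into_left[OF b] that by simp
      qed
      with nz show False by blast
    qed
    show ?thesis
      unfolding d_def[symmetric]
    proof (rule exI[of _ "\<lambda>j. specht_hom n1 n2 (T j)"], intro conjI allI impI)
      show "rep_hom GL2 (det_tensor (n1 - n2) (n2 + k)) (det_tensor (n1 + n2) k) (specht_hom n1 n2 (T j))"
        if "j < d" for j using specht_hom_hom(1)[OF T(1)[OF that] le] .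
    qed (rule nondeg)
  qed
qed

end

section \<open>Polynomial representations: coefficients and weights\<close>

abbreviation mat2 :: "'k \<Rightarrow> 'k \<Rightarrow> 'k \<Rightarrow> 'k \<Rightarrow> 'k::field ^ 2 ^ 2"
  where "mat2 a b c d \<equiv> vector [vector [a, b], vector [c, d]]"

abbreviation torus :: "'k \<Rightarrow> 'k \<Rightarrow> 'k::field ^ 2 ^ 2"
  where "torus x y \<equiv> mat2 x 0 0 y"

lemma det_mat2: "det (mat2 a b c d) = a * d - b * c"
  by (simp add: det_2)

lemma mat2_mult: "mat2 a b c d ** mat2 a' b' c' d'
    = mat2 (a * a' + b * c') (a * b' + b * d') (c * a' + d * c') (c * b' + d * d')"
  by (simp add: matrix_matrix_mult_def vec_eq_iff forall_2 sum_2)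

definition monomial_index :: "nat \<Rightarrow> (nat \<times> nat \<times> nat \<times> nat) set"
  where "monomial_index r = {(i, j, k, l). i + j + k + l = r}"

lemma finite_monomial_index: "finite (monomial_index r)"
proof (rule finite_subset)
  show "monomial_index r \<subseteq> {..r} \<times> {..r} \<times> {..r} \<times> {..r}" by (auto simp: monomial_index_def)
qed simp

definition entry_monomial :: "'k::field ^ 2 ^ 2 \<Rightarrow> nat \<times> nat \<times> nat \<times> nat \<Rightarrow> 'k"
  where "entry_monomial g = (\<lambda>(i, j, k, l). (g $ 1 $ 1) ^ i * (g $ 1 $ 2) ^ j * (g $ 2 $ 1) ^ k * (g $ 2 $ 2) ^ l)"

lemma homogeneous_on_GL2_expand:
  assumes "homogeneous_on_GL2 r f"
  shows "\<exists>c. \<forall>g\<in>carrier GL2. f g = (\<Sum>q\<in>monomial_index r. c q * entry_monomial g q)"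
proof -
  define e where "e = (\<lambda>(i, j, k, l) (a :: 2) (b :: 2). if a = 1 then (if b = 1 then i else j) else (if b = 1 then k else (l :: nat)))"
  define q where "q = (\<lambda>e :: 2 \<Rightarrow> 2 \<Rightarrow> nat. (e 1 1, e 1 2, e 2 1, e 2 2))"
  have 21: "(2 :: 2) \<noteq> 1" by simp
  from assms obtain c where c: "\<forall>g\<in>carrier GL2.
    f g = (\<Sum>e | (\<Sum>i\<in>UNIV. \<Sum>j\<in>UNIV. e i j) = r. c e * (\<Prod>i\<in>UNIV. \<Prod>j\<in>UNIV. (g $ i $ j) ^ e i j))"
    unfolding homogeneous_on_GL2_def ..
  have "f g = (\<Sum>x\<in>monomial_index r. c (e x) * entry_monomial g x)" if g: "g \<in> carrier GL2" for g
  proof -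
    have "f g = (\<Sum>e | (\<Sum>i\<in>UNIV. \<Sum>j\<in>UNIV. e i j) = r. c e * (\<Prod>i\<in>UNIV. \<Prod>j\<in>UNIV. (g $ i $ j) ^ e i j))"
      using c g by (rule bspec)
    also have "\<dots> = (\<Sum>x\<in>monomial_index r. c (e x) * entry_monomial g x)"
    proof (rule sum.reindex_bij_witness[where i = e and j = q])
      have eq: "e (q x) = x" for x
      proof (intro ext)
        fix a b :: 2 show "e (q x) a b = x a b"
          using exhaust_2[of a] exhaust_2[of b] by (auto simp: e_def q_def 21)
      qed
      show "e (q x) = x" for x by (rule eq)
      show "q (e x) = x" for x by (auto simp: e_def q_def 21 split: prod.split)
      show "q x \<in> monomial_index r" if "x \<in> {e. (\<Sum>i\<in>UNIV. \<Sum>j\<in>UNIV. e i j) = r}" for x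
        using that by (simp add: q_def monomial_index_def sum_2 add.assoc)
      show "e x \<in> {e. (\<Sum>i\<in>UNIV. \<Sum>j\<in>UNIV. e i j) = r}" if "x \<in> monomial_index r" for x
        using that by (auto simp: e_def monomial_index_def sum_2 21)
      show "c (e (q x)) * entry_monomial g (q x) = c x * (\<Prod>i\<in>UNIV. \<Prod>j\<in>UNIV. (g $ i $ j) ^ x i j)" for x
        unfolding eq by (simp add: q_def entry_monomial_def UNIV_2 mult.assoc)
    qed
    finally show ?thesis .
  qed
  then show ?thesis by (intro exI[of _ "\<lambda>x. c (e x)"] ballI)
qed

lemma polynomial_rep_is_rep: "polynomial_rep r Y \<Longrightarrow> is_rep GL2 Y"
  and polynomial_rep_fin_dim: "polynomial_rep r Y \<Longrightarrow> fin_dim (vecs Y)"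
  by (auto simp: polynomial_rep_def)

lemma polynomial_rep_expand:
  assumes Y: "polynomial_rep r Y" and v: "v \<in> vecs Y"
  shows "\<exists>\<xi>. (\<forall>q. \<xi> q \<in> vecs Y) \<and>
    (\<forall>g\<in>carrier GL2. act Y g v = (\<Sum>q\<in>monomial_index r. fscale (entry_monomial g q) (\<xi> q)))"
proof -
  note rep = polynomial_rep_is_rep[OF Y]
  note sub = rep_subspace[OF rep]
  from fin_dim_dual_basis[OF polynomial_rep_fin_dim[OF Y] sub]
  obtain B where "\<exists>G. finite B \<and> B \<subseteq> vecs Y \<and> (\<forall>b. linfun (G b)) \<and> (\<forall>v\<in>vecs Y. v = (\<Sum>b\<in>B. fscale (G b v) b))" ..
  then obtain G where BG: "finite B \<and> B \<subseteq> vecs Y \<and> (\<forall>b. linfun (G b)) \<and> (\<forall>v\<in>vecs Y. v = (\<Sum>b\<in>B. fscale (G b v) b))" ..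
  then have B: "finite B" "B \<subseteq> vecs Y" and G: "linfun (G b)" for b by auto
  have exp: "v = (\<Sum>b\<in>B. fscale (G b v) b)" if "v \<in> vecs Y" for v
    using BG that by (elim conjE) (erule (1) bspec)
  have "\<exists>c. \<forall>g\<in>carrier GL2. G b (act Y g v) = (\<Sum>q\<in>monomial_index r. c q * entry_monomial g q)" for b
  proof -
    have mem: "(\<lambda>v. if v \<in> vecs Y then G b v else 0) \<in> dual_space (vecs Y)" by (rule dual_spaceI[OF G sub])
    have "\<forall>v\<in>vecs Y. \<forall>\<phi>\<in>dual_space (vecs Y). homogeneous_on_GL2 r (\<lambda>g. \<phi> (act Y g v))"
      using Y by (simp add: polynomial_rep_def)
    from bspec[OF bspec[OF this v] mem]
    have "homogeneous_on_GL2 r (\<lambda>g. if act Y g v \<in> vecs Y then G b (act Y g v) else 0)" .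
    from homogeneous_on_GL2_expand[OF this] obtain c where c: "\<forall>g\<in>carrier GL2.
      (if act Y g v \<in> vecs Y then G b (act Y g v) else 0) = (\<Sum>q\<in>monomial_index r. c q * entry_monomial g q)" ..
    have "G b (act Y g v) = (\<Sum>q\<in>monomial_index r. c q * entry_monomial g q)" if g: "g \<in> carrier GL2" for g
      using bspec[OF c g] rep_act_mem[OF rep g v] by simp
    then show ?thesis by blast
  qed
  from choice[OF allI[OF this]] obtain c where
    c: "\<forall>b. \<forall>g\<in>carrier GL2. G b (act Y g v) = (\<Sum>q\<in>monomial_index r. c b q * entry_monomial g q)" ..
  define \<xi> where "\<xi> q = (\<Sum>b\<in>B. fscale (c b q) b)" for q
  have "\<xi> q \<in> vecs Y" for q
    unfolding \<xi>_def by (rule fs.subspace_sum[OF sub]) (use B in \<open>auto intro: fs.subspace_scale[OF sub]\<close>)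
  moreover have "act Y g v = (\<Sum>q\<in>monomial_index r. fscale (entry_monomial g q) (\<xi> q))" if g: "g \<in> carrier GL2" for g
  proof -
    have "act Y g v = (\<Sum>b\<in>B. fscale (G b (act Y g v)) b)" by (rule exp[OF rep_act_mem[OF rep g v]])
    also have "\<dots> = (\<Sum>b\<in>B. \<Sum>q\<in>monomial_index r. fscale (c b q * entry_monomial g q) b)"
      using c g by (intro sum.cong refl) (simp add: fs.scale_sum_left)
    also have "\<dots> = (\<Sum>q\<in>monomial_index r. \<Sum>b\<in>B. fscale (c b q * entry_monomial g q) b)" by (rule sum.swap)
    also have "\<dots> = (\<Sum>q\<in>monomial_index r. fscale (entry_monomial g q) (\<xi> q))"
      by (intro sum.cong refl) (simp add: \<xi>_def fs.scale_sum_right mult.commute)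
    finally show ?thesis .
  qed
  ultimately show ?thesis by (intro exI[of _ \<xi>] conjI allI ballI)
qed

definition has_weight :: "('k::field ^ 2 ^ 2, 'k, 'x) rep \<Rightarrow> nat \<times> nat \<Rightarrow> ('x \<Rightarrow> 'k) \<Rightarrow> bool"
  where "has_weight M \<mu> v \<longleftrightarrow> v \<in> vecs M \<and> (\<forall>x y. x \<noteq> 0 \<longrightarrow> y \<noteq> 0 \<longrightarrow>
    act M (torus x y) v = fscale (x ^ fst \<mu> * y ^ snd \<mu>) v)"

lemma is_weight_iff: "is_weight M \<mu> \<longleftrightarrow> (\<exists>v. v \<noteq> 0 \<and> has_weight M \<mu> v)"
  by (auto simp: is_weight_def has_weight_def)

lemma invertible_mat2: "invertible (mat2 a b c d) \<longleftrightarrow> a * d - b * c \<noteq> (0 :: 'k::field)"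
  by (simp add: invertible_det_nz det_mat2)

lemma torus_carrier: "x \<noteq> 0 \<Longrightarrow> y \<noteq> 0 \<Longrightarrow> torus x y \<in> carrier (GL2 :: ('k::field ^ 2 ^ 2) monoid)"
  by (simp add: invertible_mat2)

definition weight_family :: "('k::field ^ 2 ^ 2, 'k, 'x) rep \<Rightarrow> nat \<Rightarrow> ('x \<Rightarrow> 'k) \<Rightarrow> (nat \<Rightarrow> 'x \<Rightarrow> 'k) \<Rightarrow> bool"
  where "weight_family Y r v u \<longleftrightarrow> (\<forall>j. u j \<in> vecs Y) \<and>
    (\<forall>s t. s \<noteq> 0 \<longrightarrow> t \<noteq> 0 \<longrightarrow> act Y (torus s t) v = (\<Sum>j\<le>r. fscale (s ^ j * t ^ (r - j)) (u j)))"

text \<open>The component of weight \<open>(j, r - j)\<close>.\<close>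

definition weight_part :: "('k::field ^ 2 ^ 2, 'k, 'x) rep \<Rightarrow> nat \<Rightarrow> ('x \<Rightarrow> 'k) \<Rightarrow> nat \<Rightarrow> 'x \<Rightarrow> 'k"
  where "weight_part Y r v = (SOME u. weight_family Y r v u)"

lemma weight_family_exists:
  assumes Y: "polynomial_rep r Y" and v: "v \<in> vecs Y"
  shows "\<exists>u. weight_family Y r v u"
proof -
  from polynomial_rep_expand[OF assms] obtain \<xi> where \<xi>: "(\<forall>q. \<xi> q \<in> vecs Y) \<and>
    (\<forall>g\<in>carrier GL2. act Y g v = (\<Sum>q\<in>monomial_index r. fscale (entry_monomial g q) (\<xi> q)))" ..
  have "act Y (torus s t) v = (\<Sum>j\<le>r. fscale (s ^ j * t ^ (r - j)) (\<xi> (j, 0, 0, r - j)))"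
    if st: "s \<noteq> 0" "t \<noteq> 0" for s t
  proof -
    have "act Y (torus s t) v = (\<Sum>q\<in>monomial_index r. fscale (entry_monomial (torus s t) q) (\<xi> q))"
      using \<xi> torus_carrier[OF st] by blast
    also have "\<dots> = (\<Sum>q\<in>(\<lambda>j. (j, 0, 0, r - j)) ` {..r}. fscale (entry_monomial (torus s t) q) (\<xi> q))"
    proof (rule sum.mono_neutral_right[OF finite_monomial_index])
      show "(\<lambda>j. (j, 0, 0, r - j)) ` {..r} \<subseteq> monomial_index r" by (auto simp: monomial_index_def)
      show "\<forall>q\<in>monomial_index r - (\<lambda>j. (j, 0, 0, r - j)) ` {..r}. fscale (entry_monomial (torus s t) q) (\<xi> q) = 0"
      proof
        fix q assume q: "q \<in> monomial_index r - (\<lambda>j. (j, 0, 0, r - j)) ` {..r}"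
        obtain i j k l where ijkl: "q = (i, j, k, l)" by (cases q) auto
        have "j \<noteq> 0 \<or> k \<noteq> 0"
        proof (rule ccontr)
          assume "\<not> ?thesis"
          then have "q = (i, 0, 0, r - i)" "i \<le> r" using q ijkl by (auto simp: monomial_index_def)
          with q show False by blast
        qed
        then have "entry_monomial (torus s t) q = 0" by (auto simp: ijkl entry_monomial_def)
        then show "fscale (entry_monomial (torus s t) q) (\<xi> q) = 0" by simp
      qed
    qed
    also have "\<dots> = (\<Sum>j\<le>r. fscale (s ^ j * t ^ (r - j)) (\<xi> (j, 0, 0, r - j)))"
      by (subst sum.reindex) (auto simp: inj_on_def entry_monomial_def)
    finally show ?thesis .
  qed
  with \<xi> show ?thesis
    unfolding weight_family_def by (intro exI[of _ "\<lambda>j. \<xi> (j, 0, 0, r - j)"] conjI allI impI) auto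
qed

lemma weight_part:
  assumes "polynomial_rep r Y" "v \<in> vecs Y"
  shows weight_part_mem: "weight_part Y r v j \<in> vecs Y"
    and weight_part_sum: "s \<noteq> 0 \<Longrightarrow> t \<noteq> 0 \<Longrightarrow>
      act Y (torus s t) v = (\<Sum>j\<le>r. fscale (s ^ j * t ^ (r - j)) (weight_part Y r v j))"
proof -
  have "weight_family Y r v (weight_part Y r v)"
    unfolding weight_part_def by (rule someI_ex[OF weight_family_exists[OF assms]])
  then show "weight_part Y r v j \<in> vecs Y" "s \<noteq> 0 \<Longrightarrow> t \<noteq> 0 \<Longrightarrow>
      act Y (torus s t) v = (\<Sum>j\<le>r. fscale (s ^ j * t ^ (r - j)) (weight_part Y r v j))"
    by (auto simp: weight_family_def)
qed

lemma infinite_nonzero: "infinite (UNIV :: 'k::field set) \<Longrightarrow> infinite {s :: 'k. s \<noteq> 0}"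
proof -
  assume inf: "infinite (UNIV :: 'k::field set)"
  have "{s :: 'k. s \<noteq> 0} = UNIV - {0}" by auto
  then show ?thesis using inf by simp
qed

context
  assumes inf: "infinite (UNIV :: 'k::field set)"
begin

lemma weight_part_eqI:
  fixes Y :: "('k ^ 2 ^ 2, 'k, 'x) rep"
  assumes Y: "polynomial_rep r Y" "v \<in> vecs Y"
    and eq: "\<And>s. s \<noteq> 0 \<Longrightarrow> act Y (torus s 1) v = (\<Sum>j\<le>r. fscale (s ^ j) (u j))" and "j \<le> r"
  shows "weight_part Y r v j = u j"
proof -
  have "weight_part Y r v j - u j \<in> {0}"
  proof (rule curve_coefficients_mem[OF _ infinite_nonzero[OF inf]])
    fix s :: 'k assume "s \<in> {s. s \<noteq> 0}"
    then have s: "s \<noteq> 0" by simp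
    have "(\<Sum>j\<le>r. fscale (s ^ j) (weight_part Y r v j)) = (\<Sum>j\<le>r. fscale (s ^ j) (u j))"
      using weight_part_sum[OF Y s, of 1] eq[OF s] by simp
    then show "(\<Sum>i\<le>r. fscale (s ^ i) (weight_part Y r v i - u i)) \<in> {0}"
      by (simp add: fs.scale_right_diff_distrib sum_subtractf)
  qed (use assms(4) in auto)
  then show ?thesis by simp
qed

lemma weight_part_add:
  fixes Y :: "('k ^ 2 ^ 2, 'k, 'x) rep"
  assumes Y: "polynomial_rep r Y" and v: "v \<in> vecs Y" and w: "w \<in> vecs Y" and "j \<le> r"
  shows "weight_part Y r (v + w) j = weight_part Y r v j + weight_part Y r w j"
proof (rule weight_part_eqI[OF Y _ _ assms(4)])
  note rep = polynomial_rep_is_rep[OF Y]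
  show "v + w \<in> vecs Y" by (rule fs.subspace_add[OF rep_subspace[OF rep] v w])
  fix s :: 'k assume s: "s \<noteq> 0"
  show "act Y (torus s 1) (v + w) = (\<Sum>j\<le>r. fscale (s ^ j) (weight_part Y r v j + weight_part Y r w j))"
    using rep_act_add[OF rep torus_carrier[OF s, of 1] v w] weight_part_sum[OF Y v s, of 1]
      weight_part_sum[OF Y w s, of 1]
    by (simp add: fs.scale_right_distrib sum.distrib)
qed

lemma weight_part_scale:
  fixes Y :: "('k ^ 2 ^ 2, 'k, 'x) rep"
  assumes Y: "polynomial_rep r Y" and v: "v \<in> vecs Y" and "j \<le> r"
  shows "weight_part Y r (fscale c v) j = fscale c (weight_part Y r v j)"
proof (rule weight_part_eqI[OF Y _ _ assms(3)])
  note rep = polynomial_rep_is_rep[OF Y]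
  show "fscale c v \<in> vecs Y" by (rule fs.subspace_scale[OF rep_subspace[OF rep] v])
  fix s :: 'k assume s: "s \<noteq> 0"
  show "act Y (torus s 1) (fscale c v) = (\<Sum>j\<le>r. fscale (s ^ j) (fscale c (weight_part Y r v j)))"
    using rep_act_scale[OF rep torus_carrier[OF s, of 1] v] weight_part_sum[OF Y v s, of 1]
    by (simp add: fs.scale_sum_right mult.commute)
qed

lemma weight_part_has_weight:
  fixes Y :: "('k ^ 2 ^ 2, 'k, 'x) rep"
  assumes Y: "polynomial_rep r Y" and v: "v \<in> vecs Y" and "j \<le> r"
  shows "has_weight Y (j, r - j) (weight_part Y r v j)"
  unfolding has_weight_def
proof (intro conjI allI impI weight_part_mem[OF Y v])
  note rep = polynomial_rep_is_rep[OF Y]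
  fix x y :: 'k assume xy: "x \<noteq> 0" "y \<noteq> 0"
  have "act Y (torus x y) (weight_part Y r v j) - fscale (x ^ j * y ^ (r - j)) (weight_part Y r v j) \<in> {0}"
  proof (rule curve_coefficients_mem[OF _ infinite_nonzero[OF inf], where n = r])
    fix s :: 'k assume "s \<in> {s. s \<noteq> 0}"
    then have s: "s \<noteq> 0" by simp
    have "torus x y ** torus s 1 = torus (x * s) y" by (simp add: mat2_mult)
    then have "act Y (torus x y) (act Y (torus s 1) v) = act Y (torus (x * s) y) v"
      using rep v torus_carrier[OF xy] torus_carrier[OF s, of 1] unfolding is_rep_def by (metis mult_GL2 one_neq_zero)
    moreover have "act Y (torus x y) (act Y (torus s 1) v)
        = (\<Sum>j\<le>r. fscale (s ^ j) (act Y (torus x y) (weight_part Y r v j)))"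
    proof -
      have "act Y (torus x y) (\<Sum>j\<le>r. fscale (s ^ j) (weight_part Y r v j))
          = (\<Sum>j\<le>r. act Y (torus x y) (fscale (s ^ j) (weight_part Y r v j)))"
        by (rule rep_act_sum[OF rep torus_carrier[OF xy]])
           (rule fs.subspace_scale[OF rep_subspace[OF rep] weight_part_mem[OF Y v]])
      then show ?thesis using weight_part_sum[OF Y v s, of 1]
        by (simp add: rep_act_scale[OF rep torus_carrier[OF xy] weight_part_mem[OF Y v]])
    qed
    moreover have "act Y (torus (x * s) y) v
        = (\<Sum>j\<le>r. fscale (s ^ j) (fscale (x ^ j * y ^ (r - j)) (weight_part Y r v j)))"
      using weight_part_sum[OF Y v, of "x * s" y] xy s by (simp add: power_mult_distrib mult_ac)
    ultimately show "(\<Sum>i\<le>r. fscale (s ^ i)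
        (act Y (torus x y) (weight_part Y r v i) - fscale (x ^ i * y ^ (r - i)) (weight_part Y r v i))) \<in> {0}"
      by (simp add: fs.scale_right_diff_distrib sum_subtractf)
  qed (use assms(3) in auto)
  then show "act Y (torus x y) (weight_part Y r v j)
      = fscale (x ^ fst (j, r - j) * y ^ snd (j, r - j)) (weight_part Y r v j)" by simp
qed

lemma weight_part_of_weight:
  fixes Y :: "('k ^ 2 ^ 2, 'k, 'x) rep"
  assumes Y: "polynomial_rep r Y" and v: "has_weight Y (j, r - j) v" and "j \<le> r" "i \<le> r"
  shows "weight_part Y r v i = (if i = j then v else 0)"
proof (rule weight_part_eqI[OF Y _ _ assms(4)])
  show "v \<in> vecs Y" using v by (simp add: has_weight_def)
  fix s :: 'k assume s: "s \<noteq> 0"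
  have "(\<Sum>i\<le>r. fscale (s ^ i) (if i = j then v else 0)) = (\<Sum>i\<le>r. if i = j then fscale (s ^ j) v else 0)"
    by (rule sum.cong) auto
  then show "act Y (torus s 1) v = (\<Sum>i\<le>r. fscale (s ^ i) (if i = j then v else 0))"
    using v s assms(3) by (simp add: has_weight_def)
qed

lemma weight_part_submodule:
  fixes Y :: "('k ^ 2 ^ 2, 'k, 'x) rep"
  assumes Y: "polynomial_rep r Y" and F: "submodule GL2 Y F" and v: "v \<in> F" and "j \<le> r"
  shows "weight_part Y r v j \<in> F"
proof (rule curve_coefficients_mem[OF _ infinite_nonzero[OF inf] _ assms(4)])
  show "fs.subspace F" using F by (simp add: submodule_def)
  have vY: "v \<in> vecs Y" using F v by (auto simp: submodule_def)
  fix s :: 'k assume "s \<in> {s. s \<noteq> 0}"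
  then have s: "s \<noteq> 0" by simp
  have "act Y (torus s 1) v \<in> F" using F v torus_carrier[OF s, of 1] by (auto simp: submodule_def)
  then show "(\<Sum>i\<le>r. fscale (s ^ i) (weight_part Y r v i)) \<in> F"
    using weight_part_sum[OF Y vY s, of 1] by simp
qed

lemma weight_part_bound:
  fixes Y :: "('k ^ 2 ^ 2, 'k, 'x) rep"
  assumes Y: "polynomial_rep r Y" and v: "v \<in> vecs Y" and "j \<le> r"
    and bound: "\<And>\<mu>. is_weight Y \<mu> \<Longrightarrow> fst \<mu> \<le> l1" and "l1 < j"
  shows "weight_part Y r v j = 0"
proof (rule ccontr)
  assume "weight_part Y r v j \<noteq> 0"
  then have "is_weight Y (j, r - j)"
    unfolding is_weight_iff using weight_part_has_weight[OF Y v assms(3)] by blast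
  from bound[OF this] assms(5) show False by simp
qed

lemma power_eq_all:
  assumes "\<And>s :: 'k. s \<noteq> 0 \<Longrightarrow> s ^ m = s ^ n" shows "m = n"
proof (rule ccontr)
  assume ne: "m \<noteq> n"
  define a where "a i = (if i = m then 1 else 0) - (if i = n then 1 else 0 :: 'k)" for i
  have "a m = 0"
  proof (rule scalar_polynomial_zero[OF infinite_nonzero[OF inf], where n = "m + n"])
    fix s :: 'k assume "s \<in> {s. s \<noteq> 0}"
    then show "(\<Sum>i\<le>m + n. s ^ i * a i) = 0"
      using assms[of s] by (simp add: a_def right_diff_distrib sum_subtractf if_distrib[of "\<lambda>x. _ * x"] cong: if_cong)
  qed simp
  with ne show False by (simp add: a_def)
qed

subsection \<open>Weyl filtrations\<close>

definition plane_monomial :: "nat \<Rightarrow> nat \<Rightarrow> 'k ^ 2 \<Rightarrow> 'k"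
  where "plane_monomial p q = (\<lambda>x. (x $ 1) ^ p * (x $ 2) ^ q)"

lemma dual_weyl_vecs: "vecs (dual_weyl \<mu>) = fs.span {plane_monomial p q |p q. p + q = fst \<mu> - snd \<mu>}"
  by (simp add: dual_weyl_def plane_monomial_def)

lemma plane_monomial_mem: "p + q = fst \<mu> - snd \<mu> \<Longrightarrow> plane_monomial p q \<in> vecs (dual_weyl \<mu>)"
  unfolding dual_weyl_vecs by (rule fs.span_base) blast

lemma weyl_vecs: "vecs (weyl \<mu>) = dual_space (vecs (dual_weyl \<mu>))"
  by (simp add: weyl_def contravariant_dual_def)

lemma weyl_act: "f \<in> vecs (dual_weyl \<mu>) \<Longrightarrow>
    act (weyl \<mu>) g \<phi> f = \<phi> (\<lambda>x. det g ^ snd \<mu> * f (g *v x))"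
  by (simp add: weyl_def contravariant_dual_def) (simp add: dual_weyl_def det_transpose)

lemma weyl_torus:
  assumes \<phi>: "\<phi> \<in> vecs (weyl \<mu>)" and pq: "p + q = fst \<mu> - snd \<mu>"
  shows "act (weyl \<mu>) (torus s t) \<phi> (plane_monomial p q)
    = s ^ (p + snd \<mu>) * t ^ (q + snd \<mu>) * \<phi> (plane_monomial p q)"
proof -
  have "(\<lambda>x. det (torus s t) ^ snd \<mu> * plane_monomial p q (torus s t *v x))
      = fscale (s ^ (p + snd \<mu>) * t ^ (q + snd \<mu>)) (plane_monomial p q)"
    by (rule ext) (simp add: det_mat2 plane_monomial_def fscale_apply matrix_vector_mult_def sum_2
        power_mult_distrib power_add mult_ac)
  moreover have "\<phi> (fscale c (plane_monomial p q)) = c * \<phi> (plane_monomial p q)" for c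
    using \<phi> plane_monomial_mem[OF pq] by (simp add: weyl_vecs dual_space_def)
  ultimately show ?thesis by (simp add: weyl_act[OF plane_monomial_mem[OF pq]])
qed

text \<open>The coordinate functional of a monomial in a section is a weight functional, and weight components of
  elements of the submodule stay in it.\<close>

lemma weyl_section_weight:
  fixes Y :: "('k ^ 2 ^ 2, 'k, 'x) rep"
  assumes Y: "polynomial_rep r Y" and F: "submodule GL2 Y F"
    and \<pi>: "rep_hom GL2 (subrep Y F) (weyl \<mu>) \<pi>"
    and z: "z \<in> F" and pq: "p + q = fst \<mu> - snd \<mu>" and nz: "\<pi> z (plane_monomial p q) \<noteq> 0"
  shows "p + snd \<mu> \<le> r" "weight_part Y r z (p + snd \<mu>) \<noteq> 0"
proof -
  note rep = polynomial_rep_is_rep[OF Y]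
  have FY: "F \<subseteq> vecs Y" and Fsub: "fs.subspace F" using F by (auto simp: submodule_def)
  have zY: "z \<in> vecs Y" using z FY by blast
  have \<pi>z: "\<pi> z \<in> vecs (weyl \<mu>)" using rep_hom_mem[OF \<pi>] z by simp
  define c where "c j = \<pi> (weight_part Y r z j) (plane_monomial p q)" for j
  define P where "P = p + snd \<mu>"
  have eq: "(\<Sum>j\<le>r. s ^ j * c j) = s ^ P * \<pi> z (plane_monomial p q)" if s: "s \<noteq> 0" for s
  proof -
    have sc: "fscale (s ^ j) (weight_part Y r z j) \<in> F" if "j \<in> {..r}" for j
      using that weight_part_submodule[OF Y F z] by (intro fs.subspace_scale[OF Fsub]) simp
    have "\<pi> (act Y (torus s 1) z) = \<pi> (\<Sum>j\<le>r. fscale (s ^ j) (weight_part Y r z j))"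
      using weight_part_sum[OF Y zY s, of 1] by simp
    also have "\<dots> = (\<Sum>j\<le>r. \<pi> (fscale (s ^ j) (weight_part Y r z j)))"
      by (rule rep_hom_sum[OF \<pi>]) (use Fsub sc in simp_all)
    also have "\<dots> = (\<Sum>j\<le>r. fscale (s ^ j) (\<pi> (weight_part Y r z j)))"
      using weight_part_submodule[OF Y F z] by (intro sum.cong refl rep_hom_scale[OF \<pi>]) simp
    finally have "\<pi> (act Y (torus s 1) z) (plane_monomial p q) = (\<Sum>j\<le>r. s ^ j * c j)"
      by (simp add: fun_simps c_def)
    moreover have "\<pi> (act Y (torus s 1) z) = act (weyl \<mu>) (torus s 1) (\<pi> z)"
      using rep_hom_act[OF \<pi> torus_carrier[OF s, of 1], of z] z by simp
    ultimately show ?thesis using weyl_torus[OF \<pi>z pq, of s 1] by (simp add: P_def)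
  qed
  define a where "a j = (if j \<le> r then c j else 0) - (if j = P then \<pi> z (plane_monomial p q) else 0)" for j
  have "a P = 0"
  proof (rule scalar_polynomial_zero[OF infinite_nonzero[OF inf], where n = "r + P"])
    fix s :: 'k assume "s \<in> {s. s \<noteq> 0}"
    then have s: "s \<noteq> 0" by simp
    have "(\<Sum>j\<le>r + P. s ^ j * (if j \<le> r then c j else 0)) = (\<Sum>j\<le>r. s ^ j * c j)"
      by (rule sum.mono_neutral_cong_right) auto
    moreover have "(\<Sum>j\<le>r + P. s ^ j * (if j = P then \<pi> z (plane_monomial p q) else 0))
        = (\<Sum>j\<le>r + P. if j = P then s ^ P * \<pi> z (plane_monomial p q) else 0)"
      by (rule sum.cong) auto
    ultimately show "(\<Sum>j\<le>r + P. s ^ j * a j) = 0"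
      using eq[OF s] by (simp add: a_def right_diff_distrib sum_subtractf)
  qed simp
  then have *: "(if P \<le> r then c P else 0) = \<pi> z (plane_monomial p q)" by (simp add: a_def)
  with nz show "p + snd \<mu> \<le> r" by (auto simp: P_def split: if_splits)
  show "weight_part Y r z (p + snd \<mu>) \<noteq> 0"
  proof
    assume "weight_part Y r z (p + snd \<mu>) = 0"
    then have "c P = \<pi> 0 (plane_monomial p q)" by (simp add: c_def P_def)
    moreover have "\<pi> 0 = 0" using rep_hom_zero[OF \<pi>] Fsub by simp
    ultimately show False using * nz by (simp add: fun_simps split: if_splits)
  qed
qed

text \<open>The lowering operator \<open>f\<^sup>(\<^sup>a\<^sup>)\<close> is the weight component of the action of a lower unitriangular
  matrix. It is injective on the highest weight space, because it is so in every section.\<close>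

lemma weyl_filtration_lowering_injective:
  fixes Y :: "('k ^ 2 ^ 2, 'k, 'x) rep"
  assumes Y: "polynomial_rep (l1 + l2) Y" and fil: "has_filtration Y weyl"
    and bound: "\<And>\<mu>. is_weight Y \<mu> \<Longrightarrow> fst \<mu> \<le> l1"
    and v: "has_weight Y (l1, l2) v" "v \<noteq> 0" and a: "a \<le> l1 - l2"
  shows "weight_part Y (l1 + l2) (act Y (mat2 1 0 1 1) v) (l1 - a) \<noteq> 0"
proof -
  define r where "r = l1 + l2"
  note Y = Y[folded r_def]
  note rep = polynomial_rep_is_rep[OF Y]
  from fil obtain n F where F0: "F 0 = {0}" and Fn: "F n = vecs Y"
    and Fsub: "\<forall>i\<le>n. submodule GL2 Y (F i)"
    and Fsec: "\<forall>i<n. F i \<subseteq> F (Suc i) \<and> (\<exists>\<mu>. snd \<mu> \<le> fst \<mu> \<and> quotient_iso GL2 Y (F (Suc i)) (F i) (weyl \<mu>))"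
    unfolding has_filtration_def by blast
  have vY: "v \<in> vecs Y" using v by (simp add: has_weight_def)
  have "\<exists>i<n. v \<in> F (Suc i) \<and> v \<notin> F i"
  proof (rule ccontr)
    assume no: "\<not> ?thesis"
    have "k \<le> n \<Longrightarrow> v \<notin> F k" for k
    proof (induction k)
      case 0 then show ?case using F0 v(2) by simp
    next
      case (Suc k) then show ?case using no by auto
    qed
    from this[of n] Fn vY show False by simp
  qed
  then obtain i where i: "i < n" "v \<in> F (Suc i)" "v \<notin> F i" by blast
  from Fsec i(1) obtain \<mu> where \<mu>: "snd \<mu> \<le> fst \<mu>" "quotient_iso GL2 Y (F (Suc i)) (F i) (weyl \<mu>)" by blast
  from \<mu>(2) obtain \<pi> where "rep_hom GL2 (subrep Y (F (Suc i))) (weyl \<mu>) \<pi> \<and>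
      \<pi> ` F (Suc i) = vecs (weyl \<mu>) \<and> {v \<in> F (Suc i). \<pi> v = 0} = F i" unfolding quotient_iso_def ..
  then have \<pi>: "rep_hom GL2 (subrep Y (F (Suc i))) (weyl \<mu>) \<pi>"
    and surj: "\<pi> ` F (Suc i) = vecs (weyl \<mu>)" and ker: "{v \<in> F (Suc i). \<pi> v = 0} = F i" by auto
  have sm: "submodule GL2 Y (F (Suc i))" using Fsub i(1) by simp
  define M where "M = fst \<mu> - snd \<mu>"
  have S: "fs.subspace (vecs (dual_weyl \<mu>) :: ('k ^ 2 \<Rightarrow> 'k) set)" unfolding dual_weyl_vecs by (rule fs.subspace_span)
  have mem: "plane_monomial p q \<in> vecs (dual_weyl \<mu>)" if "p + q = M" for p q
    using plane_monomial_mem[of p q \<mu>] that by (simp add: M_def)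
  have "fst \<mu> \<le> l1"
  proof -
    have "plane_monomial M 0 (vector [1, 0]) = 1" by (simp add: plane_monomial_def)
    then have "plane_monomial M 0 \<notin> {0}" by (auto simp: zero_fun_apply)
    from functional_separates[OF _ this] obtain G where
      "linfun G \<and> G (plane_monomial M 0) = 1 \<and> (\<forall>w\<in>{0}. G w = 0)" by auto
    then have G: "linfun G" "G (plane_monomial M 0) = 1" by auto
    define \<delta> where "\<delta> = (\<lambda>f. if f \<in> vecs (dual_weyl \<mu>) then G f else 0)"
    have "\<delta> \<in> vecs (weyl \<mu>)" unfolding weyl_vecs \<delta>_def by (rule dual_spaceI[OF G(1) S])
    then obtain y where y: "y \<in> F (Suc i)" "\<pi> y = \<delta>" using surj by (metis imageE)
    have "\<pi> y (plane_monomial M 0) \<noteq> 0" using y G mem[of M 0] by (simp add: \<delta>_def)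
    from weyl_section_weight[OF Y sm \<pi> y(1) _ this]
    have "M + snd \<mu> \<le> r" "weight_part Y r y (M + snd \<mu>) \<noteq> 0" by (simp_all add: M_def)
    have yY: "y \<in> vecs Y" using y sm by (auto simp: submodule_def)
    have "\<not> l1 < M + snd \<mu>"
      using weight_part_bound[OF Y yY \<open>M + snd \<mu> \<le> r\<close> bound] \<open>weight_part Y r y (M + snd \<mu>) \<noteq> 0\<close> by blast
    then show ?thesis using \<mu>(1) by (simp add: M_def)
  qed
  define \<delta> where "\<delta> = \<pi> v"
  have \<delta>: "\<delta> \<in> dual_space (vecs (dual_weyl \<mu>))" unfolding \<delta>_def weyl_vecs[symmetric] using surj i(2) by blast
  have vr: "has_weight Y (l1, r - l1) v" "l1 \<le> r" using v by (simp_all add: r_def)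
  have only: "q = 0 \<and> p + snd \<mu> = l1" if pq: "p + q = M" and nz: "\<delta> (plane_monomial p q) \<noteq> 0" for p q
  proof -
    from weyl_section_weight[OF Y sm \<pi> i(2), of p q] pq nz
    have "p + snd \<mu> \<le> r" "weight_part Y r v (p + snd \<mu>) \<noteq> 0" by (simp_all add: M_def \<delta>_def)
    then have "p + snd \<mu> = l1" using weight_part_of_weight[OF Y vr, of "p + snd \<mu>"] by (auto split: if_splits)
    then show ?thesis using \<open>fst \<mu> \<le> l1\<close> pq \<mu>(1) by (simp add: M_def)
  qed
  have "\<exists>p q. p + q = M \<and> \<delta> (plane_monomial p q) \<noteq> 0"
  proof (rule ccontr)
    assume no: "\<not> ?thesis"
    from dual_space_extend[OF S \<delta>] obtain G where "linfun G \<and> (\<forall>f\<in>vecs (dual_weyl \<mu>). G f = \<delta> f)" ..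
    then have G: "linfun G" "f \<in> vecs (dual_weyl \<mu>) \<Longrightarrow> G f = \<delta> f" for f by auto
    have "G f = 0" if "f \<in> fs.span {plane_monomial p q |p q. p + q = M}" for f
      using that
    proof (induction rule: fs.span_induct_alt)
      case base show ?case by (rule linfun_zero[OF G(1)])
    next
      case (step c x y)
      then obtain p q where "x = plane_monomial p q" "p + q = M" by blast
      then have "G x = 0" using G(2)[OF mem] no by simp
      then have "G (fscale c x + y) = 0" unfolding linfun_add[OF G(1)] linfun_scale[OF G(1)] using step(2) by simp
      then show ?case .
    qed
    then have "\<delta> f = 0" for f
      using G(2)[of f] \<delta> by (cases "f \<in> vecs (dual_weyl \<mu>)") (auto simp: dual_weyl_vecs M_def dual_space_def)
    then have "\<pi> v = 0" by (simp add: \<delta>_def fun_eq_iff zero_fun_apply)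
    with ker i show False by blast
  qed
  then obtain p where p: "\<delta> (plane_monomial p 0) \<noteq> 0" "p = M" "M + snd \<mu> = l1" using only by fastforce
  have deg: "fst \<mu> + snd \<mu> = r"
  proof (rule power_eq_all)
    fix s :: 'k assume s: "s \<noteq> 0"
    have "\<pi> (act Y (torus s s) v) = act (weyl \<mu>) (torus s s) \<delta>"
      using rep_hom_act[OF \<pi> torus_carrier[OF s s], of v] i(2) by (simp add: \<delta>_def)
    moreover have "act Y (torus s s) v = fscale (s ^ r) v"
      using v(1) s by (simp add: has_weight_def r_def power_add)
    moreover have "\<pi> (fscale (s ^ r) v) = fscale (s ^ r) \<delta>"
      using rep_hom_scale[OF \<pi>, of v] i(2) by (simp add: \<delta>_def)
    ultimately have "fscale (s ^ r) \<delta> (plane_monomial M 0) = act (weyl \<mu>) (torus s s) \<delta> (plane_monomial M 0)" by simp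
    then have "s ^ r * \<delta> (plane_monomial M 0) = s ^ (M + snd \<mu>) * s ^ snd \<mu> * \<delta> (plane_monomial M 0)"
      using weyl_torus[of \<delta> \<mu> M 0 s s] \<delta> by (simp add: fscale_apply weyl_vecs M_def)
    then have "s ^ r = s ^ (M + snd \<mu>) * s ^ snd \<mu>" using p by simp
    then show "s ^ (fst \<mu> + snd \<mu>) = s ^ r" using \<mu>(1) by (simp add: M_def power_add[symmetric])
  qed
  have M: "M = l1 - l2" "snd \<mu> = l2" using deg p(3) \<mu>(1) by (simp_all add: M_def r_def)
  define z where "z = act Y (mat2 1 0 1 1) v"
  have lo: "mat2 1 0 1 1 \<in> carrier (GL2 :: ('k ^ 2 ^ 2) monoid)" by (simp add: invertible_mat2)
  have zF: "z \<in> F (Suc i)" using sm lo i(2) by (auto simp: z_def submodule_def)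
  have na: "M - a + a = M" using a M by simp
  have "\<pi> z (plane_monomial (M - a) a) = \<delta> (plane_monomial M 0)"
  proof -
    from dual_space_extend[OF S \<delta>] obtain G where "linfun G \<and> (\<forall>f\<in>vecs (dual_weyl \<mu>). G f = \<delta> f)" ..
    then have G: "linfun G" "f \<in> vecs (dual_weyl \<mu>) \<Longrightarrow> G f = \<delta> f" for f by auto
    define P where "P = (\<Sum>j\<le>a. fscale (of_nat (a choose j)) (plane_monomial (M - a + j) (a - j)))"
    have Pm: "plane_monomial (M - a + j) (a - j) \<in> vecs (dual_weyl \<mu>)" if "j \<in> {..a}" for j
      by (rule mem) (use that na in simp)
    have PS: "P \<in> vecs (dual_weyl \<mu>)"
      unfolding P_def by (rule fs.subspace_sum[OF S]) (rule fs.subspace_scale[OF S Pm])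
    have "\<pi> z = act (weyl \<mu>) (mat2 1 0 1 1) \<delta>"
      using rep_hom_act[OF \<pi> lo, of v] i(2) by (simp add: z_def \<delta>_def)
    then have "\<pi> z (plane_monomial (M - a) a)
        = \<delta> (\<lambda>x. det (mat2 1 0 1 (1 :: 'k)) ^ snd \<mu> * plane_monomial (M - a) a (mat2 1 0 1 1 *v x))"
      using weyl_act[OF mem[OF na]] by simp
    also have "(\<lambda>x. det (mat2 1 0 1 (1 :: 'k)) ^ snd \<mu> * plane_monomial (M - a) a (mat2 1 0 1 1 *v x)) = P"
    proof
      fix x :: "'k ^ 2"
      have "P x = (\<Sum>j\<le>a. (x $ 1) ^ (M - a) * (of_nat (a choose j) * (x $ 1) ^ j * (x $ 2) ^ (a - j)))"
        by (simp add: P_def fun_simps plane_monomial_def power_add mult_ac)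
      also have "\<dots> = (x $ 1) ^ (M - a) * (x $ 1 + x $ 2) ^ a"
        by (simp add: binomial_ring sum_distrib_left)
      finally show "det (mat2 1 0 1 (1 :: 'k)) ^ snd \<mu> * plane_monomial (M - a) a (mat2 1 0 1 1 *v x) = P x"
        by (simp add: det_mat2 plane_monomial_def matrix_vector_mult_def sum_2)
    qed
    also have "\<delta> P = G P" using G(2)[OF PS] by simp
    also have "\<dots> = (\<Sum>j\<le>a. of_nat (a choose j) * \<delta> (plane_monomial (M - a + j) (a - j)))"
      unfolding P_def linfun_sum[OF G(1)] linfun_scale[OF G(1)] by (rule sum.cong) (simp_all add: G(2)[OF Pm])
    also have "\<dots> = (\<Sum>j\<le>a. if j = a then \<delta> (plane_monomial M 0) else 0)"
    proof (rule sum.cong[OF refl])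
      fix j assume j: "j \<in> {..a}"
      show "of_nat (a choose j) * \<delta> (plane_monomial (M - a + j) (a - j)) = (if j = a then \<delta> (plane_monomial M 0) else 0)"
        using only[of "M - a + j" "a - j"] j na by auto
    qed
    finally show ?thesis by simp
  qed
  then have "\<pi> z (plane_monomial (M - a) a) \<noteq> 0" using p by simp
  from weyl_section_weight(2)[OF Y sm \<pi> zF _ this] na
  have "weight_part Y r z (M - a + snd \<mu>) \<noteq> 0" by (simp add: M_def)
  moreover have "M - a + snd \<mu> = l1 - a" using M a p(3) by simp
  ultimately show ?thesis by (simp add: z_def r_def)
qed

end

section \<open>Bihomogeneous polynomials on two by two matrices\<close>

text \<open>The polynomial with coefficients \<open>c\<close> of degree \<open>n\<close> in the first row and \<open>a\<close> in the second row of a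
  matrix. As a module under right translation these polynomials form the tensor product of the \<open>n\<close>-th and
  the \<open>a\<close>-th symmetric power of \<open>E\<close>.\<close>

definition bihom :: "nat \<Rightarrow> nat \<Rightarrow> (nat \<Rightarrow> nat \<Rightarrow> 'a) \<Rightarrow> 'a \<Rightarrow> 'a \<Rightarrow> 'a \<Rightarrow> 'a \<Rightarrow> 'a::comm_ring_1"
  where "bihom n a c x1 x2 y1 y2 = (\<Sum>i\<le>n. \<Sum>j\<le>a. c i j * (x1 ^ (n - i) * x2 ^ i * (y1 ^ (a - j) * y2 ^ j)))"

abbreviation bihom_at :: "nat \<Rightarrow> nat \<Rightarrow> (nat \<Rightarrow> nat \<Rightarrow> 'k) \<Rightarrow> 'k::field ^ 2 ^ 2 \<Rightarrow> 'k"
  where "bihom_at n a c g \<equiv> bihom n a c (g $ 1 $ 1) (g $ 1 $ 2) (g $ 2 $ 1) (g $ 2 $ 2)"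

lemma bihom_poly: "poly (bihom n a (\<lambda>i j. [:c i j:]) X1 X2 Y1 Y2) t
    = bihom n a c (poly X1 t) (poly X2 t) (poly Y1 t) (poly Y2 t)"
  by (simp add: bihom_def poly_sum)

text \<open>A bihomogeneous polynomial vanishing on matrices with equal rows is divisible by the determinant. The
  quotient has the partial sums of the coefficients along antidiagonals as coefficients: the vanishing
  says that the full sums are zero.\<close>

lemma bihom_det_divide:
  fixes c :: "nat \<Rightarrow> nat \<Rightarrow> 'k::field"
  assumes inf: "infinite (UNIV :: 'k set)"
    and zero: "\<And>u. bihom (Suc n) (Suc a) c 1 u 1 u = 0"
  shows "\<exists>d. \<forall>x1 x2 y1 y2. bihom (Suc n) (Suc a) c x1 x2 y1 y2 = (x1 * y2 - x2 * y1) * bihom n a d x1 x2 y1 y2"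
proof -
  define c0 where "c0 i j = (if i \<le> Suc n \<and> j \<le> Suc a then c i j else 0)" for i j
  define E where "E i k = (\<Sum>l\<le>i. c0 l (k - l))" for i k
  define N where "N = Suc n + Suc a"
  have anti: "E k k = 0" if "k \<le> N" for k
  proof (rule scalar_polynomial_zero[OF inf _ that])
    fix u :: 'k
    have "(\<Sum>k\<le>N. u ^ k * E k k) = (\<Sum>k\<le>N. \<Sum>l\<le>k. u ^ (l + (k - l)) * c0 l (k - l))"
      unfolding E_def sum_distrib_left by (intro sum.cong refl) simp
    also have "\<dots> = (\<Sum>(i, j)\<in>{(i, j). i + j \<le> N}. u ^ (i + j) * c0 i j)"
      by (rule sum.triangle_reindex_eq[symmetric, of "\<lambda>i j. u ^ (i + j) * c0 i j"])
    also have "\<dots> = (\<Sum>(i, j)\<in>{..Suc n} \<times> {..Suc a}. u ^ (i + j) * c0 i j)"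
    proof (rule sum.mono_neutral_right)
      show "finite {(i, j). i + j \<le> N}"
        by (rule finite_subset[of _ "{..N} \<times> {..N}"]) auto
    qed (auto simp: N_def c0_def split: if_splits)
    also have "\<dots> = (\<Sum>i\<le>Suc n. \<Sum>j\<le>Suc a. u ^ (i + j) * c0 i j)" by (rule sum.cartesian_product[symmetric])
    also have "\<dots> = bihom (Suc n) (Suc a) c 1 u 1 u"
      unfolding bihom_def by (intro sum.cong refl) (simp add: c0_def power_add)
    finally show "(\<Sum>k\<le>N. u ^ k * E k k) = 0" by (simp only: zero)
  qed
  define d where "d i j = E i (i + Suc j)" for i j
  have "bihom (Suc n) (Suc a) c x1 x2 y1 y2 = (x1 * y2 - x2 * y1) * bihom n a d x1 x2 y1 y2" for x1 x2 y1 y2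
  proof -
    define m where "m i j = x1 ^ (Suc n - i) * x2 ^ i * (y1 ^ (Suc a - j) * y2 ^ j)" for i j
    define p where "p i j = (if i \<le> n \<and> 0 < j then d i (j - 1) else 0)" for i j
    define q where "q i j = (if 0 < i \<and> j \<le> a then d (i - 1) j else 0)" for i j
    have 1: "x1 * y2 * bihom n a d x1 x2 y1 y2 = (\<Sum>i\<le>Suc n. \<Sum>j\<le>Suc a. p i j * m i j)"
    proof -
      have "(\<Sum>i\<le>Suc n. \<Sum>j\<le>Suc a. p i j * m i j) = (\<Sum>i\<le>n. \<Sum>j\<le>a. p i (Suc j) * m i (Suc j))"
        by (simp add: sum.atMost_Suc[of _ n] sum.atMost_Suc_shift[of _ a] p_def del: sum.atMost_Suc)
      also have "\<dots> = (\<Sum>i\<le>n. \<Sum>j\<le>a. x1 * y2 * (d i j * (x1 ^ (n - i) * x2 ^ i * (y1 ^ (a - j) * y2 ^ j))))"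
        by (intro sum.cong refl) (simp add: p_def m_def Suc_diff_le mult_ac)
      finally show ?thesis by (simp add: bihom_def sum_distrib_left)
    qed
    have 2: "x2 * y1 * bihom n a d x1 x2 y1 y2 = (\<Sum>i\<le>Suc n. \<Sum>j\<le>Suc a. q i j * m i j)"
    proof -
      have "(\<Sum>i\<le>Suc n. \<Sum>j\<le>Suc a. q i j * m i j) = (\<Sum>i\<le>n. \<Sum>j\<le>a. q (Suc i) j * m (Suc i) j)"
        by (simp add: sum.atMost_Suc[of _ a] sum.atMost_Suc_shift[of _ n] q_def del: sum.atMost_Suc)
      also have "\<dots> = (\<Sum>i\<le>n. \<Sum>j\<le>a. x2 * y1 * (d i j * (x1 ^ (n - i) * x2 ^ i * (y1 ^ (a - j) * y2 ^ j))))"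
        by (intro sum.cong refl) (simp add: q_def m_def Suc_diff_le mult_ac)
      finally show ?thesis by (simp add: bihom_def sum_distrib_left)
    qed
    have coef: "c i j = p i j - q i j" if i: "i \<le> Suc n" and j: "j \<le> Suc a" for i j
    proof -
      have P: "p i j = E i (i + j)"
      proof (cases "i \<le> n \<and> 0 < j")
        case True then show ?thesis by (simp add: p_def d_def)
      next
        case False
        then consider "j = 0" | "i = Suc n" using i by linarith
        then show ?thesis
        proof cases
          case 1 then show ?thesis using anti[of i] i unfolding 1 by (simp add: p_def N_def)
        next
          case 2
          have "E (i + j) (i + j) = E i (i + j)"
            unfolding E_def by (rule sum.mono_neutral_right) (use 2 in \<open>auto simp: c0_def\<close>)
          moreover have "p i j = 0" using False unfolding p_def by (rule if_not_P)
          moreover have "i + j \<le> N" using i j by (simp add: N_def)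
          ultimately show ?thesis using anti[of "i + j"] by simp
        qed
      qed
      have Q: "q i j = (if 0 < i then E (i - 1) (i + j) else 0)"
      proof (cases "j \<le> a")
        case True
        then show ?thesis by (auto simp: q_def d_def gr0_conv_Suc)
      next
        case False
        have "E (i - 1) (i + j) = 0" if "0 < i"
          unfolding E_def by (rule sum.neutral) (use False that in \<open>auto simp: c0_def\<close>)
        with False show ?thesis by (simp add: q_def)
      qed
      have "E i (i + j) = (if 0 < i then E (i - 1) (i + j) else 0) + c0 i j"
        by (cases i) (simp_all add: E_def)
      then show ?thesis using i j by (simp add: P Q c0_def)
    qed
    have "bihom (Suc n) (Suc a) c x1 x2 y1 y2 = (\<Sum>i\<le>Suc n. \<Sum>j\<le>Suc a. p i j * m i j - q i j * m i j)"
      unfolding bihom_def m_def[symmetric]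
      by (intro sum.cong refl) (simp add: coef left_diff_distrib)
    then have "bihom (Suc n) (Suc a) c x1 x2 y1 y2
        = x1 * y2 * bihom n a d x1 x2 y1 y2 - x2 * y1 * bihom n a d x1 x2 y1 y2"
      unfolding 1 2 by (simp only: sum_subtractf)
    then show ?thesis by (simp add: left_diff_distrib)
  qed
  then show ?thesis by blast
qed

text \<open>The linear functional on polynomials that takes \<open>x\<^sup>i\<close> to \<open>c i\<close>. With the
  rows of \<open>g\<close> read as linear polynomials, the action of \<open>g\<close> on a symmetric tensor becomes its evaluation at
  a product of rows.\<close>

definition coeff_functional :: "(nat \<Rightarrow> 'k::field) \<Rightarrow> 'k poly \<Rightarrow> 'k"
  where "coeff_functional c p = (\<Sum>i\<le>degree p. coeff p i * c i)"

lemma coeff_functional_eq: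
  assumes "degree p \<le> N" shows "coeff_functional c p = (\<Sum>i\<le>N. coeff p i * c i)"
  unfolding coeff_functional_def
  by (rule sum.mono_neutral_left) (use assms in \<open>auto simp: coeff_eq_0\<close>)

lemma coeff_functional_add: "coeff_functional c (p + q) = coeff_functional c p + coeff_functional c q"
proof -
  define N where "N = max (degree p) (degree q)"
  have "degree p \<le> N" "degree q \<le> N" "degree (p + q) \<le> N" by (auto simp: N_def degree_add_le)
  then show ?thesis by (simp add: coeff_functional_eq[of _ N] distrib_right sum.distrib)
qed

lemma coeff_functional_smult: "coeff_functional c (smult x p) = x * coeff_functional c p"
  by (simp add: coeff_functional_eq[OF degree_smult_le] coeff_functional_eq[of p "degree p"] sum_distrib_left mult.assoc)

lemma coeff_functional_zero [simp]: "coeff_functional c 0 = 0"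
  by (simp add: coeff_functional_def)

lemma coeff_functional_sum: "coeff_functional c (\<Sum>i\<in>A. p i) = (\<Sum>i\<in>A. coeff_functional c (p i))"
  by (induction A rule: infinite_finite_induct) (simp_all add: coeff_functional_add)

lemma coeff_functional_pCons: "coeff_functional c (pCons x p) = x * c 0 + coeff_functional (\<lambda>i. c (Suc i)) p"
proof -
  have "coeff_functional c (pCons x p) = (\<Sum>i\<le>Suc (degree p). coeff (pCons x p) i * c i)"
    by (rule coeff_functional_eq[OF degree_pCons_le])
  then show ?thesis by (simp add: sum.atMost_Suc_shift coeff_functional_def del: sum.atMost_Suc)
qed

lemma coeff_functional_mult:
  "coeff_functional c (p * q) = coeff_functional (\<lambda>i. coeff_functional (\<lambda>j. c (i + j)) q) p"
proof (induction p arbitrary: c rule: pCons_induct)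
  case (pCons x p)
  have "coeff_functional c (pCons x p * q)
      = x * coeff_functional c q + coeff_functional (\<lambda>i. c (Suc i)) (p * q)"
    by (simp add: coeff_functional_add coeff_functional_smult coeff_functional_pCons)
  then show ?case by (simp add: pCons.IH coeff_functional_pCons)
qed simp

definition row_poly :: "'k::field ^ 2 ^ 2 \<Rightarrow> 2 \<Rightarrow> 'k poly"
  where "row_poly g i = [:g $ i $ 1, g $ i $ 2:]"

lemma tensor_act_count:
  "tensor_act g (\<lambda>u. c (count_list u 2)) w = coeff_functional c (prod_list (map (row_poly g) w))"
proof (induction w arbitrary: c)
  case Nil then show ?case by (simp add: coeff_functional_def)
next
  case (Cons i w)
  have l: "lder 1 (\<lambda>u. c (count_list u 2)) = (\<lambda>u. c (count_list u 2))"
    "lder 2 (\<lambda>u. c (count_list u 2)) = (\<lambda>u. c (Suc (count_list u 2)))" by (simp_all add: lder_def)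
  show ?case
    by (simp add: tensor_act_Cons sum_2 l Cons.IH[of c] Cons.IH[of "\<lambda>i. c (Suc i)"] row_poly_def
        coeff_functional_add coeff_functional_smult coeff_functional_pCons)
qed

lemma tensor_act_two_counts:
  assumes "p \<le> length w"
  shows "tensor_act g (\<lambda>u. H (count_list (take p u) 2) (count_list (drop p u) 2)) w
    = coeff_functional (\<lambda>i. coeff_functional (H i) (prod_list (map (row_poly g) (drop p w))))
        (prod_list (map (row_poly g) (take p w)))"
  using assms
proof (induction p arbitrary: w H)
  case 0
  then show ?case using tensor_act_count[of g "H 0" w] by (simp add: coeff_functional_def)
next
  case (Suc p)
  then obtain i w' where w: "w = i # w'" "p \<le> length w'" by (cases w) auto
  have l: "lder 1 (\<lambda>u. H (count_list (take (Suc p) u) 2) (count_list (drop (Suc p) u) 2))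
      = (\<lambda>u. H (count_list (take p u) 2) (count_list (drop p u) 2))"
    "lder 2 (\<lambda>u. H (count_list (take (Suc p) u) 2) (count_list (drop (Suc p) u) 2))
      = (\<lambda>u. H (Suc (count_list (take p u) 2)) (count_list (drop p u) 2))" by (simp_all add: lder_def)
  show ?case
    by (simp add: w(1) tensor_act_Cons sum_2 l Suc.IH[OF w(2), of H] Suc.IH[OF w(2), of "\<lambda>i. H (Suc i)"]
        row_poly_def coeff_functional_add coeff_functional_smult coeff_functional_pCons)
qed

lemma prod_row_poly:
  "prod_list (map (row_poly g) w) = row_poly g 1 ^ (length w - count_list w 2) * row_poly g 2 ^ count_list w 2"
proof (induction w)
  case (Cons i w)
  have "count_list w 2 \<le> length w" by (rule count_le_length)
  then show ?case using exhaust_2[of i] by (auto simp: Cons.IH Suc_diff_le mult_ac)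
qed simp

lemma degree_row_poly_power: "degree (row_poly g i ^ n) \<le> n"
proof -
  have "degree (row_poly g i) \<le> 1" by (simp add: row_poly_def degree_pCons_le)
  then show ?thesis using degree_power_le[of "row_poly g i" n] by (metis mult_le_mono1 mult_1 order_trans)
qed

definition homog :: "nat \<Rightarrow> (nat \<Rightarrow> 'k::field) \<Rightarrow> 'k \<Rightarrow> 'k \<Rightarrow> 'k"
  where "homog n c x1 x2 = (\<Sum>i\<le>n. c i * (x1 ^ (n - i) * x2 ^ i))"

lemma bihom_homog: "bihom n a c x1 x2 y1 y2 = homog n (\<lambda>i. homog a (c i) y1 y2) x1 x2"
  unfolding bihom_def homog_def sum_distrib_right
  by (intro sum.cong refl) (simp add: mult_ac)

lemma homog_linear: "homog n (\<lambda>i. c i + d i) x1 x2 = homog n c x1 x2 + homog n d x1 x2"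
  "homog n (\<lambda>i. x * c i) x1 x2 = x * homog n c x1 x2"
  by (simp_all add: homog_def distrib_right sum.distrib sum_distrib_left mult.assoc)

lemma homog_coeff_functional:
  "homog n (\<lambda>i. coeff_functional (\<lambda>j. c j i) p) x1 x2 = coeff_functional (\<lambda>j. homog n (c j) x1 x2) p"
  unfolding homog_def coeff_functional_def sum_distrib_left sum_distrib_right
  by (subst sum.swap) (simp add: mult.assoc)

lemma linear_power_expand:
  "(smult x1 P + smult x2 Q) ^ n = (\<Sum>l\<le>n. smult (of_nat (n choose l) * (x2 ^ l * x1 ^ (n - l))) (P ^ (n - l) * Q ^ l))"
  for P Q :: "'k::field poly"
proof -
  have "(smult x2 Q + smult x1 P) ^ n = (\<Sum>l\<le>n. of_nat (n choose l) * (smult x2 Q) ^ l * (smult x1 P) ^ (n - l))"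
    by (rule binomial_ring)
  also have "\<dots> = (\<Sum>l\<le>n. smult (of_nat (n choose l) * (x2 ^ l * x1 ^ (n - l))) (P ^ (n - l) * Q ^ l))"
    by (intro sum.cong refl) (simp add: smult_power of_nat_poly mult_ac)
  finally show ?thesis by (simp add: add.commute)
qed

lemma row_of_product:
  "[:x1 * g $ 1 $ 1 + x2 * g $ 2 $ 1, x1 * g $ 1 $ 2 + x2 * g $ 2 $ 2:] = smult x1 (row_poly g 1) + smult x2 (row_poly g 2)"
  by (simp add: row_poly_def)

lemma linear_power_row:
  "[:x1 * g $ 1 $ 1 + x2 * g $ 2 $ 1, x1 * g $ 1 $ 2 + x2 * g $ 2 $ 2:] ^ n
    = (\<Sum>l\<le>n. smult (coeff ([:x1, x2:] ^ n) l) (row_poly g 1 ^ (n - l) * row_poly g 2 ^ l))"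
  unfolding row_of_product linear_power_expand
  by (intro sum.cong refl) (simp add: coeff_linear_poly_power mult.assoc)

subsection \<open>Binomial coefficients modulo two\<close>

lemma even_binomial_power_two:
  assumes "0 < i" "i < 2 ^ k" shows "even ((2 ^ k :: nat) choose i)"
proof (rule ccontr)
  assume odd: "odd ((2 ^ k :: nat) choose i)"
  have "i * (2 ^ k choose i) = 2 ^ k * ((2 ^ k - 1) choose (i - 1))"
    using times_binomial_minus1_eq[OF assms(1), of "2 ^ k"] by simp
  then have "2 ^ k dvd i * ((2 ^ k :: nat) choose i)" by simp
  moreover have "coprime (2 ^ k) ((2 ^ k :: nat) choose i)" using odd by simp
  ultimately have "(2 :: nat) ^ k dvd i" by (simp add: coprime_dvd_mult_left_iff)
  with assms show False by (auto dest: dvd_imp_le)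
qed

text \<open>Neighbouring coefficients add up to an even coefficient in the row \<open>2\<^sup>k\<close>.\<close>

lemma odd_binomial_steinberg: "i \<le> 2 ^ k - 1 \<Longrightarrow> odd ((2 ^ k - 1 :: nat) choose i)"
proof (induction i)
  case (Suc i)
  define n :: nat where "n = 2 ^ k - 1"
  have n: "Suc n = 2 ^ k" by (simp add: n_def)
  have "Suc n choose Suc i = (n choose i) + (n choose Suc i)" by simp
  moreover have "even (Suc n choose Suc i)"
    unfolding n by (rule even_binomial_power_two) (use Suc.prems in simp_all)
  moreover have "odd (n choose i)" using Suc by (simp add: n_def)
  ultimately show ?case by (simp add: n_def)
qed simp

lemma binomial_steinberg_char_two:
  assumes char2: "CHAR('k::field) = 2" and "i \<le> 2 ^ k - 1"
  shows "of_nat ((2 ^ k - 1) choose i) = (1 :: 'k)"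
proof -
  obtain m where m: "(2 ^ k - 1 :: nat) choose i = 2 * m + 1" using odd_binomial_steinberg[OF assms(2)] by (rule oddE)
  have "(2 :: 'k) = 0" using of_nat_CHAR[where 'a = 'k] char2 by simp
  then show ?thesis unfolding m by simp
qed

context
  assumes inf: "infinite (UNIV :: 'k::field set)"
begin

lemma homog_eq_coeff:
  fixes c d :: "nat \<Rightarrow> 'k"
  assumes "\<And>x1 x2. homog n c x1 x2 = homog n d x1 x2" "i \<le> n" shows "c i = d i"
proof -
  have "c i - d i = 0"
  proof (rule scalar_polynomial_zero[OF inf _ assms(2)])
    fix u :: 'k
    show "(\<Sum>i\<le>n. u ^ i * (c i - d i)) = 0"
      using assms(1)[of 1 u] by (simp add: homog_def right_diff_distrib sum_subtractf mult.commute)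
  qed
  then show ?thesis by simp
qed

lemma bihom_zero_coeff:
  fixes c :: "nat \<Rightarrow> nat \<Rightarrow> 'k"
  assumes "\<And>u w. u \<noteq> w \<Longrightarrow> bihom n a c 1 u 1 w = 0" and ij: "i \<le> n" "j \<le> a"
  shows "c i j = 0"
proof (rule scalar_polynomial_zero[OF inf _ ij(1), where a = "\<lambda>i. c i j"])
  fix u :: 'k
  have inf': "infinite {w :: 'k. w \<noteq> u}"
  proof -
    have "{w :: 'k. w \<noteq> u} = UNIV - {u}" by auto
    then show ?thesis using inf by simp
  qed
  show "(\<Sum>i\<le>n. u ^ i * c i j) = 0"
  proof (rule scalar_polynomial_zero[OF inf' _ ij(2), where a = "\<lambda>j. \<Sum>i\<le>n. u ^ i * c i j"])
    fix w assume "w \<in> {w. w \<noteq> u}"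
    then have "u \<noteq> w" by auto
    from assms(1)[OF this] have "(\<Sum>j\<le>a. \<Sum>i\<le>n. c i j * (u ^ i * w ^ j)) = 0"
      unfolding bihom_def by (subst (asm) sum.swap) simp
    then show "(\<Sum>j\<le>a. w ^ j * (\<Sum>i\<le>n. u ^ i * c i j)) = 0"
      by (simp add: sum_distrib_left mult_ac)
  qed
qed

lemma bihom_eq_coeff:
  fixes c d :: "nat \<Rightarrow> nat \<Rightarrow> 'k"
  assumes eq: "\<And>g. invertible g \<Longrightarrow> bihom_at n a c g = bihom_at n a d g" and ij: "i \<le> n" "j \<le> a"
  shows "c i j = d i j"
proof -
  have "(\<lambda>i j. c i j - d i j) i j = 0"
  proof (rule bihom_zero_coeff[OF _ ij])
    fix u w :: 'k assume "u \<noteq> w"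
    then have "invertible (mat2 1 u 1 w)" by (simp add: invertible_mat2)
    from eq[OF this] have "bihom n a c 1 u 1 w = bihom n a d 1 u 1 w" by simp
    then show "bihom n a (\<lambda>i j. c i j - d i j) 1 u 1 w = 0"
      by (simp add: bihom_def left_diff_distrib sum_subtractf)
  qed
  then show ?thesis by simp
qed

text \<open>Moving \<open>g\<close> along a line of matrices that meets the singular ones only finitely often.\<close>

lemma bihom_identity_extend:
  fixes c c' :: "nat \<Rightarrow> nat \<Rightarrow> 'k"
  assumes eq: "\<And>g. invertible g \<Longrightarrow> bihom_at n a c' g = K * bihom_at n a c (g ** h)"
  shows "bihom_at n a c' g = K * bihom_at n a c (g ** h)"
proof -
  define D where "D = bihom n a (\<lambda>i j. [:c' i j:]) [:g $ 1 $ 1, 1:] [:g $ 1 $ 2:] [:g $ 2 $ 1:] [:g $ 2 $ 2, 1:]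
    - smult K (bihom n a (\<lambda>i j. [:c i j:]) [:(g ** h) $ 1 $ 1, h $ 1 $ 1:] [:(g ** h) $ 1 $ 2, h $ 1 $ 2:]
        [:(g ** h) $ 2 $ 1, h $ 2 $ 1:] [:(g ** h) $ 2 $ 2, h $ 2 $ 2:])"
  define q where "q = [:g $ 1 $ 1 * g $ 2 $ 2 - g $ 1 $ 2 * g $ 2 $ 1, g $ 1 $ 1 + g $ 2 $ 2, 1:]"
  have "q \<noteq> 0" by (simp add: q_def)
  then have "finite {t. poly q t = 0}" by (rule poly_roots_finite)
  then have infq: "infinite {t. poly q t \<noteq> 0}"
  proof -
    have "{t. poly q t \<noteq> 0} = UNIV - {t. poly q t = 0}" by auto
    then show ?thesis using inf \<open>finite {t. poly q t = 0}\<close> by simp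
  qed
  have "poly D t = 0" if t: "poly q t \<noteq> 0" for t
  proof -
    define gt where "gt = mat2 (g $ 1 $ 1 + t) (g $ 1 $ 2) (g $ 2 $ 1) (g $ 2 $ 2 + t)"
    have "invertible gt" using t by (simp add: gt_def invertible_mat2 q_def algebra_simps)
    from eq[OF this] have "bihom_at n a c' gt = K * bihom_at n a c (gt ** h)" .
    moreover have "(gt ** h) $ i $ j = (g ** h) $ i $ j + t * h $ i $ j" for i j
      using exhaust_2[of i] by (auto simp: gt_def matrix_matrix_mult_def sum_2 algebra_simps)
    ultimately show ?thesis by (simp add: D_def bihom_poly gt_def)
  qed
  then have "{t. poly q t \<noteq> 0} \<subseteq> {t. poly D t = 0}" by auto
  then have "D = 0" using infq poly_roots_finite finite_subset by blast
  then have "poly D 0 = 0" by simp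
  then show ?thesis by (simp add: D_def bihom_poly)
qed

subsection \<open>Weight functionals as polynomials\<close>

text \<open>The first row of \<open>g\<close> contributes the degree \<open>m1\<close> exactly on the component of weight \<open>(m1, m2)\<close>, as left
  multiplication of \<open>g\<close> by the torus shows.\<close>

lemma weight_functional_bihom:
  fixes Y :: "('k ^ 2 ^ 2, 'k, 'x) rep"
  assumes Y: "polynomial_rep r Y" and y: "y \<in> vecs Y" and \<psi>: "linfun \<psi>" and r: "r = m1 + m2"
  shows "\<exists>c. \<forall>g. invertible g \<longrightarrow> \<psi> (weight_part Y r (act Y g y) m1) = bihom_at m1 m2 c g"
proof -
  note rep = polynomial_rep_is_rep[OF Y]
  from polynomial_rep_expand[OF Y y] obtain \<xi> where \<xi>: "(\<forall>q. \<xi> q \<in> vecs Y) \<and>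
    (\<forall>g\<in>carrier GL2. act Y g y = (\<Sum>q\<in>monomial_index r. fscale (entry_monomial g q) (\<xi> q)))" ..
  define rdeg :: "nat \<times> nat \<times> nat \<times> nat \<Rightarrow> nat" where "rdeg = (\<lambda>(i, j, k, l). i + j)"
  define c where "c i j = \<psi> (\<xi> (m1 - i, i, m2 - j, j))" for i j
  have "\<psi> (weight_part Y r (act Y g y) m1) = bihom_at m1 m2 c g" if g: "invertible g" for g
  proof -
    have gc: "g \<in> carrier GL2" using g by simp
    have gy: "act Y g y \<in> vecs Y" by (rule rep_act_mem[OF rep gc y])
    have "weight_part Y r (act Y g y) m1 = (\<Sum>q\<in>{q \<in> monomial_index r. rdeg q = m1}. fscale (entry_monomial g q) (\<xi> q))"
    proof (rule weight_part_eqI[OF inf Y gy, where u = "\<lambda>J. \<Sum>q\<in>{q \<in> monomial_index r. rdeg q = J}. fscale (entry_monomial g q) (\<xi> q)"])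
      fix s :: 'k assume s: "s \<noteq> 0"
      have tc: "torus s 1 \<in> carrier GL2" by (rule torus_carrier[OF s]) simp
      have "torus s 1 ** g \<in> carrier GL2" using tc g by (simp add: invertible_mult)
      then have "act Y (torus s 1 ** g) y = (\<Sum>q\<in>monomial_index r. fscale (entry_monomial (torus s 1 ** g) q) (\<xi> q))"
        using \<xi> by blast
      moreover have "act Y (torus s 1 ** g) y = act Y (torus s 1) (act Y g y)"
        using rep tc gc y unfolding is_rep_def by (metis mult_GL2)
      moreover have "entry_monomial (torus s 1 ** g) q = s ^ rdeg q * entry_monomial g q" for q
        by (cases q) (simp add: entry_monomial_def rdeg_def matrix_matrix_mult_def sum_2 power_mult_distrib power_add mult_ac)
      ultimately have "act Y (torus s 1) (act Y g y)
          = (\<Sum>q\<in>monomial_index r. fscale (s ^ rdeg q) (fscale (entry_monomial g q) (\<xi> q)))" by simp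
      also have "\<dots> = (\<Sum>J\<le>r. \<Sum>q\<in>{q \<in> monomial_index r. rdeg q = J}. fscale (s ^ rdeg q) (fscale (entry_monomial g q) (\<xi> q)))"
        by (rule sum.group[OF finite_monomial_index, symmetric]) (auto simp: monomial_index_def rdeg_def)
      also have "\<dots> = (\<Sum>J\<le>r. fscale (s ^ J) (\<Sum>q\<in>{q \<in> monomial_index r. rdeg q = J}. fscale (entry_monomial g q) (\<xi> q)))"
        unfolding fs.scale_sum_right by (intro sum.cong refl) simp
      finally show "act Y (torus s 1) (act Y g y)
        = (\<Sum>J\<le>r. fscale (s ^ J) (\<Sum>q\<in>{q \<in> monomial_index r. rdeg q = J}. fscale (entry_monomial g q) (\<xi> q)))" .
    qed (simp add: r)
    then have "\<psi> (weight_part Y r (act Y g y) m1)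
        = (\<Sum>q\<in>{q \<in> monomial_index r. rdeg q = m1}. entry_monomial g q * \<psi> (\<xi> q))"
      by (simp add: linfun_sum[OF \<psi>] linfun_scale[OF \<psi>])
    also have "\<dots> = (\<Sum>(i, j)\<in>{..m1} \<times> {..m2}. entry_monomial g (m1 - i, i, m2 - j, j) * c i j)"
      by (rule sum.reindex_bij_witness[where j = "\<lambda>(i, j, k, l). (j, l)" and i = "\<lambda>(i, j). (m1 - i, i, m2 - j, j)"])
         (auto simp: monomial_index_def rdeg_def r c_def)
    also have "\<dots> = bihom_at m1 m2 c g"
      by (simp add: sum.cartesian_product[symmetric] bihom_def entry_monomial_def mult_ac)
    finally show ?thesis .
  qed
  then show ?thesis by blast
qed

text \<open>If all weights are bounded by \<open>l1\<close>, the polynomial vanishes to order \<open>l2\<close> along the matrices with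
  proportional rows: for rows \<open>(1, u)\<close> and \<open>(1, u + t)\<close> the matrix factors through \<open>torus 1 t\<close>, which acts
  by powers of \<open>t\<close> with exponent at least \<open>l2\<close>. So \<open>det ^ l2\<close> can be split off, one factor at a time.\<close>

lemma weight_functional_det_bihom:
  fixes Y :: "('k ^ 2 ^ 2, 'k, 'x) rep"
  assumes Y: "polynomial_rep (l1 + l2) Y" and y: "y \<in> vecs Y" and \<psi>: "linfun \<psi>"
    and bound: "\<And>\<mu>. is_weight Y \<mu> \<Longrightarrow> fst \<mu> \<le> l1" and l1: "l1 = n + a + l2" and "k \<le> l2"
  shows "\<exists>c. \<forall>g. invertible g \<longrightarrow> \<psi> (weight_part Y (l1 + l2) (act Y g y) (n + l2))
    = det g ^ k * bihom_at (n + (l2 - k)) (a + (l2 - k)) c g"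
  using \<open>k \<le> l2\<close>
proof (induction k)
  case 0
  from weight_functional_bihom[OF Y y \<psi>, of "n + l2" "a + l2"] show ?case by (simp add: l1 add_ac)
next
  case (Suc k)
  define r where "r = l1 + l2"
  note Y = Y[folded r_def]
  note rep = polynomial_rep_is_rep[OF Y]
  define \<Psi> where "\<Psi> v = \<psi> (weight_part Y r v (n + l2))" for v
  have nr: "n + l2 \<le> r" by (simp add: r_def l1)
  have \<Psi>_add: "\<Psi> (u + v) = \<Psi> u + \<Psi> v" if "u \<in> vecs Y" "v \<in> vecs Y" for u v
    using weight_part_add[OF inf Y that nr] by (simp add: \<Psi>_def linfun_add[OF \<psi>])
  have \<Psi>_scale: "\<Psi> (fscale x v) = x * \<Psi> v" if "v \<in> vecs Y" for x v
    using weight_part_scale[OF inf Y that nr] by (simp add: \<Psi>_def linfun_scale[OF \<psi>])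
  have \<Psi>lin: "linear_between (vecs Y) UNIV (\<lambda>v. (\<lambda>_::unit. \<Psi> v))"
    unfolding linear_between_def by (auto simp: \<Psi>_add \<Psi>_scale fun_eq_iff fun_simps)
  have \<Psi>_sum: "\<Psi> (\<Sum>i\<in>A. f i) = (\<Sum>i\<in>A. \<Psi> (f i))" if "\<And>i. i \<in> A \<Longrightarrow> f i \<in> vecs Y" for A and f :: "nat \<Rightarrow> 'x \<Rightarrow> 'k"
    using fun_cong[OF linear_between_sum[OF \<Psi>lin rep_subspace[OF rep] that]] by (simp add: fun_simps)
  define n' a' where "n' = n + (l2 - Suc k)" and "a' = a + (l2 - Suc k)"
  have sz: "n + (l2 - k) = Suc n'" "a + (l2 - k) = Suc a'" using Suc.prems by (simp_all add: n'_def a'_def)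
  from Suc obtain c where "\<forall>g. invertible g \<longrightarrow> \<Psi> (act Y g y) = det g ^ k * bihom_at (Suc n') (Suc a') c g"
    unfolding \<Psi>_def r_def sz[symmetric] by auto
  then have c: "\<Psi> (act Y g y) = det g ^ k * bihom_at (Suc n') (Suc a') c g" if "invertible g" for g using that by blast
  have "bihom (Suc n') (Suc a') c 1 u 1 u = 0" for u
  proof -
    have up: "mat2 1 u 0 1 \<in> carrier (GL2 :: ('k ^ 2 ^ 2) monoid)" and lo: "mat2 1 0 1 1 \<in> carrier (GL2 :: ('k ^ 2 ^ 2) monoid)"
      by (simp_all add: invertible_mat2)
    define z where "z = act Y (mat2 1 u 0 1) y"
    have z: "z \<in> vecs Y" unfolding z_def by (rule rep_act_mem[OF rep up y])
    define b where "b j = \<Psi> (act Y (mat2 1 0 1 1) (weight_part Y r z j))" for j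
    have b0: "b j = 0" if j: "j \<le> r" "l1 < j" for j
    proof -
      have "weight_part Y r z j = 0" by (rule weight_part_bound[OF inf Y z j(1) bound j(2)])
      moreover have "act Y (mat2 1 0 1 1) 0 = 0"
        by (rule linear_between_zero[OF rep_act_linear[OF rep lo] rep_subspace[OF rep]])
      moreover have "\<Psi> 0 = 0" using \<Psi>_scale[of 0 0] fs.subspace_0[OF rep_subspace[OF rep]] by simp
      ultimately show ?thesis by (simp add: b_def)
    qed
    define R where "R = (\<Sum>j\<le>l1. monom (b j) (l1 - j))"
    define B where "B = bihom (Suc n') (Suc a') (\<lambda>i j. [:c i j:]) [:1:] [:u:] [:1:] [:u, 1:]"
    have main: "t ^ k * poly B t = t ^ l2 * poly R t" if t: "t \<noteq> 0" for t
    proof -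
      have T: "torus 1 t \<in> carrier GL2" by (rule torus_carrier) (use t in simp_all)
      have m: "mat2 1 u 1 (u + t) = mat2 1 0 1 1 ** (torus 1 t ** mat2 1 u 0 1)" by (simp add: mat2_mult)
      have "torus 1 t ** mat2 1 u 0 1 \<in> carrier GL2" using T up by (simp add: invertible_mult)
      then have "act Y (mat2 1 u 1 (u + t)) y = act Y (mat2 1 0 1 1) (act Y (torus 1 t ** mat2 1 u 0 1) y)"
        using rep lo y unfolding m is_rep_def by (metis mult_GL2)
      also have "act Y (torus 1 t ** mat2 1 u 0 1) y = act Y (torus 1 t) z"
        using rep T up y unfolding z_def is_rep_def by (metis mult_GL2)
      also have "\<dots> = (\<Sum>j\<le>r. fscale (t ^ (r - j)) (weight_part Y r z j))"
        using weight_part_sum[OF Y z _ t, of 1] by simp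
      also have "act Y (mat2 1 0 1 1) \<dots> = (\<Sum>j\<le>r. act Y (mat2 1 0 1 1) (fscale (t ^ (r - j)) (weight_part Y r z j)))"
        by (rule rep_act_sum[OF rep lo]) (rule fs.subspace_scale[OF rep_subspace[OF rep] weight_part_mem[OF Y z]])
      also have "\<dots> = (\<Sum>j\<le>r. fscale (t ^ (r - j)) (act Y (mat2 1 0 1 1) (weight_part Y r z j)))"
        by (intro sum.cong refl rep_act_scale[OF rep lo weight_part_mem[OF Y z]])
      finally have "\<Psi> (act Y (mat2 1 u 1 (u + t)) y)
          = \<Psi> (\<Sum>j\<le>r. fscale (t ^ (r - j)) (act Y (mat2 1 0 1 1) (weight_part Y r z j)))" by simp
      also have "\<dots> = (\<Sum>j\<le>r. \<Psi> (fscale (t ^ (r - j)) (act Y (mat2 1 0 1 1) (weight_part Y r z j))))"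
        by (rule \<Psi>_sum) (rule fs.subspace_scale[OF rep_subspace[OF rep] rep_act_mem[OF rep lo weight_part_mem[OF Y z]]])
      also have "\<dots> = (\<Sum>j\<le>r. t ^ (r - j) * b j)"
        by (intro sum.cong refl) (simp add: b_def \<Psi>_scale[OF rep_act_mem[OF rep lo weight_part_mem[OF Y z]]])
      also have "\<dots> = (\<Sum>j\<le>l1. t ^ (r - j) * b j)"
        by (rule sum.mono_neutral_right) (auto simp: r_def b0)
      also have "\<dots> = t ^ l2 * poly R t"
        unfolding R_def poly_sum poly_monom sum_distrib_left
      proof (intro sum.cong refl)
        fix j assume "j \<in> {..l1}"
        then have "r - j = l2 + (l1 - j)" by (simp add: r_def)
        then show "t ^ (r - j) * b j = t ^ l2 * (b j * t ^ (l1 - j))" by (simp add: power_add)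
      qed
      finally have "\<Psi> (act Y (mat2 1 u 1 (u + t)) y) = t ^ l2 * poly R t" .
      moreover have "invertible (mat2 1 u 1 (u + t))" using t by (simp add: invertible_mat2)
      ultimately show ?thesis using c[of "mat2 1 u 1 (u + t)"] by (simp add: det_mat2 B_def bihom_poly)
    qed
    define p where "p = B - monom 1 (l2 - k) * R"
    have "poly p t = 0" if t: "t \<noteq> 0" for t
    proof -
      have "t ^ k * poly B t = t ^ k * (t ^ (l2 - k) * poly R t)"
        using main[OF t] Suc.prems by (simp add: power_add[symmetric] mult.assoc[symmetric])
      then show ?thesis using t by (simp add: p_def poly_monom)
    qed
    then have "{t. t \<noteq> 0} \<subseteq> {t. poly p t = 0}" by auto
    then have "p = 0" using infinite_nonzero[OF inf] poly_roots_finite finite_subset by blast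
    then have "poly p 0 = 0" by simp
    moreover have "poly (monom 1 (l2 - k)) (0 :: 'k) = 0" using Suc.prems by (simp add: poly_monom)
    ultimately show ?thesis by (simp add: p_def B_def bihom_poly)
  qed
  from bihom_det_divide[OF inf this] obtain d where
    d: "\<forall>x1 x2 y1 y2. bihom (Suc n') (Suc a') c x1 x2 y1 y2 = (x1 * y2 - x2 * y1) * bihom n' a' d x1 x2 y1 y2" ..
  have "\<forall>g. invertible g \<longrightarrow> \<Psi> (act Y g y) = det g ^ Suc k * bihom_at n' a' d g"
    using c d by (simp add: det_2)
  then show ?case unfolding \<Psi>_def r_def n'_def a'_def by blast
qed

end

section \<open>Homomorphisms out of a module with a Weyl filtration\<close>

context
  assumes inf: "infinite (UNIV :: 'k::field set)" and char2: "CHAR('k) = 2"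
begin

text \<open>In degree \<open>2\<^sup>k - 1\<close> all binomial coefficients are odd, so the symmetric power and the divided
  power coincide: the coefficients of a polynomial, read as a symmetric tensor, transform correctly.\<close>

lemma steinberg_substitution:
  fixes c :: "nat \<Rightarrow> 'k"
  assumes n: "n = 2 ^ k - 1"
  shows "homog n c (x1 * g $ 1 $ 1 + x2 * g $ 2 $ 1) (x1 * g $ 1 $ 2 + x2 * g $ 2 $ 2)
    = homog n (\<lambda>i. coeff_functional c (row_poly g 1 ^ (n - i) * row_poly g 2 ^ i)) x1 x2"
proof -
  have bin: "of_nat (n choose i) = (1 :: 'k)" if "i \<le> n" for i
    using binomial_steinberg_char_two[OF char2, of i k] that n by simp
  have lin: "homog n c z1 z2 = coeff_functional c ([:z1, z2:] ^ n)" for z1 z2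
  proof -
    have "degree ([:z1, z2:] ^ n) \<le> n"
      using degree_power_le[of "[:z1, z2:]" n] degree_pCons_le[of z1 "[:z2:]"]
      by (metis degree_pCons_0 mult_le_mono1 mult_1 One_nat_def order_trans)
    then show ?thesis
      unfolding homog_def coeff_functional_eq[OF \<open>degree ([:z1, z2:] ^ n) \<le> n\<close>]
      by (intro sum.cong refl) (simp add: coeff_linear_poly_power bin mult_ac)
  qed
  have "homog n c (x1 * g $ 1 $ 1 + x2 * g $ 2 $ 1) (x1 * g $ 1 $ 2 + x2 * g $ 2 $ 2)
      = coeff_functional c (\<Sum>l\<le>n. smult (coeff ([:x1, x2:] ^ n) l) (row_poly g 1 ^ (n - l) * row_poly g 2 ^ l))"
    unfolding lin linear_power_row ..
  also have "\<dots> = (\<Sum>l\<le>n. coeff ([:x1, x2:] ^ n) l * coeff_functional c (row_poly g 1 ^ (n - l) * row_poly g 2 ^ l))"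
    by (simp add: coeff_functional_sum coeff_functional_smult)
  also have "\<dots> = homog n (\<lambda>i. coeff_functional c (row_poly g 1 ^ (n - i) * row_poly g 2 ^ i)) x1 x2"
    unfolding homog_def
    by (intro sum.cong refl) (simp add: coeff_linear_poly_power bin mult_ac)
  finally show ?thesis .
qed

text \<open>A polynomial of bidegree \<open>(n, a)\<close> is turned into a tensor that is symmetric in its first \<open>a\<close> and in its
  last \<open>n\<close> factors. The first variable of degree \<open>n\<close> is read as a symmetric tensor; \<open>a\<close> of its factors are
  kept (\<open>p\<close> of them are the second basis vector), and the other \<open>n - a\<close> are multiplied with the second
  variable to a polynomial of degree \<open>n\<close>, which is read as a symmetric tensor again.\<close>

definition mixed_coeff :: "nat \<Rightarrow> nat \<Rightarrow> (nat \<Rightarrow> nat \<Rightarrow> 'k) \<Rightarrow> nat \<Rightarrow> nat \<Rightarrow> 'k"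
  where "mixed_coeff n a D p l = (\<Sum>(l', j)\<in>{x \<in> {..n - a} \<times> {..a}. fst x + snd x = l}.
    of_nat ((n - a) choose l') * D (p + l') j)"

text \<open>The generating polynomial in the second index arises by pairing \<open>n - a\<close> of the symmetric factors with
  \<open>(x1, x2)\<close>.\<close>

lemma homog_mixed_coeff:
  assumes "a \<le> n"
  shows "homog n (mixed_coeff n a D p) x1 x2
    = coeff_functional (\<lambda>l. homog a (D (p + l)) x1 x2) ([:x1, x2:] ^ (n - a))"
proof -
  let ?S = "{..n - a} \<times> {..a}"
  let ?t = "\<lambda>(l', j). of_nat ((n - a) choose l') * D (p + l') j"
  have "homog n (mixed_coeff n a D p) x1 x2
      = (\<Sum>l\<le>n. \<Sum>x\<in>{x \<in> ?S. fst x + snd x = l}. ?t x * (x1 ^ (n - (fst x + snd x)) * x2 ^ (fst x + snd x)))"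
    unfolding homog_def mixed_coeff_def sum_distrib_right by (intro sum.cong refl) auto
  also have "\<dots> = (\<Sum>x\<in>?S. ?t x * (x1 ^ (n - (fst x + snd x)) * x2 ^ (fst x + snd x)))"
    by (rule sum.group) (use assms in auto)
  also have "\<dots> = (\<Sum>l'\<le>n - a. \<Sum>j\<le>a. of_nat ((n - a) choose l') * D (p + l') j * (x1 ^ (n - (l' + j)) * x2 ^ (l' + j)))"
    unfolding sum.cartesian_product by (intro sum.cong refl) auto
  also have "\<dots> = (\<Sum>l'\<le>n - a. coeff ([:x1, x2:] ^ (n - a)) l' * homog a (D (p + l')) x1 x2)"
  proof (rule sum.cong[OF refl])
    fix l' assume l': "l' \<in> {..n - a}"
    have "x1 ^ (n - (l' + j)) = x1 ^ (n - a - l') * x1 ^ (a - j)" if "j \<le> a" for j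
    proof -
      have "n - (l' + j) = (n - a - l') + (a - j)" using l' that assms by auto
      then show ?thesis by (simp add: power_add)
    qed
    then show "(\<Sum>j\<le>a. of_nat ((n - a) choose l') * D (p + l') j * (x1 ^ (n - (l' + j)) * x2 ^ (l' + j)))
        = coeff ([:x1, x2:] ^ (n - a)) l' * homog a (D (p + l')) x1 x2"
      using l' unfolding homog_def sum_distrib_left
      by (intro sum.cong refl) (simp add: coeff_linear_poly_power power_add mult_ac)
  qed
  also have "\<dots> = coeff_functional (\<lambda>l. homog a (D (p + l)) x1 x2) ([:x1, x2:] ^ (n - a))"
  proof -
    have "degree ([:x1, x2:] ^ (n - a)) \<le> n - a"
      using degree_power_le[of "[:x1, x2:]" "n - a"] degree_pCons_le[of x1 "[:x2:]"]
      by (metis degree_pCons_0 mult_le_mono1 mult_1 One_nat_def order_trans)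
    then show ?thesis by (simp add: coeff_functional_eq)
  qed
  finally show ?thesis .
qed

lemma mixed_coeff_zero: "mixed_coeff n a D 0 0 = D 0 0"
proof -
  have "{x \<in> {..n - a} \<times> {..a}. fst x + snd x = 0} = {(0, 0)}" by auto
  then show ?thesis by (simp add: mixed_coeff_def)
qed

text \<open>Each step of the construction commutes with substitutions: both readings as symmetric tensors do so by
  \<open>steinberg_substitution\<close>, since \<open>n = 2\<^sup>k - 1\<close>.\<close>

lemma mixed_coeff_transform:
  fixes D D' :: "nat \<Rightarrow> nat \<Rightarrow> 'k"
  assumes n: "n = 2 ^ k - 1" and a: "a \<le> n"
    and eq: "\<And>h. invertible h \<Longrightarrow> bihom_at n a D' h = K * bihom_at n a D (h ** g)"
    and p: "p \<le> a" and l: "l \<le> n"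
  shows "mixed_coeff n a D' p l = K * coeff_functional (\<lambda>i. coeff_functional (mixed_coeff n a D i)
      (row_poly g 1 ^ (n - l) * row_poly g 2 ^ l)) (row_poly g 1 ^ (a - p) * row_poly g 2 ^ p)"
proof -
  let ?P = "row_poly g 1" and ?Q = "row_poly g 2"
  let ?X1 = "\<lambda>x1 x2. x1 * g $ 1 $ 1 + x2 * g $ 2 $ 1" and ?X2 = "\<lambda>x1 x2. x1 * g $ 1 $ 2 + x2 * g $ 2 $ 2"
  define F where "F x1 x2 i = homog a (D i) (?X1 x1 x2) (?X2 x1 x2)" for x1 x2 i
  have step1: "homog a (D' i) x1 x2 = K * coeff_functional (F x1 x2) (?P ^ (n - i) * ?Q ^ i)"
    if i: "i \<le> n" for i x1 x2
  proof -
    have "homog n (\<lambda>i. homog a (D' i) x1 x2) z1 z2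
        = homog n (\<lambda>i. K * coeff_functional (F x1 x2) (?P ^ (n - i) * ?Q ^ i)) z1 z2" for z1 z2
    proof -
      have "bihom_at n a D' (mat2 z1 z2 x1 x2) = K * bihom_at n a D (mat2 z1 z2 x1 x2 ** g)"
        by (rule bihom_identity_extend[OF inf eq])
      then have "homog n (\<lambda>i. homog a (D' i) x1 x2) z1 z2 = K * homog n (F x1 x2) (?X1 z1 z2) (?X2 z1 z2)"
        by (simp add: bihom_homog matrix_matrix_mult_def sum_2 F_def[abs_def])
      also have "\<dots> = K * homog n (\<lambda>i. coeff_functional (F x1 x2) (?P ^ (n - i) * ?Q ^ i)) z1 z2"
        unfolding steinberg_substitution[OF n] ..
      finally show ?thesis by (simp add: homog_linear)
    qed
    from homog_eq_coeff[OF inf this i] show ?thesis .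
  qed
  have step2: "homog n (mixed_coeff n a D' p) x1 x2
      = K * coeff_functional (\<lambda>i. homog n (mixed_coeff n a D i) (?X1 x1 x2) (?X2 x1 x2)) (?P ^ (a - p) * ?Q ^ p)" for x1 x2
  proof -
    have deg: "degree ([:x1, x2:] ^ (n - a)) \<le> n - a"
      using degree_power_le[of "[:x1, x2:]" "n - a"] degree_pCons_le[of x1 "[:x2:]"]
      by (metis degree_pCons_0 mult_le_mono1 mult_1 One_nat_def order_trans)
    have "homog n (mixed_coeff n a D' p) x1 x2
        = (\<Sum>l\<le>n - a. coeff ([:x1, x2:] ^ (n - a)) l * homog a (D' (p + l)) x1 x2)"
      unfolding homog_mixed_coeff[OF a] coeff_functional_eq[OF deg] ..
    also have "\<dots> = (\<Sum>l\<le>n - a. coeff ([:x1, x2:] ^ (n - a)) l *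
        (K * coeff_functional (F x1 x2) ((?P ^ (a - p) * ?Q ^ p) * (?P ^ (n - a - l) * ?Q ^ l))))"
    proof (rule sum.cong[OF refl])
      fix l assume l: "l \<in> {..n - a}"
      have e: "n - (p + l) = (a - p) + (n - a - l)" using l p a by auto
      have "?P ^ (n - (p + l)) * ?Q ^ (p + l) = (?P ^ (a - p) * ?Q ^ p) * (?P ^ (n - a - l) * ?Q ^ l)"
        unfolding e by (simp add: power_add mult_ac)
      moreover have "p + l \<le> n" using l p a by auto
      ultimately show "coeff ([:x1, x2:] ^ (n - a)) l * homog a (D' (p + l)) x1 x2 =
        coeff ([:x1, x2:] ^ (n - a)) l *
        (K * coeff_functional (F x1 x2) ((?P ^ (a - p) * ?Q ^ p) * (?P ^ (n - a - l) * ?Q ^ l)))"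
        using step1[of "p + l"] by simp
    qed
    also have "\<dots> = K * coeff_functional (F x1 x2)
        ((?P ^ (a - p) * ?Q ^ p) * (\<Sum>l\<le>n - a. smult (coeff ([:x1, x2:] ^ (n - a)) l) (?P ^ (n - a - l) * ?Q ^ l)))"
      by (simp only: sum_distrib_left coeff_functional_sum mult_smult_right coeff_functional_smult mult.left_commute)
    also have "\<dots> = K * coeff_functional (F x1 x2) ((?P ^ (a - p) * ?Q ^ p) * [:?X1 x1 x2, ?X2 x1 x2:] ^ (n - a))"
      unfolding linear_power_row ..
    also have "\<dots> = K * coeff_functional (\<lambda>i. homog n (mixed_coeff n a D i) (?X1 x1 x2) (?X2 x1 x2)) (?P ^ (a - p) * ?Q ^ p)"
      unfolding coeff_functional_mult homog_mixed_coeff[OF a] F_def ..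
    finally show ?thesis .
  qed
  have "homog n (mixed_coeff n a D' p) x1 x2 = homog n (\<lambda>l. K * coeff_functional (\<lambda>i.
      coeff_functional (mixed_coeff n a D i) (?P ^ (n - l) * ?Q ^ l)) (?P ^ (a - p) * ?Q ^ p)) x1 x2" for x1 x2
    unfolding step2 steinberg_substitution[OF n] homog_linear homog_coeff_functional ..
  from homog_eq_coeff[OF inf this l] show ?thesis .
qed

text \<open>A homomorphism to \<open>S\<^sup>n \<otimes> S\<^sup>a\<close> is the same as a functional on a weight space. The given functional on
  the highest weight space is carried to the weight space for \<open>(n, a)\<close> along a lowering operator, which
  the Weyl filtration makes injective. With \<open>n = 2\<^sup>k - 1 \<ge> a\<close> the module \<open>S\<^sup>n \<otimes> S\<^sup>a\<close> maps to the
  tensor power of degree \<open>n + a\<close>, without changing the coefficient of the highest weight vector.\<close>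

theorem weyl_filtered_hom:
  fixes Y :: "('k ^ 2 ^ 2, 'k, 'x) rep"
  assumes Y: "polynomial_rep (l1 + l2) Y" and fil: "has_filtration Y weyl"
    and bound: "\<And>\<mu>. is_weight Y \<mu> \<Longrightarrow> fst \<mu> \<le> l1" and le: "l2 \<le> l1" and \<zeta>: "linfun \<zeta>"
  shows "\<exists>f. rep_hom GL2 Y (det_tensor (l1 - l2) l2) f \<and>
    (\<forall>v. has_weight Y (l1, l2) v \<longrightarrow> f v (replicate (l1 - l2) 1) = \<zeta> v)"
proof -
  \<comment> \<open>The largest \<open>n = 2\<^sup>k - 1\<close> below the degree leaves a rest \<open>a\<close> of at most \<open>n\<close>.\<close>
  obtain k where k: "2 ^ k \<le> Suc (l1 - l2)" "Suc (l1 - l2) < 2 ^ Suc k"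
    using ex_power_ivl1[of 2 "Suc (l1 - l2)"] by auto
  define n where "n = (2 :: nat) ^ k - 1"
  define a where "a = l1 - l2 - n"
  have na: "n + a = l1 - l2" "a \<le> n" using k by (auto simp: n_def a_def)
  have l1: "l1 = n + a + l2" using na le by simp
  define r where "r = l1 + l2"
  note Y' = Y[folded r_def]
  note rep = polynomial_rep_is_rep[OF Y']
  note sub = rep_subspace[OF rep]
  have lo: "mat2 1 0 1 1 \<in> carrier (GL2 :: ('k ^ 2 ^ 2) monoid)" by (simp add: invertible_mat2)
  have nr: "n + l2 \<le> r" by (simp add: r_def l1)
  define V where "V = {v. has_weight Y (l1, l2) v}"
  have VY: "v \<in> vecs Y" if "v \<in> V" for v using that by (simp add: V_def has_weight_def)
  have V: "fs.subspace V"
    unfolding fs.subspace_def V_def has_weight_def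
    using linear_between_zero[OF rep_act_linear[OF rep torus_carrier] sub]
    by (auto simp: fs.subspace_0[OF sub] fs.subspace_add[OF sub] fs.subspace_scale[OF sub]
        rep_act_add[OF rep torus_carrier] rep_act_scale[OF rep torus_carrier] fs.scale_right_distrib mult.commute)
  define low where "low v = weight_part Y r (act Y (mat2 1 0 1 1) v) (n + l2)" for v
  have low: "linear_between V UNIV low"
    unfolding linear_between_def low_def
    using weight_part_add[OF inf Y' rep_act_mem[OF rep lo VY] rep_act_mem[OF rep lo VY] nr]
      weight_part_scale[OF inf Y' rep_act_mem[OF rep lo VY] nr]
    by (auto simp: rep_act_add[OF rep lo VY VY] rep_act_scale[OF rep lo VY])
  have inj: "v = 0" if v: "v \<in> V" "low v = 0" for v
  proof (rule ccontr)
    assume "v \<noteq> 0"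
    moreover have "has_weight Y (l1, l2) v" using v(1) by (simp add: V_def)
    moreover have "a \<le> l1 - l2" using na by simp
    ultimately have "weight_part Y (l1 + l2) (act Y (mat2 1 0 1 1) v) (l1 - a) \<noteq> 0"
      by (intro weyl_filtration_lowering_injective[OF inf Y fil bound])
    then show False using v(2) by (simp add: low_def r_def l1)
  qed
  from functional_factor[OF low V inj \<zeta>] obtain \<psi> where "linfun \<psi> \<and> (\<forall>v\<in>V. \<psi> (low v) = \<zeta> v)" ..
  then have \<psi>: "linfun \<psi>" and \<psi>low: "\<psi> (low v) = \<zeta> v" if "v \<in> V" for v using that by auto
  define \<Psi> where "\<Psi> v = \<psi> (weight_part Y r v (n + l2))" for v
  have lin\<psi>: "linfun \<psi>" using \<open>linfun \<psi> \<and> _\<close> by blast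
  have "\<forall>y\<in>vecs Y. \<exists>c. \<forall>g. invertible g \<longrightarrow> \<Psi> (act Y g y) = det g ^ l2 * bihom_at n a c g"
  proof
    fix y assume y: "y \<in> vecs Y"
    from weight_functional_det_bihom[OF inf Y y lin\<psi> bound l1 order_refl]
    show "\<exists>c. \<forall>g. invertible g \<longrightarrow> \<Psi> (act Y g y) = det g ^ l2 * bihom_at n a c g"
      by (simp add: \<Psi>_def r_def)
  qed
  from bchoice[OF this] obtain D where
    "\<forall>y\<in>vecs Y. \<forall>g. invertible g \<longrightarrow> \<Psi> (act Y g y) = det g ^ l2 * bihom_at n a (D y) g" ..
  then have D: "\<Psi> (act Y g y) = det g ^ l2 * bihom_at n a (D y) g" if "y \<in> vecs Y" "invertible g" for y g
    using that by blast
  have \<Psi>_add: "\<Psi> (u + v) = \<Psi> u + \<Psi> v" if "u \<in> vecs Y" "v \<in> vecs Y" for u v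
    using weight_part_add[OF inf Y' that nr] by (simp add: \<Psi>_def linfun_add[OF lin\<psi>])
  have \<Psi>_scale: "\<Psi> (fscale x v) = x * \<Psi> v" if "v \<in> vecs Y" for x v
    using weight_part_scale[OF inf Y' that nr] by (simp add: \<Psi>_def linfun_scale[OF lin\<psi>])
  have det0: "det g \<noteq> 0" if "invertible g" for g :: "'k ^ 2 ^ 2" using that by (simp add: invertible_det_nz)
  have D_add: "D (u + v) i j = D u i j + D v i j" if u: "u \<in> vecs Y" and v: "v \<in> vecs Y" and ij: "i \<le> n" "j \<le> a" for u v i j
  proof (rule bihom_eq_coeff[OF inf _ ij])
    fix g :: "'k ^ 2 ^ 2" assume g: "invertible g"
    then have gc: "g \<in> carrier GL2" by simp
    have "\<Psi> (act Y g (u + v)) = \<Psi> (act Y g u) + \<Psi> (act Y g v)"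
      unfolding rep_act_add[OF rep gc u v] by (rule \<Psi>_add[OF rep_act_mem[OF rep gc u] rep_act_mem[OF rep gc v]])
    then have "det g ^ l2 * bihom_at n a (D (u + v)) g = det g ^ l2 * (bihom_at n a (D u) g + bihom_at n a (D v) g)"
      unfolding D[OF u g] D[OF v g] D[OF fs.subspace_add[OF sub u v] g] by (simp add: distrib_left)
    then show "bihom_at n a (D (u + v)) g = bihom_at n a (\<lambda>i j. D u i j + D v i j) g"
      using det0[OF g] by (simp add: bihom_def distrib_right sum.distrib)
  qed
  have D_scale: "D (fscale x v) i j = x * D v i j" if v: "v \<in> vecs Y" and ij: "i \<le> n" "j \<le> a" for x v i j
  proof (rule bihom_eq_coeff[OF inf _ ij])
    fix g :: "'k ^ 2 ^ 2" assume g: "invertible g"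
    then have gc: "g \<in> carrier GL2" by simp
    have "\<Psi> (act Y g (fscale x v)) = x * \<Psi> (act Y g v)"
      unfolding rep_act_scale[OF rep gc v] by (rule \<Psi>_scale[OF rep_act_mem[OF rep gc v]])
    then have "det g ^ l2 * bihom_at n a (D (fscale x v)) g = det g ^ l2 * (x * bihom_at n a (D v) g)"
      unfolding D[OF v g] D[OF fs.subspace_scale[OF sub v] g] by simp
    moreover have "bihom_at n a (\<lambda>i j. x * D v i j) g = x * bihom_at n a (D v) g"
      by (simp add: bihom_def sum_distrib_left mult.assoc)
    ultimately show "bihom_at n a (D (fscale x v)) g = bihom_at n a (\<lambda>i j. x * D v i j) g"
      using det0[OF g] by simp
  qed
  have D_act: "bihom_at n a (D (act Y g y)) h = det g ^ l2 * bihom_at n a (D y) (h ** g)"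
    if y: "y \<in> vecs Y" and g: "invertible g" and h: "invertible h" for y g h
  proof -
    have gc: "g \<in> carrier GL2" "h \<in> carrier GL2" using g h by auto
    have "act Y (h ** g) y = act Y h (act Y g y)" using rep gc y unfolding is_rep_def by (metis mult_GL2)
    then have "det (h ** g) ^ l2 * bihom_at n a (D y) (h ** g) = det h ^ l2 * bihom_at n a (D (act Y g y)) h"
      using D[OF y invertible_mult[OF h g]] D[OF rep_act_mem[OF rep gc(1) y] h] by simp
    then show ?thesis using det0[OF h] by (simp add: det_mul power_mult_distrib)
  qed
  have D_cong: "mixed_coeff n a D1 p l = x * mixed_coeff n a D2 p l + x' * mixed_coeff n a D3 p l"
    if "\<And>i j. i \<le> n \<Longrightarrow> j \<le> a \<Longrightarrow> D1 i j = x * D2 i j + x' * D3 i j" "p \<le> a" for D1 D2 D3 x x' p l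
  proof -
    have "D1 (p + l') j = x * D2 (p + l') j + x' * D3 (p + l') j" if "l' \<le> n - a" "j \<le> a" for l' j
      using that na \<open>p \<le> a\<close> \<open>\<And>i j. i \<le> n \<Longrightarrow> j \<le> a \<Longrightarrow> _\<close>[of "p + l'" j] by simp
    then show ?thesis
      unfolding mixed_coeff_def sum_distrib_left sum.distrib[symmetric]
      by (intro sum.cong refl) (auto simp: algebra_simps)
  qed
  define f where "f y = (\<lambda>w :: 2 list. if length w = a + n
    then mixed_coeff n a (D y) (count_list (take a w) 2) (count_list (drop a w) 2) else 0)" for y
  have cnt: "count_list (take a w) 2 \<le> a" "count_list (drop a w) 2 \<le> n" if "length w = a + n" for w :: "2 list"
    using that count_le_length[of "take a w" 2] count_le_length[of "drop a w" 2] by auto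
  have deg: "l1 - l2 = a + n" using na by simp
  have hom: "rep_hom GL2 Y (det_tensor (l1 - l2) l2) f"
  proof (rule rep_homI)
    show "f v \<in> vecs (det_tensor (l1 - l2) l2)" for v by (auto simp: f_def tensor_power_def deg)
    show "f (u + v) = f u + f v" if "u \<in> vecs Y" "v \<in> vecs Y" for u v
    proof
      fix w
      show "f (u + v) w = (f u + f v) w"
        using D_cong[of "D (u + v)" 1 "D u" 1 "D v" "count_list (take a w) 2" "count_list (drop a w) 2"]
          D_add[OF that] cnt[of w] by (simp add: f_def fun_simps)
    qed
    show "f (fscale x v) = fscale x (f v)" if "v \<in> vecs Y" for x v
    proof
      fix w
      show "f (fscale x v) w = fscale x (f v) w"
        using D_cong[of "D (fscale x v)" x "D v" 0 "D v" "count_list (take a w) 2" "count_list (drop a w) 2"]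
          D_scale[OF that] cnt[of w] by (simp add: f_def fun_simps)
    qed
    fix g :: "'k ^ 2 ^ 2" and y assume g: "g \<in> carrier GL2" and y: "y \<in> vecs Y"
    then have gi: "invertible g" by simp
    show "f (act Y g y) = act (det_tensor (l1 - l2) l2) g (f y)"
    proof
      fix w :: "2 list"
      show "f (act Y g y) w = act (det_tensor (l1 - l2) l2) g (f y) w"
      proof (cases "length w = a + n")
        case True
        let ?p = "count_list (take a w) 2" and ?l = "count_list (drop a w) 2"
        have "tensor_act g (f y) w
            = tensor_act g (\<lambda>u. mixed_coeff n a (D y) (count_list (take a u) 2) (count_list (drop a u) 2)) w"
          unfolding tensor_act_gcoeff by (rule sum.cong) (use True in \<open>auto simp: f_def\<close>)
        also have "\<dots> = coeff_functional (\<lambda>i. coeff_functional (mixed_coeff n a (D y) i)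
            (row_poly g 1 ^ (n - ?l) * row_poly g 2 ^ ?l)) (row_poly g 1 ^ (a - ?p) * row_poly g 2 ^ ?p)"
          using True by (simp add: tensor_act_two_counts prod_row_poly)
        finally have "act (det_tensor (l1 - l2) l2) g (f y) w = det g ^ l2 *
            coeff_functional (\<lambda>i. coeff_functional (mixed_coeff n a (D y) i)
            (row_poly g 1 ^ (n - ?l) * row_poly g 2 ^ ?l)) (row_poly g 1 ^ (a - ?p) * row_poly g 2 ^ ?p)"
          by (simp add: fscale_apply)
        also have "\<dots> = mixed_coeff n a (D (act Y g y)) ?p ?l"
          by (rule mixed_coeff_transform[OF n_def na(2) D_act[OF y gi] cnt[OF True], symmetric])
        finally show ?thesis using True by (simp add: f_def)
      next
        case False
        have "f y \<in> tensor_power (a + n)" by (simp add: f_def tensor_power_def)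
        then have "tensor_act g (f y) \<in> tensor_power (a + n)" by (rule tensor_act_power)
        then have "tensor_act g (f y) w = 0" using False by (simp add: tensor_power_def)
        then show ?thesis using False by (simp add: f_def fscale_apply)
      qed
    qed
  qed
  have "f v (replicate (l1 - l2) 1) = \<zeta> v" if v: "has_weight Y (l1, l2) v" for v
  proof -
    have vV: "v \<in> V" using v by (simp add: V_def)
    have vY: "v \<in> vecs Y" by (rule VY[OF vV])
    have "(\<Sum>j\<le>a. t ^ j * D v 0 j) = \<zeta> v" if t: "t \<noteq> 0" for t
    proof -
      have T: "torus 1 t \<in> carrier GL2" by (rule torus_carrier) (use t in simp_all)
      have m: "mat2 1 0 1 t = mat2 1 0 1 1 ** torus 1 t" by (simp add: mat2_mult)
      have "act Y (mat2 1 0 1 t) v = act Y (mat2 1 0 1 1) (act Y (torus 1 t) v)"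
        using rep lo T vY unfolding m is_rep_def by (metis mult_GL2)
      also have "act Y (torus 1 t) v = fscale (t ^ l2) v" using v t by (simp add: has_weight_def)
      also have "act Y (mat2 1 0 1 1) (fscale (t ^ l2) v) = fscale (t ^ l2) (act Y (mat2 1 0 1 1) v)"
        by (rule rep_act_scale[OF rep lo vY])
      finally have "\<Psi> (act Y (mat2 1 0 1 t) v) = t ^ l2 * \<zeta> v"
        using \<Psi>_scale[OF rep_act_mem[OF rep lo vY]] \<psi>low[OF vV] by (simp add: \<Psi>_def low_def)
      moreover have inv: "invertible (mat2 1 0 1 t)" using t by (simp add: invertible_mat2)
      ultimately have "t ^ l2 * bihom n a (D v) 1 0 1 t = t ^ l2 * \<zeta> v"
        using D[OF vY inv] by (simp add: det_mat2)
      then have "bihom n a (D v) 1 0 1 t = \<zeta> v" using t by simp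
      moreover have "bihom n a (D v) 1 0 1 t = (\<Sum>i\<le>n. if i = 0 then \<Sum>j\<le>a. t ^ j * D v 0 j else 0)"
        unfolding bihom_def by (intro sum.cong refl) (auto simp: mult.commute power_0_left intro!: sum.neutral)
      ultimately show ?thesis by simp
    qed
    then have "(\<Sum>j\<le>a. t ^ j * (D v 0 j - (if j = 0 then \<zeta> v else 0))) = 0" if "t \<in> {t. t \<noteq> 0}" for t
      using that by (simp add: right_diff_distrib sum_subtractf if_distrib[of "\<lambda>x. _ * x"] cong: if_cong)
    from scalar_polynomial_zero[OF infinite_nonzero[OF inf] this, of 0] have "D v 0 0 = \<zeta> v" by simp
    moreover have "count_list (replicate m (1 :: 2)) 2 = 0" for m by (induction m) auto
    ultimately show ?thesis by (simp add: f_def deg mixed_coeff_zero)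
  qed
  with hom show ?thesis by (intro exI[of _ f] conjI allI impI)
qed

end

section \<open>Contravariant duality\<close>

lemma contravariant_dual_simps:
  "vecs (contravariant_dual M) = dual_space (vecs M)"
  "act (contravariant_dual M) g \<phi> v = (if v \<in> vecs M then \<phi> (act M (transpose g) v) else 0)"
  by (simp_all add: contravariant_dual_def)

lemma dual_space_add: "\<phi> \<in> dual_space V \<Longrightarrow> u \<in> V \<Longrightarrow> v \<in> V \<Longrightarrow> \<phi> (u + v) = \<phi> u + \<phi> v"
  and dual_space_scale: "\<phi> \<in> dual_space V \<Longrightarrow> v \<in> V \<Longrightarrow> \<phi> (fscale c v) = c * \<phi> v"
  and dual_space_outside: "\<phi> \<in> dual_space V \<Longrightarrow> v \<notin> V \<Longrightarrow> \<phi> v = 0"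
  by (simp_all add: dual_space_def)

lemma dual_space_subspace: "fs.subspace (dual_space V)"
  by (auto simp: fs.subspace_def dual_space_def fun_simps algebra_simps)

lemma dual_space_zero: "\<phi> \<in> dual_space V \<Longrightarrow> fs.subspace V \<Longrightarrow> \<phi> 0 = 0"
  using dual_space_scale[of \<phi> V 0 0] fs.subspace_0[of V] by simp

lemma dual_space_diff:
  assumes "\<phi> \<in> dual_space V" "fs.subspace V" "u \<in> V" "v \<in> V"
  shows "\<phi> (u - v) = \<phi> u - \<phi> v"
  using dual_space_add[OF assms(1) fs.subspace_diff[OF assms(2,3,4)] assms(4)] by simp

lemma dual_space_sum:
  assumes \<phi>: "\<phi> \<in> dual_space V" and V: "fs.subspace V" and "\<And>i. i \<in> A \<Longrightarrow> f i \<in> V"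
  shows "\<phi> (\<Sum>i\<in>A. f i) = (\<Sum>i\<in>A. \<phi> (f i))"
  using assms(3)
proof (induction A rule: infinite_finite_induct)
  case (insert x A)
  have "(\<Sum>i\<in>A. f i) \<in> V" by (rule fs.subspace_sum[OF V]) (use insert.prems in blast)
  then show ?case using insert by (simp add: dual_space_add[OF \<phi>])
qed (simp_all add: dual_space_zero[OF \<phi> V])

lemma dual_space_cong:
  assumes "\<phi> \<in> dual_space V" "\<psi> \<in> dual_space V" "\<And>v. v \<in> V \<Longrightarrow> \<phi> v = \<psi> v"
  shows "\<phi> = \<psi>"
proof
  fix v show "\<phi> v = \<psi> v"
    using assms(3)[of v] dual_space_outside[OF assms(1)] dual_space_outside[OF assms(2)] by (cases "v \<in> V") auto
qed

lemma dual_space_separates: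
  assumes V: "fs.subspace V" and u: "u \<in> V" and w: "w \<in> V" and eq: "\<And>\<phi>. \<phi> \<in> dual_space V \<Longrightarrow> \<phi> u = \<phi> w"
  shows "u = w"
proof (rule ccontr)
  assume "u \<noteq> w"
  then have "u - w \<notin> {0}" by simp
  from functional_separates[OF fs.subspace_single_0 this] obtain g where "linfun g \<and> g (u - w) = 1 \<and> (\<forall>w\<in>{0}. g w = 0)" ..
  then have g: "linfun g" "g (u - w) = 1" by auto
  define \<phi> where "\<phi> = (\<lambda>v. if v \<in> V then g v else 0)"
  have \<phi>: "\<phi> \<in> dual_space V" unfolding \<phi>_def by (rule dual_spaceI[OF g(1) V])
  have "\<phi> (u - w) = 1" using g(2) fs.subspace_diff[OF V u w] by (simp add: \<phi>_def)
  moreover have "\<phi> (u - w) = \<phi> u - \<phi> w" by (rule dual_space_diff[OF \<phi> V u w])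
  ultimately show False using eq[OF \<phi>] by simp
qed

lemma fin_dim_dual_space:
  assumes "fin_dim V" "fs.subspace V" shows "fin_dim (dual_space V)"
proof -
  from fin_dim_dual_basis[OF assms]
  obtain B where "\<exists>G. finite B \<and> B \<subseteq> V \<and> (\<forall>b. linfun (G b)) \<and> (\<forall>v\<in>V. v = (\<Sum>b\<in>B. fscale (G b v) b))" ..
  then obtain G where BG: "finite B \<and> B \<subseteq> V \<and> (\<forall>b. linfun (G b)) \<and> (\<forall>v\<in>V. v = (\<Sum>b\<in>B. fscale (G b v) b))" ..
  then have B: "finite B" "B \<subseteq> V" by auto
  have exp: "v = (\<Sum>b\<in>B. fscale (G b v) b)" if "v \<in> V" for v
    using BG that by (elim conjE) (erule (1) bspec)
  define r where "r b = (\<lambda>v. if v \<in> V then G b v else 0)" for b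
  have "\<phi> \<in> fs.span (r ` B)" if \<phi>: "\<phi> \<in> dual_space V" for \<phi>
  proof -
    have "\<phi> = (\<Sum>b\<in>B. fscale (\<phi> b) (r b))"
    proof
      fix v show "\<phi> v = (\<Sum>b\<in>B. fscale (\<phi> b) (r b)) v"
      proof (cases "v \<in> V")
        case True
        have bV: "b \<in> V" if "b \<in> B" for b using B that by auto
        have "\<phi> v = \<phi> (\<Sum>b\<in>B. fscale (G b v) b)" using exp[OF True] by (rule arg_cong)
        also have "\<dots> = (\<Sum>b\<in>B. \<phi> (fscale (G b v) b))"
          by (rule dual_space_sum[OF \<phi> assms(2) fs.subspace_scale[OF assms(2) bV]])
        also have "\<dots> = (\<Sum>b\<in>B. \<phi> b * r b v)"
          by (rule sum.cong[OF refl]) (simp add: dual_space_scale[OF \<phi> bV] r_def True mult.commute)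
        finally show ?thesis by (simp add: fun_simps)
      next
        case False
        then show ?thesis by (simp add: fun_simps r_def dual_space_outside[OF \<phi>])
      qed
    qed
    moreover have "(\<Sum>b\<in>B. fscale (\<phi> b) (r b)) \<in> fs.span (r ` B)"
      by (intro fs.span_sum fs.span_scale fs.span_base imageI)
    ultimately show ?thesis by (rule ssubst[where P = "\<lambda>x. x \<in> fs.span (r ` B)"])
  qed
  then show ?thesis using B(1) unfolding fin_dim_def by (intro exI[of _ "r ` B"] conjI subsetI) auto
qed

lemma invertible_transpose_iff: "invertible (transpose g) \<longleftrightarrow> invertible (g :: 'k::field ^ 2 ^ 2)"
  by (simp add: invertible_det_nz det_transpose)

lemma is_rep_contravariant_dual:
  assumes M: "is_rep GL2 M" shows "is_rep GL2 (contravariant_dual M)"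
proof -
  note V = rep_subspace[OF M]
  have t: "transpose g \<in> carrier GL2" if "invertible g" for g :: "'a ^ 2 ^ 2"
    using that by (simp add: invertible_transpose_iff)
  have mem: "act (contravariant_dual M) g \<phi> \<in> dual_space (vecs M)"
    if "invertible g" "\<phi> \<in> dual_space (vecs M)" for g \<phi>
    unfolding dual_space_def contravariant_dual_simps
    using that by (auto simp: rep_act_add[OF M t] rep_act_scale[OF M t] rep_act_mem[OF M t] dual_space_add[OF that(2)]
        dual_space_scale[OF that(2)] fs.subspace_add[OF V] fs.subspace_scale[OF V])
  show ?thesis
    unfolding is_rep_def
  proof (intro conjI ballI)
    show "fs.subspace (vecs (contravariant_dual M))" by (simp add: contravariant_dual_simps dual_space_subspace)
    show "linear_between (vecs (contravariant_dual M)) (vecs (contravariant_dual M)) (act (contravariant_dual M) g)"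
      if "g \<in> carrier GL2" for g
      unfolding linear_between_def
    proof (intro conjI ballI allI)
      show "act (contravariant_dual M) g ` vecs (contravariant_dual M) \<subseteq> vecs (contravariant_dual M)"
        using mem[of g] that by (auto simp: contravariant_dual_simps)
    qed (rule ext, simp add: contravariant_dual_simps fun_simps)+
    show "act (contravariant_dual M) \<one>\<^bsub>GL2\<^esub> \<phi> = \<phi>" if "\<phi> \<in> vecs (contravariant_dual M)" for \<phi>
    proof (rule dual_space_cong[of _ "vecs M"])
      have "act M (mat 1) v = v" if "v \<in> vecs M" for v using M that unfolding is_rep_def by simp
      then show "act (contravariant_dual M) \<one>\<^bsub>GL2\<^esub> \<phi> v = \<phi> v" if "v \<in> vecs M" for v
        using that by (simp add: contravariant_dual_simps transpose_mat)
      show "act (contravariant_dual M) \<one>\<^bsub>GL2\<^esub> \<phi> \<in> dual_space (vecs M)"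
        by (rule mem) (use that in \<open>simp_all add: contravariant_dual_simps invertible_def\<close>)
      show "\<phi> \<in> dual_space (vecs M)" using that by (simp add: contravariant_dual_simps)
    qed
    fix g h :: "'a ^ 2 ^ 2" and \<phi>
    assume gh: "g \<in> carrier GL2" "h \<in> carrier GL2" and "\<phi> \<in> vecs (contravariant_dual M)"
    have "act M (transpose h ** transpose g) v = act M (transpose h) (act M (transpose g) v)" if "v \<in> vecs M" for v
      using M t gh that unfolding is_rep_def by simp
    then show "act (contravariant_dual M) (g \<otimes>\<^bsub>GL2\<^esub> h) \<phi>
        = act (contravariant_dual M) g (act (contravariant_dual M) h \<phi>)"
      using gh t by (intro ext) (simp add: contravariant_dual_simps matrix_transpose_mul rep_act_mem[OF M])
  qed
qed

lemma homogeneous_on_GL2_transpose: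
  fixes f :: "'k::field ^ 2 ^ 2 \<Rightarrow> 'k"
  assumes "homogeneous_on_GL2 r f" shows "homogeneous_on_GL2 r (\<lambda>g. f (transpose g))"
proof -
  from assms obtain c where c: "\<forall>g\<in>carrier GL2. f g = (\<Sum>e | (\<Sum>i\<in>UNIV. \<Sum>j\<in>UNIV. e i j) = r.
      c e * (\<Prod>i\<in>UNIV. \<Prod>j\<in>UNIV. (g $ i $ j) ^ e i j))"
    unfolding homogeneous_on_GL2_def ..
  define sw where "sw e = (\<lambda>i j. e j i)" for e :: "2 \<Rightarrow> 2 \<Rightarrow> nat"
  have sw: "(\<Sum>i\<in>UNIV. \<Sum>j\<in>UNIV. sw e i j) = (\<Sum>i\<in>UNIV. \<Sum>j\<in>UNIV. e i j)" for e :: "2 \<Rightarrow> 2 \<Rightarrow> nat"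
    unfolding sw_def by (rule sum.swap)
  have "f (transpose g) = (\<Sum>e | (\<Sum>i\<in>UNIV. \<Sum>j\<in>UNIV. e i j) = r.
      c (sw e) * (\<Prod>i\<in>UNIV. \<Prod>j\<in>UNIV. (g $ i $ j) ^ e i j))" if g: "g \<in> carrier GL2" for g
  proof -
    have pr: "(\<Prod>i\<in>UNIV. \<Prod>j\<in>UNIV. (transpose g $ i $ j) ^ e i j) = (\<Prod>i\<in>UNIV. \<Prod>j\<in>UNIV. (g $ i $ j) ^ sw e i j)" for e :: "2 \<Rightarrow> 2 \<Rightarrow> nat"
      unfolding sw_def by (subst prod.swap) (simp add: transpose_def)
    have "transpose g \<in> carrier GL2" using g by (simp add: invertible_transpose_iff)
    then have "f (transpose g) = (\<Sum>e | (\<Sum>i\<in>UNIV. \<Sum>j\<in>UNIV. e i j) = r.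
      c e * (\<Prod>i\<in>UNIV. \<Prod>j\<in>UNIV. (g $ i $ j) ^ sw e i j))" using c by (simp only: pr[symmetric])
    also have "\<dots> = (\<Sum>e | (\<Sum>i\<in>UNIV. \<Sum>j\<in>UNIV. e i j) = r.
      c (sw e) * (\<Prod>i\<in>UNIV. \<Prod>j\<in>UNIV. (g $ i $ j) ^ e i j))"
    proof (rule sum.reindex_bij_witness[where i = sw and j = sw])
      have ss: "sw (sw e) = e" for e :: "2 \<Rightarrow> 2 \<Rightarrow> nat" by (simp add: sw_def)
      fix e :: "2 \<Rightarrow> 2 \<Rightarrow> nat" assume e: "e \<in> {e. (\<Sum>i\<in>UNIV. \<Sum>j\<in>UNIV. e i j) = r}"
      show "sw (sw e) = e" by (rule ss)
      show "sw e \<in> {e. (\<Sum>i\<in>UNIV. \<Sum>j\<in>UNIV. e i j) = r}" using e by (simp only: mem_Collect_eq sw)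
      show "sw (sw e) = e" by (rule ss)
      show "sw e \<in> {e. (\<Sum>i\<in>UNIV. \<Sum>j\<in>UNIV. e i j) = r}" using e by (simp only: mem_Collect_eq sw)
      show "c (sw (sw e)) * (\<Prod>i\<in>UNIV. \<Prod>j\<in>UNIV. (g $ i $ j) ^ sw e i j)
        = c e * (\<Prod>i\<in>UNIV. \<Prod>j\<in>UNIV. (g $ i $ j) ^ sw e i j)" by (simp only: ss)
    qed
    finally show ?thesis .
  qed
  then show ?thesis unfolding homogeneous_on_GL2_def by (intro exI[of _ "\<lambda>e. c (sw e)"] ballI)
qed

lemma polynomial_rep_contravariant_dual:
  assumes M: "polynomial_rep r M" shows "polynomial_rep r (contravariant_dual M)"
proof -
  note rep = polynomial_rep_is_rep[OF M]
  note V = polynomial_rep_fin_dim[OF M] rep_subspace[OF rep]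
  have "homogeneous_on_GL2 r (\<lambda>g. \<Phi> (act (contravariant_dual M) g \<phi>))"
    if \<phi>: "\<phi> \<in> dual_space (vecs M)" and \<Phi>: "\<Phi> \<in> dual_space (dual_space (vecs M))" for \<phi> \<Phi>
  proof -
    have "\<exists>y\<in>vecs M. \<forall>\<phi>\<in>dual_space (vecs M). \<Phi> \<phi> = \<phi> y"
      by (rule double_dual[OF V dual_space_add[OF \<Phi>] dual_space_scale[OF \<Phi>]])
    then obtain y where y: "y \<in> vecs M" "\<forall>\<phi>\<in>dual_space (vecs M). \<Phi> \<phi> = \<phi> y" ..
    have "homogeneous_on_GL2 r (\<lambda>g. \<phi> (act M g y))" using M y(1) \<phi> unfolding polynomial_rep_def by blast
    then have "homogeneous_on_GL2 r (\<lambda>g. \<phi> (act M (transpose g) y))" by (rule homogeneous_on_GL2_transpose)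
    moreover have "\<Phi> (act (contravariant_dual M) g \<phi>) = \<phi> (act M (transpose g) y)" if "g \<in> carrier GL2" for g
    proof -
      have "act (contravariant_dual M) g \<phi> \<in> dual_space (vecs M)"
        using rep_act_mem[OF is_rep_contravariant_dual[OF rep] that, of \<phi>] \<phi> by (simp add: contravariant_dual_simps)
      with y(2) have "\<Phi> (act (contravariant_dual M) g \<phi>) = act (contravariant_dual M) g \<phi> y" by (rule bspec)
      then show ?thesis using y(1) by (simp add: contravariant_dual_simps)
    qed
    ultimately show ?thesis unfolding homogeneous_on_GL2_def by simp
  qed
  then show ?thesis
    unfolding polynomial_rep_def contravariant_dual_simps
    using is_rep_contravariant_dual[OF rep] fin_dim_dual_space[OF V] by blast
qed

text \<open>The annihilators of the submodules of a filtration, in reverse order, filter the dual, with the duals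
  of the sections as sections.\<close>

lemma has_filtration_contravariant_dual:
  fixes M :: "('k::field ^ 2 ^ 2, 'k, 'x) rep"
  assumes M: "is_rep GL2 M" and fil: "has_filtration M X"
  shows "has_filtration (contravariant_dual M) (\<lambda>\<mu>. contravariant_dual (X \<mu>))"
proof -
  define V where "V = vecs M"
  have V: "fs.subspace V" unfolding V_def by (rule rep_subspace[OF M])
  note repD = is_rep_contravariant_dual[OF M]
  from fil[unfolded has_filtration_def] obtain n where "\<exists>F. F 0 = {0} \<and> F n = vecs M \<and> (\<forall>i\<le>n. submodule GL2 M (F i)) \<and>
    (\<forall>i<n. F i \<subseteq> F (Suc i) \<and> (\<exists>\<mu>. snd \<mu> \<le> fst \<mu> \<and> quotient_iso GL2 M (F (Suc i)) (F i) (X \<mu>)))" ..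
  then obtain F where F: "F 0 = {0} \<and> F n = vecs M \<and> (\<forall>i\<le>n. submodule GL2 M (F i)) \<and>
    (\<forall>i<n. F i \<subseteq> F (Suc i) \<and> (\<exists>\<mu>. snd \<mu> \<le> fst \<mu> \<and> quotient_iso GL2 M (F (Suc i)) (F i) (X \<mu>)))" ..
  have sm: "submodule GL2 M (F i)" if "i \<le> n" for i using F that by blast
  have FV: "v \<in> V" if "v \<in> F i" "i \<le> n" for v i using sm[OF that(2)] that(1) by (auto simp: submodule_def V_def)
  have Fact: "act M g v \<in> F i" if "v \<in> F i" "i \<le> n" "g \<in> carrier GL2" for v i g
    using sm[OF that(2)] that by (auto simp: submodule_def)
  have Fsub: "fs.subspace (F i)" if "i \<le> n" for i using sm[OF that] by (simp add: submodule_def)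
  define A where "A i = {\<phi> \<in> dual_space V. \<forall>v\<in>F (n - i). \<phi> v = 0}" for i
  have A: "\<phi> \<in> dual_space V" "v \<in> F (n - i) \<Longrightarrow> \<phi> v = 0" if "\<phi> \<in> A i" for \<phi> i v
    using that by (auto simp: A_def)
  have A_sub: "fs.subspace (A i)" for i
    unfolding fs.subspace_def
  proof (intro conjI ballI allI)
    show "0 \<in> A i" using fs.subspace_0[OF dual_space_subspace, of V] by (simp add: A_def fun_simps)
    show "u + v \<in> A i" if "u \<in> A i" "v \<in> A i" for u v
      using that fs.subspace_add[OF dual_space_subspace, of u V v] by (simp add: A_def fun_simps)
    show "fscale c v \<in> A i" if "v \<in> A i" for c v
      using that fs.subspace_scale[OF dual_space_subspace, of v V c] by (simp add: A_def fun_simps)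
  qed
  have A_act: "act (contravariant_dual M) g \<phi> \<in> A i" if \<phi>: "\<phi> \<in> A i" and g: "g \<in> carrier GL2" for g \<phi> i
  proof -
    have gt: "transpose g \<in> carrier GL2" using g by (simp add: invertible_transpose_iff)
    have "act (contravariant_dual M) g \<phi> \<in> dual_space V"
      using rep_act_mem[OF repD g, of \<phi>] A(1)[OF \<phi>] by (simp add: contravariant_dual_simps V_def)
    moreover have "act (contravariant_dual M) g \<phi> v = 0" if "v \<in> F (n - i)" for v
      using A(2)[OF \<phi> Fact[OF that _ gt]] by (simp add: contravariant_dual_simps)
    ultimately show ?thesis by (simp add: A_def)
  qed
  show ?thesis
    unfolding has_filtration_def
  proof (intro exI[of _ n] exI[of _ A] conjI allI impI)
    show "A 0 = {0}"
    proof -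
      have "\<phi> = 0" if "\<phi> \<in> A 0" for \<phi>
        using A[OF that] F by (intro dual_space_cong[OF _ fs.subspace_0[OF dual_space_subspace]])
          (auto simp: V_def fun_simps)
      then show ?thesis using fs.subspace_0[OF A_sub, of 0] by auto
    qed
    show "A n = vecs (contravariant_dual M)"
      using F by (auto simp: A_def contravariant_dual_simps V_def dual_space_zero[OF _ V[unfolded V_def]])
    show "submodule GL2 (contravariant_dual M) (A i)" if "i \<le> n" for i
      unfolding submodule_def contravariant_dual_simps(1) using A_sub A_act A(1) by (auto simp: V_def)
    fix i assume i: "i < n"
    define p where "p = n - Suc i"
    have p: "p < n" "n - i = Suc p" using i by (auto simp: p_def)
    have Fpp: "F p \<subseteq> F (Suc p)" using F p(1) by blast
    then show "A i \<subseteq> A (Suc i)" by (auto simp: A_def p p_def[symmetric])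
    from F p(1) obtain \<mu> where \<mu>: "snd \<mu> \<le> fst \<mu>" "quotient_iso GL2 M (F (Suc p)) (F p) (X \<mu>)" by blast
    from \<mu>(2)[unfolded quotient_iso_def] obtain \<pi> where \<pi>: "rep_hom GL2 (subrep M (F (Suc p))) (X \<mu>) \<pi> \<and>
      \<pi> ` F (Suc p) = vecs (X \<mu>) \<and> {v \<in> F (Suc p). \<pi> v = 0} = F p" ..
    define W where "W = vecs (X \<mu>)"
    define U where "U = F (Suc p)"
    have U: "fs.subspace U" unfolding U_def by (rule Fsub) (use p in simp)
    have UV: "v \<in> V" if "v \<in> U" for v using FV[of v "Suc p"] that p by (simp add: U_def)
    have hom: "rep_hom GL2 (subrep M U) (X \<mu>) \<pi>" and onto: "\<pi> ` U = W" and ker: "{v \<in> U. \<pi> v = 0} = F p"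
      using \<pi> by (simp_all add: U_def W_def)
    have \<pi>_add: "\<pi> (u + v) = \<pi> u + \<pi> v" if "u \<in> U" "v \<in> U" for u v
      using rep_hom_add[OF hom] that by (simp add: subrep_def)
    have \<pi>_scale: "\<pi> (fscale c v) = fscale c (\<pi> v)" if "v \<in> U" for c v
      using rep_hom_scale[OF hom] that by (simp add: subrep_def)
    have \<pi>_act: "\<pi> (act M g v) = act (X \<mu>) g (\<pi> v)" if "v \<in> U" "g \<in> carrier GL2" for g v
      using rep_hom_act[OF hom] that by (simp add: subrep_def)
    have Uact: "act M g v \<in> U" if "v \<in> U" "g \<in> carrier GL2" for g v
      using Fact[of v "Suc p" g] that p by (simp add: U_def)
    define \<Theta> where "\<Theta> \<phi> = (\<lambda>f. if f \<in> W then \<phi> (inv_into U \<pi> f) else 0)" for \<phi> :: "('x \<Rightarrow> 'k) \<Rightarrow> 'k"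
    have \<pi>W: "\<pi> v \<in> W" if "v \<in> U" for v using onto that by blast
    have AS: "\<phi> v = 0" if "\<phi> \<in> A (Suc i)" "v \<in> U" "\<pi> v = 0" for \<phi> v
      using A(2)[OF that(1), of v] ker that by (auto simp: p_def)
    have \<Theta>: "\<Theta> \<phi> (\<pi> v) = \<phi> v" if \<phi>: "\<phi> \<in> A (Suc i)" and v: "v \<in> U" for \<phi> v
    proof -
      define u where "u = inv_into U \<pi> (\<pi> v)"
      have u: "u \<in> U" "\<pi> u = \<pi> v" unfolding u_def by (rule inv_into_into[OF imageI[OF v]], rule f_inv_into_f[OF imageI[OF v]])
      have "u - v \<in> U" by (rule fs.subspace_diff[OF U u(1) v])
      moreover from this have "\<pi> (u - v) + \<pi> v = \<pi> u" using \<pi>_add[of "u - v" v] v by simp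
      ultimately have "\<phi> (u - v) = 0" using AS[OF \<phi>] u(2) by simp
      then have "\<phi> u = \<phi> v" using dual_space_diff[OF A(1)[OF \<phi>] V UV[OF u(1)] UV[OF v]] by simp
      then show ?thesis using \<pi>W[OF v] by (simp add: \<Theta>_def u_def)
    qed
    have \<Theta>out: "\<Theta> \<phi> f = 0" if "f \<notin> W" for \<phi> f using that by (simp add: \<Theta>_def)
    have lift: "\<exists>v\<in>U. \<pi> v = f" if "f \<in> W" for f using onto that by blast
    have \<Theta>mem: "\<Theta> \<phi> \<in> dual_space W" if \<phi>: "\<phi> \<in> A (Suc i)" for \<phi>
      unfolding dual_space_def
    proof (intro CollectI conjI ballI allI impI)
      show "\<Theta> \<phi> (f + f') = \<Theta> \<phi> f + \<Theta> \<phi> f'" if "f \<in> W" "f' \<in> W" for f f'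
      proof -
        from lift[OF that(1)] obtain u where u: "u \<in> U" "\<pi> u = f" ..
        from lift[OF that(2)] obtain v where v: "v \<in> U" "\<pi> v = f'" ..
        have "\<Theta> \<phi> (\<pi> (u + v)) = \<phi> u + \<phi> v"
          using \<Theta>[OF \<phi> fs.subspace_add[OF U u(1) v(1)]] dual_space_add[OF A(1)[OF \<phi>] UV[OF u(1)] UV[OF v(1)]] by simp
        moreover have "\<Theta> \<phi> (\<pi> u) = \<phi> u" "\<Theta> \<phi> (\<pi> v) = \<phi> v" by (rule \<Theta>[OF \<phi> u(1)], rule \<Theta>[OF \<phi> v(1)])
        ultimately show ?thesis by (simp only: \<pi>_add[OF u(1) v(1)] u(2) v(2))
      qed
      show "\<Theta> \<phi> (fscale c f) = c * \<Theta> \<phi> f" if "f \<in> W" for c f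
      proof -
        from lift[OF that] obtain u where u: "u \<in> U" "\<pi> u = f" ..
        have "\<Theta> \<phi> (\<pi> (fscale c u)) = c * \<phi> u"
          using \<Theta>[OF \<phi> fs.subspace_scale[OF U u(1)]] dual_space_scale[OF A(1)[OF \<phi>] UV[OF u(1)]] by simp
        moreover have "\<Theta> \<phi> (\<pi> u) = \<phi> u" by (rule \<Theta>[OF \<phi> u(1)])
        ultimately show ?thesis by (simp only: \<pi>_scale[OF u(1)] u(2))
      qed
    qed (rule \<Theta>out)
    have \<Theta>hom: "rep_hom GL2 (subrep (contravariant_dual M) (A (Suc i))) (contravariant_dual (X \<mu>)) \<Theta>"
    proof (rule rep_homI)
      show "\<Theta> \<phi> \<in> vecs (contravariant_dual (X \<mu>))" if "\<phi> \<in> vecs (subrep (contravariant_dual M) (A (Suc i)))" for \<phi>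
        using that \<Theta>mem by (simp add: subrep_def contravariant_dual_simps W_def)
      show "\<Theta> (\<phi> + \<psi>) = \<Theta> \<phi> + \<Theta> \<psi>" for \<phi> \<psi> by (rule ext) (simp add: \<Theta>_def fun_simps)
      show "\<Theta> (fscale c \<phi>) = fscale c (\<Theta> \<phi>)" for c \<phi> by (rule ext) (simp add: \<Theta>_def fun_simps)
      fix g :: "'k ^ 2 ^ 2" and \<phi>
      assume g: "g \<in> carrier GL2" and "\<phi> \<in> vecs (subrep (contravariant_dual M) (A (Suc i)))"
      then have \<phi>: "\<phi> \<in> A (Suc i)" by (simp add: subrep_def)
      have gt: "transpose g \<in> carrier GL2" using g by (simp add: invertible_transpose_iff)
      have "\<Theta> (act (contravariant_dual M) g \<phi>) f = act (contravariant_dual (X \<mu>)) g (\<Theta> \<phi>) f" for f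
      proof (cases "f \<in> W")
        case True
        from lift[OF this] obtain u where u: "u \<in> U" "\<pi> u = f" ..
        have "\<Theta> (act (contravariant_dual M) g \<phi>) (\<pi> u) = \<phi> (act M (transpose g) u)"
          unfolding \<Theta>[OF A_act[OF \<phi> g] u(1)] using UV[OF u(1)] by (simp add: contravariant_dual_simps V_def)
        moreover have "\<Theta> \<phi> (\<pi> (act M (transpose g) u)) = \<phi> (act M (transpose g) u)"
          by (rule \<Theta>[OF \<phi> Uact[OF u(1) gt]])
        ultimately show ?thesis using True
          by (simp add: \<pi>_act[OF u(1) gt] u(2) contravariant_dual_simps W_def)
      next
        case False
        then show ?thesis by (simp add: \<Theta>out contravariant_dual_simps W_def)
      qed
      then show "\<Theta> (act (subrep (contravariant_dual M) (A (Suc i))) g \<phi>) = act (contravariant_dual (X \<mu>)) g (\<Theta> \<phi>)"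
        by (intro ext) (simp add: subrep_def)
    qed
    have \<Theta>onto: "\<Theta> ` A (Suc i) = vecs (contravariant_dual (X \<mu>))"
    proof
      show "\<Theta> ` A (Suc i) \<subseteq> vecs (contravariant_dual (X \<mu>))"
        using \<Theta>mem by (auto simp: contravariant_dual_simps W_def)
      show "vecs (contravariant_dual (X \<mu>)) \<subseteq> \<Theta> ` A (Suc i)"
      proof
        fix \<theta> assume "\<theta> \<in> vecs (contravariant_dual (X \<mu>))"
        then have \<theta>: "\<theta> \<in> dual_space W" by (simp add: contravariant_dual_simps W_def)
        have "\<exists>g. linfun g \<and> (\<forall>v\<in>U. g v = \<theta> (\<pi> v))"
          by (rule functional_extend[OF U])
             (simp_all add: \<pi>_add \<pi>_scale dual_space_add[OF \<theta> \<pi>W \<pi>W] dual_space_scale[OF \<theta> \<pi>W])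
        then obtain g where g: "linfun g \<and> (\<forall>v\<in>U. g v = \<theta> (\<pi> v))" ..
        define \<phi> where "\<phi> = (\<lambda>v. if v \<in> V then g v else 0)"
        have \<phi>d: "\<phi> \<in> dual_space V" unfolding \<phi>_def by (rule dual_spaceI[OF conjunct1[OF g] V])
        have \<phi>U: "\<phi> v = \<theta> (\<pi> v)" if "v \<in> U" for v using g that UV[OF that] by (simp add: \<phi>_def)
        have "0 \<in> U" by (rule fs.subspace_0[OF U])
        from \<pi>_scale[OF this, of 0] have "\<pi> 0 = 0" by simp
        then have "\<theta> 0 = 0" using dual_space_scale[OF \<theta> \<pi>W[OF \<open>0 \<in> U\<close>], of 0] by simp
        moreover have "v \<in> U \<and> \<pi> v = 0" if "v \<in> F p" for v using that unfolding ker[symmetric] by simp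
        ultimately have "\<phi> v = 0" if "v \<in> F p" for v using \<phi>U[of v] that by simp
        then have \<phi>: "\<phi> \<in> A (Suc i)" using \<phi>d by (simp add: A_def p_def[symmetric])
        have "\<theta> = \<Theta> \<phi>"
        proof (rule dual_space_cong[OF \<theta> \<Theta>mem[OF \<phi>]])
          fix f assume "f \<in> W"
          from lift[OF this] obtain u where u: "u \<in> U" "\<pi> u = f" ..
          show "\<theta> f = \<Theta> \<phi> f" using \<Theta>[OF \<phi> u(1)] \<phi>U[OF u(1)] u(2) by simp
        qed
        then show "\<theta> \<in> \<Theta> ` A (Suc i)" using \<phi> by (rule image_eqI)
      qed
    qed
    have \<Theta>ker: "{\<phi> \<in> A (Suc i). \<Theta> \<phi> = 0} = A i"
    proof (intro equalityI subsetI)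
      fix \<phi> assume "\<phi> \<in> {\<phi> \<in> A (Suc i). \<Theta> \<phi> = 0}"
      then have \<phi>: "\<phi> \<in> A (Suc i)" "\<Theta> \<phi> = 0" by auto
      have "\<phi> v = 0" if "v \<in> U" for v using \<Theta>[OF \<phi>(1) that] fun_cong[OF \<phi>(2), of "\<pi> v"] by (simp add: fun_simps)
      then show "\<phi> \<in> A i" using A(1)[OF \<phi>(1)] by (simp add: A_def p U_def)
    next
      fix \<phi> assume \<phi>: "\<phi> \<in> A i"
      then have \<phi>': "\<phi> \<in> A (Suc i)" using \<open>A i \<subseteq> A (Suc i)\<close> by blast
      have "\<Theta> \<phi> f = 0" for f
      proof (cases "f \<in> W")
        case True
        from lift[OF this] obtain u where u: "u \<in> U" "\<pi> u = f" ..
        show ?thesis using \<Theta>[OF \<phi>' u(1)] A(2)[OF \<phi>, of u] u by (simp add: p U_def)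
      qed (rule \<Theta>out)
      then have "\<Theta> \<phi> = 0" by (intro ext) (simp add: fun_simps)
      then show "\<phi> \<in> {\<phi> \<in> A (Suc i). \<Theta> \<phi> = 0}" using \<phi>' by simp
    qed
    show "\<exists>\<mu>. snd \<mu> \<le> fst \<mu> \<and> quotient_iso GL2 (contravariant_dual M) (A (Suc i)) (A i) (contravariant_dual (X \<mu>))"
      unfolding quotient_iso_def
      by (intro exI[of _ \<mu>] exI[of _ \<Theta>] conjI \<mu>(1) \<Theta>hom \<Theta>onto \<Theta>ker)
  qed
qed

text \<open>\<open>E\<^sup>\<otimes>\<^sup>m\<close> twisted by a power of the determinant is its own contravariant dual, via the form for which
  words are orthonormal; so a homomorphism from the dual of \<open>M\<close> gives one into \<open>M\<close>.\<close>

lemma dualize_hom: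
  fixes M :: "('k::field ^ 2 ^ 2, 'k, 'x) rep"
  assumes M: "is_rep GL2 M" "fin_dim (vecs M)" and h: "rep_hom GL2 (contravariant_dual M) (det_tensor m k) h"
  shows "\<exists>g. rep_hom GL2 (det_tensor m k) M g \<and>
    (\<forall>n\<in>tensor_power m. \<forall>\<phi>\<in>dual_space (vecs M). \<phi> (g n) = word_form m (h \<phi>) n)"
proof -
  define V where "V = vecs M"
  have V: "fs.subspace V" unfolding V_def by (rule rep_subspace[OF M(1)])
  have fV: "fin_dim V" unfolding V_def by (rule M(2))
  have h_add: "h (\<phi> + \<psi>) = h \<phi> + h \<psi>" if "\<phi> \<in> dual_space V" "\<psi> \<in> dual_space V" for \<phi> \<psi>
    using rep_hom_add[OF h] that by (simp add: contravariant_dual_simps V_def)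
  have h_scale: "h (fscale c \<phi>) = fscale c (h \<phi>)" if "\<phi> \<in> dual_space V" for c \<phi>
    using rep_hom_scale[OF h] that by (simp add: contravariant_dual_simps V_def)
  have "\<forall>n. \<exists>y. y \<in> V \<and> (\<forall>\<phi>\<in>dual_space V. word_form m (h \<phi>) n = \<phi> y)"
  proof
    fix n
    have "\<exists>y\<in>V. \<forall>\<phi>\<in>dual_space V. word_form m (h \<phi>) n = \<phi> y"
      by (rule double_dual[OF fV V]) (simp_all add: h_add h_scale word_form_add_left word_form_scale_left)
    then obtain y where "y \<in> V" "\<forall>\<phi>\<in>dual_space V. word_form m (h \<phi>) n = \<phi> y" ..
    then show "\<exists>y. y \<in> V \<and> (\<forall>\<phi>\<in>dual_space V. word_form m (h \<phi>) n = \<phi> y)" by (intro exI[of _ y] conjI)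
  qed
  from choice[OF this] obtain g where g: "\<forall>n. g n \<in> V \<and> (\<forall>\<phi>\<in>dual_space V. word_form m (h \<phi>) n = \<phi> (g n))" ..
  have gn: "g n \<in> V \<and> (\<forall>\<phi>\<in>dual_space V. word_form m (h \<phi>) n = \<phi> (g n))" for n using g ..
  note gV = conjunct1[OF gn]
  have gf: "\<phi> (g n) = word_form m (h \<phi>) n" if "\<phi> \<in> dual_space V" for n \<phi>
    using bspec[OF conjunct2[OF gn] that] by (rule sym)
  have "rep_hom GL2 (det_tensor m k) M g"
  proof (rule rep_homI)
    show "g n \<in> vecs M" for n using gV by (simp add: V_def)
    show "g (u + v) = g u + g v" for u v
      by (rule dual_space_separates[OF V gV fs.subspace_add[OF V gV gV]])
         (simp add: dual_space_add[OF _ gV gV] gf word_form_add_right)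
    show "g (fscale c v) = fscale c (g v)" for c v
      by (rule dual_space_separates[OF V gV fs.subspace_scale[OF V gV]])
         (simp add: dual_space_scale[OF _ gV] gf word_form_scale_right)
    fix a :: "'k ^ 2 ^ 2" and n assume a: "a \<in> carrier GL2"
    then have at: "transpose a \<in> carrier GL2" by (simp add: invertible_transpose_iff)
    show "g (act (det_tensor m k) a n) = act M a (g n)"
    proof (rule dual_space_separates[OF V gV])
      show "act M a (g n) \<in> V" using rep_act_mem[OF M(1) a, of "g n"] gV by (simp add: V_def)
      fix \<phi> assume \<phi>: "\<phi> \<in> dual_space V"
      then have \<phi>': "\<phi> \<in> vecs (contravariant_dual M)" by (simp add: contravariant_dual_simps V_def)
      define \<psi> where "\<psi> = act (contravariant_dual M) (transpose a) \<phi>"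
      have \<psi>: "\<psi> \<in> dual_space V"
        using rep_act_mem[OF is_rep_contravariant_dual[OF M(1)] at \<phi>'] by (simp add: \<psi>_def contravariant_dual_simps V_def)
      have "\<phi> (g (act (det_tensor m k) a n)) = word_form m (h \<phi>) (fscale (det a ^ k) (tensor_act a n))"
        by (simp add: gf[OF \<phi>])
      also have "\<dots> = word_form m (act (det_tensor m k) (transpose a) (h \<phi>)) n"
        by (simp add: word_form_scale_left word_form_scale_right word_form_tensor_act det_transpose transpose_transpose)
      also have "act (det_tensor m k) (transpose a) (h \<phi>) = h \<psi>"
        unfolding \<psi>_def by (rule rep_hom_act[OF h at \<phi>', symmetric])
      also have "word_form m (h \<psi>) n = \<psi> (g n)" by (rule gf[OF \<psi>, symmetric])
      also have "\<dots> = \<phi> (act M a (g n))"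
        using gV by (simp add: \<psi>_def contravariant_dual_simps V_def transpose_transpose)
      finally show "\<phi> (g (act (det_tensor m k) a n)) = \<phi> (act M a (g n))" .
    qed
  qed
  then show ?thesis using gf by (intro exI[of _ g] conjI ballI) (simp_all add: V_def)
qed

section \<open>The highest weight space of an indecomposable tilting module\<close>

lemma tensor_act_torus: "tensor_act (torus x y) f w = x ^ count_list w 1 * y ^ count_list w 2 * f w"
proof (induction w arbitrary: f)
  case Nil then show ?case by (simp add: tensor_act_gcoeff)
next
  case (Cons i w)
  then show ?case using exhaust_2[of i] by (auto simp: tensor_act_Cons sum_2 lder_def)
qed

lemma count_list_eq_length: "count_list w x = length w \<Longrightarrow> w = replicate (length w) x"
proof (induction w)
  case (Cons y w)
  have "count_list w x \<le> length w" by (rule count_le_length)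
  with Cons show ?case by (auto split: if_splits)
qed simp

lemma rep_hom_has_weight: "rep_hom GL2 M N f \<Longrightarrow> has_weight M \<mu> v \<Longrightarrow> has_weight N \<mu> (f v)"
  unfolding has_weight_def
  using rep_hom_mem[of GL2 M N f v] rep_hom_act[of GL2 M N f] rep_hom_scale[of GL2 M N f v] torus_carrier
  by metis

lemma transpose_torus: "transpose (torus x y) = torus x y"
  by (simp add: vec_eq_iff forall_2 transpose_def)

context
  assumes inf: "infinite (UNIV :: 'k::field set)"
begin

lemma det_tensor_highest_weight:
  fixes f :: "2 list \<Rightarrow> 'k"
  assumes "has_weight (det_tensor m k) (m + k, k) f"
  shows "f = fscale (f (replicate m 1)) (delta (replicate m 1))"
proof
  fix w
  have fm: "f \<in> tensor_power m" using assms by (simp add: has_weight_def)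
  show "f w = fscale (f (replicate m 1)) (delta (replicate m 1)) w"
  proof (cases "w = replicate m 1")
    case True then show ?thesis by (simp add: fscale_apply delta_def)
  next
    case False
    have "f w = 0"
    proof (rule ccontr)
      assume nz: "f w \<noteq> 0"
      then have l: "length w = m" using fm by (auto simp: tensor_power_def)
      have "s ^ (k + count_list w 1) = s ^ (m + k)" if "s \<noteq> 0" for s :: 'k
      proof -
        have "act (det_tensor m k) (torus s 1) f = fscale (s ^ (m + k) * 1 ^ k) f"
          using assms that unfolding has_weight_def by simp
        from fun_cong[OF this, of w] nz show ?thesis
          by (simp add: fscale_apply tensor_act_torus det_mat2 power_add)
      qed
      from power_eq_all[OF inf this] have "count_list w 1 = length w" using l by simp
      from count_list_eq_length[OF this] l False show False by simp
    qed
    with False show ?thesis by (simp add: fscale_apply delta_def)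
  qed
qed

lemma delta_has_weight: "has_weight (det_tensor m k) (m + k, k) (delta (replicate m 1) :: 2 list \<Rightarrow> 'k)"
proof -
  have c: "count_list (replicate m (1 :: 2)) 1 = m" "count_list (replicate m (1 :: 2)) 2 = 0"
    by (induction m) auto
  have "act (det_tensor m k) (torus x y) (delta (replicate m 1)) w
      = fscale (x ^ (m + k) * y ^ k) (delta (replicate m 1)) w" for x y :: 'k and w
    by (cases "w = replicate m 1")
       (simp_all add: fscale_apply tensor_act_torus det_mat2 delta_def c power_add power_mult_distrib mult_ac)
  then show ?thesis
    using delta_power[of "replicate m (1 :: 2)"] by (auto simp: has_weight_def)
qed

lemma weight_part_torus:
  fixes Y :: "('k ^ 2 ^ 2, 'k, 'x) rep"
  assumes Y: "polynomial_rep r Y" and v: "v \<in> vecs Y" and j: "j \<le> r" and st: "s \<noteq> 0" "t \<noteq> 0"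
  shows "weight_part Y r (act Y (torus s t) v) j = fscale (s ^ j * t ^ (r - j)) (weight_part Y r v j)"
proof (rule weight_part_eqI[OF inf Y _ _ j])
  note rep = polynomial_rep_is_rep[OF Y]
  have T: "torus s t \<in> carrier GL2" by (rule torus_carrier[OF st])
  show "act Y (torus s t) v \<in> vecs Y" by (rule rep_act_mem[OF rep T v])
  fix x :: 'k assume x: "x \<noteq> 0"
  have T': "torus x 1 \<in> carrier GL2" by (rule torus_carrier) (use x in simp_all)
  have "act Y (torus x 1) (act Y (torus s t) v) = act Y (torus x 1 ** torus s t) v"
    using rep T T' v unfolding is_rep_def by (metis mult_GL2)
  also have "torus x 1 ** torus s t = torus (x * s) t" by (simp add: mat2_mult)
  also have "act Y (torus (x * s) t) v = (\<Sum>j\<le>r. fscale ((x * s) ^ j * t ^ (r - j)) (weight_part Y r v j))"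
    by (rule weight_part_sum[OF Y v]) (use x st in simp_all)
  finally show "act Y (torus x 1) (act Y (torus s t) v)
      = (\<Sum>j\<le>r. fscale (x ^ j) (fscale (s ^ j * t ^ (r - j)) (weight_part Y r v j)))"
    by (simp add: power_mult_distrib mult.assoc)
qed

text \<open>The torus is fixed by transposition, so a module and its dual have the same weights.\<close>

lemma contravariant_dual_weight_bound:
  fixes Y :: "('k ^ 2 ^ 2, 'k, 'x) rep"
  assumes Y: "polynomial_rep r Y" and bound: "\<And>\<mu>. is_weight Y \<mu> \<Longrightarrow> fst \<mu> \<le> l"
    and \<mu>: "is_weight (contravariant_dual Y) \<mu>"
  shows "fst \<mu> \<le> l"
proof -
  note rep = polynomial_rep_is_rep[OF Y]
  note V = rep_subspace[OF rep]
  from \<mu> obtain \<phi> where \<phi>0: "\<phi> \<noteq> 0" and \<phi>w: "has_weight (contravariant_dual Y) \<mu> \<phi>"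
    unfolding is_weight_iff by auto
  have \<phi>: "\<phi> \<in> dual_space (vecs Y)" using \<phi>w by (simp add: has_weight_def contravariant_dual_simps)
  have "\<exists>y. y \<in> vecs Y \<and> \<phi> y \<noteq> 0"
  proof (rule ccontr)
    assume none: "\<not> ?thesis"
    have "\<phi> = 0"
      by (rule dual_space_cong[OF \<phi> fs.subspace_0[OF dual_space_subspace]]) (use none in \<open>auto simp: fun_simps\<close>)
    with \<phi>0 show False ..
  qed
  then obtain y where y: "y \<in> vecs Y" "\<phi> y \<noteq> 0" by auto
  have "torus 1 1 = (mat 1 :: 'k ^ 2 ^ 2)" by (simp add: vec_eq_iff forall_2 mat_def)
  then have "act Y (torus 1 1) y = y" using rep y(1) unfolding is_rep_def by simp
  then have "y = (\<Sum>j\<le>r. weight_part Y r y j)" using weight_part_sum[OF Y y(1), of 1 1] by simp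
  then have "\<phi> y = (\<Sum>j\<le>r. \<phi> (weight_part Y r y j))"
    using dual_space_sum[OF \<phi> V, of "{..r}" "weight_part Y r y"] weight_part_mem[OF Y y(1)] by simp
  with y(2) have "\<exists>j\<in>{..r}. \<phi> (weight_part Y r y j) \<noteq> 0" by (metis sum.neutral)
  then obtain j where j: "j \<le> r" "\<phi> (weight_part Y r y j) \<noteq> 0" by auto
  define u where "u = weight_part Y r y j"
  have uw: "has_weight Y (j, r - j) u" unfolding u_def by (rule weight_part_has_weight[OF inf Y y(1) j(1)])
  have uY: "u \<in> vecs Y" using uw by (simp add: has_weight_def)
  have "s ^ fst \<mu> = s ^ j" if s: "s \<noteq> 0" for s :: 'k
  proof -
    have "act (contravariant_dual Y) (torus s 1) \<phi> = fscale (s ^ fst \<mu> * 1 ^ snd \<mu>) \<phi>"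
      using \<phi>w s unfolding has_weight_def by simp
    from fun_cong[OF this, of u] have "\<phi> (act Y (torus s 1) u) = s ^ fst \<mu> * \<phi> u"
      using uY by (simp add: contravariant_dual_simps transpose_torus fscale_apply)
    moreover have "act Y (torus s 1) u = fscale (s ^ j) u" using uw s unfolding has_weight_def by simp
    ultimately show ?thesis using dual_space_scale[OF \<phi> uY] j(2) by (simp add: u_def)
  qed
  then have "fst \<mu> = j" by (rule power_eq_all[OF inf])
  moreover have "is_weight Y (j, r - j)" unfolding is_weight_iff
  proof (intro exI conjI)
    show "u \<noteq> 0" using j(2) dual_space_zero[OF \<phi> V] by (auto simp: u_def)
  qed (rule uw)
  ultimately show ?thesis using bound by fastforce
qed

text \<open>Let \<open>f\<close> come from the Weyl filtration of \<open>T\<close>, and \<open>g\<close> by duality from that of the dual of \<open>T\<close>, both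
  normalized on the highest weight space. Then \<open>g \<circ> f\<close> fixes the highest weight vector \<open>g e\<close>, hence is not
  nilpotent, hence bijective. It maps the whole highest weight space to the line of \<open>g e\<close>, so this space is
  a line.\<close>

theorem tilting_endo_scalar:
  fixes T :: "('k ^ 2 ^ 2, 'k, 'x) rep"
  assumes char2: "CHAR('k) = 2" and le: "l2 \<le> l1" and T: "indecomposable_tilting (l1, l2) T"
  shows "\<exists>v1 \<zeta> f g. endo_scalar GL2 T v1 \<zeta> \<and> rep_hom GL2 T (det_tensor (l1 - l2) l2) f \<and>
    rep_hom GL2 (det_tensor (l1 - l2) l2) T g \<and>
    f v1 = delta (replicate (l1 - l2) 1) \<and> g (delta (replicate (l1 - l2) 1)) = v1"
proof -
  define m where "m = l1 - l2"
  define r where "r = l1 + l2"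
  define e :: "2 list \<Rightarrow> 'k" where "e = delta (replicate m 1)"
  define V where "V = vecs T"
  have l1: "l1 = m + l2" using le by (simp add: m_def)
  have l1r: "l1 \<le> r" "r - l1 = l2" by (simp_all add: r_def)
  have poly: "polynomial_rep (l1 + l2) T" and ind: "indecomposable GL2 T" and wf: "has_filtration T weyl"
    and dwf: "has_filtration T dual_weyl" and hw: "highest_weight T (l1, l2)"
    using T by (simp_all add: indecomposable_tilting_def)
  note poly' = poly[folded r_def]
  note rep = polynomial_rep_is_rep[OF poly] and fd = polynomial_rep_fin_dim[OF poly]
  have V: "fs.subspace V" unfolding V_def by (rule rep_subspace[OF rep])
  have bound: "fst \<mu> \<le> l1" if "is_weight T \<mu>" for \<mu>
    using hw that unfolding highest_weight_def fst_conv by blast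
  from hw obtain v0 where v0: "v0 \<noteq> 0" "has_weight T (l1, l2) v0"
    unfolding highest_weight_def is_weight_iff by auto
  have "v0 \<notin> {0}" using v0 by simp
  from functional_separates[OF fs.subspace_single_0 this]
  obtain \<eta> where "linfun \<eta> \<and> \<eta> v0 = 1 \<and> (\<forall>w\<in>{0}. \<eta> w = 0)" ..
  then have \<eta>: "linfun \<eta>" "\<eta> v0 = 1" by auto
  \<comment> \<open>A functional of weight \<open>(l1, l2)\<close> on \<open>T\<close>: a highest weight vector of the dual.\<close>
  define \<epsilon> where "\<epsilon> = (\<lambda>v. if v \<in> V then \<eta> (weight_part T r v l1) else 0)"
  have \<epsilon>: "\<epsilon> \<in> dual_space V"
    unfolding dual_space_def \<epsilon>_def V_def
    by (auto simp: weight_part_add[OF inf poly' _ _ l1r(1)] weight_part_scale[OF inf poly' _ l1r(1)]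
        linfun_add[OF \<eta>(1)] linfun_scale[OF \<eta>(1)] fs.subspace_add[OF V[unfolded V_def]] fs.subspace_scale[OF V[unfolded V_def]])
  have "weight_part T r v0 l1 = v0"
    using weight_part_of_weight[OF inf poly', of l1 v0 l1] v0(2) l1r by simp
  moreover have "v0 \<in> V" using v0(2) by (simp add: has_weight_def V_def)
  ultimately have \<epsilon>v0: "\<epsilon> v0 = 1" by (simp add: \<epsilon>_def \<eta>)
  then have \<epsilon>0: "\<epsilon> \<noteq> 0" by (auto simp: fun_simps)
  have \<epsilon>w: "has_weight (contravariant_dual T) (l1, l2) \<epsilon>"
    unfolding has_weight_def
  proof (intro conjI allI impI)
    show "\<epsilon> \<in> vecs (contravariant_dual T)" using \<epsilon> by (simp add: contravariant_dual_simps V_def)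
    fix x y :: 'k assume xy: "x \<noteq> 0" "y \<noteq> 0"
    have "act T (torus x y) v \<in> V" if "v \<in> V" for v
      using rep_act_mem[OF rep torus_carrier[OF xy], of v] that by (simp add: V_def)
    then show "act (contravariant_dual T) (torus x y) \<epsilon> = fscale (x ^ fst (l1, l2) * y ^ snd (l1, l2)) \<epsilon>"
      using weight_part_torus[OF poly' _ l1r(1) xy]
      by (intro ext) (auto simp: contravariant_dual_simps transpose_torus fscale_apply \<epsilon>_def V_def l1r linfun_scale[OF \<eta>(1)])
  qed
  from dual_space_extend[OF V \<epsilon>] obtain \<zeta>0 where "linfun \<zeta>0 \<and> (\<forall>v\<in>V. \<zeta>0 v = \<epsilon> v)" ..
  then have \<zeta>0: "linfun \<zeta>0" "v \<in> V \<Longrightarrow> \<zeta>0 v = \<epsilon> v" for v by auto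
  from weyl_filtered_hom[OF inf char2 poly wf bound le \<zeta>0(1)]
  obtain f where f: "rep_hom GL2 T (det_tensor m l2) f"
    and fz: "\<forall>v. has_weight T (l1, l2) v \<longrightarrow> f v (replicate m 1) = \<zeta>0 v" unfolding m_def by auto
  have "\<epsilon> \<notin> {0}" using \<epsilon>0 by simp
  from functional_separates[OF fs.subspace_single_0 this]
  obtain \<zeta>' where "linfun \<zeta>' \<and> \<zeta>' \<epsilon> = 1 \<and> (\<forall>w\<in>{0}. \<zeta>' w = 0)" ..
  then have \<zeta>': "linfun \<zeta>'" "\<zeta>' \<epsilon> = 1" by auto
  have dfil: "has_filtration (contravariant_dual T) weyl"
    using has_filtration_contravariant_dual[OF rep dwf] by (simp add: weyl_def[symmetric])
  have dbound: "fst \<mu> \<le> l1" if "is_weight (contravariant_dual T) \<mu>" for \<mu>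
    by (rule contravariant_dual_weight_bound[OF poly bound that])
  from weyl_filtered_hom[OF inf char2 polynomial_rep_contravariant_dual[OF poly] dfil dbound le \<zeta>'(1)]
  obtain h where h: "rep_hom GL2 (contravariant_dual T) (det_tensor m l2) h"
    and hz: "\<forall>v. has_weight (contravariant_dual T) (l1, l2) v \<longrightarrow> h v (replicate m 1) = \<zeta>' v"
    unfolding m_def by auto
  from dualize_hom[OF rep fd h] obtain g where g: "rep_hom GL2 (det_tensor m l2) T g"
    and gh: "\<forall>n\<in>tensor_power m. \<forall>\<phi>\<in>dual_space (vecs T). \<phi> (g n) = word_form m (h \<phi>) n" by auto
  define v1 where "v1 = g e"
  have ew: "has_weight (det_tensor m l2) (l1, l2) e" unfolding e_def l1 by (rule delta_has_weight)
  have eT: "e \<in> tensor_power m" using ew by (simp add: has_weight_def)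
  have v1w: "has_weight T (l1, l2) v1" unfolding v1_def by (rule rep_hom_has_weight[OF g ew])
  have v1V: "v1 \<in> V" using v1w by (simp add: has_weight_def V_def)
  have "\<epsilon> v1 = word_form m (h \<epsilon>) e" using bspec[OF bspec[OF gh eT], of \<epsilon>] \<epsilon> by (simp add: v1_def V_def)
  also have "\<dots> = word_form m e (h \<epsilon>)" by (simp add: word_form_def mult.commute)
  also have "\<dots> = 1" using hz \<epsilon>w \<zeta>'(2) by (simp add: e_def word_form_delta)
  finally have \<epsilon>v1: "\<epsilon> v1 = 1" .
  have fw: "f v = fscale (\<epsilon> v) e" if v: "has_weight T (l1, l2) v" for v
  proof -
    have "has_weight (det_tensor m l2) (m + l2, l2) (f v)" using rep_hom_has_weight[OF f v] by (simp add: l1)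
    from det_tensor_highest_weight[OF this] have "f v = fscale (f v (replicate m 1)) e" by (simp add: e_def)
    moreover have "f v (replicate m 1) = \<epsilon> v" using fz v \<zeta>0(2)[of v] by (simp add: has_weight_def V_def)
    ultimately show ?thesis by simp
  qed
  define \<theta> where "\<theta> v = g (f v)" for v
  have \<theta>: "rep_hom GL2 T T \<theta>" unfolding \<theta>_def by (rule rep_hom_comp[OF f g])
  have \<theta>w: "\<theta> v = fscale (\<epsilon> v) v1" if v: "has_weight T (l1, l2) v" for v
    using rep_hom_scale[OF g, of e "\<epsilon> v"] eT by (simp add: \<theta>_def fw[OF v] v1_def)
  have \<theta>v1: "\<theta> v1 = v1" using \<theta>w[OF v1w] \<epsilon>v1 by simp
  have v10: "v1 \<noteq> 0" using \<epsilon>v1 dual_space_zero[OF \<epsilon> V] by auto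
  have "(\<theta> ^^ n) v1 = v1" for n by (induction n) (simp_all add: \<theta>v1)
  then have bij: "bij_betw \<theta> V V" using fitting[OF \<theta> rep fd ind] v1V v10 by (metis V_def)
  have line: "v = fscale (\<epsilon> v) v1" if v: "has_weight T (l1, l2) v" for v
  proof (rule inj_onD[OF bij_betw_imp_inj_on[OF bij]])
    show "\<theta> v = \<theta> (fscale (\<epsilon> v) v1)"
      using \<theta>w[OF v] rep_hom_scale[OF \<theta>, of v1 "\<epsilon> v"] v1V \<theta>v1 by (simp add: V_def)
    show "v \<in> V" using v by (simp add: has_weight_def V_def)
    show "fscale (\<epsilon> v) v1 \<in> V" by (rule fs.subspace_scale[OF V v1V])
  qed
  have "endo_scalar GL2 T v1 \<zeta>0"
    unfolding endo_scalar_def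
  proof (intro conjI allI impI rep fd ind \<zeta>0(1))
    show "v1 \<in> vecs T" using v1V by (simp add: V_def)
    show "\<zeta>0 v1 = 1" using \<zeta>0(2)[OF v1V] \<epsilon>v1 by simp
    fix k assume "rep_hom GL2 T T k"
    then have "has_weight T (l1, l2) (k v1)" using v1w by (rule rep_hom_has_weight)
    from line[OF this] \<zeta>0(2)[of "k v1"] this show "k v1 = fscale (\<zeta>0 (k v1)) v1"
      by (simp add: has_weight_def V_def)
  qed
  moreover have "f v1 = e" using fw[OF v1w] \<epsilon>v1 by simp
  ultimately show ?thesis
    using f g v1_def unfolding m_def e_def by (intro exI[of _ v1] exI[of _ \<zeta>0] exI[of _ f] exI[of _ g]) simp
qed

end

section \<open>Counting independent homomorphisms\<close>

lemma nonempty_count: "w \<noteq> [] \<Longrightarrow> count_list w True = 0 \<Longrightarrow> count_list w False = 0 \<Longrightarrow> False"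
  using length_two_letter_word[of w] by simp

text \<open>Words that give the same degree in the tensor algebra are never proper prefixes of one another.\<close>

lemma lex_gt_total_degree:
  "2 * count_list x True + 3 * count_list x False = 2 * count_list y True + 3 * count_list y False \<Longrightarrow>
    x \<noteq> y \<Longrightarrow> lex_gt x y \<or> lex_gt y x"
  by (induction x y rule: lex_gt.induct)
     (auto split: if_splits dest: nonempty_count nonempty_count[OF not_sym])

definition lyndon_words_for :: "nat \<Rightarrow> nat \<Rightarrow> bool list set"
  where "lyndon_words_for r m = {w. lyndon w \<and> 2 * count_list w True + 3 * count_list w False = r \<and>
    1 \<le> count_list w False \<and> m \<le> count_list w False}"

lemma finite_lyndon_words_for: "finite (lyndon_words_for r m)"
proof (rule finite_subset)
  show "lyndon_words_for r m \<subseteq> (\<Union>s\<le>r. \<Union>t\<le>r. two_letter_words s t)"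
    by (auto simp: lyndon_words_for_def two_letter_words_def)
qed simp

text \<open>The maps are indexed by a Lyndon word \<open>w\<close> and an index \<open>j\<close> for a basis of \<open>D\<^sup>\<nu>\<close>: first \<open>T \<rightarrow> E\<^sup>\<otimes>\<^sup>m\<close>,
  then the \<open>j\<close>-th Specht map, then the Lyndon map of \<open>w\<close>.\<close>

theorem lyndon_specht_independent:
  fixes T :: "('k::field ^ 2 ^ 2, 'k, 'x) rep"
  assumes inf: "infinite (UNIV :: 'k set)" and char2: "CHAR('k) = 2"
    and le: "l2 \<le> l1" and r: "l1 + l2 = r" and T: "indecomposable_tilting (l1, l2) T"
    and W: "W \<subseteq> lyndon_words_for r (l1 - l2)"
  shows "(\<Sum>w\<in>W. dim_D TYPE('k) [l1 - length w, l2 - length w])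
    \<le> ks_multiplicity GL2 (lie_power r :: ('k ^ 2 ^ 2, 'k, 2 list) rep) T"
proof -
  define m where "m = l1 - l2"
  define e :: "2 list \<Rightarrow> 'k" where "e = delta (replicate m 1)"
  define D where "D w = dim_D TYPE('k) [l1 - length w, l2 - length w]" for w :: "bool list"
  define t where "t w = count_list w False" for w
  have finW: "finite W" by (rule finite_subset[OF W finite_lyndon_words_for])
  have w: "lyndon w" "2 * count_list w True + 3 * t w = r" "1 \<le> t w" "m \<le> t w" if "w \<in> W" for w
    using W that by (auto simp: lyndon_words_for_def t_def m_def)
  from tilting_endo_scalar[OF inf char2 le T]
  obtain v1 \<zeta> f g where E: "endo_scalar GL2 T v1 \<zeta>" and f: "rep_hom GL2 T (det_tensor m l2) f"
    and g: "rep_hom GL2 (det_tensor m l2) T g" and fe: "f v1 = e" and ge: "g e = v1"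
    unfolding m_def e_def by auto
  have ew: "has_weight (det_tensor m l2) (m + l2, l2) e" unfolding e_def by (rule delta_has_weight[OF inf])
  have em: "e \<in> vecs (det_tensor m l2)" using ew by (simp add: has_weight_def)
  have v1: "v1 \<in> vecs T" and \<zeta>: "linfun \<zeta>" "\<zeta> v1 = 1" using E by (auto simp: endo_scalar_def)
  have "\<forall>w\<in>W. \<exists>F. (\<forall>j<D w. rep_hom GL2 (det_tensor m l2) (det_tensor (t w) (length w)) (F j)) \<and>
      (\<forall>\<alpha>. (\<exists>j<D w. \<alpha> j \<noteq> (0 :: 'k)) \<longrightarrow>
        (\<exists>G. rep_hom GL2 (det_tensor (t w) (length w)) (det_tensor m l2) G \<and>
          G (\<Sum>j<D w. fscale (\<alpha> j) (F j e)) (replicate m 1) \<noteq> 0))"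
  proof
    fix w assume wW: "w \<in> W"
    have "length w \<le> l2" and tw: "l1 + l2 = 2 * length w + t w"
      using w(2,4)[OF wW] le r length_two_letter_word[of w] by (auto simp: t_def m_def)
    then have n: "l2 - length w \<le> l1 - length w" "(l1 - length w) - (l2 - length w) = m"
        "(l1 - length w) + (l2 - length w) = t w" "(l2 - length w) + length w = l2"
      using le by (auto simp: m_def)
    from specht_homs_independent[OF char2 n(1), of "length w"]
    show "\<exists>F. (\<forall>j<D w. rep_hom GL2 (det_tensor m l2) (det_tensor (t w) (length w)) (F j)) \<and>
      (\<forall>\<alpha>. (\<exists>j<D w. \<alpha> j \<noteq> (0 :: 'k)) \<longrightarrow>
        (\<exists>G. rep_hom GL2 (det_tensor (t w) (length w)) (det_tensor m l2) G \<and>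
          G (\<Sum>j<D w. fscale (\<alpha> j) (F j e)) (replicate m 1) \<noteq> 0))"
      unfolding n(2-4) D_def[symmetric] e_def .
  qed
  from bchoice[OF this] obtain F where F: "\<forall>w\<in>W. (\<forall>j<D w. rep_hom GL2 (det_tensor m l2) (det_tensor (t w) (length w)) (F w j)) \<and>
      (\<forall>\<alpha>. (\<exists>j<D w. \<alpha> j \<noteq> (0 :: 'k)) \<longrightarrow>
        (\<exists>G. rep_hom GL2 (det_tensor (t w) (length w)) (det_tensor m l2) G \<and>
          G (\<Sum>j<D w. fscale (\<alpha> j) (F w j e)) (replicate m 1) \<noteq> 0))" ..
  have Fh: "rep_hom GL2 (det_tensor m l2) (det_tensor (t w) (length w)) (F w j)" if "w \<in> W" "j < D w" for w j
    using conjunct1[OF bspec[OF F that(1)]] that(2) by (elim allE impE)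
  have "\<forall>w\<in>W. \<exists>P :: (2 list \<Rightarrow> 'k) \<Rightarrow> 2 list \<Rightarrow> 'k.
    rep_hom GL2 (det_tensor (t w) (length w)) (lie_power r) P \<and>
    (\<forall>f\<in>tensor_power (t w). lyndon_cut w (P f) = f) \<and>
    (\<forall>f v. v \<noteq> [] \<longrightarrow> \<not> hd v \<longrightarrow> lex_gt w v \<longrightarrow> lyndon_cut v (P f) = 0)"
  proof
    fix w assume wW: "w \<in> W"
    have "1 \<le> count_list w False" using w(3)[OF wW] by (simp add: t_def)
    from lyndon_maps[OF char2 w(1)[OF wW] this]
    show "\<exists>P :: (2 list \<Rightarrow> 'k) \<Rightarrow> 2 list \<Rightarrow> 'k.
      rep_hom GL2 (det_tensor (t w) (length w)) (lie_power r) P \<and>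
      (\<forall>f\<in>tensor_power (t w). lyndon_cut w (P f) = f) \<and>
      (\<forall>f v. v \<noteq> [] \<longrightarrow> \<not> hd v \<longrightarrow> lex_gt w v \<longrightarrow> lyndon_cut v (P f) = 0)"
      unfolding w(2)[OF wW, unfolded t_def] t_def .
  qed
  from bchoice[OF this] obtain P :: "bool list \<Rightarrow> (2 list \<Rightarrow> 'k) \<Rightarrow> 2 list \<Rightarrow> 'k" where
    P: "\<forall>w\<in>W. rep_hom GL2 (det_tensor (t w) (length w)) (lie_power r) (P w) \<and>
    (\<forall>f\<in>tensor_power (t w). lyndon_cut w (P w f) = f) \<and>
    (\<forall>f v. v \<noteq> [] \<longrightarrow> \<not> hd v \<longrightarrow> lex_gt w v \<longrightarrow> lyndon_cut v (P w f) = 0)" ..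
  have Ph: "rep_hom GL2 (det_tensor (t w) (length w)) (lie_power r) (P w)" if "w \<in> W" for w
    by (rule conjunct1[OF bspec[OF P that]])
  have Pc: "lyndon_cut w (P w f) = f" if "w \<in> W" "f \<in> tensor_power (t w)" for w f
    by (rule bspec[OF conjunct1[OF conjunct2[OF bspec[OF P that(1)]]] that(2)])
  have Pz: "lyndon_cut v (P w f) = 0" if "w \<in> W" "v \<noteq> []" "\<not> hd v" "lex_gt w v" for w v f
    using conjunct2[OF conjunct2[OF bspec[OF P that(1)]]] that(2-4) by (elim allE impE) assumption+
  have Fm: "F w j e \<in> tensor_power (t w)" if "w \<in> W" "j < D w" for w j
    using rep_hom_mem[OF Fh[OF that] em] by simp
  define J where "J = Sigma W (\<lambda>w. {..<D w})"
  define \<Phi> where "\<Phi> x v = P (fst x) (F (fst x) (snd x) (f v))" for x v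
  have \<Phi>h: "rep_hom GL2 T (lie_power r) (\<Phi> x)" if "x \<in> J" for x
  proof -
    have x: "fst x \<in> W" "snd x < D (fst x)" using that by (auto simp: J_def)
    show ?thesis unfolding \<Phi>_def by (rule rep_hom_comp[OF rep_hom_comp[OF f Fh[OF x]] Ph[OF x(1)]])
  qed
  have \<Phi>m: "\<Phi> x v1 \<in> vecs (lie_power r)" if "x \<in> J" for x by (rule rep_hom_mem[OF \<Phi>h[OF that] v1])
  have "radical_independent GL2 T v1 \<zeta> (lie_power r) J \<Phi>"
    unfolding radical_independent_def
  proof (intro conjI ballI allI impI)
    show "rep_hom GL2 T (lie_power r) (\<Phi> x)" if "x \<in> J" for x by (rule \<Phi>h[OF that])
    fix \<alpha> :: "bool list \<times> nat \<Rightarrow> 'k" assume "\<exists>x\<in>J. \<alpha> x \<noteq> 0"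
    \<comment> \<open>The contraction for the least word that occurs kills the contributions of all other words.\<close>
    define A where "A = {w \<in> W. \<exists>j<D w. \<alpha> (w, j) \<noteq> 0}"
    have "A \<noteq> {}" using \<open>\<exists>x\<in>J. \<alpha> x \<noteq> 0\<close> by (auto simp: A_def J_def)
    moreover have "finite A" using finW by (simp add: A_def)
    ultimately obtain w0 where w0: "w0 \<in> A" "\<And>x. x \<in> A \<Longrightarrow> \<not> lex_gt w0 x"
      using lex_gt_minimal by blast
    have w0W: "w0 \<in> W" and ex: "\<exists>j<D w0. \<alpha> (w0, j) \<noteq> 0" using w0(1) by (auto simp: A_def)
    have "False \<in> set w0" using w(3)[OF w0W] count_list_zero[of w0 False] by (auto simp: t_def)
    then obtain w0' where w0': "w0 = False # w0'" using lyndon_starts_False[OF w(1)[OF w0W]] by blast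
    have cut: "rep_hom GL2 (lie_power r) (det_tensor (t w0) (length w0)) (lyndon_cut w0 :: (2 list \<Rightarrow> 'k) \<Rightarrow> 2 list \<Rightarrow> 'k)"
      using cut_hom[OF w0'] w(2)[OF w0W] by (simp add: t_def)
    have "lyndon_cut w0 (\<Sum>x\<in>J. fscale (\<alpha> x) (\<Phi> x v1)) = (\<Sum>x\<in>J. lyndon_cut w0 (fscale (\<alpha> x) (\<Phi> x v1)))"
      by (rule rep_hom_sum[OF cut rep_subspace[OF is_rep_lie_power]
            fs.subspace_scale[OF rep_subspace[OF is_rep_lie_power] \<Phi>m]])
    also have "\<dots> = (\<Sum>x\<in>J. fscale (\<alpha> x) (lyndon_cut w0 (\<Phi> x v1)))"
      by (rule sum.cong[OF refl rep_hom_scale[OF cut \<Phi>m]])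
    also have "\<dots> = (\<Sum>w\<in>W. \<Sum>j<D w. fscale (\<alpha> (w, j)) (lyndon_cut w0 (\<Phi> (w, j) v1)))"
      unfolding J_def by (subst sum.Sigma) (simp_all add: finW split_def)
    also have "\<dots> = (\<Sum>w\<in>W. if w = w0 then \<Sum>j<D w0. fscale (\<alpha> (w0, j)) (F w0 j e) else 0)"
    proof (rule sum.cong[OF refl])
      fix w assume wW: "w \<in> W"
      show "(\<Sum>j<D w. fscale (\<alpha> (w, j)) (lyndon_cut w0 (\<Phi> (w, j) v1)))
        = (if w = w0 then \<Sum>j<D w0. fscale (\<alpha> (w0, j)) (F w0 j e) else 0)"
      proof (cases "w = w0")
        case True
        show ?thesis unfolding True if_P[OF refl]
          by (rule sum.cong[OF refl]) (simp_all add: \<Phi>_def fe Pc[OF w0W Fm[OF w0W]])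
      next
        case False
        have "fscale (\<alpha> (w, j)) (lyndon_cut w0 (\<Phi> (w, j) v1)) = 0" if j: "j < D w" for j
        proof (cases "\<alpha> (w, j) = 0")
          case True then show ?thesis by simp
        next
          case nz: False
          then have "w \<in> A" using wW j by (auto simp: A_def)
          then have "\<not> lex_gt w0 w" by (rule w0(2))
          then have "lex_gt w w0"
            using lex_gt_total_degree[of w w0] w(2)[OF wW] w(2)[OF w0W] False by (simp add: t_def)
          then have "lyndon_cut w0 (\<Phi> (w, j) v1) = 0" unfolding \<Phi>_def fst_conv by (intro Pz[OF wW]) (simp_all add: w0')
          then show ?thesis by simp
        qed
        then show ?thesis unfolding if_not_P[OF False] by (intro sum.neutral ballI) simp
      qed
    qed
    also have "\<dots> = (\<Sum>j<D w0. fscale (\<alpha> (w0, j)) (F w0 j e))" using finW w0W by simp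
    finally have image: "lyndon_cut w0 (\<Sum>x\<in>J. fscale (\<alpha> x) (\<Phi> x v1)) = (\<Sum>j<D w0. fscale (\<alpha> (w0, j)) (F w0 j e))" .
    from conjunct2[OF bspec[OF F w0W], rule_format, of "\<lambda>j. \<alpha> (w0, j)", OF ex] obtain G where
      G: "rep_hom GL2 (det_tensor (t w0) (length w0)) (det_tensor m l2) G"
      and Gnz: "G (\<Sum>j<D w0. fscale (\<alpha> (w0, j)) (F w0 j e)) (replicate m 1) \<noteq> 0" by auto
    define x where "x = G (\<Sum>j<D w0. fscale (\<alpha> (w0, j)) (F w0 j e))"
    have "rep_hom GL2 (det_tensor m l2) (det_tensor m l2) (\<lambda>v. G (\<Sum>j<D w0. fscale (\<alpha> (w0, j)) (F w0 j v)))"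
      by (rule rep_hom_comp[OF rep_hom_lincomb[OF is_rep_det_tensor] G]) (use Fh[OF w0W] in simp)
    from rep_hom_has_weight[OF this ew] have "has_weight (det_tensor m l2) (m + l2, l2) x" by (simp add: x_def)
    from det_tensor_highest_weight[OF inf this] have x: "x = fscale (x (replicate m 1)) e" by (simp add: e_def)
    have "g x = fscale (x (replicate m 1)) v1"
      using rep_hom_scale[OF g em, of "x (replicate m 1)"] x ge by simp
    then have "\<zeta> (g (G (lyndon_cut w0 (\<Sum>x\<in>J. fscale (\<alpha> x) (\<Phi> x v1))))) = x (replicate m 1)"
      unfolding image x_def[symmetric] by (simp add: linfun_scale[OF \<zeta>(1)] \<zeta>(2))
    moreover have "x (replicate m 1) \<noteq> 0" using Gnz by (simp add: x_def)
    ultimately have "\<zeta> (g (G (lyndon_cut w0 (\<Sum>x\<in>J. fscale (\<alpha> x) (\<Phi> x v1))))) \<noteq> 0" by simp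
    moreover have "rep_hom GL2 (lie_power r) T (\<lambda>u. g (G (lyndon_cut w0 u)))"
      by (rule rep_hom_comp[OF rep_hom_comp[OF cut G] g])
    ultimately show "\<exists>h. rep_hom GL2 (lie_power r) T h \<and> \<zeta> (h (\<Sum>x\<in>J. fscale (\<alpha> x) (\<Phi> x v1))) \<noteq> 0"
      by (intro exI[of _ "\<lambda>u. g (G (lyndon_cut w0 u))"] conjI)
  qed
  moreover have "finite J" using finW by (simp add: J_def)
  ultimately have "card J \<le> ks_multiplicity GL2 (lie_power r :: ('k ^ 2 ^ 2, 'k, 2 list) rep) T"
    by (intro card_le_ks_multiplicity[OF E is_rep_lie_power fin_dim_lie_power])
  moreover have "card J = (\<Sum>w\<in>W. D w)" using finW by (simp add: J_def)
  ultimately show ?thesis by (simp add: D_def)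
qed

theorem corollary3p8:
  fixes T :: "('k::field ^ 2 ^ 2, 'k, 'x) rep"
    and r l1 l2 :: nat
  assumes "infinite (UNIV :: 'k set)"
    and "CHAR('k) = 2"
    and "r \<ge> 1"
    and "l2 \<le> l1" and "l1 + l2 = r"
    and "indecomposable_tilting (l1, l2) T"
  shows "(\<Sum>(s, t) | s \<ge> 1 \<and> t \<ge> 1 \<and> r = 2 * s + 3 * t \<and> 0 < l1 - l2 \<and> l1 - l2 \<le> t.
            m_coeff s t * of_nat (dim_D TYPE('k) [l1 - (s + t), l2 - (s + t)]))
         \<le> of_nat (ks_multiplicity GL2 (lie_power r :: ('k ^ 2 ^ 2, 'k, 2 list) rep) T)"
proof -
  define R where "R = {(s, t). s \<ge> 1 \<and> t \<ge> 1 \<and> r = 2 * s + 3 * t \<and> 0 < l1 - l2 \<and> l1 - l2 \<le> t}"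
  define L where "L p = {w \<in> two_letter_words (fst p) (snd p). lyndon w}" for p
  define d where "d p = dim_D TYPE('k) [l1 - (fst p + snd p), l2 - (fst p + snd p)]" for p
  define W where "W = (\<Union>p\<in>R. L p)"
  have finR: "finite R"
    by (rule finite_subset[of _ "{..r} \<times> {..r}"]) (auto simp: R_def)
  have finL: "finite (L p)" for p unfolding L_def by (rule finite_subset[OF _ finite_two_letter_words]) auto
  have W: "W \<subseteq> lyndon_words_for r (l1 - l2)"
    by (auto simp: W_def L_def R_def two_letter_words_def lyndon_words_for_def)
  have "(\<Sum>w\<in>W. dim_D TYPE('k) [l1 - length w, l2 - length w])
      = (\<Sum>p\<in>R. \<Sum>w\<in>L p. dim_D TYPE('k) [l1 - length w, l2 - length w])"
    unfolding W_def by (rule sum.UNION_disjoint[OF finR]) (use finL in \<open>auto simp: L_def two_letter_words_def\<close>)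
  also have "\<dots> = (\<Sum>p\<in>R. card (L p) * d p)"
  proof (rule sum.cong[OF refl])
    fix p
    have "(\<Sum>w\<in>L p. dim_D TYPE('k) [l1 - length w, l2 - length w]) = (\<Sum>w\<in>L p. d p)"
      by (rule sum.cong[OF refl]) (auto simp: L_def two_letter_words_def d_def length_two_letter_word)
    then show "(\<Sum>w\<in>L p. dim_D TYPE('k) [l1 - length w, l2 - length w]) = card (L p) * d p" by simp
  qed
  finally have le: "(\<Sum>p\<in>R. card (L p) * d p) \<le> ks_multiplicity GL2 (lie_power r :: ('k ^ 2 ^ 2, 'k, 2 list) rep) T"
    using lyndon_specht_independent[OF assms(1,2,4,5,6) W] by simp
  have "(\<Sum>(s, t)\<in>R. m_coeff s t * of_nat (dim_D TYPE('k) [l1 - (s + t), l2 - (s + t)]))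
      \<le> (\<Sum>p\<in>R. of_nat (card (L p) * d p))"
  proof (rule sum_mono)
    fix p assume p: "p \<in> R"
    obtain s t where st: "p = (s, t)" by (cases p)
    have "m_coeff s t \<le> of_nat (card (L p))"
      using m_coeff_le_lyndon[of s t] p by (simp add: L_def R_def st)
    then show "(case p of (s, t) \<Rightarrow> m_coeff s t * of_nat (dim_D TYPE('k) [l1 - (s + t), l2 - (s + t)]))
        \<le> of_nat (card (L p) * d p)"
      by (simp add: st d_def mult_right_mono)
  qed
  also have "\<dots> = of_nat (\<Sum>p\<in>R. card (L p) * d p)" by simp
  also have "\<dots> \<le> of_nat (ks_multiplicity GL2 (lie_power r :: ('k ^ 2 ^ 2, 'k, 2 list) rep) T)"
    using le by (rule of_nat_mono)
  finally show ?thesis unfolding R_def .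
qed

end
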